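(* There is a constant $c>0$ such that, for every $n$ (for all sufficiently large $n$, in the sense that the bound holds as stated with this $c$), the number of pairwise non-isomorphic $n$-vertex graphs that are determined by their spectrum is at least $e^{cn}$.
   Context: All graphs are finite and simple. The spectrum of a graph is the multiset of eigenvalues of its adjacency matrix $\mathrm{A}(G)\in\{0,1\}^{n\times n}$ (whose $(i,j)$-entry is $1$ iff $v_i v_j$ is an edge). A graph $G$ is determined by its spectrum if every graph with the same spectrum as $G$ is isomorphic to $G$. *)

theory Defs
  imports
    Complex_Main
    "HOL-Computational_Algebra.Fundamental_Theorem_Algebra"
    "Jordan_Normal_Form.Char_Poly"
begin

text \<open>
  A finite simple graph with \<open>n\<close> vertices has vertex set \<open>{..<n}\<close> and is given by its set of edges,
  an edge being a two-element set of vertices.  Every finite simple graph is isomorphic to one of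
  this form.  All notions below that take \<open>n\<close> and \<open>E\<close> refer to the graph with vertex set
  \<open>{..<n}\<close> and edge set \<open>E\<close>.
\<close>

definition simple_graphs :: "nat \<Rightarrow> nat set set set" where
  "simple_graphs n = {E. \<forall>e\<in>E. e \<subseteq> {..<n} \<and> card e = 2}"

definition graph_isomorphic :: "nat \<Rightarrow> nat set set \<Rightarrow> nat \<Rightarrow> nat set set \<Rightarrow> bool" where
  "graph_isomorphic n E m F \<longleftrightarrow>
     (\<exists>f. bij_betw f {..<n} {..<m} \<and>
          (\<forall>u\<in>{..<n}. \<forall>v\<in>{..<n}. {u, v} \<in> E \<longleftrightarrow> {f u, f v} \<in> F))"

definition adjacency_matrix :: "nat \<Rightarrow> nat set set \<Rightarrow> complex mat" where
  "adjacency_matrix n E = mat n n (\<lambda>(i, j). if {i, j} \<in> E then 1 else 0)"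

text \<open>
  The multiset of eigenvalues is the multiset of roots of the characteristic polynomial.  The
  entries are taken in the complex numbers so that it has size \<open>n\<close> by construction; for the
  symmetric matrices at hand, the eigenvalues are real and their algebraic and geometric
  multiplicities agree.
\<close>

definition graph_spectrum :: "nat \<Rightarrow> nat set set \<Rightarrow> complex multiset" where
  "graph_spectrum n E = proots (char_poly (adjacency_matrix n E))"

text \<open>The competing graph may a priori have a different number of vertices.\<close>

definition determined_by_spectrum :: "nat \<Rightarrow> nat set set \<Rightarrow> bool" where
  "determined_by_spectrum n E \<longleftrightarrow>
     (\<forall>m. \<forall>F\<in>simple_graphs m.
        graph_spectrum m F = graph_spectrum n E \<longrightarrow> graph_isomorphic m F n E)"

definition graph_iso_rel :: "nat \<Rightarrow> (nat set set \<times> nat set set) set" where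
  "graph_iso_rel n =
     {(E, F). E \<in> simple_graphs n \<and> F \<in> simple_graphs n \<and> graph_isomorphic n E n F}"

definition DS_graphs :: "nat \<Rightarrow> nat set set set" where
  "DS_graphs n = {E \<in> simple_graphs n. determined_by_spectrum n E}"

definition num_DS_graphs :: "nat \<Rightarrow> nat" where
  "num_DS_graphs n = card (DS_graphs n // graph_iso_rel n)"

lemma adjacency_matrix_carrier: "adjacency_matrix n E \<in> carrier_mat n n"
  by (simp add: adjacency_matrix_def)

lemma set_mset_graph_spectrum:
  "set_mset (graph_spectrum n E) = {x. eigenvalue (adjacency_matrix n E) x}"
proof -
  have "char_poly (adjacency_matrix n E) \<noteq> 0"
    using degree_monic_char_poly[OF adjacency_matrix_carrier[of n E]] by auto
  then show ?thesis
    by (simp add: graph_spectrum_def eigenvalue_root_char_poly[OF adjacency_matrix_carrier])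
qed

lemma size_graph_spectrum: "size (graph_spectrum n E) = n"
  using degree_monic_char_poly[OF adjacency_matrix_carrier[of n E]]
  by (simp add: graph_spectrum_def size_proots_complex)

lemma finite_simple_graphs: "finite (simple_graphs n)"
  by (rule finite_subset[of _ "Pow (Pow {..<n})"]) (auto simp: simple_graphs_def)

lemma equiv_graph_iso_rel: "equiv (simple_graphs n) (graph_iso_rel n)"
proof (rule equivI)
  show "graph_iso_rel n \<subseteq> simple_graphs n \<times> simple_graphs n"
    by (auto simp: graph_iso_rel_def)
  show "refl_on (simple_graphs n) (graph_iso_rel n)"
    unfolding refl_on_def graph_iso_rel_def graph_isomorphic_def
    by (auto intro!: exI[of _ id])
  show "sym (graph_iso_rel n)"
  proof (rule symI)
    fix E F assume "(E, F) \<in> graph_iso_rel n"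
    then obtain f where EF: "E \<in> simple_graphs n" "F \<in> simple_graphs n"
      and f: "bij_betw f {..<n} {..<n}"
      and adj: "\<And>u v. u < n \<Longrightarrow> v < n \<Longrightarrow> {u, v} \<in> E \<longleftrightarrow> {f u, f v} \<in> F"
      unfolding graph_iso_rel_def graph_isomorphic_def by auto
    let ?g = "inv_into {..<n} f"
    have g: "bij_betw ?g {..<n} {..<n}"
      using f by (rule bij_betw_inv_into)
    have "{u, v} \<in> F \<longleftrightarrow> {?g u, ?g v} \<in> E" if "u < n" "v < n" for u v
      using adj[of "?g u" "?g v"] that bij_betwE[OF g] bij_betw_inv_into_right[OF f] by auto
    with EF g show "(F, E) \<in> graph_iso_rel n"
      unfolding graph_iso_rel_def graph_isomorphic_def by auto
  qed
  show "trans (graph_iso_rel n)"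
  proof (rule transI)
    fix E F G assume "(E, F) \<in> graph_iso_rel n" "(F, G) \<in> graph_iso_rel n"
    then obtain f g where EG: "E \<in> simple_graphs n" "G \<in> simple_graphs n"
      and f: "bij_betw f {..<n} {..<n}" and g: "bij_betw g {..<n} {..<n}"
      and adj: "\<And>u v. u < n \<Longrightarrow> v < n \<Longrightarrow> {u, v} \<in> E \<longleftrightarrow> {f u, f v} \<in> F"
        "\<And>u v. u < n \<Longrightarrow> v < n \<Longrightarrow> {u, v} \<in> F \<longleftrightarrow> {g u, g v} \<in> G"
      unfolding graph_iso_rel_def graph_isomorphic_def by auto
    have "bij_betw (g \<circ> f) {..<n} {..<n}"
      using f g by (rule bij_betw_trans)
    moreover have "{u, v} \<in> E \<longleftrightarrow> {(g \<circ> f) u, (g \<circ> f) v} \<in> G" if "u < n" "v < n" for u v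
      using adj(1)[OF that] adj(2)[of "f u" "f v"] that bij_betwE[OF f] by auto
    ultimately show "(E, G) \<in> graph_iso_rel n"
      using EG unfolding graph_iso_rel_def graph_isomorphic_def by blast
  qed
qed

end

theory Submission
  imports Defs
    "HOL-Library.Ramsey"
    "HOL-Computational_Algebra.Primes"
    "HOL-Computational_Algebra.Formal_Power_Series"
    "HOL-Computational_Algebra.Polynomial_FPS"
    "HOL-Real_Asymp.Real_Asymp"
begin

text \<open>
  For a tree \<open>T\<close> with \<open>p\<close> vertices, the adjacency matrix \<open>A\<close> of its line graph satisfies
  \<open>det (A + 2I) = p\<close>, and \<open>A + 2I\<close> is positive definite.  Take \<open>p\<close> prime with
  \<open>(n + 2) / 2 < p \<le> n + 1\<close> and complete the line graph of \<open>T\<close> to \<open>n\<close> vertices by a disjoint complete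
  graph.  In a cospectral graph the matrix \<open>A + 2I\<close> is positive definite as well, and \<open>p\<close> divides the
  determinant of some component.  Growing this component vertex by vertex from a large clique or a
  long induced path shows that it is the line graph of a tree or is represented by integral vectors
  as in the root lattice \<open>D\<^sub>k\<close>; in the second case its determinant is a square, which is impossible.
  So it is the line graph of a tree \<open>T'\<close> with \<open>p\<close> vertices, and the largest eigenvalue of
  the complete graph forces the remaining vertices to form a complete graph too.

  It remains to recover \<open>T\<close> from \<open>det ((1 - q)\<^sup>2 I + q N N\<^sup>T)\<close>, where \<open>N\<close> is the incidence matrix.
  The trees are caterpillars with leaves at spine vertices separated by gaps \<open>g\<^sub>1, \<dots>, g\<^sub>k \<ge> 4\<close>.
  The expansion up to \<open>q\<^sup>4\<close> determines the numbers of vertices of degree 1, 2 and 3 and shows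
  that leaves are adjacent to vertices of degree 3 only and that these are not adjacent to each
  other.  Divisibility by \<open>1 - q + q\<^sup>2\<close> bounds the number of vertices with two leaves, so that \<open>T'\<close> is
  a caterpillar again.  If one gap at the end is huge and the others are 4 or 5, then all gaps can
  be read off from the polynomial.  There are exponentially many such sequences.
\<close>

section \<open>Determinants indexed by finite sets\<close>

text \<open>Since (1 - q)^2 I + q (A + 2I) = (1 + q^2) I + q A, the determinant is the
  characteristic polynomial in the variable q + 1/q. Along vertices of degree 2 the elimination then
  has the eigenvalues 1 and q^2, so a gap g enters as q^(2g). To first order in these powers the
  coefficients show only the multiset of gaps and which of them lie at the ends; the order becomes
  visible because the huge gap exceeds all other degrees and separates the terms of the polynomial.

  The prime has several tasks. It divides the determinant p (r + 1) of the whole graph, with r the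
  size of the complete graph, exactly once, as r + 1 < p; it exceeds the determinants of all small
  components; and the next multiple 2p is out of reach. The complete graph is there because n + 1
  need not be prime; it is the line graph of a star, so the same formulas apply to it.

  At a primitive sixth root of unity, a root of 1 - q + q^2, each gap contributes 1 - q^(2g). Gaps
  not divisible by 3 keep this nonzero, so that the two ends of the caterpillar account for all
  factors 1 - q + q^2.\<close>

definition enum_set :: "'v set \<Rightarrow> nat \<Rightarrow> 'v" where
  "enum_set A = (SOME e. bij_betw e {0..<card A} A)"

text \<open>Indexing by finite sets allows passing between vertices, edges and disjoint unions
  without fixing orders; \<open>det_reindex\<close> makes the choice of the enumeration immaterial.
  Entries will be integers, real and complex numbers, polynomials and power series.\<close>

definition sdet :: "'v set \<Rightarrow> ('v \<Rightarrow> 'v \<Rightarrow> 'a::comm_ring_1) \<Rightarrow> 'a" where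
  "sdet A f = det (mat (card A) (card A) (\<lambda>(i, j). f (enum_set A i) (enum_set A j)))"

lemma enum_set: "finite A \<Longrightarrow> bij_betw (enum_set A) {0..<card A} A"
  unfolding enum_set_def using ex_bij_betw_nat_finite[of A] by (rule someI_ex)

lemma enum_set_ex:
  assumes "finite A" "x \<in> A"
  obtains k where "k < card A" "x = enum_set A k"
proof -
  have "x \<in> enum_set A ` {0..<card A}"
    using enum_set[OF assms(1)] assms(2) by (simp add: bij_betw_def)
  then show ?thesis using that by auto
qed

text \<open>The same permutation acts on rows and on columns, so its sign occurs squared.\<close>

lemma det_reindex:
  fixes f :: "'v \<Rightarrow> 'v \<Rightarrow> 'a::comm_ring_1"
  assumes e: "bij_betw e {0..<n} A" and d: "bij_betw d {0..<n} A"
  shows "det (mat n n (\<lambda>(i, j). f (d i) (d j))) = det (mat n n (\<lambda>(i, j). f (e i) (e j)))"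
proof -
  define p where "p = (\<lambda>i. if i \<in> {0..<n} then inv_into {0..<n} e (d i) else i)"
  have "bij_betw (inv_into {0..<n} e \<circ> d) {0..<n} {0..<n}"
    using bij_betw_trans[OF d bij_betw_inv_into[OF e]] .
  then have "bij_betw p {0..<n} {0..<n}"
    by (rule bij_betw_cong[THEN iffD1, rotated]) (simp add: p_def)
  then have p: "p permutes {0..<n}"
    by (rule bij_imp_permutes) (simp add: p_def)
  have dp: "d i = e (p i)" if "i < n" for i
    using that bij_betw_inv_into_right[OF e, of "d i"] bij_betwE[OF d] by (auto simp: p_def)
  have pn: "p i < n" if "i < n" for i
    using permutes_in_image[OF p, of i] that by auto
  let ?E = "mat n n (\<lambda>(i, j). f (e i) (e j))"
  let ?R = "mat n n (\<lambda>(i, j). ?E $$ (p i, j))"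
  \<comment> \<open>Columns are permuted as rows of the transpose.\<close>
  let ?C = "mat n n (\<lambda>(i, j). transpose_mat ?R $$ (p i, j))"
  have "mat n n (\<lambda>(i, j). f (d i) (d j)) = transpose_mat ?C"
    by (rule eq_matI) (auto simp: dp pn)
  then have "det (mat n n (\<lambda>(i, j). f (d i) (d j))) = det ?C"
    using det_transpose[of ?C n] by simp
  also have "\<dots> = signof p * det (transpose_mat ?R)"
    by (rule det_permute_rows[OF _ p]) simp
  also have "det (transpose_mat ?R) = det ?R"
    by (rule det_transpose[of _ n]) simp
  also have "det ?R = signof p * det ?E"
    by (rule det_permute_rows[OF _ p]) simp
  finally show ?thesis
    by (simp add: sign_def)
qed

lemma sdet_enum:
  assumes "bij_betw e {0..<n} A"
  shows "sdet A f = det (mat n n (\<lambda>(i, j). f (e i) (e j)))"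
proof -
  have "finite A" "card A = n"
    using assms bij_betw_finite bij_betw_same_card[OF assms] by auto
  then show ?thesis
    unfolding sdet_def using det_reindex[OF assms, of "enum_set A" f] enum_set[of A] by simp
qed

lemma sdet_cong:
  assumes "A = B" "\<And>x y. x \<in> B \<Longrightarrow> y \<in> B \<Longrightarrow> f x y = g x y"
  shows "sdet A f = sdet B g"
proof (cases "finite B")
  case True
  have "enum_set B i \<in> B" if "i < card B" for i
    using enum_set[OF True] that by (auto simp: bij_betw_def)
  then show ?thesis
    unfolding sdet_def assms(1) by (intro arg_cong[of _ _ det] eq_matI) (auto simp: assms(2))
next
  case False
  then show ?thesis by (simp add: sdet_def assms(1))
qed

lemma sdet_reindex:
  assumes "finite A" "bij_betw g A B"
  shows "sdet B f = sdet A (\<lambda>x y. f (g x) (g y))"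
  using sdet_enum[OF bij_betw_trans[OF enum_set[OF assms(1)] assms(2)], of f]
    sdet_enum[OF enum_set[OF assms(1)], of "\<lambda>x y. f (g x) (g y)"] by (simp add: o_def)

lemma sdet_empty [simp]: "sdet {} f = 1"
  by (simp add: sdet_def)

lemma sdet_singleton [simp]: "sdet {v} f = f v v"
proof -
  have "bij_betw (\<lambda>_. v) {0..<1::nat} {v}" by (auto simp: bij_betw_def inj_on_def)
  from sdet_enum[OF this, of f] show ?thesis
    by (simp add: det_single[of _ ])
qed

lemma sdet_transpose:
  assumes "finite A"
  shows "sdet A (\<lambda>x y. f y x) = sdet A f"
proof -
  note e = enum_set[OF assms]
  have "mat (card A) (card A) (\<lambda>(i, j). f (enum_set A j) (enum_set A i)) =
      transpose_mat (mat (card A) (card A) (\<lambda>(i, j). f (enum_set A i) (enum_set A j)))"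
    by (rule eq_matI) auto
  then show ?thesis
    unfolding sdet_enum[OF e] by (simp add: det_transpose[of _ "card A"])
qed

lemma sdet_mult:
  assumes "finite A"
  shows "sdet A (\<lambda>x y. \<Sum>z\<in>A. f x z * g z y) = sdet A f * sdet A g"
proof -
  note e = enum_set[OF assms]
  let ?n = "card A"
  let ?F = "mat ?n ?n (\<lambda>(i, j). f (enum_set A i) (enum_set A j))"
  let ?G = "mat ?n ?n (\<lambda>(i, j). g (enum_set A i) (enum_set A j))"
  have "mat ?n ?n (\<lambda>(i, j). \<Sum>z\<in>A. f (enum_set A i) z * g z (enum_set A j)) = ?F * ?G"
  proof (rule eq_matI)
    fix i j assume "i < dim_row (?F * ?G)" "j < dim_col (?F * ?G)"
    then show "mat ?n ?n (\<lambda>(i, j). \<Sum>z\<in>A. f (enum_set A i) z * g z (enum_set A j)) $$ (i, j) =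
        (?F * ?G) $$ (i, j)"
      using sum.reindex_bij_betw[OF e, of "\<lambda>z. f (enum_set A i) z * g z (enum_set A j)"]
      by (simp add: scalar_prod_def)
  qed auto
  then show ?thesis
    unfolding sdet_enum[OF e] by (simp add: det_mult[of _ ?n])
qed

lemma sdet_block:
  fixes f :: "'v \<Rightarrow> 'v \<Rightarrow> 'a::idom"
  assumes "finite A" "finite B" "A \<inter> B = {}"
    and zero: "\<And>x y. x \<in> A \<Longrightarrow> y \<in> B \<Longrightarrow> f x y = 0"
  shows "sdet (A \<union> B) f = sdet A f * sdet B f"
proof -
  define a b where "a = card A" and "b = card B"
  define e where "e = (\<lambda>i. if i < a then enum_set A i else enum_set B (i - a))"
  have eA: "bij_betw (enum_set A) {0..<a} A" and eB: "bij_betw (enum_set B) {0..<b} B"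
    using enum_set assms by (auto simp: a_def b_def)
  have 1: "bij_betw e {0..<a} A"
    using eA by (rule bij_betw_cong[THEN iffD1, rotated]) (simp add: e_def)
  have "bij_betw (\<lambda>i. i - a) {a..<a+b} {0..<b}"
    by (rule bij_betw_byWitness[of _ "\<lambda>i. i + a"]) auto
  from bij_betw_trans[OF this eB] have 2: "bij_betw e {a..<a+b} B"
    by (rule bij_betw_cong[THEN iffD1, rotated]) (simp add: e_def)
  have e: "bij_betw e {0..<a+b} (A \<union> B)"
    using bij_betw_combine[OF 1 2 assms(3)] ivl_disj_un_two(3)[of 0 a "a + b"] by simp
  let ?A = "mat a a (\<lambda>(i, j). f (enum_set A i) (enum_set A j))"
  let ?B = "mat b b (\<lambda>(i, j). f (enum_set B i) (enum_set B j))"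
  let ?C = "mat b a (\<lambda>(i, j). f (enum_set B i) (enum_set A j))"
  have in_A: "enum_set A i \<in> A" if "i < a" for i using eA that by (auto simp: bij_betw_def)
  have in_B: "enum_set B i \<in> B" if "i < b" for i using eB that by (auto simp: bij_betw_def)
  have "mat (a+b) (a+b) (\<lambda>(i, j). f (e i) (e j)) = four_block_mat ?A (0\<^sub>m a b) ?C ?B"
    by (rule eq_matI) (auto simp: e_def zero in_A in_B)
  then show ?thesis
    unfolding sdet_enum[OF e] sdet_enum[OF eA] sdet_enum[OF eB]
    by (simp add: det_four_block_mat_upper_right_zero[of _ a _ b])
qed

lemma sdet_block':
  fixes f :: "'v \<Rightarrow> 'v \<Rightarrow> 'a::idom"
  assumes "finite A" "finite B" "A \<inter> B = {}"
    and zero: "\<And>x y. x \<in> A \<Longrightarrow> y \<in> B \<Longrightarrow> f y x = 0"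
  shows "sdet (A \<union> B) f = sdet A f * sdet B f"
  using sdet_block[of B A f] assms by (simp add: Un_commute Int_commute mult.commute)

lemma sdet_diagonal:
  fixes d :: "'v \<Rightarrow> 'a::idom"
  assumes "finite A"
  shows "sdet A (\<lambda>x y. if x = y then d x else 0) = prod d A"
  using assms
proof (induction A)
  case (insert v A)
  have "sdet ({v} \<union> A) (\<lambda>x y. if x = y then d x else 0) =
      sdet {v} (\<lambda>x y. if x = y then d x else 0) * sdet A (\<lambda>x y. if x = y then d x else 0)"
    using insert.hyps by (intro sdet_block) auto
  then show ?case using insert by simp
qed simp

text \<open>The inverse \<open>c\<close> of the pivot is a hypothesis, so that elimination also
  works over power series, where some nonzero pivots are not units. The proof factors
  \<open>f\<close> into a column operation \<open>L\<close> of determinant 1 and \<open>R\<close>,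
  which consists of the pivot row and the Schur complement.\<close>

lemma sdet_schur:
  fixes f :: "'v \<Rightarrow> 'v \<Rightarrow> 'a::idom"
  assumes A: "finite A" "v \<notin> A" and c: "f v v * c = 1"
  shows "sdet (insert v A) f = f v v * sdet A (\<lambda>x y. f x y - f x v * c * f v y)"
proof -
  define L where "L = (\<lambda>x y. if x = y then 1 else if y = v then f x v * c else 0)"
  define R where "R = (\<lambda>x y. if x = v then f v y else if y = v then 0 else f x y - f x v * c * f v y)"
  have "(\<Sum>z\<in>insert v A. L x z * R z y) = f x y" if "x \<in> insert v A" "y \<in> insert v A" for x y
  proof -
    have "(\<Sum>z\<in>A. L x z * R z y) = (\<Sum>z\<in>A. if z = x then R x y else 0)"
      by (rule sum.cong) (use A in \<open>auto simp: L_def\<close>)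
    then have *: "(\<Sum>z\<in>A. L x z * R z y) = (if x \<in> A then R x y else 0)"
      using A by simp
    have c': "c * f v v = 1" using c by (simp add: mult.commute)
    have "f x v * c * f v v = f x v" using c' by (simp add: mult.assoc)
    have "(\<Sum>z\<in>insert v A. L x z * R z y) = L x v * R v y + (if x \<in> A then R x y else 0)"
      using A by (simp add: *)
    then show ?thesis
      using A that c' * by (auto simp: L_def R_def mult.assoc)
  qed
  then have "sdet (insert v A) f = sdet (insert v A) (\<lambda>x y. \<Sum>z\<in>insert v A. L x z * R z y)"
    by (intro sdet_cong) auto
  also have "\<dots> = sdet (insert v A) L * sdet (insert v A) R"
    using A by (intro sdet_mult) auto
  also have "sdet (insert v A) L = sdet ({v} \<union> A) L" by simp
  also have "\<dots> = sdet {v} L * sdet A L"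
    using A by (intro sdet_block) (auto simp: L_def)
  also have "sdet {v} L = 1" by (simp add: L_def)
  also have "sdet A L = sdet A (\<lambda>x y. if x = y then 1 else 0)"
    using A by (intro sdet_cong) (auto simp: L_def)
  also have "\<dots> = 1" using sdet_diagonal[OF A(1), of "\<lambda>_. 1::'a"] by simp
  also have "sdet (insert v A) R = sdet ({v} \<union> A) R" by simp
  also have "\<dots> = sdet {v} R * sdet A R"
    using A by (intro sdet_block') (auto simp: R_def)
  also have "sdet {v} R = f v v" by (simp add: R_def)
  also have "sdet A R = sdet A (\<lambda>x y. f x y - f x v * c * f v y)"
    using A by (intro sdet_cong) (auto simp: R_def)
  finally show ?thesis by simp
qed

text \<open>The matrix is the product of an elementary matrix of determinant \<open>c\<close>,
  acting on rows \<open>u\<close> and \<open>v\<close> only, and the matrix with row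
  \<open>u\<close> replaced by \<open>g\<close>. It extracts one factor for each pair of leaves with
  a common neighbour.\<close>

lemma sdet_row_factor:
  fixes f :: "'v \<Rightarrow> 'v \<Rightarrow> 'a::idom"
  assumes A: "finite A" "u \<in> A" "v \<in> A" "u \<noteq> v"
    and row: "\<And>y. y \<in> A \<Longrightarrow> f u y = f v y + c * g y"
  shows "sdet A f = c * sdet A (f(u := g))"
proof -
  define L where "L = (\<lambda>x z. if x = z then (if x = u then c else 1) else if x = u \<and> z = v then 1 else (0::'a))"
  have "(\<Sum>z\<in>A. L x z * (f(u := g)) z y) = f x y" if "x \<in> A" "y \<in> A" for x y
  proof (cases "x = u")
    case True
    have "(\<Sum>z\<in>A. L x z * (f(u := g)) z y) =
        (\<Sum>z\<in>A. (if z = u then c * g y else 0) + (if z = v then f v y else 0))"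
      by (rule sum.cong) (use A True in \<open>auto simp: L_def\<close>)
    then show ?thesis using A True row that by (simp add: sum.distrib)
  next
    case False
    have "(\<Sum>z\<in>A. L x z * (f(u := g)) z y) = (\<Sum>z\<in>A. if z = x then f x y else 0)"
      by (rule sum.cong) (use A False in \<open>auto simp: L_def\<close>)
    then show ?thesis using A that by simp
  qed
  then have "sdet A f = sdet A (\<lambda>x y. \<Sum>z\<in>A. L x z * (f(u := g)) z y)"
    by (intro sdet_cong) auto
  also have "\<dots> = sdet A L * sdet A (f(u := g))"
    using A by (intro sdet_mult)
  also have "sdet A L = sdet ((A - {v}) \<union> {v}) L"
    using A by (intro arg_cong[of _ _ "\<lambda>X. sdet X L"]) auto
  also have "\<dots> = sdet (A - {v}) L * sdet {v} L"
    using A by (intro sdet_block') (auto simp: L_def)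
  also have "sdet (A - {v}) L = sdet (A - {v}) (\<lambda>x y. if x = y then (if x = u then c else 1) else 0)"
    using A by (intro sdet_cong) (auto simp: L_def)
  also have "\<dots> = (\<Prod>x\<in>A - {v}. if x = u then c else 1)"
    using A by (intro sdet_diagonal) auto
  also have "\<dots> = c" using A by simp
  also have "sdet {v} L = 1" using A by (simp add: L_def)
  finally show ?thesis by (simp add: fun_upd_def)
qed

lemma sdet_hom:
  assumes "comm_ring_hom h" "finite A"
  shows "h (sdet A f) = sdet A (\<lambda>x y. h (f x y))"
proof -
  interpret comm_ring_hom h by fact
  have "mat (card A) (card A) (\<lambda>(i, j). h (f (enum_set A i) (enum_set A j))) =
      map_mat h (mat (card A) (card A) (\<lambda>(i, j). f (enum_set A i) (enum_set A j)))"
    by (rule eq_matI) auto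
  then show ?thesis
    unfolding sdet_def by simp
qed

section \<open>Kernel vectors, inverses and linear systems over a field\<close>

lemma sdet_kernel:
  fixes f :: "'v \<Rightarrow> 'v \<Rightarrow> 'a::field"
  assumes A: "finite A" and "sdet A f = 0"
  shows "\<exists>c. (\<exists>x\<in>A. c x \<noteq> 0) \<and> (\<forall>x\<in>A. (\<Sum>y\<in>A. f x y * c y) = 0)"
proof -
  note e = enum_set[OF A]
  let ?n = "card A"
  let ?F = "mat ?n ?n (\<lambda>(i, j). f (enum_set A i) (enum_set A j))"
  obtain v where v: "v \<in> carrier_vec ?n" "v \<noteq> 0\<^sub>v ?n" "?F *\<^sub>v v = 0\<^sub>v ?n"
    using assms(2) det_0_iff_vec_prod_zero_field[of ?F ?n] unfolding sdet_def by auto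
  define c where "c x = v $ (inv_into {0..<?n} (enum_set A) x)" for x
  have ce: "c (enum_set A i) = v $ i" if "i < ?n" for i
    using e that by (auto simp: c_def bij_betw_def inv_into_f_f)
  obtain i where i: "i < ?n" "v $ i \<noteq> 0"
    using v(1,2) by (metis carrier_vecD eq_vecI index_zero_vec(1,2))
  have "(\<Sum>y\<in>A. f x y * c y) = 0" if xA: "x \<in> A" for x
  proof -
    obtain k where k: "k < ?n" "x = enum_set A k"
      by (rule enum_set_ex[OF A xA])
    have "(\<Sum>y\<in>A. f x y * c y) = (\<Sum>j\<in>{0..<?n}. f x (enum_set A j) * c (enum_set A j))"
      using sum.reindex_bij_betw[OF e, of "\<lambda>y. f x y * c y"] by simp
    also have "\<dots> = (?F *\<^sub>v v) $ k"
      using k v(1) by (auto simp: scalar_prod_def ce intro!: sum.cong)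
    finally show ?thesis using v(3) k by simp
  qed
  moreover have "enum_set A i \<in> A" using e i by (auto simp: bij_betw_def)
  ultimately show ?thesis
    using i ce[OF i(1)] by (intro exI[of _ c] conjI bexI[of _ "enum_set A i"]) auto
qed

lemma sdet_inverse:
  fixes f :: "'v \<Rightarrow> 'v \<Rightarrow> 'a::field"
  assumes A: "finite A" and "sdet A f \<noteq> 0"
  shows "\<exists>g. \<forall>x\<in>A. \<forall>z\<in>A. (\<Sum>y\<in>A. f x y * g y z) = (if x = z then 1 else 0)"
proof -
  note e = enum_set[OF A]
  let ?n = "card A"
  let ?F = "mat ?n ?n (\<lambda>(i, j). f (enum_set A i) (enum_set A j))"
  have "?F \<in> Units (ring_mat TYPE('a) ?n ())"
    using assms(2) det_non_zero_imp_unit[of ?F ?n] unfolding sdet_def by auto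
  then obtain G where G: "G \<in> carrier_mat ?n ?n" "?F * G = 1\<^sub>m ?n"
    unfolding Units_def ring_mat_def by auto
  define r where "r = inv_into {0..<?n} (enum_set A)"
  have re: "r (enum_set A i) = i" if "i < ?n" for i
    using e that by (auto simp: r_def bij_betw_def inv_into_f_f)
  have "(\<Sum>y\<in>A. f x y * G $$ (r y, r z)) = (if x = z then 1 else 0)" if xA: "x \<in> A" and zA: "z \<in> A" for x z
  proof -
    obtain k where k: "k < ?n" "x = enum_set A k"
      by (rule enum_set_ex[OF A xA])
    obtain l where l: "l < ?n" "z = enum_set A l"
      by (rule enum_set_ex[OF A zA])
    have "(\<Sum>y\<in>A. f x y * G $$ (r y, r z)) =
        (\<Sum>j\<in>{0..<?n}. f x (enum_set A j) * G $$ (r (enum_set A j), r z))"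
      using sum.reindex_bij_betw[OF e, of "\<lambda>y. f x y * G $$ (r y, r z)"] by simp
    also have "\<dots> = (?F * G) $$ (k, l)"
      using k l G(1) by (auto simp: scalar_prod_def re intro!: sum.cong)
    also have "\<dots> = (if k = l then 1 else 0)" using k l G by simp
    also have "(k = l) = (x = z)"
      using k l re by metis
    finally show ?thesis .
  qed
  then show ?thesis by (intro exI[of _ "\<lambda>y z. G $$ (r y, r z)"]) auto
qed

lemma sdet_solve:
  fixes f :: "'v \<Rightarrow> 'v \<Rightarrow> 'a::field"
  assumes A: "finite A" and "sdet A f \<noteq> 0"
  shows "\<exists>c. \<forall>x\<in>A. (\<Sum>y\<in>A. f x y * c y) = b x"
proof -
  obtain g where g: "\<And>x z. x \<in> A \<Longrightarrow> z \<in> A \<Longrightarrow> (\<Sum>y\<in>A. f x y * g y z) = (if x = z then 1 else 0)"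
    using sdet_inverse[OF assms] by auto
  have "(\<Sum>y\<in>A. f x y * (\<Sum>z\<in>A. g y z * b z)) = b x" if "x \<in> A" for x
  proof -
    have "(\<Sum>y\<in>A. f x y * (\<Sum>z\<in>A. g y z * b z)) = (\<Sum>z\<in>A. (\<Sum>y\<in>A. f x y * g y z) * b z)"
      by (simp add: sum_distrib_left sum_distrib_right mult.assoc) (rule sum.swap)
    also have "\<dots> = (\<Sum>z\<in>A. if z = x then b x else 0)"
      by (rule sum.cong) (auto simp: g that)
    finally show ?thesis using A that by simp
  qed
  then show ?thesis by (intro exI[of _ "\<lambda>y. \<Sum>z\<in>A. g y z * b z"]) auto
qed

text \<open>In \<open>sdet_sylvester\<close> the two index sets have different types, so the blocks
  are indexed by a sum type.\<close>

lemma sdet_Plus: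
  fixes f :: "'v + 'w \<Rightarrow> 'v + 'w \<Rightarrow> 'a::idom"
  assumes "finite A" "finite B"
    and "(\<forall>x\<in>A. \<forall>y\<in>B. f (Inl x) (Inr y) = 0) \<or> (\<forall>x\<in>A. \<forall>y\<in>B. f (Inr y) (Inl x) = 0)"
  shows "sdet (A <+> B) f = sdet A (\<lambda>x y. f (Inl x) (Inl y)) * sdet B (\<lambda>x y. f (Inr x) (Inr y))"
proof -
  have "sdet (A <+> B) f = sdet (Inl ` A) f * sdet (Inr ` B) f"
    unfolding Plus_def using assms(3)
  proof
    assume "\<forall>x\<in>A. \<forall>y\<in>B. f (Inl x) (Inr y) = 0"
    then show "sdet (Inl ` A \<union> Inr ` B) f = sdet (Inl ` A) f * sdet (Inr ` B) f"
      using assms(1,2) by (intro sdet_block) auto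
  next
    assume "\<forall>x\<in>A. \<forall>y\<in>B. f (Inr y) (Inl x) = 0"
    then show "sdet (Inl ` A \<union> Inr ` B) f = sdet (Inl ` A) f * sdet (Inr ` B) f"
      using assms(1,2) by (intro sdet_block') auto
  qed
  also have "sdet (Inl ` A) f = sdet A (\<lambda>x y. f (Inl x) (Inl y))"
    by (rule sdet_reindex[OF assms(1)]) (auto simp: bij_betw_def)
  also have "sdet (Inr ` B) f = sdet B (\<lambda>x y. f (Inr x) (Inr y))"
    by (rule sdet_reindex[OF assms(2)]) (auto simp: bij_betw_def)
  finally show ?thesis .
qed

text \<open>Sylvester's determinant identity, read off from two triangular factorizations of the block
  matrix with rows \<open>(u, q N)\<close> and \<open>(- N\<^sup>T, 1)\<close>.\<close>

lemma sdet_sylvester: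
  fixes N :: "'v \<Rightarrow> 'w \<Rightarrow> 'a::idom"
  assumes A: "finite A" and B: "finite B"
  shows "u ^ card B * sdet A (\<lambda>x y. (if x = y then u else 0) + q * (\<Sum>e\<in>B. N x e * N y e)) =
    u ^ card A * sdet B (\<lambda>e g. (if e = g then u else 0) + q * (\<Sum>x\<in>A. N x e * N x g))"
proof -
  define X where "X = (\<lambda>s t. case s of
      Inl x \<Rightarrow> (case t of Inl y \<Rightarrow> if x = y then u else 0 | Inr e \<Rightarrow> q * N x e)
    | Inr e \<Rightarrow> (case t of Inl y \<Rightarrow> - N y e | Inr g \<Rightarrow> if e = g then 1 else 0))"
  define R where "R = (\<lambda>s t. case s of
      Inl x \<Rightarrow> (case t of Inl y \<Rightarrow> if x = y then 1 else 0 | Inr e \<Rightarrow> 0)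
    | Inr e \<Rightarrow> (case t of Inl y \<Rightarrow> N y e | Inr g \<Rightarrow> if e = g then 1 else (0::'a)))"
  define L where "L = (\<lambda>s t. case s of
      Inl x \<Rightarrow> (case t of Inl y \<Rightarrow> if x = y then 1 else 0 | Inr e \<Rightarrow> 0)
    | Inr e \<Rightarrow> (case t of Inl y \<Rightarrow> N y e | Inr g \<Rightarrow> if e = g then u else 0))"
  let ?S = "A <+> B"
  have fin: "finite ?S" using A B by simp
  have d: "sdet A (\<lambda>x y. if x = y then c else 0) = c ^ card A"
    "sdet B (\<lambda>x y. if x = y then c else 0) = c ^ card B" for c :: 'a
    using sdet_diagonal[OF A, of "\<lambda>_. c"] sdet_diagonal[OF B, of "\<lambda>_. c"] by simp_all
  have split: "(\<Sum>z\<in>?S. h z) = (\<Sum>x\<in>A. h (Inl x)) + (\<Sum>e\<in>B. h (Inr e))" for h :: "'v + 'w \<Rightarrow> 'a"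
    using A B by (simp add: sum.Plus)
  have delta: "(\<Sum>x\<in>A. (if y = x then c x else 0) * h x) = (if y \<in> A then c y * h y else 0)"
    "(\<Sum>x\<in>A. h x * (if x = y then c x else 0)) = (if y \<in> A then h y * c y else 0)"
    for c h :: "'v \<Rightarrow> 'a" and y
    using A by (simp_all add: if_distrib if_distribR sum.delta sum.delta' cong: if_cong)
  have delta': "(\<Sum>x\<in>B. (if y = x then c x else 0) * h x) = (if y \<in> B then c y * h y else 0)"
    "(\<Sum>x\<in>B. h x * (if x = y then c x else 0)) = (if y \<in> B then h y * c y else 0)"
    for c h :: "'w \<Rightarrow> 'a" and y
    using B by (simp_all add: if_distrib if_distribR sum.delta sum.delta' cong: if_cong)
  have "sdet ?S (\<lambda>s t. \<Sum>z\<in>?S. X s z * R z t) = sdet ?S X * sdet ?S R"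
    by (rule sdet_mult[OF fin])
  moreover have "sdet ?S R = 1"
    using sdet_Plus[OF A B, of R] d[of 1] by (simp add: R_def)
  \<comment> \<open>Multiplication by \<open>R\<close> from the right clears the lower left block -
    N^T; the diagonal blocks become u + q N N^T and the identity.\<close>
  moreover have "sdet ?S (\<lambda>s t. \<Sum>z\<in>?S. X s z * R z t) =
      sdet A (\<lambda>x y. (if x = y then u else 0) + q * (\<Sum>e\<in>B. N x e * N y e))"
  proof -
    let ?Y = "\<lambda>s t. \<Sum>z\<in>?S. X s z * R z t"
    have "?Y (Inr e) (Inl x) = 0" if "x \<in> A" "e \<in> B" for x e
    proof -
      have "?Y (Inr e) (Inl x) = (\<Sum>z\<in>A. (- N z e) * (if z = x then 1 else 0)) +
          (\<Sum>g\<in>B. (if e = g then 1 else 0) * N x g)"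
        by (simp add: split X_def R_def)
      then show ?thesis
        unfolding delta delta' using that by simp
    qed
    then have "sdet ?S ?Y = sdet A (\<lambda>x y. ?Y (Inl x) (Inl y)) * sdet B (\<lambda>x y. ?Y (Inr x) (Inr y))"
      by (intro sdet_Plus[OF A B]) blast
    also have "sdet B (\<lambda>x y. ?Y (Inr x) (Inr y)) = sdet B (\<lambda>x y. if x = y then 1 else 0)"
      by (rule sdet_cong) (auto simp: split X_def R_def delta delta')
    also have "\<dots> = 1" using d[of 1] by simp
    also have "sdet A (\<lambda>x y. ?Y (Inl x) (Inl y)) =
        sdet A (\<lambda>x y. (if x = y then u else 0) + q * (\<Sum>e\<in>B. N x e * N y e))"
      by (rule sdet_cong) (auto simp: split X_def R_def delta delta' sum_distrib_left mult.assoc)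
    finally show ?thesis by simp
  qed
  ultimately have 1: "sdet A (\<lambda>x y. (if x = y then u else 0) + q * (\<Sum>e\<in>B. N x e * N y e)) = sdet ?S X"
    by simp
  have "sdet ?S (\<lambda>s t. \<Sum>z\<in>?S. L s z * X z t) = sdet ?S L * sdet ?S X"
    by (rule sdet_mult[OF fin])
  moreover have "sdet ?S L = u ^ card B"
    using sdet_Plus[OF A B, of L] d[of 1] d[of u] by (simp add: L_def)
  \<comment> \<open>The scalar \<open>u\<close> in the second block of \<open>L\<close> lets N^T u
    cancel against - u N^T; the diagonal blocks become u and u + q N^T N.\<close>
  moreover have "sdet ?S (\<lambda>s t. \<Sum>z\<in>?S. L s z * X z t) =
      u ^ card A * sdet B (\<lambda>e g. (if e = g then u else 0) + q * (\<Sum>x\<in>A. N x e * N x g))"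
  proof -
    let ?Y = "\<lambda>s t. \<Sum>z\<in>?S. L s z * X z t"
    have "?Y (Inr e) (Inl x) = 0" if "x \<in> A" "e \<in> B" for x e
    proof -
      have "?Y (Inr e) (Inl x) = (\<Sum>z\<in>A. N z e * (if z = x then u else 0)) +
          (\<Sum>g\<in>B. (if e = g then u else 0) * (- N x g))"
        by (simp add: split X_def L_def)
      then show ?thesis
        unfolding delta delta' using that by (simp add: mult.commute)
    qed
    then have "sdet ?S ?Y = sdet A (\<lambda>x y. ?Y (Inl x) (Inl y)) * sdet B (\<lambda>x y. ?Y (Inr x) (Inr y))"
      by (intro sdet_Plus[OF A B]) blast
    also have "sdet A (\<lambda>x y. ?Y (Inl x) (Inl y)) = sdet A (\<lambda>x y. if x = y then u else 0)"
      by (rule sdet_cong) (auto simp: split X_def L_def delta delta')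
    also have "\<dots> = u ^ card A" using d[of u] by simp
    also have "sdet B (\<lambda>x y. ?Y (Inr x) (Inr y)) =
        sdet B (\<lambda>e g. (if e = g then u else 0) + q * (\<Sum>x\<in>A. N x e * N x g))"
      by (rule sdet_cong)
        (auto simp: split X_def L_def delta delta' sum_distrib_left mult.left_commute)
    finally show ?thesis .
  qed
  ultimately show ?thesis using 1 by simp
qed

section \<open>Positive definite forms\<close>

definition qform :: "'v set \<Rightarrow> ('v \<Rightarrow> 'v \<Rightarrow> real) \<Rightarrow> ('v \<Rightarrow> real) \<Rightarrow> real" where
  "qform A f c = (\<Sum>x\<in>A. \<Sum>y\<in>A. c x * f x y * c y)"

definition posdef :: "'v set \<Rightarrow> ('v \<Rightarrow> 'v \<Rightarrow> real) \<Rightarrow> bool" where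
  "posdef A f \<longleftrightarrow> (\<forall>c. (\<exists>x\<in>A. c x \<noteq> 0) \<longrightarrow> qform A f c > 0)"

abbreviation shifted :: "('v \<Rightarrow> 'v \<Rightarrow> 'a::comm_ring_1) \<Rightarrow> 'a \<Rightarrow> 'v \<Rightarrow> 'v \<Rightarrow> 'a" where
  "shifted f t \<equiv> \<lambda>x y. (if x = y then t else 0) + f x y"

lemma posdef_subset:
  fixes f :: "'a \<Rightarrow> 'a \<Rightarrow> real"
  assumes "finite A" "B \<subseteq> A" "posdef A f"
  shows "posdef B f"
  unfolding posdef_def
proof (intro allI impI)
  fix c :: "'a \<Rightarrow> real" assume c: "\<exists>x\<in>B. c x \<noteq> 0"
  define d where "d x = (if x \<in> B then c x else 0)" for x
  have "qform A f d = (\<Sum>x\<in>A. if x \<in> B then (\<Sum>y\<in>A. if y \<in> B then c x * f x y * c y else 0) else 0)"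
    unfolding qform_def by (intro sum.cong refl) (auto simp: d_def intro!: sum.cong)
  also have "\<dots> = qform B f c"
    using assms by (simp add: qform_def sum.If_cases Int_absorb1)
  finally have "qform A f d = qform B f c" .
  moreover have "\<exists>x\<in>A. d x \<noteq> 0" using c assms(2) by (auto simp: d_def)
  ultimately show "qform B f c > 0" using assms(3) by (auto simp: posdef_def)
qed

lemma qform_shifted:
  assumes "finite A"
  shows "qform A (shifted f t) c = qform A f c + t * (\<Sum>x\<in>A. (c x)\<^sup>2)"
proof -
  have "(\<Sum>y\<in>A. c x * shifted f t x y * c y) = (\<Sum>y\<in>A. c x * f x y * c y) + t * (c x)\<^sup>2"
    if "x \<in> A" for x
  proof -
    have "(\<Sum>y\<in>A. c x * shifted f t x y * c y) =
        (\<Sum>y\<in>A. c x * f x y * c y + (if y = x then t * (c x)\<^sup>2 else 0))"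
      by (rule sum.cong) (auto simp: algebra_simps power2_eq_square)
    then show ?thesis using assms that by (simp add: sum.distrib)
  qed
  then show ?thesis by (simp add: qform_def sum.distrib sum_distrib_left)
qed

text \<open>Crude, but enough to find one semidefinite shift and to bound the form of an inverse
  matrix.\<close>

lemma qform_abs_le:
  assumes "finite A"
  shows "\<bar>qform A f c\<bar> \<le> (\<Sum>x\<in>A. \<Sum>y\<in>A. \<bar>f x y\<bar>) * (\<Sum>x\<in>A. (c x)\<^sup>2)"
proof -
  let ?S = "\<Sum>x\<in>A. (c x)\<^sup>2"
  have "\<bar>qform A f c\<bar> \<le> (\<Sum>x\<in>A. \<Sum>y\<in>A. \<bar>c x * f x y * c y\<bar>)"
    unfolding qform_def by (intro order_trans[OF sum_abs] sum_mono order_trans[OF sum_abs]) auto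
  also have "\<dots> \<le> (\<Sum>x\<in>A. \<Sum>y\<in>A. \<bar>f x y\<bar> * ?S)"
  proof (intro sum_mono)
    fix x y assume xy: "x \<in> A" "y \<in> A"
    have "(c x)\<^sup>2 \<le> ?S" "(c y)\<^sup>2 \<le> ?S"
      using xy assms by (intro member_le_sum; simp)+
    moreover have "2 * \<bar>c x * c y\<bar> \<le> (c x)\<^sup>2 + (c y)\<^sup>2"
      using zero_le_power2[of "\<bar>c x\<bar> - \<bar>c y\<bar>"] by (simp add: power2_diff abs_mult)
    ultimately have "\<bar>c x * c y\<bar> \<le> ?S" by linarith
    then have "\<bar>f x y\<bar> * \<bar>c x * c y\<bar> \<le> \<bar>f x y\<bar> * ?S" by (intro mult_left_mono) auto
    then show "\<bar>c x * f x y * c y\<bar> \<le> \<bar>f x y\<bar> * ?S" by (simp add: abs_mult mult_ac)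
  qed
  finally show ?thesis by (simp add: sum_distrib_right)
qed

lemma qform_diff:
  "qform A f (\<lambda>x. c x - k * d x) = qform A f c - k * (\<Sum>x\<in>A. \<Sum>y\<in>A. c x * f x y * d y)
    - k * (\<Sum>x\<in>A. \<Sum>y\<in>A. d x * f x y * c y) + k\<^sup>2 * qform A f d"
proof -
  have "(c x - k * d x) * f x y * (c y - k * d y) = c x * f x y * c y - k * (c x * f x y * d y)
      - k * (d x * f x y * c y) + k\<^sup>2 * (d x * f x y * d y)" for x y
    by (simp add: algebra_simps power2_eq_square)
  then show ?thesis
    by (simp only: qform_def sum.distrib sum_subtractf sum_distrib_left)
qed

lemma posdef_sdet_nonzero:
  assumes "finite A" "posdef A f"
  shows "sdet A f \<noteq> 0"
proof
  assume "sdet A f = 0"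
  then obtain c where c: "\<exists>x\<in>A. c x \<noteq> 0" "\<forall>x\<in>A. (\<Sum>y\<in>A. f x y * c y) = 0"
    using sdet_kernel[OF assms(1)] by blast
  have "qform A f c = (\<Sum>x\<in>A. c x * (\<Sum>y\<in>A. f x y * c y))"
    by (simp add: qform_def sum_distrib_left mult.assoc)
  then show False using c assms(2) by (auto simp: posdef_def)
qed

text \<open>A nonsingular positive semidefinite form is bounded below by a multiple of the standard one:
  expand the form at \<open>c - t d\<close>, where \<open>d\<close> solves \<open>f d = c\<close>.\<close>

lemma semidef_nonsingular_bound:
  assumes A: "finite A" and sym: "\<And>x y. x \<in> A \<Longrightarrow> y \<in> A \<Longrightarrow> f x y = f y x"
    and psd: "\<And>c. qform A f c \<ge> 0" and ns: "sdet A f \<noteq> 0"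
  shows "\<exists>\<epsilon>>0. \<forall>c. qform A f c \<ge> \<epsilon> * (\<Sum>x\<in>A. (c x)\<^sup>2)"
proof -
  obtain h where h: "\<And>x z. x \<in> A \<Longrightarrow> z \<in> A \<Longrightarrow> (\<Sum>y\<in>A. f x y * h y z) = (if x = z then 1 else 0)"
    using sdet_inverse[OF A ns] by auto
  define C where "C = 1 + (\<Sum>x\<in>A. \<Sum>y\<in>A. \<bar>h x y\<bar>)"
  have C: "C > 0" unfolding C_def by (intro add_pos_nonneg sum_nonneg) auto
  have "qform A f c \<ge> 1 / C * (\<Sum>x\<in>A. (c x)\<^sup>2)" for c
  proof -
    define S where "S = (\<Sum>x\<in>A. (c x)\<^sup>2)"
    \<comment> \<open>As f d = c, both mixed terms of the expansion at c - t d are equal to the sum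
      of squares of \<open>c\<close>.\<close>
    define d where "d y = (\<Sum>z\<in>A. h y z * c z)" for y
    have fd: "(\<Sum>y\<in>A. f x y * d y) = c x" if "x \<in> A" for x
    proof -
      have "(\<Sum>y\<in>A. f x y * d y) = (\<Sum>z\<in>A. (\<Sum>y\<in>A. f x y * h y z) * c z)"
        unfolding d_def by (simp add: sum_distrib_left sum_distrib_right mult.assoc) (rule sum.swap)
      also have "\<dots> = (\<Sum>z\<in>A. if z = x then c x else 0)"
        by (rule sum.cong) (auto simp: h that)
      finally show ?thesis using A that by simp
    qed
    have 1: "(\<Sum>x\<in>A. \<Sum>y\<in>A. c x * f x y * d y) = S"
    proof -
      have "(\<Sum>x\<in>A. \<Sum>y\<in>A. c x * f x y * d y) = (\<Sum>x\<in>A. c x * (\<Sum>y\<in>A. f x y * d y))"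
        by (simp add: sum_distrib_left mult.assoc)
      then show ?thesis by (simp add: fd S_def power2_eq_square)
    qed
    have 2: "(\<Sum>x\<in>A. \<Sum>y\<in>A. d x * f x y * c y) = S"
    proof -
      have "(\<Sum>x\<in>A. \<Sum>y\<in>A. d x * f x y * c y) = (\<Sum>y\<in>A. \<Sum>x\<in>A. d x * f x y * c y)"
        by (rule sum.swap)
      also have "\<dots> = (\<Sum>x\<in>A. \<Sum>y\<in>A. c x * f x y * d y)"
        by (intro sum.cong refl) (simp add: sym mult_ac)
      finally show ?thesis using 1 by simp
    qed
    have 3: "qform A f d \<le> C * S"
    proof -
      have "qform A f d = (\<Sum>x\<in>A. d x * (\<Sum>y\<in>A. f x y * d y))"
        by (simp add: qform_def sum_distrib_left mult.assoc)
      also have "\<dots> = (\<Sum>x\<in>A. c x * d x)" by (rule sum.cong[OF refl]) (subst fd, assumption, rule mult.commute)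
      also have "\<dots> = qform A h c"
        by (simp add: d_def qform_def sum_distrib_left mult.assoc)
      also have "\<dots> \<le> (C - 1) * S"
        using qform_abs_le[OF A, of h c] by (simp add: C_def S_def)
      also have "\<dots> \<le> C * S" by (simp add: S_def sum_nonneg algebra_simps)
      finally show ?thesis .
    qed
    \<comment> \<open>With t = 1 / C the quadratic term is at most S / C, half of what the two mixed
      terms subtract.\<close>
    have "0 \<le> qform A f (\<lambda>x. c x - 1 / C * d x)" by (rule psd)
    also have "\<dots> = qform A f c - 1 / C * (\<Sum>x\<in>A. \<Sum>y\<in>A. c x * f x y * d y)
        - 1 / C * (\<Sum>x\<in>A. \<Sum>y\<in>A. d x * f x y * c y) + (1 / C)\<^sup>2 * qform A f d"
      by (rule qform_diff)
    also have "\<dots> = qform A f c - 2 / C * S + (1 / C)\<^sup>2 * qform A f d" using 1 2 by simp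
    also have "\<dots> \<le> qform A f c - 2 / C * S + (1 / C)\<^sup>2 * (C * S)"
      using 3 by (intro add_left_mono mult_left_mono) auto
    also have "\<dots> = qform A f c - 1 / C * S" using C by (simp add: field_simps power2_eq_square)
    finally show ?thesis by (simp add: S_def)
  qed
  then show ?thesis using C by (intro exI[of _ "1 / C"]) auto
qed

text \<open>A symmetric form without nonpositive eigenvalues is positive definite: otherwise consider the
  least \<open>t\<close> for which the shift by \<open>t\<close> is positive semidefinite.\<close>

lemma posdef_of_nonsingular_shifts:
  fixes f :: "'a \<Rightarrow> 'a \<Rightarrow> real"
  assumes A: "finite A" and sym: "\<And>x y. x \<in> A \<Longrightarrow> y \<in> A \<Longrightarrow> f x y = f y x"
    and ns: "\<And>t. t \<ge> 0 \<Longrightarrow> sdet A (shifted f t) \<noteq> 0"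
  shows "posdef A f"
proof -
  define T where "T = {t. 0 \<le> t \<and> (\<forall>c. qform A (shifted f t) c \<ge> 0)}"
  let ?S = "\<lambda>c :: 'a \<Rightarrow> real. \<Sum>x\<in>A. (c x)\<^sup>2"
  have S0: "?S c \<ge> 0" for c by (simp add: sum_nonneg)
  have large: "(\<Sum>x\<in>A. \<Sum>y\<in>A. \<bar>f x y\<bar>) \<in> T"
  proof -
    have "qform A (shifted f (\<Sum>x\<in>A. \<Sum>y\<in>A. \<bar>f x y\<bar>)) c \<ge> 0" for c
      unfolding qform_shifted[OF A] using qform_abs_le[OF A, of f c] by linarith
    then show ?thesis by (auto simp: T_def intro!: sum_nonneg)
  qed
  define s where "s = Inf T"
  have bdd: "bdd_below T" by (rule bdd_belowI[of _ 0]) (simp add: T_def)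
  have s0: "s \<ge> 0" unfolding s_def using large by (intro cInf_greatest) (auto simp: T_def)
  \<comment> \<open>The infimum is attained, because the form depends continuously on the
    shift.\<close>
  have psd: "qform A (shifted f s) c \<ge> 0" for c
  proof (rule field_le_epsilon)
    fix e :: real assume e: "e > 0"
    define \<delta> where "\<delta> = e / (?S c + 1)"
    have \<delta>: "\<delta> > 0" "\<delta> * ?S c \<le> e"
      using e S0[of c] by (auto simp: \<delta>_def field_simps intro!: divide_pos_pos add_nonneg_pos)
    have "Inf T < s + \<delta>" using \<delta> by (simp add: s_def)
    then obtain t where t: "t \<in> T" "t < s + \<delta>"
      using large cInf_lessD[of T "s + \<delta>"] by auto
    have "0 \<le> qform A (shifted f t) c" using t by (simp add: T_def)
    also have "\<dots> = qform A f c + t * ?S c" by (rule qform_shifted[OF A])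
    also have "\<dots> \<le> qform A f c + (s + \<delta>) * ?S c"
      using t S0[of c] by (intro add_left_mono mult_right_mono) auto
    also have "\<dots> \<le> qform A (shifted f s) c + e"
      unfolding qform_shifted[OF A] using \<delta> by (simp add: algebra_simps)
    finally show "0 \<le> qform A (shifted f s) c + e" .
  qed
  have "shifted f s x y = shifted f s y x" if "x \<in> A" "y \<in> A" for x y
    using sym[OF that] by simp
  then obtain \<epsilon> where \<epsilon>: "\<epsilon> > 0" "\<And>c. qform A (shifted f s) c \<ge> \<epsilon> * ?S c"
    using semidef_nonsingular_bound[OF A _ psd ns[OF s0]] by blast
  \<comment> \<open>At \<open>s\<close> the form dominates \<epsilon> times the sum of squares, so
    the shift could be lowered by \<epsilon> unless it meets 0.\<close>
  have "s = 0"
  proof (rule ccontr)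
    assume "s \<noteq> 0"
    define t where "t = max 0 (s - \<epsilon>)"
    have "qform A (shifted f t) c \<ge> 0" for c
    proof -
      have "\<epsilon> * ?S c \<le> qform A f c + s * ?S c" using \<epsilon>(2)[of c] by (simp add: qform_shifted[OF A])
      moreover have "(s - \<epsilon>) * ?S c \<le> t * ?S c" using S0 by (intro mult_right_mono) (auto simp: t_def)
      ultimately show ?thesis unfolding qform_shifted[OF A] by (simp add: algebra_simps)
    qed
    moreover have "t \<ge> 0" by (simp add: t_def)
    ultimately have "t \<in> T" by (simp add: T_def)
    then have "s \<le> t" unfolding s_def by (rule cInf_lower[OF _ bdd])
    then show False using \<epsilon>(1) s0 \<open>s \<noteq> 0\<close> by (auto simp: t_def)
  qed
  show ?thesis
    unfolding posdef_def
  proof (intro allI impI)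
    fix c :: "'a \<Rightarrow> real" assume c: "\<exists>x\<in>A. c x \<noteq> 0"
    then have "?S c > 0" using A by (auto simp: sum_nonneg_eq_0_iff less_le intro!: sum_nonneg)
    then have "0 < \<epsilon> * ?S c" using \<epsilon>(1) by simp
    also have "\<dots> \<le> qform A f c" using \<epsilon>(2)[of c] by (simp add: qform_shifted[OF A] \<open>s = 0\<close>)
    finally show "qform A f c > 0" .
  qed
qed

section \<open>Graphs and their spectra\<close>

text \<open>This is A + 2I. The diagonal is 2 whatever \<open>R x x\<close> is, so that the
  constantly true relation can stand for a complete graph.\<close>

definition gram :: "('v \<Rightarrow> 'v \<Rightarrow> bool) \<Rightarrow> 'v \<Rightarrow> 'v \<Rightarrow> 'a::comm_ring_1" where
  "gram R x y = (if x = y then 2 else if R x y then 1 else 0)"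

abbreviation adj :: "'v set set \<Rightarrow> 'v \<Rightarrow> 'v \<Rightarrow> bool" where
  "adj E u v \<equiv> {u, v} \<in> E"

lemma char_poly_eq_iff_spectrum:
  "graph_spectrum m F = graph_spectrum n E \<longleftrightarrow>
    char_poly (adjacency_matrix m F) = char_poly (adjacency_matrix n E)"
proof
  assume eq: "graph_spectrum m F = graph_spectrum n E"
  have "char_poly (adjacency_matrix k X) = (\<Prod>x\<in>#graph_spectrum k X. [:-x, 1:])" for k X
    using complex_poly_decompose_multiset[of "char_poly (adjacency_matrix k X)"]
      degree_monic_char_poly[OF adjacency_matrix_carrier[of k X]]
    by (simp add: graph_spectrum_def)
  then show "char_poly (adjacency_matrix m F) = char_poly (adjacency_matrix n E)"
    using eq by simp
qed (simp add: graph_spectrum_def)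

text \<open>The matrix is (- q) (z I - A) with z = - (u + 2 q) / q. Keeping both \<open>u\<close>
  and \<open>q\<close> gives a homogeneous form of the characteristic polynomial: q = 1 yields the
  shifts of A + 2I, and u = (1 - q)^2 the polynomial from which the tree is recovered.\<close>

lemma gram_sdet_char_poly:
  fixes u q :: complex
  assumes E: "E \<in> simple_graphs n" and q: "q \<noteq> 0"
  shows "sdet {..<n} (shifted (\<lambda>x y. q * gram (adj E) x y) u) =
    (- q) ^ n * poly (char_poly (adjacency_matrix n E)) (- (u + 2 * q) / q)"
proof -
  let ?A = "adjacency_matrix n E"
  let ?z = "- (u + 2 * q) / q"
  have id: "bij_betw (\<lambda>i. i) {0..<n} {..<n}" by (auto simp: bij_betw_def)
  have noloop: "{i} \<notin> E" for i using E by (auto simp: simple_graphs_def)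
  have "mat n n (\<lambda>(i, j). shifted (\<lambda>x y. q * gram (adj E) x y) u i j) = (- q) \<cdot>\<^sub>m (- char_matrix ?A ?z)"
    by (rule eq_matI) (use q noloop in \<open>auto simp: char_matrix_def adjacency_matrix_def gram_def field_simps\<close>)
  then have "sdet {..<n} (shifted (\<lambda>x y. q * gram (adj E) x y) u) = det ((- q) \<cdot>\<^sub>m (- char_matrix ?A ?z))"
    unfolding sdet_enum[OF id] by simp
  also have "\<dots> = (- q) ^ n * det (- char_matrix ?A ?z)"
    by (subst det_smult) (simp add: char_matrix_def adjacency_matrix_def)
  also have "det (- char_matrix ?A ?z) = poly (char_poly ?A) ?z"
    by (simp add: char_poly_matrix[OF adjacency_matrix_carrier])
  finally show ?thesis .
qed

lemma cospectral_gram_sdet_complex: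
  fixes u q :: complex
  assumes E: "E \<in> simple_graphs n" and F: "F \<in> simple_graphs n"
    and eq: "graph_spectrum n F = graph_spectrum n E"
  shows "sdet {..<n} (shifted (\<lambda>x y. q * gram (adj F) x y) u) =
    sdet {..<n} (shifted (\<lambda>x y. q * gram (adj E) x y) u)"
proof (cases "q = 0")
  case False
  then show ?thesis
    using gram_sdet_char_poly[OF E False] gram_sdet_char_poly[OF F False] eq
    by (simp add: char_poly_eq_iff_spectrum)
qed simp

lemma sdet_of_real:
  fixes f :: "'v \<Rightarrow> 'v \<Rightarrow> real"
  assumes "finite A"
  shows "of_real (sdet A f) = (sdet A (\<lambda>x y. of_real (f x y)) :: complex)"
  by (rule sdet_hom[OF _ assms]) (unfold_locales, auto)

lemma cospectral_gram_sdet: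
  fixes u q :: real
  assumes E: "E \<in> simple_graphs n" and F: "F \<in> simple_graphs n"
    and eq: "graph_spectrum n F = graph_spectrum n E"
  shows "sdet {..<n} (shifted (\<lambda>x y. q * gram (adj F) x y) u) =
    sdet {..<n} (shifted (\<lambda>x y. q * gram (adj E) x y) u)"
proof -
  have *: "of_real (sdet {..<n} (shifted (\<lambda>x y. q * gram (adj X) x y) u)) =
    sdet {..<n} (shifted (\<lambda>x y. of_real q * gram (adj X) x y) (of_real u :: complex))" for X
    unfolding sdet_of_real[OF finite_lessThan]
    by (rule sdet_cong) (auto simp: gram_def)
  have "complex_of_real (sdet {..<n} (shifted (\<lambda>x y. q * gram (adj F) x y) u)) =
      complex_of_real (sdet {..<n} (shifted (\<lambda>x y. q * gram (adj E) x y) u))"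
    unfolding * by (rule cospectral_gram_sdet_complex[OF assms])
  then show ?thesis by (simp only: of_real_eq_iff)
qed

no_notation vec_index (infixl "$" 100)
unbundle fps_syntax

section \<open>Rooted trees and their line graphs\<close>

text \<open>A tree is given by its set \<open>V\<close> of edges and a map \<open>par\<close>: its vertices are the root \<open>None\<close> and
  \<open>Some e\<close> for \<open>e \<in> V\<close>, and the edge \<open>e\<close> joins \<open>Some e\<close> to \<open>par e\<close>.\<close>

inductive rtree :: "('v \<Rightarrow> 'v option) \<Rightarrow> 'v set \<Rightarrow> bool" for par where
  rtree_empty: "rtree par {}"
| rtree_insert: "rtree par V \<Longrightarrow> v \<notin> V \<Longrightarrow> par v \<in> insert None (Some ` V) \<Longrightarrow> rtree par (insert v V)"

abbreviation verts :: "'v set \<Rightarrow> 'v option set" where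
  "verts V \<equiv> insert None (Some ` V)"

text \<open>The vertex-edge incidence matrix N.\<close>

definition inc :: "('v \<Rightarrow> 'v option) \<Rightarrow> 'v option \<Rightarrow> 'v \<Rightarrow> 'a::comm_ring_1" where
  "inc par a e = of_bool (a = Some e \<or> a = par e)"

text \<open>The end sets of two edges can meet in these three ways only, as
  \<open>Some e = Some f\<close> would mean that the edges are equal.\<close>

definition ladj :: "('v \<Rightarrow> 'v option) \<Rightarrow> 'v \<Rightarrow> 'v \<Rightarrow> bool" where
  "ladj par e f \<longleftrightarrow> e \<noteq> f \<and> (par e = par f \<or> par e = Some f \<or> par f = Some e)"

definition tadj :: "('v \<Rightarrow> 'v option) \<Rightarrow> 'v set \<Rightarrow> 'v option \<Rightarrow> 'v option \<Rightarrow> bool" where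
  "tadj par V a b \<longleftrightarrow> (\<exists>e\<in>V. (a = Some e \<and> b = par e) \<or> (b = Some e \<and> a = par e))"

definition deg :: "('v \<Rightarrow> 'v option) \<Rightarrow> 'v set \<Rightarrow> 'v option \<Rightarrow> nat" where
  "deg par V w = card {e\<in>V. w = Some e \<or> w = par e}"

definition children :: "('v \<Rightarrow> 'v option) \<Rightarrow> 'v set \<Rightarrow> 'v option \<Rightarrow> 'v set" where
  "children par V w = {e\<in>V. par e = w}"

lemma rtree_finite: "rtree par V \<Longrightarrow> finite V"
  by (induction rule: rtree.induct) auto

lemma rtree_cong:
  assumes "rtree par V" "\<And>e. e \<in> V \<Longrightarrow> par' e = par e"
  shows "rtree par' V"
  using assms by (induction rule: rtree.induct) (auto intro: rtree.intros)

lemma rtree_par_in: "rtree par V \<Longrightarrow> e \<in> V \<Longrightarrow> par e \<in> verts V"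
  by (induction rule: rtree.induct) auto

text \<open>A depth exists since vertices are only ever attached below earlier ones. It excludes
  loops and two edges with the same ends.\<close>

lemma rtree_rank:
  assumes "rtree par V"
  shows "\<exists>r::'v option \<Rightarrow> nat. \<forall>e\<in>V. r (par e) < r (Some e)"
  using assms
proof (induction rule: rtree.induct)
  case (rtree_insert V v)
  then obtain r :: "'v option \<Rightarrow> nat" where r: "\<forall>e\<in>V. r (par e) < r (Some e)" by blast
  have "par e \<noteq> Some v" if "e \<in> insert v V" for e
    using that rtree_par_in[OF rtree_insert(1)] rtree_insert by fastforce
  then show ?case
    using r rtree_insert.hyps by (intro exI[of _ "r(Some v := Suc (r (par v)))"]) auto
qed simp

lemma par_neq: "rtree par V \<Longrightarrow> e \<in> V \<Longrightarrow> par e \<noteq> Some e"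
  using rtree_rank by fastforce

lemma par_antisym: "rtree par V \<Longrightarrow> e \<in> V \<Longrightarrow> f \<in> V \<Longrightarrow> par e = Some f \<Longrightarrow> par f \<noteq> Some e"
  using rtree_rank[of par V] by (metis order_less_asym)

lemma sum_inc:
  assumes "rtree par V" "e \<in> V"
  shows "(\<Sum>a\<in>verts V. inc par a e * h a) = h (Some e) + h (par e)"
proof -
  have "(\<Sum>a\<in>verts V. inc par a e * h a) = (\<Sum>a\<in>{Some e, par e}. h a)"
    using rtree_finite[OF assms(1)] rtree_par_in[OF assms] assms(2)
    by (intro sum.mono_neutral_cong_right) (auto simp: inc_def)
  then show ?thesis using par_neq[OF assms] by auto
qed

text \<open>N^T N = A + 2I for the line graph, because distinct edges of a tree share at most one
  end.\<close>

lemma gram_ladj: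
  assumes "rtree par V" "e \<in> V" "f \<in> V"
  shows "(\<Sum>a\<in>verts V. inc par a e * inc par a f) = (gram (ladj par) e f :: 'a::comm_ring_1)"
  using par_neq[OF assms(1,2)] par_neq[OF assms(1,3)] par_antisym[OF assms]
  unfolding sum_inc[OF assms(1,2)] by (auto simp: inc_def gram_def ladj_def)

text \<open>The matrix with diagonal \<open>a\<close> and entries \<open>\<theta>\<close> at the edges; \<open>b\<close> are its pivots under
  elimination from the leaves to the root.\<close>

definition tmat :: "('v \<Rightarrow> 'v option) \<Rightarrow> 'v set \<Rightarrow> ('v option \<Rightarrow> 'a) \<Rightarrow> 'a \<Rightarrow>
    'v option \<Rightarrow> 'v option \<Rightarrow> 'a::comm_ring_1" where
  "tmat par V a \<theta> x y = (if x = y then a x else if tadj par V x y then \<theta> else 0)"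

lemma tadj_insert:
  assumes "rtree par V" "v \<notin> V" "x \<in> verts V"
  shows "tadj par (insert v V) x (Some v) \<longleftrightarrow> x = par v"
    and "tadj par (insert v V) (Some v) x \<longleftrightarrow> x = par v"
    and "y \<in> verts V \<Longrightarrow> tadj par (insert v V) x y \<longleftrightarrow> tadj par V x y"
proof -
  have "par e \<noteq> Some v" "Some v \<noteq> par e" if "e \<in> V" for e
    using rtree_par_in[OF assms(1) that] assms(2) by auto
  then show "tadj par (insert v V) x (Some v) \<longleftrightarrow> x = par v"
    and "tadj par (insert v V) (Some v) x \<longleftrightarrow> x = par v"
    and "y \<in> verts V \<Longrightarrow> tadj par (insert v V) x y \<longleftrightarrow> tadj par V x y"
    using assms(2,3) unfolding tadj_def by auto
qed

text \<open>The vertex inserted last is a leaf, so its Schur complement changes one diagonal entry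
  only, that of its parent; this is why \<open>a\<close> varies in the induction. Inverses
  \<open>c\<close> of the pivots are demanded at \<open>Some e\<close> only, since the root pivot
  may fail to be a unit.\<close>

lemma sdet_tmat:
  fixes a b c :: "'v option \<Rightarrow> 'a::idom"
  assumes "rtree par V"
    and "\<And>w. w \<in> verts V \<Longrightarrow> b w = a w - \<theta>\<^sup>2 * (\<Sum>e\<in>children par V w. c (Some e))"
    and "\<And>e. e \<in> V \<Longrightarrow> b (Some e) * c (Some e) = 1"
  shows "sdet (verts V) (tmat par V a \<theta>) = (\<Prod>w\<in>verts V. b w)"
  using assms
proof (induction arbitrary: a rule: rtree.induct)
  case rtree_empty
  then show ?case by (simp add: children_def tmat_def)
next
  case (rtree_insert V v)
  note fin = rtree_finite[OF rtree_insert(1)]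
  have no_child: "children par (insert v V) (Some v) = {}"
    using rtree_par_in[OF rtree_insert(1)] rtree_insert(2,3) by (fastforce simp: children_def)
  then have bv: "b (Some v) = a (Some v)" using rtree_insert.prems(1)[of "Some v"] by simp
  define a' where "a' = a(par v := a (par v) - \<theta>\<^sup>2 * c (Some v))"
  have IH: "sdet (verts V) (tmat par V a' \<theta>) = (\<Prod>w\<in>verts V. b w)"
  proof (rule rtree_insert.IH)
    fix w assume w: "w \<in> verts V"
    have "children par (insert v V) w =
        (if w = par v then insert v (children par V w) else children par V w)"
      by (auto simp: children_def)
    moreover have "v \<notin> children par V w" "finite (children par V w)"
      using rtree_insert(2) fin by (auto simp: children_def)
    moreover have "b w = a w - \<theta>\<^sup>2 * (\<Sum>e\<in>children par (insert v V) w. c (Some e))"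
      using rtree_insert.prems(1)[of w] w by blast
    ultimately show "b w = a' w - \<theta>\<^sup>2 * (\<Sum>e\<in>children par V w. c (Some e))"
      by (cases "w = par v") (simp_all add: a'_def algebra_simps)
  qed (use rtree_insert.prems(2) in auto)
  let ?f = "tmat par (insert v V) a \<theta>"
  have "sdet (insert (Some v) (verts V)) ?f =
      ?f (Some v) (Some v) * sdet (verts V) (\<lambda>x y. ?f x y - ?f x (Some v) * c (Some v) * ?f (Some v) y)"
  proof (rule sdet_schur)
    show "?f (Some v) (Some v) * c (Some v) = 1"
      using rtree_insert.prems(2)[of v] bv by (simp add: tmat_def)
  qed (use rtree_insert(2) fin in auto)
  also have "sdet (verts V) (\<lambda>x y. ?f x y - ?f x (Some v) * c (Some v) * ?f (Some v) y) =
      sdet (verts V) (tmat par V a' \<theta>)"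
  proof (rule sdet_cong[OF refl])
    fix x y assume xy: "x \<in> verts V" "y \<in> verts V"
    then have "x \<noteq> Some v" "y \<noteq> Some v" using rtree_insert(2) by auto
    then show "?f x y - ?f x (Some v) * c (Some v) * ?f (Some v) y = tmat par V a' \<theta> x y"
      using tadj_insert[OF rtree_insert(1,2) xy(1)] tadj_insert[OF rtree_insert(1,2) xy(2)] xy
      by (auto simp: tmat_def a'_def power2_eq_square algebra_simps)
  qed
  also have "?f (Some v) (Some v) = b (Some v)" by (simp add: tmat_def bv)
  finally have "sdet (insert (Some v) (verts V)) ?f = b (Some v) * (\<Prod>w\<in>verts V. b w)"
    by (simp only: IH)
  also have "\<dots> = (\<Prod>w\<in>insert (Some v) (verts V). b w)"
    using rtree_insert(2) fin by (subst prod.insert) auto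
  also have "insert (Some v) (verts V) = verts (insert v V)" by auto
  finally show ?case .
qed

text \<open>N N^T is the signless Laplacian of the tree: degrees on the diagonal plus the adjacency
  matrix.\<close>

lemma sum_inc_edges:
  assumes "rtree par V" "a \<in> verts V" "b \<in> verts V"
  shows "(\<Sum>e\<in>V. inc par a e * inc par b e) =
    (if a = b then of_nat (deg par V a) else if tadj par V a b then 1 else (0::'a::comm_ring_1))"
proof (cases "a = b")
  case True
  have "(\<Sum>e\<in>V. inc par a e * inc par a e) = (\<Sum>e\<in>{e\<in>V. a = Some e \<or> a = par e}. (1::'a))"
    using rtree_finite[OF assms(1)] by (intro sum.mono_neutral_cong_right) (auto simp: inc_def)
  then show ?thesis using True by (simp add: deg_def)
next
  case False
  show ?thesis
  proof (cases "tadj par V a b")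
    case True
    then obtain e where e: "e \<in> V" "{a, b} = {Some e, par e}" by (auto simp: tadj_def)
    have "inc par a g * inc par b g = (if g = e then 1 else (0::'a))" if "g \<in> V" for g
    proof (cases "g = e")
      case True
      then show ?thesis using e(2) by (auto simp: inc_def doubleton_eq_iff)
    next
      case ne: False
      have "\<not> (a \<in> {Some g, par g} \<and> b \<in> {Some g, par g})"
      proof
        assume "a \<in> {Some g, par g} \<and> b \<in> {Some g, par g}"
        then have "{Some e, par e} = {Some g, par g}" using e(2) False by auto
        then show False
          using ne par_antisym[OF assms(1) e(1) that] by (auto simp: doubleton_eq_iff)
      qed
      then show ?thesis using ne by (auto simp: inc_def)
    qed
    then have "(\<Sum>g\<in>V. inc par a g * inc par b g) = (\<Sum>g\<in>V. if g = e then 1 else (0::'a))"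
      by (intro sum.cong) auto
    then show ?thesis using True \<open>a \<noteq> b\<close> e rtree_finite[OF assms(1)] by simp
  next
    case nt: False
    have "inc par a g * inc par b g = (0::'a)" if "g \<in> V" for g
      using nt that \<open>a \<noteq> b\<close> by (auto simp: inc_def tadj_def)
    then have "(\<Sum>g\<in>V. inc par a g * inc par b g) = (0::'a)" by (intro sum.neutral) auto
    then show ?thesis using nt \<open>a \<noteq> b\<close> by simp
  qed
qed

text \<open>Sylvester's identity for N; a tree has one vertex more than edges, which leaves the
  single factor \<open>u\<close>. The right hand side can be eliminated leaf by leaf.\<close>

lemma sdet_line_graph:
  fixes u q :: "'a::idom"
  assumes T: "rtree par V" and u: "u \<noteq> 0"
  shows "u * sdet V (shifted (\<lambda>e f. q * gram (ladj par) e f) u) =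
    sdet (verts V) (tmat par V (\<lambda>w. u + q * of_nat (deg par V w)) q)"
proof -
  note fin = rtree_finite[OF T]
  have card: "card (verts V) = Suc (card V)" using fin by (simp add: card_image)
  have "sdet (verts V) (\<lambda>x y. (if x = y then u else 0) + q * (\<Sum>e\<in>V. inc par x e * inc par y e)) =
      sdet (verts V) (tmat par V (\<lambda>w. u + q * of_nat (deg par V w)) q)"
    by (rule sdet_cong[OF refl]) (auto simp: sum_inc_edges[OF T] tmat_def simp del: insert_iff)
  moreover have "sdet V (\<lambda>e g. (if e = g then u else 0) + q * (\<Sum>x\<in>verts V. inc par x e * inc par x g)) =
      sdet V (shifted (\<lambda>e f. q * gram (ladj par) e f) u)"
    by (rule sdet_cong[OF refl]) (simp add: gram_ladj[OF T])
  ultimately have "u ^ card V * sdet (verts V) (tmat par V (\<lambda>w. u + q * of_nat (deg par V w)) q) =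
      u ^ card V * (u * sdet V (shifted (\<lambda>e f. q * gram (ladj par) e f) u))"
    using sdet_sylvester[of "verts V" V u q "inc par"] fin by (simp add: card mult_ac)
  then show ?thesis using u by simp
qed

lemma deg_children:
  assumes "rtree par V"
  shows "deg par V None = card (children par V None)"
    and "e \<in> V \<Longrightarrow> deg par V (Some e) = Suc (card (children par V (Some e)))"
proof -
  show "deg par V None = card (children par V None)"
    unfolding deg_def children_def by (rule arg_cong[of _ _ card]) auto
  assume e: "e \<in> V"
  have "{f\<in>V. Some e = Some f \<or> Some e = par f} = insert e (children par V (Some e))"
    using e by (auto simp: children_def)
  moreover have "e \<notin> children par V (Some e)" "finite (children par V (Some e))"
    using par_neq[OF assms] rtree_finite[OF assms] by (auto simp: children_def)
  ultimately show "deg par V (Some e) = Suc (card (children par V (Some e)))"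
    by (simp add: deg_def)
qed

lemma children_insert:
  assumes "rtree par V" "v \<notin> V" "par v \<in> verts V"
  shows "children par (insert v V) (Some v) = {}"
    and "w \<in> verts V \<Longrightarrow> children par (insert v V) w =
      (if w = par v then insert v (children par V w) else children par V w)"
    and "v \<notin> children par V w" and "finite (children par V w)"
proof -
  have "par e \<noteq> Some v" if "e \<in> V" for e
    using rtree_par_in[OF assms(1) that] assms(2) by auto
  moreover have "par v \<noteq> Some v" using assms(2,3) by auto
  ultimately show "children par (insert v V) (Some v) = {}" by (auto simp: children_def)
  show "children par (insert v V) w =
      (if w = par v then insert v (children par V w) else children par V w)" if "w \<in> verts V"
    by (auto simp: children_def)
  show "v \<notin> children par V w" "finite (children par V w)"
    using assms(2) rtree_finite[OF assms(1)] by (auto simp: children_def)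
qed

section \<open>The determinant of a tree line graph\<close>

text \<open>The pivots start with 1, except that of the root, which starts with 0. Since 1 / (1 + t
  X) begins with 1 - t X, each step of the elimination adds the linear coefficient of a leaf to that
  of its parent, so all of them accumulate at the root.\<close>

lemma pivots_at_zero:
  fixes a :: "'v option \<Rightarrow> 'a::field fps"
  assumes "rtree par V"
    and "\<And>e. e \<in> V \<Longrightarrow> a (Some e) $ 0 = 1 + of_nat (card (children par V (Some e)))"
    and "a None $ 0 = of_nat (card (children par V None))"
  shows "\<exists>b. (\<forall>w\<in>verts V. b w = a w - (\<Sum>e\<in>children par V w. inverse (b (Some e)))) \<and>
    (\<forall>e\<in>V. b (Some e) $ 0 = 1) \<and> b None $ 0 = 0 \<and> b None $ 1 = (\<Sum>w\<in>verts V. a w $ 1)"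
  using assms
proof (induction arbitrary: a rule: rtree.induct)
  case rtree_empty
  then show ?case by (intro exI[of _ a]) (simp add: children_def)
next
  case (rtree_insert V v)
  note ch = children_insert[OF rtree_insert(1,2,3)]
  define a' where "a' = a(par v := a (par v) - inverse (a (Some v)))"
  have av: "a (Some v) $ 0 = 1" using rtree_insert.prems(1)[of v] ch(1) by simp
  have inv0: "inverse (a (Some v)) $ 0 = 1" by (simp add: av)
  have inv1: "inverse (a (Some v)) $ 1 = - (a (Some v) $ 1)"
  proof -
    have "a (Some v) * inverse (a (Some v)) = 1"
      using av by (intro inverse_mult_eq_1') simp
    then have "(a (Some v) * inverse (a (Some v))) $ 1 = 0" by simp
    then show ?thesis using av inv0 by (simp add: fps_mult_nth add_eq_0_iff)
  qed
  have "\<exists>b. (\<forall>w\<in>verts V. b w = a' w - (\<Sum>e\<in>children par V w. inverse (b (Some e)))) \<and>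
    (\<forall>e\<in>V. b (Some e) $ 0 = 1) \<and> b None $ 0 = 0 \<and> b None $ 1 = (\<Sum>w\<in>verts V. a' w $ 1)"
  proof (rule rtree_insert.IH)
    show "a' (Some e) $ 0 = 1 + of_nat (card (children par V (Some e)))" if "e \<in> V" for e
      using rtree_insert.prems(1)[of e] that ch(2)[of "Some e"] ch(3,4)[of "Some e"] inv0
      by (auto simp: a'_def simp del: fps_inverse_nth_0)
    show "a' None $ 0 = of_nat (card (children par V None))"
      using rtree_insert.prems(2) ch(2)[of None] ch(3,4)[of None] inv0
      by (auto simp: a'_def simp del: fps_inverse_nth_0)
  qed
  then obtain b where b: "\<And>w. w \<in> verts V \<Longrightarrow> b w = a' w - (\<Sum>e\<in>children par V w. inverse (b (Some e)))"
    "\<And>e. e \<in> V \<Longrightarrow> b (Some e) $ 0 = 1" "b None $ 0 = 0" "b None $ 1 = (\<Sum>w\<in>verts V. a' w $ 1)"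
    by blast
  define b' where "b' = b(Some v := a (Some v))"
  have b'_eq: "b' w = b w" if "w \<in> verts V" for w using that rtree_insert(2) by (auto simp: b'_def)
  have sum_eq: "(\<Sum>e\<in>children par V w. inverse (b' (Some e))) = (\<Sum>e\<in>children par V w. inverse (b (Some e)))" for w
    by (rule sum.cong) (auto simp: b'_eq children_def)
  have "b' w = a w - (\<Sum>e\<in>children par (insert v V) w. inverse (b' (Some e)))"
    if w: "w \<in> verts (insert v V)" for w
  proof (cases "w = Some v")
    case True
    then show ?thesis using ch(1) by (simp add: b'_def)
  next
    case False
    then have w': "w \<in> verts V" using w by auto
    show ?thesis
      using b(1)[OF w'] ch(3,4)[of w] unfolding ch(2)[OF w'] b'_eq[OF w']
      by (auto simp: a'_def sum_eq) (simp add: b'_def)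
  qed
  moreover have "(\<Sum>w\<in>verts V. a' w $ 1) = (\<Sum>w\<in>verts (insert v V). a w $ 1)"
  proof -
    have fin: "finite (verts V)" using rtree_finite[OF rtree_insert(1)] by simp
    have "(\<Sum>w\<in>verts V. a' w $ 1) = (\<Sum>w\<in>verts V. a w $ 1 + (if w = par v then a (Some v) $ 1 else 0))"
      by (rule sum.cong) (use inv1 in \<open>auto simp: a'_def\<close>)
    also have "\<dots> = (\<Sum>w\<in>verts V. a w $ 1) + a (Some v) $ 1"
      using fin rtree_insert(3) by (simp add: sum.distrib)
    also have "\<dots> = (\<Sum>w\<in>insert (Some v) (verts V). a w $ 1)"
      using fin rtree_insert(2) by (subst sum.insert) auto
    finally show ?thesis by (simp add: insert_commute)
  qed
  ultimately show ?case
    using b av by (intro exI[of _ b']) (auto simp: b'_def)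
qed

text \<open>For u = X and q = 1 every vertex contributes linear coefficient 1, so the product of the
  pivots begins with the number of vertices times X. Cancelling the factor \<open>u\<close> and
  evaluating at X = 0 leaves the determinant of A + 2I.\<close>

lemma sdet_gram_tree:
  assumes T: "rtree par V"
  shows "sdet V (gram (ladj par)) = (of_nat (card V + 1) :: 'a::field)"
proof -
  note fin = rtree_finite[OF T]
  let ?a = "\<lambda>w. fps_X + 1 * of_nat (deg par V w) :: 'a fps"
  have nth0: "(of_nat n :: 'a fps) $ 0 = of_nat n" "(of_nat n :: 'a fps) $ Suc 0 = 0" for n
    by (simp_all add: fps_of_nat[symmetric])
  have "\<exists>b. (\<forall>w\<in>verts V. b w = ?a w - (\<Sum>e\<in>children par V w. inverse (b (Some e)))) \<and>
    (\<forall>e\<in>V. b (Some e) $ 0 = 1) \<and> b None $ 0 = 0 \<and> b None $ 1 = (\<Sum>w\<in>verts V. ?a w $ 1)"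
    by (rule pivots_at_zero[OF T]) (simp_all add: deg_children[OF T] nth0)
  then obtain b where b: "\<And>w. w \<in> verts V \<Longrightarrow> b w = ?a w - (\<Sum>e\<in>children par V w. inverse (b (Some e)))"
    "\<And>e. e \<in> V \<Longrightarrow> b (Some e) $ 0 = 1" "b None $ 0 = 0" "b None $ 1 = (\<Sum>w\<in>verts V. ?a w $ 1)"
    by blast
  have "fps_X * sdet V (shifted (\<lambda>e f. 1 * gram (ladj par) e f) fps_X) =
      sdet (verts V) (tmat par V ?a 1)"
    by (rule sdet_line_graph[OF T]) simp
  also have "\<dots> = (\<Prod>w\<in>verts V. b w)"
    using b by (intro sdet_tmat[OF T, where c = "\<lambda>w. inverse (b w)"]) (auto intro!: inverse_mult_eq_1')
  also have "\<dots> = b None * (\<Prod>w\<in>Some ` V. b w)" using fin by simp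
  finally have eq: "fps_X * sdet V (shifted (gram (ladj par)) fps_X) = b None * (\<Prod>w\<in>Some ` V. b w)"
    by simp
  have prod1: "(\<Prod>w\<in>Some ` V. b w) $ 0 = 1"
    using fin b(2) by (simp add: prod.reindex) (induction V rule: finite_induct; simp)
  have "sdet V (shifted (gram (ladj par)) fps_X) $ 0 = (fps_X * sdet V (shifted (gram (ladj par)) fps_X)) $ 1"
    by simp
  also have "\<dots> = b None $ 1"
    unfolding eq using b(3) prod1 by (simp add: fps_mult_nth)
  also have "\<dots> = of_nat (card V + 1)"
    using b(4) fin by (simp add: nth0 card_image add.commute)
  finally have 1: "sdet V (shifted (gram (ladj par)) fps_X) $ 0 = (of_nat (card V + 1) :: 'a)" .
  have hom: "comm_ring_hom (\<lambda>f::'a fps. f $ 0)" by unfold_locales auto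
  have "sdet V (shifted (gram (ladj par)) fps_X) $ 0 = sdet V (\<lambda>x y. shifted (gram (ladj par)) fps_X x y $ 0 :: 'a)"
    by (rule sdet_hom[OF hom fin])
  also have "\<dots> = sdet V (gram (ladj par))"
    by (rule sdet_cong) (auto simp: gram_def numeral_fps_const)
  finally show ?thesis using 1 by simp
qed

section \<open>Power series up to a given order\<close>

definition fcong :: "nat \<Rightarrow> 'a::comm_ring_1 fps \<Rightarrow> 'a fps \<Rightarrow> bool" where
  "fcong n f g \<longleftrightarrow> (\<forall>i<n. f $ i = g $ i)"

lemma fcong_refl [simp]: "fcong n f f"
  by (simp add: fcong_def)

lemma fcong_sym: "fcong n f g \<Longrightarrow> fcong n g f"
  by (simp add: fcong_def)

lemma fcong_trans [trans]: "fcong n f g \<Longrightarrow> fcong n g h \<Longrightarrow> fcong n f h"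
  by (simp add: fcong_def)

lemma fcong_mono: "fcong n f g \<Longrightarrow> m \<le> n \<Longrightarrow> fcong m f g"
  by (simp add: fcong_def)

lemma fcong_add: "fcong n f g \<Longrightarrow> fcong n f' g' \<Longrightarrow> fcong n (f + f') (g + g')"
  by (simp add: fcong_def)

lemma fcong_diff: "fcong n f g \<Longrightarrow> fcong n f' g' \<Longrightarrow> fcong n (f - f') (g - g')"
  by (simp add: fcong_def)

lemma fcong_mult: "fcong n f g \<Longrightarrow> fcong n f' g' \<Longrightarrow> fcong n (f * f') (g * g')"
  by (auto simp: fcong_def fps_mult_nth intro!: sum.cong)

lemma fcong_sum: "(\<And>x. x \<in> A \<Longrightarrow> fcong n (f x) (g x)) \<Longrightarrow> fcong n (sum f A) (sum g A)"
  by (induction A rule: infinite_finite_induct) (auto intro: fcong_add)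

lemma fcong_prod: "(\<And>x. x \<in> A \<Longrightarrow> fcong n (f x) (g x)) \<Longrightarrow> fcong n (prod f A) (prod g A)"
  by (induction A rule: infinite_finite_induct) (auto intro: fcong_mult)

lemma fcong_X_power_mult: "fcong n f g \<Longrightarrow> fcong (m + n) (fps_X ^ m * f) (fps_X ^ m * g)"
  by (auto simp: fcong_def fps_X_power_mult_nth)

lemma fcong_X_power_0: "n \<le> m \<Longrightarrow> fcong n (fps_X ^ m * f) 0"
  by (auto simp: fcong_def fps_X_power_mult_nth)

lemma fcong_0_iff: "fcong n f 0 \<longleftrightarrow> (\<exists>g. f = fps_X ^ n * g)"
proof
  assume "fcong n f 0"
  then have "f = fps_X ^ n * fps_shift n f"
    by (intro fps_ext) (auto simp: fcong_def fps_X_power_mult_nth)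
  then show "\<exists>g. f = fps_X ^ n * g" by blast
qed (auto simp: fcong_X_power_0)

lemma fcong_iff: "fcong n f g \<longleftrightarrow> (\<exists>h. f = g + fps_X ^ n * h)"
proof -
  have "fcong n f g \<longleftrightarrow> fcong n (f - g) 0" by (auto simp: fcong_def)
  then show ?thesis by (auto simp: fcong_0_iff algebra_simps)
qed

lemma fcong_if: "(P \<Longrightarrow> fcong n f g) \<Longrightarrow> fcong n (if P then f else h) (if P then g else h)"
  by simp

lemma fcong_cancel:
  fixes f g h :: "'a::field fps"
  assumes "fcong n (h * f) (h * g)" "h $ 0 \<noteq> 0"
  shows "fcong n f g"
proof -
  have "fcong n (inverse h * (h * f)) (inverse h * (h * g))"
    using assms(1) by (rule fcong_mult[OF fcong_refl])
  moreover have "inverse h * (h * x) = x" for x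
    using inverse_mult_eq_1[OF assms(2)] by (metis mult.assoc mult_1)
  ultimately show ?thesis by (simp only:)
qed

text \<open>Products of two of the \<open>u x\<close> are divisible by X^(2 m).\<close>

lemma fcong_prod_1:
  assumes "\<And>x. x \<in> A \<Longrightarrow> fcong m (u x) 0" "n \<le> 2 * m"
  shows "fcong n (\<Prod>x\<in>A. 1 + u x) (1 + (\<Sum>x\<in>A. u x))"
  using assms(1)
proof (induction A rule: infinite_finite_induct)
  case (insert x A)
  obtain g where g: "u x = fps_X ^ m * g" using insert.prems[of x] by (auto simp: fcong_0_iff)
  have "fcong m (\<Sum>x\<in>A. u x) (\<Sum>x\<in>A. 0)" using insert.prems by (intro fcong_sum) auto
  then obtain h where h: "(\<Sum>x\<in>A. u x) = fps_X ^ m * h" by (auto simp: fcong_0_iff)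
  have "fcong n ((1 + u x) * (\<Prod>x\<in>A. 1 + u x)) ((1 + u x) * (1 + (\<Sum>x\<in>A. u x)))"
    using insert by (intro fcong_mult) auto
  also have "(1 + u x) * (1 + (\<Sum>x\<in>A. u x)) = (1 + (u x + (\<Sum>x\<in>A. u x))) + fps_X ^ (2 * m) * (g * h)"
    unfolding g h mult_2 power_add by (simp add: algebra_simps)
  also have "fcong n \<dots> ((1 + (u x + (\<Sum>x\<in>A. u x))) + 0)"
    using assms(2) by (intro fcong_add fcong_X_power_0) auto
  finally show ?case using insert.hyps by simp
qed auto

section \<open>Low order terms of the characteristic polynomial of a tree line graph\<close>

text \<open>The factor X^2 makes the corrections vanish at X = 0, so all pivots, also that of the
  root, inherit constant term 1 and are units.\<close>

lemma pivots_at_X: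
  fixes a :: "'v option \<Rightarrow> 'a::field fps"
  assumes "rtree par V" and "\<And>w. w \<in> verts V \<Longrightarrow> a w $ 0 = 1"
  shows "\<exists>b. \<forall>w\<in>verts V. b w $ 0 = 1 \<and>
    b w = a w - fps_X\<^sup>2 * (\<Sum>e\<in>children par V w. inverse (b (Some e)))"
  using assms
proof (induction arbitrary: a rule: rtree.induct)
  case rtree_empty
  then show ?case by (intro exI[of _ a]) (simp add: children_def)
next
  case (rtree_insert V v)
  note ch = children_insert[OF rtree_insert(1,2,3)]
  define a' where "a' = a(par v := a (par v) - fps_X\<^sup>2 * inverse (a (Some v)))"
  have "a (par v) $ 0 = 1" using rtree_insert.prems[of "par v"] rtree_insert(3) by auto
  then have "\<exists>b. \<forall>w\<in>verts V. b w $ 0 = 1 \<and>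
    b w = a' w - fps_X\<^sup>2 * (\<Sum>e\<in>children par V w. inverse (b (Some e)))"
    using rtree_insert.prems by (intro rtree_insert.IH) (auto simp: a'_def)
  then obtain b where b: "\<And>w. w \<in> verts V \<Longrightarrow> b w $ 0 = 1"
    "\<And>w. w \<in> verts V \<Longrightarrow> b w = a' w - fps_X\<^sup>2 * (\<Sum>e\<in>children par V w. inverse (b (Some e)))"
    by blast
  define b' where "b' = b(Some v := a (Some v))"
  have b'_eq: "b' w = b w" if "w \<in> verts V" for w using that rtree_insert(2) by (auto simp: b'_def)
  have sum_eq: "(\<Sum>e\<in>children par V w. inverse (b' (Some e))) = (\<Sum>e\<in>children par V w. inverse (b (Some e)))" for w
    by (rule sum.cong) (auto simp: b'_eq children_def)
  have "b' w $ 0 = 1 \<and>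
      b' w = a w - fps_X\<^sup>2 * (\<Sum>e\<in>children par (insert v V) w. inverse (b' (Some e)))"
    if w: "w \<in> verts (insert v V)" for w
  proof (cases "w = Some v")
    case True
    then show ?thesis using ch(1) rtree_insert.prems[of w] by (simp add: b'_def)
  next
    case False
    then have w': "w \<in> verts V" using w by auto
    have "b w = a w - fps_X\<^sup>2 * (\<Sum>e\<in>children par (insert v V) w. inverse (b' (Some e)))"
    proof (cases "w = par v")
      case True
      then show ?thesis
        unfolding ch(2)[OF w'] using b(2)[OF w'] ch(3,4)[of w]
        by (simp add: a'_def sum_eq) (simp add: b'_def algebra_simps)
    next
      case False
      then show ?thesis
        unfolding ch(2)[OF w'] using b(2)[OF w'] by (simp add: a'_def sum_eq)
    qed
    then show ?thesis using b(1)[OF w'] b'_eq[OF w'] by simp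
  qed
  then show ?case by (intro exI[of _ b']) blast
qed

text \<open>The pivots for u = (1 - q)^2 at q = X. The diagonal entry is 1 + q (deg - 2) + q^2,
  which makes degree 2 the neutral case and explains the shift by 2 in \<open>dm\<close>.\<close>

abbreviation tree_pivots :: "('v \<Rightarrow> 'v option) \<Rightarrow> 'v set \<Rightarrow> ('v option \<Rightarrow> 'a::field fps) \<Rightarrow> bool" where
  "tree_pivots par V b \<equiv> (\<forall>w\<in>verts V. b w $ 0 = 1 \<and>
    b w = (1 - fps_X)\<^sup>2 + fps_X * of_nat (deg par V w) -
      fps_X\<^sup>2 * (\<Sum>e\<in>children par V w. inverse (b (Some e))))"

lemma of_nat_fps_nth [simp]: "(of_nat n :: 'a::comm_ring_1 fps) $ 0 = of_nat n"
  by (simp add: fps_of_nat[symmetric])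

lemma tree_pivots_exist:
  assumes "rtree par V"
  shows "\<exists>b. tree_pivots par V b"
  using pivots_at_X[OF assms, of "\<lambda>w. (1 - fps_X)\<^sup>2 + fps_X * of_nat (deg par V w)"]
  by (simp add: power2_eq_square)

lemma line_graph_pivots:
  fixes b :: "'v option \<Rightarrow> 'a::field fps"
  assumes T: "rtree par V" and b: "tree_pivots par V b"
  shows "(1 - fps_X)\<^sup>2 * sdet V (shifted (\<lambda>e f. fps_X * gram (ladj par) e f) ((1 - fps_X)\<^sup>2)) =
    (\<Prod>w\<in>verts V. b w)"
proof -
  have "(1 - fps_X :: 'a fps) $ 0 \<noteq> 0" by simp
  then have "(1 - fps_X :: 'a fps)\<^sup>2 \<noteq> 0" by (metis fps_zero_nth power_eq_0_iff)
  from sdet_line_graph[OF T this, of fps_X]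
  have "(1 - fps_X)\<^sup>2 * sdet V (shifted (\<lambda>e f. fps_X * gram (ladj par) e f) ((1 - fps_X)\<^sup>2)) =
      sdet (verts V) (tmat par V (\<lambda>w. (1 - fps_X :: 'a fps)\<^sup>2 + fps_X * of_nat (deg par V w)) fps_X)" .
  also have "\<dots> = (\<Prod>w\<in>verts V. b w)"
    using b by (intro sdet_tmat[OF T, where c = "\<lambda>w. inverse (b w)"]) (auto intro!: inverse_mult_eq_1')
  finally show ?thesis .
qed

definition dm :: "('v \<Rightarrow> 'v option) \<Rightarrow> 'v set \<Rightarrow> 'v option \<Rightarrow> int" where
  "dm par V w = int (deg par V w) - 2"

lemma sum_deg:
  assumes "rtree par V"
  shows "(\<Sum>w\<in>verts V. deg par V w) = 2 * card V"
proof -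
  have 1: "int (deg par V w) = (\<Sum>e\<in>V. inc par w e * inc par w e)" if "w \<in> verts V" for w
    unfolding sum_inc_edges[OF assms that that] by simp
  have 2: "(\<Sum>w\<in>verts V. inc par w e * inc par w e) = (2::int)" if "e \<in> V" for e
    unfolding gram_ladj[OF assms that that] by (simp add: gram_def)
  have "int (\<Sum>w\<in>verts V. deg par V w) = (\<Sum>w\<in>verts V. \<Sum>e\<in>V. inc par w e * inc par w e)"
    unfolding of_nat_sum by (rule sum.cong[OF refl 1])
  also have "\<dots> = (\<Sum>e\<in>V. \<Sum>w\<in>verts V. inc par w e * inc par w e)" by (rule sum.swap)
  also have "\<dots> = (\<Sum>e\<in>V. 2)" by (rule sum.cong[OF refl 2])
  also have "\<dots> = of_nat (2 * card V)" by simp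
  finally show ?thesis by (simp only: of_nat_eq_iff)
qed

lemma sum_dm:
  assumes "rtree par V"
  shows "(\<Sum>w\<in>verts V. dm par V w) = -2"
proof -
  have "(\<Sum>w\<in>verts V. dm par V w) = int (\<Sum>w\<in>verts V. deg par V w) - 2 * int (card (verts V))"
    by (simp add: dm_def sum_subtractf)
  then show ?thesis
    unfolding sum_deg[OF assms] using rtree_finite[OF assms] by (simp add: card_image)
qed

lemma sum_children:
  assumes "rtree par V"
  shows "(\<Sum>w\<in>verts V. \<Sum>e\<in>children par V w. h w e) = (\<Sum>e\<in>V. h (par e) e)"
proof -
  note fin = rtree_finite[OF assms]
  have "(\<Sum>w\<in>verts V. \<Sum>e\<in>children par V w. h w e) = (\<Sum>w\<in>verts V. \<Sum>e\<in>V. if par e = w then h w e else 0)"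
    by (rule sum.cong[OF refl]) (simp only: children_def sum.inter_filter[OF fin])
  also have "\<dots> = (\<Sum>e\<in>V. \<Sum>w\<in>verts V. if par e = w then h w e else 0)" by (rule sum.swap)
  also have "\<dots> = (\<Sum>e\<in>V. h (par e) e)"
    using fin rtree_par_in[OF assms] by (intro sum.cong[OF refl]) (simp del: insert_iff)
  finally show ?thesis .
qed

text \<open>The first quantity in the expansion that depends on which degrees are adjacent.\<close>

definition edge_dm :: "('v \<Rightarrow> 'v option) \<Rightarrow> 'v set \<Rightarrow> int" where
  "edge_dm par V = (\<Sum>e\<in>V. dm par V (Some e) * dm par V (par e))"

text \<open>Stated for ring variables, so that no sum or series is expanded when they are used. The
  first two say that multiplying the corrections by 1 + (x - x^2) m leaves - x^2 and x^3 A - x^4 (A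
  + B), up to terms of order 5.\<close>

lemma order_4_identities:
  fixes x m A B U S :: "'a::comm_ring_1"
  shows "(1 + (x - x\<^sup>2) * m) * (- x\<^sup>2 + x ^ 3 * m - x ^ 4 * (m + m\<^sup>2)) =
      - x\<^sup>2 + x ^ 5 * (- 2 * m\<^sup>2 - m ^ 3 + x * (m\<^sup>2 + m ^ 3))"
    and "(1 + (x - x\<^sup>2) * m) * (x ^ 3 * A - x ^ 4 * (A + B + m * A)) =
      x ^ 3 * A - x ^ 4 * (A + B) +
      x ^ 5 * (- m * A - m * (A + B + m * A) + x * m * (A + B + m * A))"
    and "- x\<^sup>2 + x ^ 3 * m - x ^ 4 * (m + m\<^sup>2) + (x ^ 3 * A - x ^ 4 * (A + B + m * A)) =
      x\<^sup>2 * (- 1 + x * m - x\<^sup>2 * (m + m\<^sup>2) + x * (A - x * (A + B + m * A)))"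
    and "x ^ 3 * A - x ^ 4 * (A + B + m * A) = x ^ 3 * (A - x * (A + B + m * A))"
    and "x\<^sup>2 * U * (x ^ 3 * S) = x ^ 5 * (U * S)"
    and "(1 + (x - x\<^sup>2) * m) * (1 - (x * m - x\<^sup>2 * (m + m\<^sup>2))) =
      1 + x ^ 3 * (2 * m\<^sup>2 + m ^ 3 - x * (m\<^sup>2 + m ^ 3))"
    and "x\<^sup>2 * (x * A - x\<^sup>2 * B) = x ^ 3 * A - x ^ 4 * B"
  by (simp_all add: algebra_simps eval_nat_numeral)

text \<open>Because of the factor X^2 the inverse pivots of the children are needed modulo X^3 only,
  and to that order the grandchildren do not enter. The root has no edge to a parent, which produces
  its extra - X^2.\<close>

lemma tree_pivot_approx:
  fixes b :: "'v option \<Rightarrow> 'a::field fps"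
  assumes T: "rtree par V" and b: "tree_pivots par V b" and w: "w \<in> verts V"
  defines "m \<equiv> \<lambda>w. of_int (dm par V w) :: 'a fps"
  shows "fcong 5 (b w) (1 + (fps_X - fps_X\<^sup>2) * m w - (if w = None then fps_X\<^sup>2 else 0) +
    fps_X ^ 3 * (\<Sum>e\<in>children par V w. m (Some e)) -
    fps_X ^ 4 * (\<Sum>e\<in>children par V w. m (Some e) + (m (Some e))\<^sup>2))"
proof -
  note fin = rtree_finite[OF T]
  have eq: "b w = 1 + (fps_X - fps_X\<^sup>2) * m w - (if w = None then fps_X\<^sup>2 else 0) +
      fps_X\<^sup>2 * (\<Sum>e\<in>children par V w. 1 - inverse (b (Some e)))" if "w \<in> verts V" for w
  proof -
    have d: "(of_nat (deg par V w) :: 'a fps) =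
        of_nat (card (children par V w)) + (if w = None then 0 else 1)"
      using that deg_children[OF T] by (cases w) auto
    have mw: "m w = of_nat (card (children par V w)) + (if w = None then 0 else 1) - 2"
      by (simp add: m_def dm_def d)
    have bw: "b w = (1 - fps_X)\<^sup>2 + fps_X * of_nat (deg par V w) -
      fps_X\<^sup>2 * (\<Sum>e\<in>children par V w. inverse (b (Some e)))"
      by (rule conjunct2[OF bspec[OF b that]])
    show ?thesis
      unfolding bw mw d sum_subtractf
      by (cases "w = None") (simp_all add: algebra_simps power2_eq_square)
  qed
  have inv: "fcong 3 (1 - inverse (b (Some e))) (fps_X * m (Some e) - fps_X\<^sup>2 * (m (Some e) + (m (Some e))\<^sup>2))"
    if e: "e \<in> V" for e
  proof -
    let ?m = "m (Some e)"
    have b0: "b (Some e) $ 0 = 1" by (rule conjunct1[OF bspec[OF b]]) (use e in simp)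
    have c0: "fcong 1 (\<Sum>f\<in>children par V (Some e). 1 - inverse (b (Some f))) 0"
    proof -
      have "fcong 1 (1 - inverse (b (Some f))) 0" if "f \<in> children par V (Some e)" for f
      proof -
        have "b (Some f) $ 0 = 1"
          by (rule conjunct1[OF bspec[OF b]]) (use that in \<open>simp add: children_def\<close>)
        then show ?thesis by (simp add: fcong_def)
      qed
      then have "fcong 1 (\<Sum>f\<in>children par V (Some e). 1 - inverse (b (Some f))) (\<Sum>f\<in>children par V (Some e). 0)"
        by (rule fcong_sum)
      then show ?thesis by simp
    qed
    have c3: "fcong (2 + 1) (fps_X\<^sup>2 * (\<Sum>f\<in>children par V (Some e). 1 - inverse (b (Some f)))) (fps_X\<^sup>2 * 0)"
      by (rule fcong_X_power_mult[OF c0])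
    have be: "b (Some e) = (1 + (fps_X - fps_X\<^sup>2) * ?m) +
        fps_X\<^sup>2 * (\<Sum>f\<in>children par V (Some e). 1 - inverse (b (Some f)))"
      using eq[of "Some e"] e by simp
    have "fcong (2 + 1) (b (Some e)) ((1 + (fps_X - fps_X\<^sup>2) * ?m) + fps_X\<^sup>2 * 0)"
      unfolding be by (rule fcong_add[OF fcong_refl c3])
    then have "fcong 3 (b (Some e)) (1 + (fps_X - fps_X\<^sup>2) * ?m)" by simp
    then have "fcong 3 (b (Some e) * (1 - (fps_X * ?m - fps_X\<^sup>2 * (?m + ?m\<^sup>2))))
        ((1 + (fps_X - fps_X\<^sup>2) * ?m) * (1 - (fps_X * ?m - fps_X\<^sup>2 * (?m + ?m\<^sup>2))))"
      by (rule fcong_mult[OF _ fcong_refl])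
    also have "(1 + (fps_X - fps_X\<^sup>2) * ?m) * (1 - (fps_X * ?m - fps_X\<^sup>2 * (?m + ?m\<^sup>2))) =
        1 + fps_X ^ 3 * (2 * ?m\<^sup>2 + ?m ^ 3 - fps_X * (?m\<^sup>2 + ?m ^ 3))"
      by (rule order_4_identities(6))
    also have "fcong 3 \<dots> (1 + 0)" by (rule fcong_add[OF fcong_refl fcong_X_power_0]) simp
    also have "1 + 0 = b (Some e) * inverse (b (Some e))"
      using b0 by (simp add: inverse_mult_eq_1')
    finally have "fcong 3 (1 - (fps_X * ?m - fps_X\<^sup>2 * (?m + ?m\<^sup>2))) (inverse (b (Some e)))"
      by (rule fcong_cancel) (simp add: b0)
    then have "fcong 3 (1 - inverse (b (Some e))) (1 - (1 - (fps_X * ?m - fps_X\<^sup>2 * (?m + ?m\<^sup>2))))"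
      by (rule fcong_diff[OF fcong_refl fcong_sym])
    then show ?thesis by simp
  qed
  have "fcong (2 + 3) (fps_X\<^sup>2 * (\<Sum>e\<in>children par V w. 1 - inverse (b (Some e))))
      (fps_X\<^sup>2 * (\<Sum>e\<in>children par V w. fps_X * m (Some e) - fps_X\<^sup>2 * (m (Some e) + (m (Some e))\<^sup>2)))"
    by (rule fcong_X_power_mult[OF fcong_sum[OF inv]]) (auto simp: children_def)
  also have "fps_X\<^sup>2 * (\<Sum>e\<in>children par V w. fps_X * m (Some e) - fps_X\<^sup>2 * (m (Some e) + (m (Some e))\<^sup>2)) =
      fps_X ^ 3 * (\<Sum>e\<in>children par V w. m (Some e)) -
      fps_X ^ 4 * (\<Sum>e\<in>children par V w. m (Some e) + (m (Some e))\<^sup>2)"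
    by (simp only: sum_subtractf sum_distrib_left[symmetric] order_4_identities(7))
  finally have "fcong 5 (1 + (fps_X - fps_X\<^sup>2) * m w - (if w = None then fps_X\<^sup>2 else 0) +
      fps_X\<^sup>2 * (\<Sum>e\<in>children par V w. 1 - inverse (b (Some e))))
    (1 + (fps_X - fps_X\<^sup>2) * m w - (if w = None then fps_X\<^sup>2 else 0) +
     (fps_X ^ 3 * (\<Sum>e\<in>children par V w. m (Some e)) -
      fps_X ^ 4 * (\<Sum>e\<in>children par V w. m (Some e) + (m (Some e))\<^sup>2)))"
    by (intro fcong_add[OF fcong_refl]) simp
  then show ?thesis unfolding eq[OF w, symmetric] by (simp only: add_diff_eq)
qed

text \<open>Divided by 1 + (X - X^2) dm, a pivot becomes 1 + \<open>u w\<close>, where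
  \<open>u w\<close> has order 3, and order 2 at the root. Products of two corrections have order at
  least 5, so the corrections add up; the sums are evaluated by \<open>sum_dm\<close> and
  \<open>sum_children\<close>.\<close>

lemma tree_order_4:
  fixes b :: "'v option \<Rightarrow> 'a::field fps"
  assumes T: "rtree par V" and b: "tree_pivots par V b"
  defines "m \<equiv> \<lambda>w. of_int (dm par V w) :: 'a fps"
  shows "fcong 5 (\<Prod>w\<in>verts V. b w) ((\<Prod>w\<in>verts V. 1 + (fps_X - fps_X\<^sup>2) * m w) *
    (1 - fps_X\<^sup>2 - 2 * fps_X ^ 3 -
      fps_X ^ 4 * of_int (-2 + (\<Sum>w\<in>verts V. (dm par V w)\<^sup>2) + edge_dm par V)))"
proof -
  note fin = rtree_finite[OF T]
  define A where "A w = (\<Sum>e\<in>children par V w. m (Some e))" for w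
  define B where "B w = (\<Sum>e\<in>children par V w. (m (Some e))\<^sup>2)" for w
  define v where "v w = fps_X ^ 3 * A w - fps_X ^ 4 * (A w + B w + m w * A w)" for w
  define r where "r = - fps_X\<^sup>2 + fps_X ^ 3 * m None - fps_X ^ 4 * (m None + (m None)\<^sup>2)"
  define u where "u w = (if w = None then r else 0) + v w" for w
  let ?x = "fps_X - fps_X\<^sup>2 :: 'a fps"
  have bu: "fcong 5 (b w) ((1 + ?x * m w) * (1 + u w))" if w: "w \<in> verts V" for w
  proof -
    have rt: "(1 + ?x * m None) * r = - fps_X\<^sup>2 + fps_X ^ 5 *
        (- 2 * (m None)\<^sup>2 - (m None) ^ 3 + fps_X * ((m None)\<^sup>2 + (m None) ^ 3))"
      unfolding r_def by (rule order_4_identities(1))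
    have vt: "(1 + ?x * m w) * v w = fps_X ^ 3 * A w - fps_X ^ 4 * (A w + B w) +
        fps_X ^ 5 * (- m w * A w - m w * (A w + B w + m w * A w) + fps_X * m w * (A w + B w + m w * A w))"
      unfolding v_def by (rule order_4_identities(2))
    have "(1 + ?x * m w) * (1 + u w) = (1 + ?x * m w) +
        (if w = None then (1 + ?x * m None) * r else 0) + (1 + ?x * m w) * v w"
      by (simp add: u_def algebra_simps)
    also have "fcong 5 \<dots> ((1 + ?x * m w) + (if w = None then - fps_X\<^sup>2 + 0 else 0) +
        (fps_X ^ 3 * A w - fps_X ^ 4 * (A w + B w) + 0))"
      unfolding rt vt by (intro fcong_add fcong_if fcong_refl fcong_X_power_0) simp_all
    finally have c1: "fcong 5 ((1 + ?x * m w) * (1 + u w)) ((1 + ?x * m w) + (if w = None then - fps_X\<^sup>2 + 0 else 0) +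
        (fps_X ^ 3 * A w - fps_X ^ 4 * (A w + B w) + 0))" .
    have c2: "fcong 5 (b w) ((1 + ?x * m w) + (if w = None then - fps_X\<^sup>2 + 0 else 0) +
        (fps_X ^ 3 * A w - fps_X ^ 4 * (A w + B w) + 0))"
      using tree_pivot_approx[OF T b w]
      by (cases w) (simp_all add: A_def B_def m_def sum.distrib add_diff_eq)
    show ?thesis by (rule fcong_trans[OF c2 fcong_sym[OF c1]])
  qed
  have "fcong 5 (\<Prod>w\<in>verts V. b w) (\<Prod>w\<in>verts V. (1 + ?x * m w) * (1 + u w))"
    by (intro fcong_prod bu)
  also have "\<dots> = (\<Prod>w\<in>verts V. 1 + ?x * m w) * (\<Prod>w\<in>verts V. 1 + u w)"
    by (rule prod.distrib)
  also have "(\<Prod>w\<in>verts V. 1 + u w) = (1 + u None) * (\<Prod>w\<in>Some ` V. 1 + u w)"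
    using fin by simp
  also have "(\<Prod>w\<in>Some ` V. 1 + u w) = (\<Prod>w\<in>Some ` V. 1 + v w)"
    by (rule prod.cong) (auto simp: u_def)
  finally have 1: "fcong 5 (\<Prod>w\<in>verts V. b w)
    ((\<Prod>w\<in>verts V. 1 + ?x * m w) * ((1 + u None) * (\<Prod>w\<in>Some ` V. 1 + v w)))" .
  have v3: "v w = fps_X ^ 3 * (A w - fps_X * (A w + B w + m w * A w))" for w
    unfolding v_def by (rule order_4_identities(4))
  have u2: "u None = fps_X\<^sup>2 * (- 1 + fps_X * m None - fps_X\<^sup>2 * (m None + (m None)\<^sup>2) +
      fps_X * (A None - fps_X * (A None + B None + m None * A None)))"
    unfolding u_def r_def v_def by (simp only: if_True refl order_4_identities(3))
  have "fcong 5 (\<Prod>w\<in>Some ` V. 1 + v w) (1 + (\<Sum>w\<in>Some ` V. v w))"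
    by (rule fcong_prod_1[of _ 3]) (auto simp: v3 fcong_X_power_0)
  then have "fcong 5 ((1 + u None) * (\<Prod>w\<in>Some ` V. 1 + v w)) ((1 + u None) * (1 + (\<Sum>w\<in>Some ` V. v w)))"
    by (rule fcong_mult[OF fcong_refl])
  also have "(1 + u None) * (1 + (\<Sum>w\<in>Some ` V. v w)) =
      1 + r + (\<Sum>w\<in>verts V. v w) + u None * (\<Sum>w\<in>Some ` V. v w)"
    using fin by (simp add: u_def algebra_simps)
  also have "fcong 5 \<dots> (1 + r + (\<Sum>w\<in>verts V. v w) + 0)"
  proof -
    obtain U where U: "u None = fps_X\<^sup>2 * U" using u2 by blast
    obtain S where S: "(\<Sum>w\<in>Some ` V. v w) = fps_X ^ 3 * S"
      unfolding v3 sum_distrib_left[symmetric] by blast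
    have "u None * (\<Sum>w\<in>Some ` V. v w) = fps_X ^ 5 * (U * S)"
      unfolding U S by (rule order_4_identities(5))
    then show ?thesis by (simp only:) (intro fcong_add fcong_refl fcong_X_power_0 order_refl)
  qed
  also have "1 + r + (\<Sum>w\<in>verts V. v w) + 0 = 1 - fps_X\<^sup>2 - 2 * fps_X ^ 3 -
      fps_X ^ 4 * of_int (-2 + (\<Sum>w\<in>verts V. (dm par V w)\<^sup>2) + edge_dm par V)"
  proof -
    have sA: "(\<Sum>w\<in>verts V. A w) = (\<Sum>e\<in>V. m (Some e))"
      unfolding A_def by (rule sum_children[OF T])
    have sB: "(\<Sum>w\<in>verts V. B w) = (\<Sum>e\<in>V. (m (Some e))\<^sup>2)"
      unfolding B_def by (rule sum_children[OF T])
    have sC: "(\<Sum>w\<in>verts V. m w * A w) = of_int (edge_dm par V)"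
      unfolding A_def sum_distrib_left using sum_children[OF T, of "\<lambda>w e. m w * m (Some e)"]
      by (simp add: edge_dm_def m_def mult.commute)
    have m1: "m None + (\<Sum>e\<in>V. m (Some e)) = -2"
    proof -
      have "m None + (\<Sum>e\<in>V. m (Some e)) = of_int (\<Sum>w\<in>verts V. dm par V w)"
        using fin by (simp add: m_def sum.reindex)
      then show ?thesis by (simp add: sum_dm[OF T])
    qed
    have m2: "(m None)\<^sup>2 + (\<Sum>e\<in>V. (m (Some e))\<^sup>2) = of_int (\<Sum>w\<in>verts V. (dm par V w)\<^sup>2)"
      using fin by (simp add: m_def sum.reindex)
    have "(\<Sum>w\<in>verts V. v w) = fps_X ^ 3 * (\<Sum>w\<in>verts V. A w) -
        fps_X ^ 4 * ((\<Sum>w\<in>verts V. A w) + (\<Sum>w\<in>verts V. B w) + (\<Sum>w\<in>verts V. m w * A w))"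
      unfolding v_def by (simp only: sum_subtractf sum_distrib_left[symmetric] sum.distrib)
    then have "1 + r + (\<Sum>w\<in>verts V. v w) + 0 = 1 - fps_X\<^sup>2 + fps_X ^ 3 * (m None + (\<Sum>e\<in>V. m (Some e))) -
        fps_X ^ 4 * ((m None + (\<Sum>e\<in>V. m (Some e))) + ((m None)\<^sup>2 + (\<Sum>e\<in>V. (m (Some e))\<^sup>2)) + of_int (edge_dm par V))"
      unfolding sA sB sC r_def by (simp add: algebra_simps)
    then show ?thesis unfolding m1 m2 by (simp add: algebra_simps)
  qed
  finally have "fcong 5 ((\<Prod>w\<in>verts V. 1 + ?x * m w) * ((1 + u None) * (\<Prod>w\<in>Some ` V. 1 + v w)))
    ((\<Prod>w\<in>verts V. 1 + ?x * m w) * (1 - fps_X\<^sup>2 - 2 * fps_X ^ 3 -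
      fps_X ^ 4 * of_int (-2 + (\<Sum>w\<in>verts V. (dm par V w)\<^sup>2) + edge_dm par V)))"
    by (rule fcong_mult[OF fcong_refl])
  with 1 show ?thesis by (rule fcong_trans)
qed

section \<open>The transfer recursion of a caterpillar\<close>

text \<open>\<open>cA\<close>, \<open>cB\<close>, \<open>cC\<close> are the entries of the transfer
  matrix of a spine vertex with a leaf, multiplied by 1 + q and written in the coordinates
  \<open>fw\<close> and \<open>fy\<close> introduced later, the second one divided by q^2;
  \<open>cD\<close> is its determinant. The vector (\<open>ca\<close>, \<open>cb\<close>) describes
  the last such vertex together with the end of the spine.\<close>

definition cA :: "'a::comm_ring_1 \<Rightarrow> 'a" where "cA q = 1 + q - q\<^sup>2 + q ^ 3"
definition cB :: "'a::comm_ring_1 \<Rightarrow> 'a" where "cB q = q - q\<^sup>2"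
definition cC :: "'a::comm_ring_1 \<Rightarrow> 'a" where "cC q = 1 - q + q\<^sup>2 + q ^ 3"
definition cD :: "'a::comm_ring_1 \<Rightarrow> 'a" where "cD q = (1 + q ^ 3)\<^sup>2"
definition ca :: "'a::comm_ring_1 \<Rightarrow> 'a" where "ca q = cA q + q ^ 3 * cB q"
definition cb :: "'a::comm_ring_1 \<Rightarrow> 'a" where "cb q = cB q - q ^ 3 * cC q"

primrec cWY :: "'a::comm_ring_1 \<Rightarrow> 'a \<Rightarrow> 'a \<Rightarrow> nat list \<Rightarrow> 'a \<times> 'a" where
  "cWY q s t [] = (s, t)"
| "cWY q s t (g # gs) =
    (cA q * fst (cWY q s t gs) - cB q * q ^ (2 * g) * snd (cWY q s t gs),
     cB q * fst (cWY q s t gs) + cC q * q ^ (2 * g) * snd (cWY q s t gs))"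

definition "cW q s t gs = fst (cWY q s t gs)"
definition "cY q s t gs = snd (cWY q s t gs)"

lemma cWY_simps [simp]:
  "cW q s t [] = s"
  "cW q s t (g # gs) = cA q * cW q s t gs - cB q * q ^ (2 * g) * cY q s t gs"
  "cY q s t [] = t"
  "cY q s t (g # gs) = cB q * cW q s t gs + cC q * q ^ (2 * g) * cY q s t gs"
  by (simp_all add: cW_def cY_def)

text \<open>The vector (s, t) of one end is paired with the product of transfer matrices applied to
  the vector of the other end. Both ends look alike, hence the quadratic scaling in
  \<open>cJ_scale\<close>.\<close>

definition cJ :: "'a::comm_ring_1 \<Rightarrow> 'a \<Rightarrow> 'a \<Rightarrow> nat list \<Rightarrow> 'a" where
  "cJ q s t gs = s * cW q s t (tl gs) - t * q ^ (2 * hd gs) * cY q s t (tl gs)"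

lemma cACB: "cA q * cC q + (cB q)\<^sup>2 = cD q"
  by (simp add: cA_def cB_def cC_def cD_def algebra_simps eval_nat_numeral)

lemma cAb: "cA q * cb q = ca q * cB q - q ^ 3 * cD q"
  by (simp add: cA_def cB_def cC_def cD_def ca_def cb_def algebra_simps eval_nat_numeral)

lemma cWY_scale: "cW q (c * s) (c * t) gs = c * cW q s t gs \<and> cY q (c * s) (c * t) gs = c * cY q s t gs"
  by (induction gs) (auto simp: algebra_simps)

lemma cJ_scale: "cJ q (c * s) (c * t) gs = c\<^sup>2 * cJ q s t gs"
  using cWY_scale[of q c s t "tl gs"] by (simp add: cJ_def algebra_simps power2_eq_square)

lemma cWY_hom:
  assumes "comm_ring_hom h"
  shows "h (cW q s t gs) = cW (h q) (h s) (h t) gs \<and> h (cY q s t gs) = cY (h q) (h s) (h t) gs"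
proof -
  interpret comm_ring_hom h by fact
  show ?thesis
    by (induction gs) (auto simp: cA_def cB_def cC_def hom_distribs)
qed

lemma cJ_hom:
  assumes "comm_ring_hom h"
  shows "h (cJ q s t gs) = cJ (h q) (h s) (h t) gs"
proof -
  interpret comm_ring_hom h by fact
  show ?thesis
    using cWY_hom[OF assms, of q s t "tl gs"] by (simp add: cJ_def hom_distribs)
qed

lemma ca_hom:
  assumes "comm_ring_hom h"
  shows "h (ca q) = ca (h q)" "h (cb q) = cb (h q)"
proof -
  interpret comm_ring_hom h by fact
  show "h (ca q) = ca (h q)" "h (cb q) = cb (h q)"
    by (simp_all add: ca_def cb_def cA_def cB_def cC_def hom_distribs)
qed

text \<open>At each end of the caterpillar two leaves share a neighbour; this is the origin of the
  common factor.\<close>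

lemma ca_factor:
  "ca q = (1 - q + q\<^sup>2) * (1 + 2 * q - q ^ 3)" "cb q = (1 - q + q\<^sup>2) * (q - 2 * q ^ 3 - q ^ 4)"
  by (simp_all add: cA_def cB_def cC_def ca_def cb_def algebra_simps eval_nat_numeral)

text \<open>At a root of 1 - q + q^2 the coefficients become 1, 1, -1 and the two entries of the end
  vector coincide. Then both coordinates stay equal, and each gap multiplies them by 1 - w^(2
  g).\<close>

lemma cJ_nonzero:
  fixes w :: "'a::idom"
  assumes w: "w\<^sup>2 = w - 1" and w2: "2 + 2 * w \<noteq> 0" and "gs \<noteq> []" "\<forall>g\<in>set gs. w ^ (2 * g) \<noteq> 1"
  shows "cJ w (1 + 2 * w - w ^ 3) (w - 2 * w ^ 3 - w ^ 4) gs \<noteq> 0"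
proof -
  have "w ^ 3 = w * w\<^sup>2" by (simp add: eval_nat_numeral)
  also have "\<dots> = w * (w - 1)" using w by simp
  also have "\<dots> = w\<^sup>2 - w" by (simp add: algebra_simps power2_eq_square)
  finally have w3: "w ^ 3 = -1" using w by simp
  have "w ^ 4 = w * w ^ 3" by (simp add: eval_nat_numeral)
  then have w4: "w ^ 4 = - w" by (simp add: w3)
  have AB: "cA w = 1" "cB w = 1" "cC w = -1"
    unfolding cA_def cB_def cC_def w3 using w by (simp_all add: algebra_simps)
  have st: "1 + 2 * w - w ^ 3 = 2 + 2 * w" "w - 2 * w ^ 3 - w ^ 4 = 2 + 2 * w"
    unfolding w3 w4 by (simp_all add: algebra_simps)
  have WY: "cW w s s hs = cY w s s hs \<and> cW w s s hs = s * (\<Prod>g\<leftarrow>hs. 1 - w ^ (2 * g))" for s hs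
    by (induction hs) (auto simp: AB algebra_simps)
  have "cJ w s s gs = s * s * (\<Prod>g\<leftarrow>gs. 1 - w ^ (2 * g))" for s
    using assms(3) WY[of s "tl gs"] by (cases gs) (auto simp: cJ_def algebra_simps)
  moreover have "(\<Prod>g\<leftarrow>gs. 1 - w ^ (2 * g)) \<noteq> 0"
    using assms(4) by (induction gs) auto
  ultimately show ?thesis unfolding st using w2 by simp
qed

section \<open>Reading off the gaps\<close>

abbreviation XW :: "nat list \<Rightarrow> real fps" where "XW \<equiv> cW fps_X (ca fps_X) (cb fps_X)"
abbreviation XY :: "nat list \<Rightarrow> real fps" where "XY \<equiv> cY fps_X (ca fps_X) (cb fps_X)"
abbreviation XJ :: "nat list \<Rightarrow> real fps" where "XJ \<equiv> cJ fps_X (ca fps_X) (cb fps_X)"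

text \<open>Encodes the multiset of gaps, but not their order.\<close>

definition gap_series :: "nat list \<Rightarrow> real fps" where
  "gap_series gs = (\<Sum>g\<leftarrow>gs. fps_X ^ (2 * g))"

lemma gap_series_nth:
  "gap_series gs $ n = (if even n then of_nat (count_list gs (n div 2)) else 0)"
proof -
  have "(fps_X ^ (2 * g) :: real fps) $ n = (if even n \<and> n div 2 = g then 1 else 0)" for g
    by (auto simp: fps_X_power_iff)
  then show ?thesis by (induction gs) (auto simp: gap_series_def)
qed

lemma XB: "cB (fps_X :: real fps) = fps_X ^ 1 * (1 - fps_X)"
  by (simp add: cB_def algebra_simps power2_eq_square)

lemma Xb: "cb (fps_X :: real fps) = fps_X ^ 1 * (1 - fps_X - fps_X\<^sup>2 * cC fps_X)"
  by (simp add: cb_def cB_def algebra_simps power2_eq_square power3_eq_cube)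

lemma units_at_0: "cA (fps_X :: real fps) $ 0 = 1" "ca (fps_X :: real fps) $ 0 = 1"
  by (simp_all add: cA_def ca_def)

lemma XY_0: "\<exists>u. XY gs = fps_X ^ 1 * u"
proof (induction gs)
  case Nil
  then show ?case by (auto simp: Xb)
next
  case (Cons g gs)
  then obtain u where u: "XY gs = fps_X ^ 1 * u" by blast
  have "XY (g # gs) = fps_X ^ 1 * ((1 - fps_X) * XW gs + cC fps_X * fps_X ^ (2 * g) * u)"
    by (simp add: u XB algebra_simps)
  then show ?case by blast
qed

text \<open>In cA Y - cB W the \<open>W\<close> of the tail cancels, and cD X^(2 g) times the
  \<open>Y\<close> of the tail remains, which is divisible by one more X.\<close>

lemma XY_XW_cong:
  assumes "gs \<noteq> []" "\<forall>g\<in>set gs. h \<le> g"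
  shows "fcong (2 * h + 1) (cA fps_X * XY gs) (cB fps_X * XW gs)"
proof -
  obtain g hs where gs: "gs = g # hs" using assms(1) by (cases gs) auto
  obtain u where u: "XY hs = fps_X ^ 1 * u" using XY_0 by blast
  have "cA fps_X * XY gs = cB fps_X * XW gs + (cA fps_X * cC fps_X + (cB fps_X)\<^sup>2) * fps_X ^ (2 * g) * XY hs"
    by (simp add: gs algebra_simps power2_eq_square)
  also have "\<dots> = cB fps_X * XW gs + fps_X ^ (2 * g + 1) * (cD fps_X * u)"
    unfolding cACB u by (simp add: algebra_simps)
  also have "fcong (2 * h + 1) \<dots> (cB fps_X * XW gs + 0)"
    by (rule fcong_add[OF fcong_refl fcong_X_power_0]) (use assms(2) gs in auto)
  finally show ?thesis by simp
qed

text \<open>The part linear in the gap powers: \<open>S\<close> is the sum of all X^(2 g) and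
  \<open>Z\<close> that of the end gaps, which deviate from inner gaps by the last term of
  \<open>cAb\<close>.\<close>

definition XM :: "real fps \<Rightarrow> real fps \<Rightarrow> real fps" where
  "XM S Z = ca fps_X * (cA fps_X)\<^sup>2 - ca fps_X * (cB fps_X)\<^sup>2 * S + cB fps_X * fps_X ^ 3 * cD fps_X * Z"

lemma gap_series_0:
  assumes "\<forall>g\<in>set gs. h \<le> g"
  shows "fcong (2 * h) (gap_series gs) 0"
  unfolding fcong_def
proof (intro allI impI)
  fix i assume "i < 2 * h"
  then have "count_list gs (i div 2) = 0" if "even i"
    using assms that by (auto simp: count_list_0_iff)
  then show "gap_series gs $ i = 0 $ i" by (simp add: gap_series_nth)
qed

lemma fcong_mult_0: "fcong m f 0 \<Longrightarrow> fcong m (f * g) 0" "fcong m f 0 \<Longrightarrow> fcong m (g * f) 0"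
  using fcong_mult[of m f 0 g g] fcong_mult[of m g g f 0] by auto

lemma XM_0:
  assumes "fcong (2 * h) S 0" "fcong (2 * h) Z 0"
  shows "fcong (2 * h) (XM S Z) (ca fps_X * (cA fps_X)\<^sup>2)"
proof -
  have "fcong (2 * h) (XM S Z) (ca fps_X * (cA fps_X)\<^sup>2 - 0 + 0)"
    unfolding XM_def by (intro fcong_add fcong_diff fcong_refl fcong_mult_0(2) assms)
  then show ?thesis by simp
qed

text \<open>Replacing cA \<open>XY\<close> by cB \<open>XW\<close> in the recursion costs order 2 h
  + 1 on top of the factor cB X^(2 g), also of order 2 h + 1. The resulting term has order 2 h + 2,
  so its cofactor \<open>XW\<close> may be replaced by its value without gaps, which is correct up
  to order 2 h.\<close>

lemma XW_approx:
  assumes "gs \<noteq> []" "\<forall>g\<in>set gs. h \<le> g"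
  shows "fcong (4 * h + 2) ((cA fps_X)\<^sup>2 * XW gs)
    ((cA fps_X) ^ length gs * XM (gap_series gs) (fps_X ^ (2 * last gs)))"
  using assms
proof (induction gs)
  case (Cons g gs)
  let ?A = "cA fps_X :: real fps" and ?B = "cB fps_X :: real fps" and ?a = "ca fps_X :: real fps"
    and ?b = "cb fps_X :: real fps" and ?D = "cD fps_X :: real fps"
  show ?case
  proof (cases "gs = []")
    case True
    have "?A\<^sup>2 * XW [g] = ?A * (?A\<^sup>2 * ?a - ?B * fps_X ^ (2 * g) * (?A * ?b))"
      by (simp add: algebra_simps power2_eq_square)
    also have "\<dots> = ?A ^ length [g] * XM (gap_series [g]) (fps_X ^ (2 * last [g]))"
      unfolding cAb by (simp add: XM_def gap_series_def algebra_simps power2_eq_square)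
    finally show ?thesis by (simp add: True)
  next
    case False
    have hg: "h \<le> g" and hgs: "\<forall>g\<in>set gs. h \<le> g" using Cons.prems by auto
    let ?M = "XM (gap_series gs) (fps_X ^ (2 * last gs))"
    have IH: "fcong (4 * h + 2) (?A\<^sup>2 * XW gs) (?A ^ length gs * ?M)"
      using Cons.IH[OF False hgs] .
    have W0: "fcong (2 * h) (XW gs) (?a * ?A ^ length gs)"
    proof -
      have "fcong (2 * h) (?A\<^sup>2 * XW gs) (?A ^ length gs * ?M)" by (rule fcong_mono[OF IH]) simp
      also have "fcong (2 * h) \<dots> (?A ^ length gs * (?a * ?A\<^sup>2))"
        using hgs False last_in_set[OF False]
        by (intro fcong_mult[OF fcong_refl] XM_0 gap_series_0)
           (auto intro!: fcong_X_power_0[of _ _ 1, simplified])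
      also have "?A ^ length gs * (?a * ?A\<^sup>2) = ?A\<^sup>2 * (?a * ?A ^ length gs)" by (simp add: algebra_simps)
      finally show ?thesis by (rule fcong_cancel) (simp add: units_at_0)
    qed
    have BQ: "?B * fps_X ^ (2 * g) = fps_X ^ (2 * h + 1) * ((1 - fps_X) * fps_X ^ (2 * (g - h)))"
      using hg by (simp add: XB algebra_simps power_add[symmetric] flip: power_Suc)
    have small: "fcong (4 * h + 2) (?B * fps_X ^ (2 * g) * (?A * XY gs)) (?B * fps_X ^ (2 * g) * (?B * XW gs))"
      using fcong_X_power_mult[OF fcong_mult[OF fcong_refl[of _ "(1 - fps_X) * fps_X ^ (2 * (g - h))"]
            XY_XW_cong[OF False hgs]], of "2 * h + 1"]
      unfolding BQ by (simp add: mult.assoc)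
    have small2: "fcong (4 * h + 2) (?B * (?B * fps_X ^ (2 * g)) * XW gs) (?B * (?B * fps_X ^ (2 * g)) * (?a * ?A ^ length gs))"
    proof -
      have e: "?B * (?B * fps_X ^ (2 * g)) = fps_X ^ (2 * h + 2) * ((1 - fps_X) * ((1 - fps_X) * fps_X ^ (2 * (g - h))))"
        unfolding BQ by (simp add: XB algebra_simps)
      show ?thesis
        using fcong_X_power_mult[OF fcong_mult[OF fcong_refl[of _ "(1 - fps_X) * ((1 - fps_X) * fps_X ^ (2 * (g - h)))"] W0], of "2 * h + 2"]
        unfolding e by (simp add: mult.assoc)
    qed
    have "?A\<^sup>2 * XW (g # gs) = ?A * (?A\<^sup>2 * XW gs - ?B * fps_X ^ (2 * g) * (?A * XY gs))"
      by (simp add: algebra_simps power2_eq_square)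
    also have "fcong (4 * h + 2) \<dots> (?A * (?A ^ length gs * ?M - ?B * (?B * fps_X ^ (2 * g)) * (?a * ?A ^ length gs)))"
    proof (rule fcong_mult[OF fcong_refl fcong_diff[OF IH]])
      show "fcong (4 * h + 2) (?B * fps_X ^ (2 * g) * (?A * XY gs)) (?B * (?B * fps_X ^ (2 * g)) * (?a * ?A ^ length gs))"
        using fcong_trans[OF small] small2 by (simp add: mult_ac)
    qed
    also have "?A * (?A ^ length gs * ?M - ?B * (?B * fps_X ^ (2 * g)) * (?a * ?A ^ length gs)) =
        ?A ^ length (g # gs) * XM (gap_series (g # gs)) (fps_X ^ (2 * last (g # gs)))"
      using False by (simp add: XM_def gap_series_def algebra_simps power2_eq_square)
    finally show ?thesis .
  qed
qed simp

text \<open>The same estimate with the end vector (\<open>ca\<close>, \<open>cb\<close>) in place of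
  a step of the recursion, so that the first gap becomes an end gap like the last one.\<close>

lemma XJ_approx:
  assumes "length gs \<ge> 2" "\<forall>g\<in>set gs. h \<le> g"
  shows "fcong (4 * h + 2) ((cA fps_X)\<^sup>2 * XJ gs)
    (ca fps_X * (cA fps_X) ^ (length gs - 1) *
      XM (gap_series gs) (fps_X ^ (2 * hd gs) + fps_X ^ (2 * last gs)))"
proof -
  let ?A = "cA fps_X :: real fps" and ?B = "cB fps_X :: real fps" and ?a = "ca fps_X :: real fps"
    and ?b = "cb fps_X :: real fps" and ?D = "cD fps_X :: real fps"
  obtain g hs where gs: "gs = g # hs" using assms(1) by (cases gs) auto
  then have False: "hs \<noteq> []" using assms(1) by auto
  have hg: "h \<le> g" and hhs: "\<forall>g\<in>set hs. h \<le> g" using assms(2) gs by auto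
  let ?M = "XM (gap_series hs) (fps_X ^ (2 * last hs))"
  have IH: "fcong (4 * h + 2) (?A\<^sup>2 * XW hs) (?A ^ length hs * ?M)"
    by (rule XW_approx[OF False hhs])
  have W0: "fcong (2 * h) (XW hs) (?a * ?A ^ length hs)"
  proof -
    have "fcong (2 * h) (?A\<^sup>2 * XW hs) (?A ^ length hs * ?M)" by (rule fcong_mono[OF IH]) simp
    also have "fcong (2 * h) \<dots> (?A ^ length hs * (?a * ?A\<^sup>2))"
      using hhs False last_in_set[OF False]
      by (intro fcong_mult[OF fcong_refl] XM_0 gap_series_0)
         (auto intro!: fcong_X_power_0[of _ _ 1, simplified])
    also have "?A ^ length hs * (?a * ?A\<^sup>2) = ?A\<^sup>2 * (?a * ?A ^ length hs)" by (simp add: algebra_simps)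
    finally show ?thesis by (rule fcong_cancel) (simp add: units_at_0)
  qed
  have Xg: "fps_X ^ (2 * g) = fps_X ^ (2 * h) * (fps_X ^ (2 * (g - h)) :: real fps)"
    using hg by (simp flip: power_add)
  obtain c where c: "?b = fps_X ^ 1 * c" using Xb by blast
  have bQ: "?b * fps_X ^ (2 * g) = fps_X ^ (2 * h + 1) * (c * fps_X ^ (2 * (g - h)))"
    unfolding Xg c by (simp add: algebra_simps)
  have small: "fcong (4 * h + 2) (?b * fps_X ^ (2 * g) * (?A * XY hs)) (?b * fps_X ^ (2 * g) * (?B * XW hs))"
    using fcong_X_power_mult[OF fcong_mult[OF fcong_refl[of _ "c * fps_X ^ (2 * (g - h))"]
          XY_XW_cong[OF False hhs]], of "2 * h + 1"]
    unfolding bQ by (simp add: mult.assoc)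
  have small2: "fcong (4 * h + 2) (?B * (?b * fps_X ^ (2 * g)) * XW hs) (?B * (?b * fps_X ^ (2 * g)) * (?a * ?A ^ length hs))"
  proof -
    have e: "?B * (?b * fps_X ^ (2 * g)) = fps_X ^ (2 * h + 2) * ((1 - fps_X) * (c * fps_X ^ (2 * (g - h))))"
      unfolding bQ by (simp add: XB algebra_simps)
    show ?thesis
      using fcong_X_power_mult[OF fcong_mult[OF fcong_refl[of _ "(1 - fps_X) * (c * fps_X ^ (2 * (g - h)))"] W0], of "2 * h + 2"]
      unfolding e by (simp add: mult.assoc)
  qed
  have "?A\<^sup>2 * XJ gs = ?a * (?A\<^sup>2 * XW hs) - ?A * (?b * fps_X ^ (2 * g) * (?A * XY hs))"
    by (simp add: gs cJ_def algebra_simps power2_eq_square)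
  also have "fcong (4 * h + 2) \<dots> (?a * (?A ^ length hs * ?M) - ?A * (?B * (?b * fps_X ^ (2 * g)) * (?a * ?A ^ length hs)))"
  proof (intro fcong_diff fcong_mult[OF fcong_refl] IH)
    show "fcong (4 * h + 2) (?b * fps_X ^ (2 * g) * (?A * XY hs)) (?B * (?b * fps_X ^ (2 * g)) * (?a * ?A ^ length hs))"
      using fcong_trans[OF small] small2 by (simp add: mult_ac)
  qed
  also have "?a * (?A ^ length hs * ?M) - ?A * (?B * (?b * fps_X ^ (2 * g)) * (?a * ?A ^ length hs)) =
      ?a * ?A ^ length hs * (?M - ?B * fps_X ^ (2 * g) * (?A * ?b))"
    by (simp add: algebra_simps)
  also have "\<dots> = ?a * ?A ^ length hs * XM (gap_series gs) (fps_X ^ (2 * g) + fps_X ^ (2 * last hs))"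
    unfolding cAb by (simp add: gs XM_def gap_series_def algebra_simps power2_eq_square)
  finally show ?thesis using False by (simp add: gs)
qed

lemma fcong_X_cancel: "fcong (m + n) (fps_X ^ m * f) 0 \<Longrightarrow> fcong n f 0"
  unfolding fcong_def
proof (intro allI impI)
  fix i assume "\<forall>i<m + n. (fps_X ^ m * f) $ i = 0 $ i" "i < n"
  then show "f $ i = 0 $ i"
    using spec[of "\<lambda>i. i < m + n \<longrightarrow> (fps_X ^ m * f) $ i = 0 $ i" "m + i"]
    by (simp add: fps_X_power_mult_nth)
qed

lemma XM_diff:
  "XM S Z - XM S' Z' = fps_X\<^sup>2 * ((1 - fps_X) *
      (fps_X\<^sup>2 * (1 + 2 * fps_X ^ 3 + fps_X ^ 6) * (Z - Z') -
       (1 - 2 * fps_X\<^sup>2 + 2 * fps_X ^ 3 - 2 * fps_X ^ 5 + fps_X ^ 6) * (S - S')))"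
proof -
  have a: "1 - 2 * q\<^sup>2 + 2 * q ^ 3 - 2 * q ^ 5 + q ^ 6 = ca q * (1 - q)" for q :: "real fps"
    by (simp add: ca_def cA_def cB_def algebra_simps eval_nat_numeral)
  have D: "1 + 2 * q ^ 3 + q ^ 6 = cD q" for q :: "real fps"
    by (simp add: cD_def algebra_simps eval_nat_numeral)
  have B: "cB q = q * (1 - q)" for q :: "real fps"
    by (simp add: cB_def algebra_simps eval_nat_numeral)
  have "XM S Z - XM S' Z' = cB fps_X * (fps_X ^ 3 * cD fps_X * (Z - Z') - ca fps_X * cB fps_X * (S - S'))"
    by (simp add: XM_def algebra_simps power2_eq_square)
  then show ?thesis
    unfolding a D B by (simp add: algebra_simps eval_nat_numeral)
qed

text \<open>\<open>ca\<close> and the powers of \<open>cA\<close> are units and cancel. The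
  difference of the linear parts has the factor X^2 (1 - X), which lowers the precision from 4 h + 2
  to 4 h. The two polynomials left are ca (1 - X) and X^2 cD.\<close>

lemma gaps_cong:
  assumes "length gs \<ge> 2" "length gs' = length gs" "\<forall>g\<in>set gs. h \<le> g" "\<forall>g\<in>set gs'. h \<le> g"
    and J: "XJ gs = XJ gs'"
  shows "fcong (4 * h) ((1 - 2 * fps_X\<^sup>2 + 2 * fps_X ^ 3 - 2 * fps_X ^ 5 + fps_X ^ 6) * (gap_series gs - gap_series gs'))
    (fps_X\<^sup>2 * (1 + 2 * fps_X ^ 3 + fps_X ^ 6) *
      (gap_series [hd gs, last gs] - gap_series [hd gs', last gs']))"
proof -
  let ?A = "cA fps_X :: real fps" and ?B = "cB fps_X :: real fps" and ?a = "ca fps_X :: real fps"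
    and ?D = "cD fps_X :: real fps"
  let ?S = "gap_series gs" and ?S' = "gap_series gs'"
  let ?Z = "gap_series [hd gs, last gs]" and ?Z' = "gap_series [hd gs', last gs']"
  have "fcong (4 * h + 2) (?a * ?A ^ (length gs - 1) * XM ?S ?Z) (?a * ?A ^ (length gs - 1) * XM ?S' ?Z')"
    using fcong_trans[OF fcong_sym[OF XJ_approx[OF assms(1,3)]]] XJ_approx[of gs' h] assms
    by (simp add: gap_series_def)
  then have "fcong (4 * h + 2) (XM ?S ?Z) (XM ?S' ?Z')"
    by (rule fcong_cancel) (simp add: units_at_0)
  then have "fcong (4 * h + 2) (XM ?S ?Z - XM ?S' ?Z') 0"
    using fcong_diff[of "4 * h + 2" _ _ "XM ?S' ?Z'" "XM ?S' ?Z'"] by fastforce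
  moreover have "XM ?S ?Z - XM ?S' ?Z' = fps_X\<^sup>2 * ((1 - fps_X) *
      (fps_X\<^sup>2 * (1 + 2 * fps_X ^ 3 + fps_X ^ 6) * (?Z - ?Z') -
       (1 - 2 * fps_X\<^sup>2 + 2 * fps_X ^ 3 - 2 * fps_X ^ 5 + fps_X ^ 6) * (?S - ?S')))"
    by (rule XM_diff)
  ultimately have "fcong (4 * h) ((1 - fps_X) *
      (fps_X\<^sup>2 * (1 + 2 * fps_X ^ 3 + fps_X ^ 6) * (?Z - ?Z') -
       (1 - 2 * fps_X\<^sup>2 + 2 * fps_X ^ 3 - 2 * fps_X ^ 5 + fps_X ^ 6) * (?S - ?S'))) ((1 - fps_X) * 0)"
    using fcong_X_cancel[of 2 "4 * h"] by (simp add: add.commute)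
  then have "fcong (4 * h) (fps_X\<^sup>2 * (1 + 2 * fps_X ^ 3 + fps_X ^ 6) * (?Z - ?Z') -
       (1 - 2 * fps_X\<^sup>2 + 2 * fps_X ^ 3 - 2 * fps_X ^ 5 + fps_X ^ 6) * (?S - ?S')) 0"
    by (rule fcong_cancel) simp
  then show ?thesis by (simp add: fcong_def)
qed

lemma kappa_nth:
  fixes f :: "real fps"
  shows "((1 - 2 * fps_X\<^sup>2 + 2 * fps_X ^ 3 - 2 * fps_X ^ 5 + fps_X ^ 6) * f) $ n =
    f $ n - 2 * (if n < 2 then 0 else f $ (n - 2)) + 2 * (if n < 3 then 0 else f $ (n - 3))
    - 2 * (if n < 5 then 0 else f $ (n - 5)) + (if n < 6 then 0 else f $ (n - 6))"
proof -
  have "(1 - 2 * fps_X\<^sup>2 + 2 * fps_X ^ 3 - 2 * fps_X ^ 5 + fps_X ^ 6) * f =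
      f - fps_const 2 * (fps_X ^ 2 * f) + fps_const 2 * (fps_X ^ 3 * f) - fps_const 2 * (fps_X ^ 5 * f) + fps_X ^ 6 * f"
    by (simp add: algebra_simps numeral_fps_const)
  then show ?thesis
    by (simp only: fps_add_nth fps_sub_nth fps_mult_left_const_nth fps_X_power_mult_nth)
qed

lemma lambda_nth:
  fixes f :: "real fps"
  shows "(fps_X\<^sup>2 * (1 + 2 * fps_X ^ 3 + fps_X ^ 6) * f) $ n =
    (if n < 2 then 0 else f $ (n - 2)) + 2 * (if n < 5 then 0 else f $ (n - 5)) +
    (if n < 8 then 0 else f $ (n - 8))"
proof -
  have e: "(fps_X :: real fps) ^ 5 = fps_X ^ 2 * fps_X ^ 3" "(fps_X :: real fps) ^ 8 = fps_X ^ 2 * fps_X ^ 6"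
    by (simp_all flip: power_add)
  have "fps_X\<^sup>2 * (1 + 2 * fps_X ^ 3 + fps_X ^ 6) * f =
      fps_X ^ 2 * f + fps_const 2 * (fps_X ^ 5 * f) + fps_X ^ 8 * f"
    unfolding e by (simp add: algebra_simps numeral_fps_const)
  then show ?thesis
    by (simp only: fps_add_nth fps_mult_left_const_nth fps_X_power_mult_nth)
qed

lemma sum_length_by_count:
  "sum_list (gs :: nat list) = 4 * count_list gs 4 + 5 * count_list gs 5 + 6 * count_list gs 6 +
      sum_list (filter (\<lambda>x. x \<notin> {4, 5, 6}) gs)"
  "length gs = count_list gs 4 + count_list gs 5 + count_list gs 6 + length (filter (\<lambda>x. x \<notin> {4, 5, 6}) gs)"
  by (induction gs) auto

text \<open>The coefficients up to order 12 count the gaps 4, 5 and 6, and how many of them are end gaps.\<close>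

lemma huge_gap_at_end:
  assumes w: "w \<noteq> []" "set w \<subseteq> {4, 5}" "last w = 5" and N: "N > 6"
    and len: "length gs' = length (N # w)" and sum: "sum_list gs' = sum_list (N # w)"
    and g2: "\<forall>g\<in>set gs'. 2 \<le> g" and J: "XJ (N # w) = XJ gs'"
  shows "hd gs' = N \<or> last gs' = N"
proof -
  let ?gs = "N # w"
  define f where "f = gap_series ?gs - gap_series gs'"
  define z where "z = gap_series [hd ?gs, last ?gs] - gap_series [hd gs', last gs']"
  have ge4: "\<forall>g\<in>set ?gs. h \<le> g" if "h \<le> 4" for h using w N that by auto
  have len2: "length ?gs \<ge> 2" using w(1) by (cases w) auto
  \<comment> \<open>The precision grows as small gaps are excluded from \<open>gs'\<close>: h = 2
    gives coefficient 4 and excludes the gap 2, h = 3 gives coefficient 6 and excludes the gap 3,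
    and h = 4 gives the coefficients 8, 10 and 12.\<close>
  have eq: "((1 - 2 * fps_X\<^sup>2 + 2 * fps_X ^ 3 - 2 * fps_X ^ 5 + fps_X ^ 6) * f) $ n =
      (fps_X\<^sup>2 * (1 + 2 * fps_X ^ 3 + fps_X ^ 6) * z) $ n"
    if "n < 4 * h" "h \<le> 4" "\<forall>g\<in>set gs'. h \<le> g" for n h
    using gaps_cong[OF len2 len ge4 that(3) J] that(1,2) unfolding fcong_def f_def z_def by blast
  have f: "f $ n = (if even n then real (count_list ?gs (n div 2)) - real (count_list gs' (n div 2)) else 0)" for n
    by (simp add: f_def gap_series_nth)
  have z: "z $ n = (if even n then real (count_list [hd ?gs, last ?gs] (n div 2)) -
      real (count_list [hd gs', last gs'] (n div 2)) else 0)" for n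
    by (simp add: z_def gap_series_nth)
  have cw: "count_list w j = 0" if "j \<notin> {4, 5}" for j
    using w(2) that by (auto simp: count_list_0_iff)
  have cg: "count_list gs' j = 0" "count_list [hd gs', last gs'] j = 0" if "\<forall>g\<in>set gs'. j < g" for j
  proof -
    have "gs' \<noteq> []" using len by auto
    then have "hd gs' \<in> set gs'" "last gs' \<in> set gs'" by auto
    then show "count_list gs' j = 0" "count_list [hd gs', last gs'] j = 0"
      using that by (auto simp: count_list_0_iff)
  qed
  have lw: "last ?gs = 5" using w by simp
  have c0: "count_list gs' 0 = 0" "count_list gs' (Suc 0) = 0" "count_list [hd gs', last gs'] 0 = 0"
    "count_list [hd gs', last gs'] (Suc 0) = 0"
    using cg[of 0] cg[of "Suc 0"] g2 by fastforce+
  have c2: "count_list gs' 2 = 0"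
    using eq[of 4 2] g2 N c0 by (simp only: kappa_nth lambda_nth f z) (simp add: cw)
  then have g3: "\<forall>g\<in>set gs'. 3 \<le> g"
    using g2 by (auto simp: count_list_0_iff) (metis One_nat_def Suc_1 Suc_leI le_neq_implies_less numeral_3_eq_3)
  have c2': "count_list [hd gs', last gs'] 2 = 0" using cg[of 2] g3 by fastforce
  have c3: "count_list gs' 3 = 0"
    using eq[of 6 3] g3 N c0 c2 c2' lw by (simp only: kappa_nth lambda_nth f z) (simp add: cw)
  then have g4: "\<forall>g\<in>set gs'. 4 \<le> g"
    using g3 by (auto simp: count_list_0_iff) (metis Suc_leI le_neq_implies_less numeral_3_eq_3 numeral_eq_Suc pred_numeral_simps(2) semiring_norm(26,27))
  have c3': "count_list [hd gs', last gs'] 3 = 0" using cg[of 3] g4 by fastforce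
  define e4 e5 where "e4 = count_list [hd gs', last gs'] 4" and "e5 = count_list [hd gs', last gs'] 5"
  have c4: "count_list w 4 = count_list gs' 4"
    using eq[of 8 4] g4 N c0 c2 c2' c3 c3' lw by (simp only: kappa_nth lambda_nth f z) (simp add: cw)
  have c5: "count_list gs' 5 = count_list w 5 + e4"
  proof -
    have "real (count_list w 5) - real (count_list gs' 5) = - real e4"
      using eq[of 10 4] g4 N c0 c2 c2' c3 c3' c4 lw by (simp only: kappa_nth lambda_nth f z) (simp add: cw e4_def)
    then show ?thesis by linarith
  qed
  have c6: "count_list gs' 6 + 1 = e5 + 2 * e4"
  proof -
    have "- real (count_list gs' 6) - 2 * (real (count_list w 5) - real (count_list gs' 5)) = 1 - real e5"
      using eq[of 12 4] g4 N c0 c2 c2' c3 c3' c4 lw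
      by (simp only: kappa_nth lambda_nth f z) (simp add: cw e5_def)
    moreover have "real (count_list gs' 5) = real (count_list w 5) + real e4" using c5 by simp
    ultimately have "real (count_list gs' 6) + 1 = real e5 + 2 * real e4" by argo
    then have "real (count_list gs' 6 + 1) = real (e5 + 2 * e4)" by simp
    then show ?thesis by (simp only: of_nat_eq_iff)
  qed
  have e5le: "e5 \<le> 2" by (simp add: e5_def)
  have lw': "length w = count_list w 4 + count_list w 5"
    "sum_list w = 4 * count_list w 4 + 5 * count_list w 5"
  proof -
    have "filter (\<lambda>x. x \<notin> {4, 5, 6}) w = []" using w(2) by (auto simp: filter_empty_conv)
    then show "length w = count_list w 4 + count_list w 5"
      "sum_list w = 4 * count_list w 4 + 5 * count_list w 5"
      using sum_length_by_count[of w] cw[of 6] by simp_all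
  qed
  let ?r = "filter (\<lambda>x. x \<notin> {4, 5, 6}) gs'"
  have L: "count_list w 4 + count_list w 5 + 1 =
      count_list gs' 4 + count_list gs' 5 + count_list gs' 6 + length ?r"
    using sum_length_by_count(2)[of gs'] len lw'(1) by simp
  have S: "N + (4 * count_list w 4 + 5 * count_list w 5) =
      4 * count_list gs' 4 + 5 * count_list gs' 5 + 6 * count_list gs' 6 + sum_list ?r"
    using sum_length_by_count(1)[of gs'] sum lw'(2) by simp
  \<comment> \<open>Comparing lengths gives 3 e4 + e5 + length ?r = 2.\<close>
  have e4: "e4 = 0" using L c4 c5 c6 by linarith
  have ne: "gs' \<noteq> []" using len by auto
  \<comment> \<open>Otherwise a single gap 6 takes the place of \<open>N\<close>, and the sums force
    N = 6.\<close>
  have "e5 \<noteq> 2"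
  proof
    assume "e5 = 2"
    then have "length ?r = 0" "count_list gs' 6 = 1" using L c4 c5 c6 e4 by linarith+
    then show False using S c4 c5 e4 N by simp
  qed
  then have e5: "e5 = 1" and n6: "count_list gs' 6 = 0" using c6 e4 e5le by linarith+
  then have "length ?r = 1" using L c4 c5 e4 by linarith
  then obtain x where x: "?r = [x]" by (cases ?r) auto
  then have "x = N" using S c4 c5 e4 n6 by simp
  then have r: "y = N" if "y \<in> set gs'" "y \<notin> {4, 5, 6}" for y
  proof -
    have "y \<in> set ?r" using that by simp
    moreover have "set ?r = {N}" unfolding x by (simp add: \<open>x = N\<close>)
    ultimately show ?thesis by blast
  qed
  have n46: "hd gs' \<noteq> 4" "last gs' \<noteq> 4" "hd gs' \<noteq> 6" "last gs' \<noteq> 6"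
    using e4 n6 hd_in_set[OF ne] last_in_set[OF ne] by (auto simp: e4_def count_list_0_iff split: if_splits)
  have "\<not> (hd gs' = 5 \<and> last gs' = 5)" using e5 by (auto simp: e5_def)
  then show ?thesis using r[of "hd gs'"] r[of "last gs'"] n46 ne by auto
qed

section \<open>Decoding the gaps\<close>

lemma XW_0: "\<forall>g\<in>set gs. 1 \<le> g \<Longrightarrow> XW gs $ 0 = 1 \<and> subdegree (XY gs) = 1 \<and> XY gs \<noteq> 0"
proof (induction gs)
  case Nil
  have "subdegree (cb fps_X :: real fps) = 1"
    by (rule subdegreeI) (simp_all add: Xb cC_def)
  moreover have "(cb fps_X :: real fps) $ 1 \<noteq> 0" by (simp add: Xb cC_def)
  ultimately show ?case by (auto simp: units_at_0)
next
  case (Cons g gs)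
  then have IH: "XW gs $ 0 = 1" and g: "1 \<le> g" by auto
  obtain u where u: "XY gs = fps_X ^ 1 * u" using XY_0 by blast
  have "XW (g # gs) $ 0 = 1"
    using IH g by (simp add: units_at_0 XB)
  moreover have eq: "XY (g # gs) = fps_X ^ 1 * ((1 - fps_X) * XW gs + cC fps_X * fps_X ^ (2 * g) * u)"
    by (simp add: u XB algebra_simps)
  have "XY (g # gs) $ 1 = 1" unfolding eq using IH g by (simp add: fps_X_power_iff)
  moreover have "XY (g # gs) $ 0 = 0" unfolding eq by simp
  ultimately show ?case
    by (metis One_nat_def fps_zero_nth less_one subdegreeI zero_neq_one)
qed

text \<open>The adjugate of the transfer matrix recovers both coordinates of the tail, the second
  one multiplied by X^(2 g). As \<open>XY\<close> vanishes to order exactly 1, the subdegree reveals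
  g.\<close>

lemma XWY_inj:
  assumes "length w = length w'" "\<forall>g\<in>set w. 1 \<le> g" "\<forall>g\<in>set w'. 1 \<le> g" "XW w = XW w'" "XY w = XY w'"
  shows "w = w'"
  using assms
proof (induction w w' rule: list_induct2)
  case (Cons g w g' w')
  have D: "cD (fps_X :: real fps) \<noteq> 0"
  proof -
    have "cD (fps_X :: real fps) $ 0 = 1" by (simp add: cD_def power2_eq_square)
    then show ?thesis by (metis fps_zero_nth zero_neq_one)
  qed
  have 1: "cC fps_X * XW (h # v) + cB fps_X * XY (h # v) = cD fps_X * XW v" for h v
    unfolding cACB[symmetric] by (simp add: algebra_simps power2_eq_square)
  have 2: "cA fps_X * XY (h # v) - cB fps_X * XW (h # v) = cD fps_X * (fps_X ^ (2 * h) * XY v)" for h v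
    unfolding cACB[symmetric] by (simp add: algebra_simps power2_eq_square)
  have W: "XW w = XW w'" using 1[of g w] 1[of g' w'] Cons.prems D by simp
  have Y: "fps_X ^ (2 * g) * XY w = fps_X ^ (2 * g') * XY w'"
    using 2[of g w] 2[of g' w'] Cons.prems D by simp
  have "subdegree (fps_X ^ (2 * h) * XY v) = 2 * h + 1" if "\<forall>g\<in>set v. 1 \<le> g" for h v
    using XW_0[OF that] by (simp add: subdegree_mult)
  then have "2 * g + 1 = 2 * g' + 1" using Y Cons.prems by (metis list.set_intros(2))
  then have "g = g'" by simp
  then show ?case using Cons W Y by simp
qed simp

abbreviation "polyX \<equiv> [:0, 1:] :: real poly"

text \<open>6 is the degree of \<open>cb\<close>, 3 bounds those of \<open>cA\<close>,
  \<open>cB\<close> and \<open>cC\<close>, and a gap adds 2 g.\<close>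

lemma degree_cWY:
  "degree (cW polyX (ca polyX) (cb polyX) gs) \<le> 6 + 2 * sum_list gs + 3 * length gs \<and>
   degree (cY polyX (ca polyX) (cb polyX) gs) \<le> 6 + 2 * sum_list gs + 3 * length gs"
proof (induction gs)
  case Nil
  have "ca polyX = [:1, 1, -1, 1, 1, -1:]" "cb polyX = [:0, 1, -1, -1, 1, -1, -1:]"
    by (simp_all add: ca_def cb_def cA_def cB_def cC_def eval_nat_numeral one_pCons)
  then show ?case by simp
next
  case (Cons g gs)
  let ?W = "cW polyX (ca polyX) (cb polyX) gs" and ?Y = "cY polyX (ca polyX) (cb polyX) gs"
  let ?d = "6 + 2 * sum_list gs + 3 * length gs"
  have deg: "degree (cA polyX) \<le> 3" "degree (cB polyX) \<le> 3" "degree (cC polyX) \<le> 3"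
    by (simp_all add: cA_def cB_def cC_def eval_nat_numeral one_pCons)
  have X: "degree (polyX ^ (2 * g)) \<le> 2 * g" using degree_power_le[of polyX "2 * g"] by simp
  have "degree (p * ?W) \<le> 3 + ?d" "degree (p * polyX ^ (2 * g) * ?Y) \<le> 3 + 2 * g + ?d" if "degree p \<le> 3" for p
  proof -
    show "degree (p * ?W) \<le> 3 + ?d"
      using degree_mult_le[of p ?W] that Cons.IH by linarith
    show "degree (p * polyX ^ (2 * g) * ?Y) \<le> 3 + 2 * g + ?d"
      using degree_mult_le[of "p * polyX ^ (2 * g)" ?Y] degree_mult_le[of p "polyX ^ (2 * g)"] X that Cons.IH
      by linarith
  qed
  note * = this
  have "degree (cA polyX * ?W - cB polyX * polyX ^ (2 * g) * ?Y) \<le> 3 + 2 * g + ?d"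
    by (rule degree_diff_le) (use *(1)[OF deg(1)] *(2)[OF deg(2)] in linarith)+
  moreover have "degree (cB polyX * ?W + cC polyX * polyX ^ (2 * g) * ?Y) \<le> 3 + 2 * g + ?d"
    by (rule degree_add_le) (use *(1)[OF deg(2)] *(2)[OF deg(3)] in linarith)+
  ultimately show ?case by simp
qed

lemma fps_of_poly_hom: "comm_ring_hom (fps_of_poly :: real poly \<Rightarrow> real fps)"
  by unfold_locales (simp_all add: fps_of_poly_add fps_of_poly_mult)

text \<open>As the first gap is longer than the degrees of all other terms, the two halves of \<open>cJ\<close> can be
  separated.\<close>

lemma decode_gaps:
  assumes J: "cJ polyX (ca polyX) (cb polyX) (N # w) = cJ polyX (ca polyX) (cb polyX) (N # w')"
    and len: "length w = length w'" "sum_list w = sum_list w'"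
    and N: "2 * N > 11 + 2 * sum_list w + 3 * length w"
    and pos: "\<forall>g\<in>set w. 1 \<le> g" "\<forall>g\<in>set w'. 1 \<le> g"
  shows "w = w'"
proof -
  let ?a = "ca polyX" and ?b = "cb polyX"
  let ?W = "cW polyX ?a ?b" and ?Y = "cY polyX ?a ?b"
  have ab: "?a = [:1, 1, -1, 1, 1, -1:]" "?b = [:0, 1, -1, -1, 1, -1, -1:]"
    by (simp_all add: ca_def cb_def cA_def cB_def cC_def eval_nat_numeral one_pCons)
  have eq: "?a * (?W w - ?W w') = polyX ^ (2 * N) * (?b * (?Y w - ?Y w'))"
    using J by (simp add: cJ_def algebra_simps)
  have "?a * (?W w - ?W w') = 0"
  proof (rule ccontr)
    assume ne: "?a * (?W w - ?W w') \<noteq> 0"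
    have "degree (?W w - ?W w') \<le> 6 + 2 * sum_list w + 3 * length w"
      by (rule degree_diff_le) (use degree_cWY[of w] degree_cWY[of w'] len in auto)
    moreover have "degree ?a \<le> 5" by (simp add: ab)
    \<comment> \<open>The constant 11 in the assumption on \<open>N\<close> is 5 + 6, the degree of
      \<open>ca\<close> and the constant of \<open>degree_cWY\<close>.\<close>
    ultimately have "degree (?a * (?W w - ?W w')) < 2 * N"
      using degree_mult_le[of ?a "?W w - ?W w'"] N by linarith
    moreover have "degree (polyX ^ (2 * N) * (?b * (?Y w - ?Y w'))) \<ge> 2 * N"
      using ne unfolding eq by (simp add: degree_mult_eq degree_power_eq)
    ultimately show False unfolding eq by simp
  qed
  moreover have "?a \<noteq> 0" "?b \<noteq> 0" by (simp_all add: ab)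
  ultimately have W: "?W w = ?W w'" and Y: "?Y w = ?Y w'"
    using eq by auto
  have hom: "fps_of_poly (?W v) = XW v" "fps_of_poly (?Y v) = XY v" for v
    using cWY_hom[OF fps_of_poly_hom, of polyX ?a ?b v] ca_hom[OF fps_of_poly_hom, of polyX]
    by (simp_all add: fps_of_poly_pCons)
  show ?thesis
    by (rule XWY_inj[OF len(1) pos]) (simp_all add: hom[symmetric] W Y)
qed

section \<open>Caterpillars\<close>

text \<open>The spine vertices are \<open>None\<close> and \<open>Some (i, False)\<close> for \<open>1 \<le> i < length bs\<close>; the spine vertex
  with index \<open>i\<close> carries the pendant leaf \<open>Some (i, True)\<close> if \<open>bs ! i\<close>.\<close>

definition cat_edges :: "bool list \<Rightarrow> (nat \<times> bool) set" where
  "cat_edges bs = {(i, b). i < length bs \<and> (if b then bs ! i else i > 0)}"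

fun cat_par :: "nat \<times> bool \<Rightarrow> (nat \<times> bool) option" where
  "cat_par (i, False) = (if i \<le> 1 then None else Some (i - 1, False))"
| "cat_par (i, True) = (if i = 0 then None else Some (i, False))"

definition gap_bits :: "nat list \<Rightarrow> bool list" where
  "gap_bits gs = concat (map (\<lambda>g. replicate (g - 1) False @ [True]) gs)"

text \<open>A gap is the distance between consecutive spine vertices with a pendant leaf. The outer
  two \<open>False\<close> bits are the end points of the spine; they are leaves themselves and put
  a further leaf next to the first and the last vertex of degree 3.\<close>

definition cat_bits :: "nat list \<Rightarrow> bool list" where
  "cat_bits gs = False # True # gap_bits gs @ [False]"

lemma finite_cat_edges [simp]: "finite (cat_edges bs)"
  by (rule finite_subset[of _ "{..<length bs} \<times> UNIV"]) (auto simp: cat_edges_def)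

text \<open>A new bit appends a spine vertex and below it possibly a leaf; \<open>V\<close> is the
  state in between. The spine vertex of index 0 is the root and carries no edge of its own.\<close>

lemma rtree_cat: "rtree cat_par (cat_edges bs)"
proof (induction bs rule: rev_induct)
  case Nil
  then show ?case by (simp add: cat_edges_def rtree_empty)
next
  case (snoc b bs)
  let ?n = "length bs"
  define V where "V = (if ?n = 0 then cat_edges bs else insert (?n, False) (cat_edges bs))"
  have V: "rtree cat_par V"
  proof (cases "?n = 0")
    case False
    have "rtree cat_par (insert (?n, False) (cat_edges bs))"
      using False by (intro rtree_insert[OF snoc]) (auto simp: cat_edges_def)
    then show ?thesis using False by (simp add: V_def)
  qed (use snoc in \<open>simp add: V_def\<close>)
  have V_eq: "V = {(i, c). i < length (bs @ [b]) \<and> (if c then i < ?n \<and> bs ! i else i > 0)}"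
    by (auto simp: V_def cat_edges_def less_Suc_eq)
  show ?case
  proof (cases b)
    case True
    have "cat_edges (bs @ [b]) = insert (?n, True) V"
      unfolding V_eq cat_edges_def using True by (auto simp: nth_append less_Suc_eq split: if_splits)
    moreover have "rtree cat_par (insert (?n, True) V)"
      by (rule rtree_insert[OF V]) (auto simp: V_eq)
    ultimately show ?thesis by simp
  next
    case False
    have "cat_edges (bs @ [b]) = V"
      unfolding V_eq cat_edges_def using False by (auto simp: nth_append less_Suc_eq split: if_splits)
    then show ?thesis using V by simp
  qed
qed

lemma cat_children:
  assumes "length bs \<ge> 2" "\<not> bs ! 0"
  shows "children cat_par (cat_edges bs) None = {(1, False)}"
    and "1 \<le> i \<Longrightarrow> i < length bs \<Longrightarrow> children cat_par (cat_edges bs) (Some (i, False)) =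
      (if Suc i < length bs then {(Suc i, False)} else {}) \<union> (if bs ! i then {(i, True)} else {})"
    and "children cat_par (cat_edges bs) (Some (i, True)) = {}"
proof -
  have nz: "0 < i" if "bs ! i" for i using that assms(2) by (cases i) auto
  have 1: "cat_par e = None \<longleftrightarrow> e = (1, False)" if "e \<in> cat_edges bs" for e
  proof -
    obtain i b where e: "e = (i, b)" by (cases e)
    show ?thesis using that assms nz by (cases b) (auto simp: e cat_edges_def)
  qed
  have "children cat_par (cat_edges bs) None = {e \<in> cat_edges bs. e = (1, False)}"
    unfolding children_def by (rule Collect_cong) (metis 1)
  also have "\<dots> = {(1, False)}" using assms by (auto simp: cat_edges_def)
  finally show "children cat_par (cat_edges bs) None = {(1, False)}" .
  have 2: "cat_par e = Some (i, False) \<longleftrightarrow> e = (Suc i, False) \<or> e = (i, True)"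
    if "e \<in> cat_edges bs" "1 \<le> i" for e i
  proof -
    obtain j b where e: "e = (j, b)" by (cases e)
    show ?thesis using that assms by (cases b) (auto simp: e cat_edges_def)
  qed
  show "children cat_par (cat_edges bs) (Some (i, False)) =
      (if Suc i < length bs then {(Suc i, False)} else {}) \<union> (if bs ! i then {(i, True)} else {})"
    if i: "1 \<le> i" "i < length bs"
  proof -
    have "children cat_par (cat_edges bs) (Some (i, False)) =
        {e \<in> cat_edges bs. e = (Suc i, False) \<or> e = (i, True)}"
      unfolding children_def by (rule Collect_cong) (metis 2 i(1))
    also have "\<dots> = (if Suc i < length bs then {(Suc i, False)} else {}) \<union> (if bs ! i then {(i, True)} else {})"
      using i by (auto simp: cat_edges_def)
    finally show ?thesis .
  qed
  have "cat_par e \<noteq> Some (i, True)" for e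
    by (cases e rule: cat_par.cases) auto
  then show "children cat_par (cat_edges bs) (Some (i, True)) = {}"
    by (auto simp: children_def)
qed

text \<open>Continuants of a suffix of the spine ending in \<open>False\<close>: the determinant of
  the part beginning with its first spine vertex, and the one with this vertex deleted but its leaf
  kept. The diagonal entry of a leaf is 1 - q + q^2.\<close>

primrec fgb :: "'a::comm_ring_1 \<Rightarrow> bool list \<Rightarrow> 'a \<times> 'a" where
  "fgb q [] = (1, 0)"
| "fgb q (b # cs) = (if cs = [] then (1 - q + q\<^sup>2, 1)
    else if b then ((1 + q ^ 4) * fst (fgb q cs) - q\<^sup>2 * (1 - q + q\<^sup>2) * snd (fgb q cs),
      (1 - q + q\<^sup>2) * fst (fgb q cs))
    else ((1 + q\<^sup>2) * fst (fgb q cs) - q\<^sup>2 * snd (fgb q cs), fst (fgb q cs)))"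

lemma prod_cat_edges:
  assumes "\<not> bs ! 0" "length bs \<ge> 1"
  shows "(\<Prod>w\<in>Some ` cat_edges bs. b w) =
    (\<Prod>i\<in>{1..<length bs}. b (Some (i, False)) * (if bs ! i then b (Some (i, True)) else (1::'a::comm_monoid_mult)))"
proof -
  let ?n = "length bs"
  have "cat_edges bs = (\<lambda>i. (i, False)) ` {1..<?n} \<union> (\<lambda>i. (i, True)) ` {i\<in>{1..<?n}. bs ! i}"
  proof (rule Set.set_eqI)
    fix e :: "nat \<times> bool"
    have nz: "0 < i" if "bs ! i" for i using that assms(1) by (cases i) auto
    obtain i b where e: "e = (i, b)" by (cases e)
    show "e \<in> cat_edges bs \<longleftrightarrow> e \<in> (\<lambda>i. (i, False)) ` {1..<?n} \<union> (\<lambda>i. (i, True)) ` {i\<in>{1..<?n}. bs ! i}"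
      using nz[of i] by (cases b) (auto simp: e cat_edges_def image_iff Suc_le_eq)
  qed
  then have "(\<Prod>w\<in>Some ` cat_edges bs. b w) =
      (\<Prod>e\<in>(\<lambda>i. (i, False)) ` {1..<?n} \<union> (\<lambda>i. (i, True)) ` {i\<in>{1..<?n}. bs ! i}. b (Some e))"
    by (simp add: prod.reindex)
  also have "\<dots> = (\<Prod>e\<in>(\<lambda>i. (i, False)) ` {1..<?n}. b (Some e)) *
      (\<Prod>e\<in>(\<lambda>i. (i, True)) ` {i\<in>{1..<?n}. bs ! i}. b (Some e))"
    by (rule prod.union_disjoint) auto
  also have "(\<Prod>e\<in>(\<lambda>i. (i, False)) ` {1..<?n}. b (Some e)) = (\<Prod>i\<in>{1..<?n}. b (Some (i, False)))"
    by (simp add: prod.reindex inj_on_def)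
  also have "(\<Prod>e\<in>(\<lambda>i. (i, True)) ` {i\<in>{1..<?n}. bs ! i}. b (Some e)) =
      (\<Prod>i\<in>{i\<in>{1..<?n}. bs ! i}. b (Some (i, True)))"
    by (simp add: prod.reindex inj_on_def)
  also have "\<dots> = (\<Prod>i\<in>{1..<?n}. if bs ! i then b (Some (i, True)) else 1)"
    by (rule prod.inter_filter) simp
  finally show ?thesis by (simp only: prod.distrib)
qed

lemma card_cat_edges_bits:
  assumes "\<not> bs ! 0" "length bs \<ge> 1"
  shows "card (cat_edges bs) + 1 = length bs + length (filter id bs)"
proof -
  let ?n = "length bs"
  have "cat_edges bs = (\<lambda>i. (i, False)) ` {1..<?n} \<union> (\<lambda>i. (i, True)) ` {i. i < ?n \<and> bs ! i}"
  proof (rule Set.set_eqI)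
    fix e :: "nat \<times> bool"
    obtain i b where e: "e = (i, b)" by (cases e)
    show "e \<in> cat_edges bs \<longleftrightarrow> e \<in> (\<lambda>i. (i, False)) ` {1..<?n} \<union> (\<lambda>i. (i, True)) ` {i. i < ?n \<and> bs ! i}"
      by (cases b) (auto simp: e cat_edges_def image_iff Suc_le_eq)
  qed
  then have "card (cat_edges bs) = card ((\<lambda>i. (i, False)) ` {1..<?n}) + card ((\<lambda>i. (i, True)) ` {i. i < ?n \<and> bs ! i})"
    by (simp add: card_Un_disjoint disjoint_iff image_iff)
  also have "\<dots> = (?n - 1) + card {i. i < ?n \<and> bs ! i}"
    by (simp add: card_image inj_on_def)
  also have "card {i. i < ?n \<and> bs ! i} = length (filter id bs)"
    by (simp add: length_filter_conv_card)
  finally show ?thesis using assms(2) by simp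
qed

lemma pivot_identities:
  fixes q i j :: "'a::comm_ring_1"
  shows "(1 - q)\<^sup>2 + q * 3 - q\<^sup>2 * (i + j) = (1 + q\<^sup>2 + (q - q\<^sup>2 * j)) - q\<^sup>2 * i"
    and "(1 - q)\<^sup>2 + q * 2 - q\<^sup>2 * (i + 0) = (1 + q\<^sup>2 + 0) - q\<^sup>2 * i"
  by (simp_all add: algebra_simps power2_eq_square)

text \<open>A pivot contains the inverse of the next one, which cancels in the product of all later
  pivots. This turns the pivots into a recursion without division.\<close>

lemma cat_pivots_fgb:
  fixes b :: "(nat \<times> bool) option \<Rightarrow> 'a::field fps"
  assumes n: "length bs \<ge> 2" and b0: "\<not> bs ! 0" and bl: "\<not> last bs"
    and piv: "tree_pivots cat_par (cat_edges bs) b"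
  shows "(\<Prod>w\<in>verts (cat_edges bs). b w) =
    (1 - fps_X + fps_X\<^sup>2) * fst (fgb fps_X (drop 1 bs)) - fps_X\<^sup>2 * snd (fgb fps_X (drop 1 bs))"
proof -
  let ?n = "length bs" and ?V = "cat_edges bs" and ?q = "fps_X :: 'a fps"
  note ch = cat_children[OF n b0]
  have T: "rtree cat_par ?V" by (rule rtree_cat)
  have in_V: "(i, False) \<in> ?V" if "1 \<le> i" "i < ?n" for i using that by (simp add: cat_edges_def)
  have in_V': "(i, True) \<in> ?V" if "i < ?n" "bs ! i" for i using that by (simp add: cat_edges_def)
  have beq: "b w = (1 - ?q)\<^sup>2 + ?q * of_nat (deg cat_par ?V w) -
      ?q\<^sup>2 * (\<Sum>e\<in>children cat_par ?V w. inverse (b (Some e)))" if "w \<in> verts ?V" for w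
    by (rule conjunct2[OF bspec[OF piv that]])
  have bunit: "b w * inverse (b w) = 1" if "w \<in> verts ?V" for w
    using conjunct1[OF bspec[OF piv that]] by (simp add: inverse_mult_eq_1')
  let ?l = "1 - ?q + ?q\<^sup>2"
  have leaf: "b (Some (i, True)) = ?l" if "i < ?n" "bs ! i" for i
    using beq[of "Some (i, True)"] in_V'[OF that] deg_children(2)[OF T in_V'[OF that]] ch(3)[of i]
    by (simp add: power2_eq_square algebra_simps)
  \<comment> \<open>\<open>F i\<close> collects the pivots from spine vertex \<open>i\<close> on;
    \<open>G i\<close> omits the pivot of spine vertex \<open>i\<close> but keeps that of its leaf.
    They will be the two components of \<open>fgb\<close>.\<close>
  define f where "f i = b (Some (i, False)) * (if bs ! i then b (Some (i, True)) else 1)" for i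
  define F where "F i = (\<Prod>j\<in>{i..<?n}. f j)" for i
  define G where "G i = (if bs ! i then b (Some (i, True)) else 1) * F (Suc i)" for i
  have FS: "F i = f i * F (Suc i)" if "i < ?n" for i
    unfolding F_def using that by (simp add: prod.atLeast_Suc_lessThan)
  have FG: "F i = b (Some (i, False)) * G i" if "i < ?n" for i
    using FS[OF that] by (simp add: f_def G_def mult_ac)
  have step: "b (Some (i, False)) * F (Suc i) =
      (1 + ?q\<^sup>2 + (if bs ! i then ?q - ?q\<^sup>2 * inverse ?l else 0)) * F (Suc i) - ?q\<^sup>2 * G (Suc i)"
    if i: "1 \<le> i" "Suc i < ?n" for i
  proof -
    have d: "deg cat_par ?V (Some (i, False)) = (if bs ! i then 3 else 2)"
      using deg_children(2)[OF T in_V, of i] ch(2)[of i] i by simp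
    let ?c = "1 + ?q\<^sup>2 + (if bs ! i then ?q - ?q\<^sup>2 * inverse ?l else 0)"
    let ?i = "inverse (b (Some (Suc i, False)))"
    have "b (Some (i, False)) = (1 - ?q)\<^sup>2 + ?q * (if bs ! i then 3 else 2) -
      ?q\<^sup>2 * (?i + (if bs ! i then inverse ?l else 0))"
      using beq[of "Some (i, False)"] in_V[of i] ch(2)[of i] leaf[of i] i unfolding d by (simp split: if_splits)
    then have bi: "b (Some (i, False)) = ?c - ?q\<^sup>2 * ?i"
      by (cases "bs ! i") (simp_all only: if_True if_False pivot_identities)
    have "?i * F (Suc i) = (b (Some (Suc i, False)) * ?i) * G (Suc i)"
      unfolding FG[OF i(2)] by (simp only: mult_ac)
    also have "b (Some (Suc i, False)) * ?i = 1"
      using i in_V[of "Suc i"] by (intro bunit) simp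
    finally have iF: "?i * F (Suc i) = G (Suc i)" by simp
    have "b (Some (i, False)) * F (Suc i) = ?c * F (Suc i) - ?q\<^sup>2 * (?i * F (Suc i))"
      unfolding bi by (simp only: left_diff_distrib mult.assoc)
    then show ?thesis unfolding iF .
  qed
  have l_unit: "?l * inverse ?l = 1" by (rule inverse_mult_eq_1') (simp add: power2_eq_square)
  have main: "fgb ?q (drop i bs) = (F i, G i)" if "1 \<le> i" "i < ?n" for i
    using that(2,1)
  proof (induction i rule: strict_inc_induct)
    case (base i)
    then have i: "i = ?n - 1" and il: "i < ?n" by auto
    have d: "drop i bs = [bs ! i]"
      using Cons_nth_drop_Suc[OF il, symmetric] base by simp
    have "bs \<noteq> []" using n by auto
    then have bi: "\<not> bs ! i" using bl i by (simp add: last_conv_nth)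
    have iV: "Some (i, False) \<in> verts ?V" using in_V[OF base.prems il] by simp
    have c0: "children cat_par ?V (Some (i, False)) = {}"
      using ch(2)[OF base.prems il] bi base.hyps by simp
    have d1: "deg cat_par ?V (Some (i, False)) = 1"
      using deg_children(2)[OF T in_V[OF base.prems il]] unfolding c0 by simp
    have "b (Some (i, False)) = (1 - ?q)\<^sup>2 + ?q * of_nat 1 - ?q\<^sup>2 * 0"
      using beq[OF iV] unfolding c0 d1 sum.empty .
    also have "\<dots> = ?l" by (simp add: power2_eq_square algebra_simps)
    finally have bl': "b (Some (i, False)) = ?l" .
    have "F i = ?l" "G i = 1"
      using bi base.hyps unfolding FS[OF il] G_def f_def F_def by (simp_all add: bl')
    then show ?case unfolding d by simp
  next
    case (step i)
    have d: "drop i bs = bs ! i # drop (Suc i) bs" using step.hyps by (simp add: Cons_nth_drop_Suc)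
    have ne: "drop (Suc i) bs \<noteq> []" using step.hyps by auto
    have IH: "fgb ?q (drop (Suc i) bs) = (F (Suc i), G (Suc i))" using step by simp
    have i: "1 \<le> i" "Suc i < ?n" "i < ?n" using step by auto
    note st = \<open>\<And>i. 1 \<le> i \<Longrightarrow> Suc i < ?n \<Longrightarrow> b (Some (i, False)) * F (Suc i) =
      (1 + ?q\<^sup>2 + (if bs ! i then ?q - ?q\<^sup>2 * inverse ?l else 0)) * F (Suc i) - ?q\<^sup>2 * G (Suc i)\<close>[OF i(1,2)]
    show ?case
    proof (cases "bs ! i")
      case True
      have "F i = ?l * (b (Some (i, False)) * F (Suc i))"
        using FG[OF i(3)] True leaf[OF i(3)] by (simp add: G_def mult_ac)
      also have "\<dots> = (?l * (1 + ?q + ?q\<^sup>2)) * F (Suc i) - ?q\<^sup>2 * (?l * inverse ?l) * F (Suc i) - ?q\<^sup>2 * ?l * G (Suc i)"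
        unfolding st using True by (simp only: if_True) (simp only: algebra_simps)
      \<comment> \<open>The term q^2 is removed by the leaf's own contribution, which leaves the
        coefficient 1 + q^4 of \<open>fgb\<close>.\<close>
      also have "?l * (1 + ?q + ?q\<^sup>2) = 1 + ?q\<^sup>2 + ?q ^ 4"
        by (simp add: algebra_simps eval_nat_numeral)
      finally have "F i = (1 + ?q ^ 4) * F (Suc i) - ?q\<^sup>2 * ?l * G (Suc i)"
        unfolding l_unit by (simp add: algebra_simps)
      then show ?thesis using ne IH True leaf[OF i(3)] unfolding d by (simp add: G_def)
    next
      case False
      have "F i = b (Some (i, False)) * F (Suc i)" using FG[OF i(3)] False by (simp add: G_def)
      then have "F i = (1 + ?q\<^sup>2) * F (Suc i) - ?q\<^sup>2 * G (Suc i)" unfolding st using False by simp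
      then show ?thesis using ne IH False unfolding d by (simp add: G_def)
    qed
  qed
  have "(\<Prod>w\<in>verts ?V. b w) = b None * F 1"
    using prod_cat_edges[OF b0, of b] n by (simp add: F_def f_def)
  also have "b None = ?l - ?q\<^sup>2 * inverse (b (Some (1, False)))"
    using beq[of None] ch(1) deg_children(1)[OF T] by (simp add: power2_eq_square algebra_simps)
  also have "(?l - ?q\<^sup>2 * inverse (b (Some (1, False)))) * F 1 =
      ?l * F 1 - ?q\<^sup>2 * ((b (Some (1, False)) * inverse (b (Some (1, False)))) * G 1)"
    using FG[of 1] n by (simp add: algebra_simps)
  also have "b (Some (1, False)) * inverse (b (Some (1, False))) = 1"
    using bunit[of "Some (1, False)"] in_V[of 1] n by simp
  finally show ?thesis using main[of 1] n by simp
qed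

text \<open>\<open>fw\<close> and \<open>fy\<close> are the coordinates in which a spine vertex of
  degree 2 acts diagonally, with eigenvalues 1 and q^2.\<close>

definition fw :: "'a::comm_ring_1 \<Rightarrow> bool list \<Rightarrow> 'a" where
  "fw q cs = fst (fgb q cs) - q\<^sup>2 * snd (fgb q cs)"

definition fy :: "'a::comm_ring_1 \<Rightarrow> bool list \<Rightarrow> 'a" where
  "fy q cs = q\<^sup>2 * (fst (fgb q cs) - snd (fgb q cs))"

lemma fwy_replicate:
  assumes "cs \<noteq> []"
  shows "fw q (replicate m False @ cs) = fw q cs \<and> fy q (replicate m False @ cs) = q ^ (2 * m) * fy q cs"
proof (induction m)
  case (Suc m)
  have "fw q (False # ds) = fw q ds \<and> fy q (False # ds) = q\<^sup>2 * fy q ds" if "ds \<noteq> []" for ds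
    using that by (simp add: fw_def fy_def algebra_simps power2_eq_square)
  from this[of "replicate m False @ cs"] show ?case
    using Suc assms by (simp add: mult.assoc power2_eq_square)
qed simp

text \<open>The change of coordinates brings in the denominator 1 - q^2; its factor 1 - q cancels,
  and 1 + q is moved to the left.\<close>

lemma fwy_True:
  assumes "cs \<noteq> []"
  shows "(1 + q) * fw q (True # cs) = cA q * fw q cs - cB q * fy q cs"
    and "(1 + q) * fy q (True # cs) = q\<^sup>2 * (cB q * fw q cs + cC q * fy q cs)"
proof -
  obtain F G where FG: "fgb q cs = (F, G)" by (cases "fgb q cs")
  show "(1 + q) * fw q (True # cs) = cA q * fw q cs - cB q * fy q cs"
    and "(1 + q) * fy q (True # cs) = q\<^sup>2 * (cB q * fw q cs + cC q * fy q cs)"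
    using assms by (simp_all add: fw_def fy_def FG cA_def cB_def cC_def algebra_simps eval_nat_numeral)
qed

text \<open>There is one factor 1 + q for each of the \<open>length gs + 1\<close> spine vertices
  with a leaf; 1 - q comes from the end of the spine.\<close>

lemma fwy_gap_bits:
  assumes "\<forall>g\<in>set gs. 1 \<le> g"
  shows "(1 + q) ^ (length gs + 1) * fw q (True # gap_bits gs @ [False]) = (1 - q) * cW q (ca q) (cb q) gs \<and>
    (1 + q) ^ (length gs + 1) * fy q (True # gap_bits gs @ [False]) = (1 - q) * q\<^sup>2 * cY q (ca q) (cb q) gs"
  using assms
proof (induction gs)
  case Nil
  have v: "fw q [False] = 1 - q" "fy q [False] = - (q ^ 3) * (1 - q)"
    by (simp_all add: fw_def fy_def algebra_simps eval_nat_numeral)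
  have "(1 + q) * fw q [True, False] = cA q * (1 - q) - cB q * (- (q ^ 3) * (1 - q))"
    using fwy_True(1)[of "[False]" q] unfolding v by simp
  also have "\<dots> = (1 - q) * ca q" by (simp add: ca_def algebra_simps)
  finally have 1: "(1 + q) * fw q [True, False] = (1 - q) * ca q" .
  have "(1 + q) * fy q [True, False] = q\<^sup>2 * (cB q * (1 - q) + cC q * (- (q ^ 3) * (1 - q)))"
    using fwy_True(2)[of "[False]" q] unfolding v by simp
  also have "\<dots> = (1 - q) * q\<^sup>2 * cb q" by (simp add: cb_def algebra_simps)
  finally have "(1 + q) * fy q [True, False] = (1 - q) * q\<^sup>2 * cb q" .
  note 1 this
  moreover have "True # gap_bits [] @ [False] = [True, False]" by (simp add: gap_bits_def)
  ultimately show ?case by simp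
next
  case (Cons g gs)
  let ?cs = "True # gap_bits gs @ [False]"
  let ?c = "(1 + q) ^ (length gs + 1)"
  have bits: "True # gap_bits (g # gs) @ [False] = True # (replicate (g - 1) False @ ?cs)"
    by (simp add: gap_bits_def)
  have r: "fw q (replicate (g - 1) False @ ?cs) = fw q ?cs"
    "fy q (replicate (g - 1) False @ ?cs) = q ^ (2 * (g - 1)) * fy q ?cs"
    using fwy_replicate[of ?cs q "g - 1"] by auto
  have IH: "?c * fw q ?cs = (1 - q) * cW q (ca q) (cb q) gs"
    "?c * fy q ?cs = (1 - q) * q\<^sup>2 * cY q (ca q) (cb q) gs"
    using Cons by auto
  have g: "q ^ (2 * (g - 1)) * q\<^sup>2 = q ^ (2 * g)"
    using Cons.prems by (cases g) (simp_all add: power2_eq_square mult_ac)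
  have ne: "replicate (g - 1) False @ ?cs \<noteq> []" by simp
  have "(1 + q) ^ (length (g # gs) + 1) * fw q (True # (replicate (g - 1) False @ ?cs)) =
      ?c * ((1 + q) * fw q (True # (replicate (g - 1) False @ ?cs)))" by (simp add: mult_ac)
  also have "\<dots> = cA q * (?c * fw q ?cs) - cB q * q ^ (2 * (g - 1)) * (?c * fy q ?cs)"
    unfolding fwy_True(1)[OF ne] r by (simp add: algebra_simps)
  also have "\<dots> = (1 - q) * (cA q * cW q (ca q) (cb q) gs - cB q * (q ^ (2 * (g - 1)) * q\<^sup>2) * cY q (ca q) (cb q) gs)"
    unfolding IH by (simp add: algebra_simps)
  finally have 1: "(1 + q) ^ (length (g # gs) + 1) * fw q (True # (replicate (g - 1) False @ ?cs)) =
      (1 - q) * cW q (ca q) (cb q) (g # gs)" unfolding g by simp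
  have "(1 + q) ^ (length (g # gs) + 1) * fy q (True # (replicate (g - 1) False @ ?cs)) =
      ?c * ((1 + q) * fy q (True # (replicate (g - 1) False @ ?cs)))" by (simp add: mult_ac)
  also have "\<dots> = q\<^sup>2 * (cB q * (?c * fw q ?cs) + cC q * q ^ (2 * (g - 1)) * (?c * fy q ?cs))"
    unfolding fwy_True(2)[OF ne] r by (simp add: algebra_simps)
  also have "\<dots> = (1 - q) * q\<^sup>2 * (cB q * cW q (ca q) (cb q) gs + cC q * (q ^ (2 * (g - 1)) * q\<^sup>2) * cY q (ca q) (cb q) gs)"
    unfolding IH by (simp add: algebra_simps)
  finally have 2: "(1 + q) ^ (length (g # gs) + 1) * fy q (True # (replicate (g - 1) False @ ?cs)) =
      (1 - q) * q\<^sup>2 * cY q (ca q) (cb q) (g # gs)" unfolding g by simp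
  show ?case unfolding bits using 1 2 by blast
qed

lemma cat_pivots_cJ:
  fixes b :: "(nat \<times> bool) option \<Rightarrow> 'a::field fps"
  assumes gs: "gs \<noteq> []" "\<forall>g\<in>set gs. 1 \<le> g"
    and piv: "tree_pivots cat_par (cat_edges (cat_bits gs)) b"
  shows "(1 + fps_X) ^ (length gs + 2) * (\<Prod>w\<in>verts (cat_edges (cat_bits gs)). b w) =
    (1 - fps_X) * cJ fps_X (ca fps_X) (cb fps_X) gs"
proof -
  let ?q = "fps_X :: 'a fps"
  let ?cs = "True # gap_bits gs @ [False]"
  have P: "(\<Prod>w\<in>verts (cat_edges (cat_bits gs)). b w) =
      (1 - ?q + ?q\<^sup>2) * fst (fgb ?q ?cs) - ?q\<^sup>2 * snd (fgb ?q ?cs)"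
    using cat_pivots_fgb[OF _ _ _ piv] by (simp add: cat_bits_def)
  \<comment> \<open>The root is a leaf next to the first vertex of degree 3; passing to the
    coordinates \<open>fw\<close> and \<open>fy\<close> costs a last factor 1 + q, by (1 + q) (1 - q
    + q^2) = 1 + q^3.\<close>
  have "(1 + ?q) * (\<Prod>w\<in>verts (cat_edges (cat_bits gs)). b w) = fw ?q ?cs + ?q * fy ?q ?cs"
    unfolding P fw_def fy_def by (simp add: algebra_simps eval_nat_numeral)
  then have "(1 + ?q) ^ (length gs + 2) * (\<Prod>w\<in>verts (cat_edges (cat_bits gs)). b w) =
      (1 + ?q) ^ (length gs + 1) * (fw ?q ?cs + ?q * fy ?q ?cs)"
    by (simp add: mult_ac)
  also have "\<dots> = (1 - ?q) * (cW ?q (ca ?q) (cb ?q) gs + ?q ^ 3 * cY ?q (ca ?q) (cb ?q) gs)"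
  proof -
    have "(1 + ?q) ^ (length gs + 1) * (fw ?q ?cs + ?q * fy ?q ?cs) =
        (1 + ?q) ^ (length gs + 1) * fw ?q ?cs + ?q * ((1 + ?q) ^ (length gs + 1) * fy ?q ?cs)"
      by (simp only: algebra_simps)
    also have "\<dots> = (1 - ?q) * cW ?q (ca ?q) (cb ?q) gs + ?q * ((1 - ?q) * ?q\<^sup>2 * cY ?q (ca ?q) (cb ?q) gs)"
      using fwy_gap_bits[OF gs(2), of ?q] by (simp only:)
    finally show ?thesis by (simp add: algebra_simps eval_nat_numeral)
  qed
  also have "cW ?q (ca ?q) (cb ?q) gs + ?q ^ 3 * cY ?q (ca ?q) (cb ?q) gs = cJ ?q (ca ?q) (cb ?q) gs"
  proof -
    obtain g hs where g: "gs = g # hs" using gs(1) by (cases gs) auto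
    have "(A * W - B * P * Y) + r * (B * W + C * P * Y) = (A + r * B) * W - (B - r * C) * P * Y"
      for A B C P r W Y :: "'a fps"
      by (simp add: algebra_simps)
    then show ?thesis
      unfolding g cJ_def list.sel cWY_simps ca_def[of ?q, symmetric] cb_def[of ?q, symmetric]
      by (simp only: ca_def[symmetric] cb_def[symmetric])
  qed
  finally show ?thesis .
qed

lemma card_cat_edges: "\<forall>g\<in>set gs. 1 \<le> g \<Longrightarrow> card (cat_edges (cat_bits gs)) = sum_list gs + length gs + 3"
proof -
  assume g: "\<forall>g\<in>set gs. 1 \<le> g"
  have "length (gap_bits gs) = sum_list gs" "length (filter id (gap_bits gs)) = length gs"
    using g by (induction gs) (auto simp: gap_bits_def)
  then show ?thesis
    using card_cat_edges_bits[of "cat_bits gs"] by (simp add: cat_bits_def)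
qed

section \<open>Degrees are determined by the pivots\<close>

lemma handshake:
  fixes g :: "'v option \<Rightarrow> int"
  assumes "rtree par V"
  shows "(\<Sum>w\<in>verts V. int (deg par V w) * g w) = (\<Sum>e\<in>V. g (Some e) + g (par e))"
proof -
  note fin = rtree_finite[OF assms]
  have 1: "int (deg par V w) * g w = (\<Sum>e\<in>V. inc par w e * g w)" if "w \<in> verts V" for w
  proof -
    have "(\<Sum>e\<in>V. inc par w e * g w) = (\<Sum>e\<in>{e\<in>V. w = Some e \<or> w = par e}. g w)"
      using fin by (intro sum.mono_neutral_cong_right) (auto simp: inc_def)
    then show ?thesis by (simp add: deg_def)
  qed
  have "(\<Sum>w\<in>verts V. int (deg par V w) * g w) = (\<Sum>w\<in>verts V. \<Sum>e\<in>V. inc par w e * g w)"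
    by (rule sum.cong[OF refl 1])
  also have "\<dots> = (\<Sum>e\<in>V. \<Sum>w\<in>verts V. inc par w e * g w)" by (rule sum.swap)
  also have "\<dots> = (\<Sum>e\<in>V. g (Some e) + g (par e))"
    by (rule sum.cong[OF refl]) (rule sum_inc[OF assms])
  finally show ?thesis .
qed

text \<open>The coefficients are 3! times the elementary symmetric functions, expressed by the power
  sums a, b, c; the factor 6 avoids division. A further factor 1 + x m adds m, m^2, m^3 to the power
  sums, up to order 4.\<close>

lemma newton_step:
  fixes x m a b c :: "'a::comm_ring_1"
  shows "(1 + x * m) * (6 + 6 * a * x + 3 * (a\<^sup>2 - b) * x\<^sup>2 + (a ^ 3 - 3 * a * b + 2 * c) * x ^ 3) =
    (6 + 6 * (m + a) * x + 3 * ((m + a)\<^sup>2 - (m\<^sup>2 + b)) * x\<^sup>2 +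
      ((m + a) ^ 3 - 3 * (m + a) * (m\<^sup>2 + b) + 2 * (m ^ 3 + c)) * x ^ 3) +
    x ^ 4 * (m * (a ^ 3 - 3 * a * b + 2 * c))"
  by (simp add: algebra_simps eval_nat_numeral)

text \<open>Newton's identities, with the power sums in place of the elementary symmetric functions.\<close>

lemma prod_power_sums:
  fixes m :: "'v \<Rightarrow> 'a::comm_ring_1 fps"
  assumes "finite A" and x: "x = fps_X * y"
  shows "fcong 4 (6 * (\<Prod>w\<in>A. 1 + x * m w))
    (6 + 6 * (\<Sum>w\<in>A. m w) * x + 3 * ((\<Sum>w\<in>A. m w)\<^sup>2 - (\<Sum>w\<in>A. (m w)\<^sup>2)) * x\<^sup>2 +
      ((\<Sum>w\<in>A. m w) ^ 3 - 3 * (\<Sum>w\<in>A. m w) * (\<Sum>w\<in>A. (m w)\<^sup>2) + 2 * (\<Sum>w\<in>A. (m w) ^ 3)) * x ^ 3)"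
  using assms(1)
proof induction
  case (insert v A)
  let ?R = "\<lambda>a b c. 6 + 6 * a * x + 3 * (a\<^sup>2 - b) * x\<^sup>2 + (a ^ 3 - 3 * a * b + 2 * c) * x ^ 3"
  let ?a = "\<Sum>w\<in>A. m w" and ?b = "\<Sum>w\<in>A. (m w)\<^sup>2" and ?c = "\<Sum>w\<in>A. (m w) ^ 3"
  have "6 * (\<Prod>w\<in>insert v A. 1 + x * m w) = (1 + x * m v) * (6 * (\<Prod>w\<in>A. 1 + x * m w))"
    using insert by (simp add: mult_ac)
  moreover have "fcong 4 ((1 + x * m v) * (6 * (\<Prod>w\<in>A. 1 + x * m w))) ((1 + x * m v) * ?R ?a ?b ?c)"
    by (rule fcong_mult[OF fcong_refl insert.IH])
  moreover have "fcong 4 ((1 + x * m v) * ?R ?a ?b ?c) (?R (m v + ?a) ((m v)\<^sup>2 + ?b) ((m v) ^ 3 + ?c))"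
  proof -
    have "x ^ 4 * (m v * (?a ^ 3 - 3 * ?a * ?b + 2 * ?c)) = fps_X ^ 4 * (y ^ 4 * (m v * (?a ^ 3 - 3 * ?a * ?b + 2 * ?c)))"
      unfolding x by (simp only: power_mult_distrib mult.assoc)
    then show ?thesis unfolding newton_step fcong_iff by (intro exI) (rule arg_cong[where f = "\<lambda>u. _ + u"])
  qed
  moreover have "(\<Sum>w\<in>insert v A. f w) = f v + (\<Sum>w\<in>A. f w)" for f :: "'v \<Rightarrow> 'a fps"
    using insert.hyps by simp
  ultimately show ?case by (simp only:) (rule fcong_trans)
qed simp

lemma fcong_cancel_unit:
  fixes f g h :: "'a::field fps"
  assumes "fcong n (f * h) (g * h)" "h $ 0 \<noteq> 0"
  shows "fcong n f g"
proof -
  have "fcong n (f * h * inverse h) (g * h * inverse h)" by (rule fcong_mult[OF assms(1) fcong_refl])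
  then show ?thesis using inverse_mult_eq_1'[OF assms(2)] by (simp add: mult.assoc)
qed

definition power_sum_dm :: "('v \<Rightarrow> 'v option) \<Rightarrow> 'v set \<Rightarrow> nat \<Rightarrow> int" where
  "power_sum_dm par V k = (\<Sum>w\<in>verts V. dm par V w ^ k)"

text \<open>Modulo X^4 only the product over the degrees and a fixed unit matter. The first power
  sum is -2 for every tree, so the coefficients of X^2 and X^3 yield the next two.\<close>

lemma pivots_power_sums:
  fixes b :: "'v option \<Rightarrow> real fps" and b' :: "'w option \<Rightarrow> real fps"
  assumes T: "rtree par V" "tree_pivots par V b" and T': "rtree par' V'" "tree_pivots par' V' b'"
    and eq: "(\<Prod>w\<in>verts V. b w) = (\<Prod>w\<in>verts V'. b' w)"
  shows "power_sum_dm par V 2 = power_sum_dm par' V' 2" "power_sum_dm par V 3 = power_sum_dm par' V' 3"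
proof -
  let ?x = "fps_X - fps_X\<^sup>2 :: real fps"
  have x: "?x = fps_X * (1 - fps_X)" by (simp add: power2_eq_square algebra_simps)
  let ?h = "1 - fps_X\<^sup>2 - 2 * fps_X ^ 3 :: real fps"
  define E where "E = (\<Prod>w\<in>verts V. 1 + ?x * of_int (dm par V w))"
  define E' where "E' = (\<Prod>w\<in>verts V'. 1 + ?x * of_int (dm par' V' w))"
  have cut: "fcong 4 (f * (?h - fps_X ^ 4 * c)) (f * ?h)" for f c :: "real fps"
  proof -
    have "g * (h - p * d) = g * h + p * (- g * d)" for g h p d :: "real fps" by (simp add: algebra_simps)
    then show ?thesis unfolding fcong_iff by (intro exI)
  qed
  have "fcong 4 (\<Prod>w\<in>verts V. b w) (E * ?h)"
    using fcong_trans[OF fcong_mono[OF tree_order_4[OF T], of 4] cut] unfolding E_def by simp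
  moreover have "fcong 4 (\<Prod>w\<in>verts V'. b' w) (E' * ?h)"
    using fcong_trans[OF fcong_mono[OF tree_order_4[OF T'], of 4] cut] unfolding E'_def by simp
  ultimately have "fcong 4 (E * ?h) (E' * ?h)" unfolding eq by (rule fcong_trans[OF fcong_sym])
  then have "fcong 4 E E'" by (rule fcong_cancel_unit) simp
  then have E6: "fcong 4 (6 * E) (6 * E')" by (rule fcong_mult[OF fcong_refl])
  let ?S = "power_sum_dm par V" and ?S' = "power_sum_dm par' V'"
  define R where "R b c = 6 + 6 * of_int (-2) * ?x + 3 * ((of_int (-2))\<^sup>2 - of_int b) * ?x\<^sup>2 +
      ((of_int (-2)) ^ 3 - 3 * of_int (-2) * of_int b + 2 * of_int c) * ?x ^ 3" for b c :: int
  have ps: "fcong 4 (6 * (\<Prod>w\<in>verts U. 1 + ?x * of_int (dm p U w))) (R (power_sum_dm p U 2) (power_sum_dm p U 3))"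
    if "rtree p U" for p and U :: "'u set"
  proof -
    have "finite (verts U)" using rtree_finite[OF that] by simp
    from prod_power_sums[OF this x, of "\<lambda>w. of_int (dm p U w)"] show ?thesis
      unfolding R_def sum_dm[OF that, symmetric] power_sum_dm_def of_int_sum of_int_power .
  qed
  have ps': "fcong 4 (6 * (\<Prod>w\<in>verts U. 1 + ?x * of_int (dm p U w))) (R (power_sum_dm p U 2) (power_sum_dm p U 3))"
    if "rtree p U" for p and U :: "'w set"
  proof -
    have "finite (verts U)" using rtree_finite[OF that] by simp
    from prod_power_sums[OF this x, of "\<lambda>w. of_int (dm p U w)"] show ?thesis
      unfolding R_def sum_dm[OF that, symmetric] power_sum_dm_def of_int_sum of_int_power .
  qed
  have RR: "fcong 4 (R (?S 2) (?S 3)) (R (?S' 2) (?S' 3))"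
    using fcong_trans[OF fcong_trans[OF fcong_sym[OF ps[OF T(1)]] E6[unfolded E_def E'_def]] ps'[OF T'(1)]] .
  have Rn: "R b c = (6 + 12 * fps_X\<^sup>2 - 12 * fps_X) + of_int (3 * (4 - b)) * (fps_X\<^sup>2 * (1 - fps_X)\<^sup>2) +
      of_int (6 * b - 8 + 2 * c) * (fps_X ^ 3 * (1 - fps_X) ^ 3)" for b c
  proof -
    have "6 + 6 * (-2) * (y * (1 - y)) + 3 * ((-2)\<^sup>2 - b) * (y\<^sup>2 * (1 - y)\<^sup>2) +
        ((-2) ^ 3 - 3 * (-2) * b + 2 * c) * (y ^ 3 * (1 - y) ^ 3) =
      (6 + 12 * y\<^sup>2 - 12 * y) + (3 * (4 - b)) * (y\<^sup>2 * (1 - y)\<^sup>2) + (6 * b - 8 + 2 * c) * (y ^ 3 * (1 - y) ^ 3)"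
      for y b c :: "real fps"
    proof -
      have "(-2)\<^sup>2 = (4 :: real fps)" "(-2) ^ 3 = (-8 :: real fps)" by simp_all
      then show ?thesis by (simp add: algebra_simps power2_eq_square)
    qed
    from this[of fps_X "of_int b" "of_int c"] show ?thesis
      unfolding R_def x power_mult_distrib by simp
  qed
  have nth: "(fps_X\<^sup>2 * (1 - fps_X)\<^sup>2 :: real fps) $ 2 = 1" "(fps_X ^ 3 * (1 - fps_X) ^ 3 :: real fps) $ 2 = 0"
    "(fps_X ^ 3 * (1 - fps_X) ^ 3 :: real fps) $ 3 = 1"
    by (simp_all add: fps_X_power_mult_nth fps_power_zeroth)
  have of_int_nth: "((of_int k :: real fps) * f) $ n = of_int k * f $ n" for k f n
    by (simp flip: fps_of_int)
  have "R (?S 2) (?S 3) $ 2 = R (?S' 2) (?S' 3) $ 2" using RR by (simp add: fcong_def)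
  then have "real_of_int (3 * (4 - ?S 2)) = real_of_int (3 * (4 - ?S' 2))"
    unfolding Rn fps_add_nth of_int_nth nth by simp
  then have "3 * (4 - ?S 2) = 3 * (4 - ?S' 2)" by (simp only: of_int_eq_iff)
  then show 2: "?S 2 = ?S' 2" by simp
  have "R (?S 2) (?S 3) $ 3 = R (?S' 2) (?S' 3) $ 3" using RR by (simp add: fcong_def)
  then have "real_of_int (6 * ?S 2 - 8 + 2 * ?S 3) = real_of_int (6 * ?S' 2 - 8 + 2 * ?S' 3)"
    unfolding Rn fps_add_nth of_int_nth nth 2 by simp
  then have "6 * ?S 2 - 8 + 2 * ?S 3 = 6 * ?S' 2 - 8 + 2 * ?S' 3" by (simp only: of_int_eq_iff)
  then show "?S 3 = ?S' 3" using 2 by simp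
qed

lemma root_edge: "rtree par V \<Longrightarrow> V \<noteq> {} \<Longrightarrow> \<exists>e\<in>V. par e = None"
  by (induction rule: rtree.induct) auto

lemma deg_pos:
  assumes "rtree par V" "V \<noteq> {}" "w \<in> verts V"
  shows "1 \<le> deg par V w"
proof (cases w)
  case None
  have "children par V None \<noteq> {}" using root_edge[OF assms(1,2)] by (auto simp: children_def)
  moreover have "finite (children par V None)" using rtree_finite[OF assms(1)] by (simp add: children_def)
  ultimately show ?thesis using deg_children(1)[OF assms(1)] None by (simp add: Suc_le_eq card_gt_0_iff)
next
  case (Some e)
  then show ?thesis using deg_children(2)[OF assms(1), of e] assms(3) by auto
qed

text \<open>Summed over the edges, the two corrections count the leaves. For degrees at most 3 they
  make the value nonnegative; it vanishes when a leaf meets degree 3, or when no end is a leaf and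
  some end has degree 2.\<close>

definition edge_excess :: "('v \<Rightarrow> 'v option) \<Rightarrow> 'v set \<Rightarrow> 'v \<Rightarrow> int" where
  "edge_excess par V e = dm par V (Some e) * dm par V (par e) +
    of_bool (deg par V (Some e) = 1) + of_bool (deg par V (par e) = 1)"

text \<open>The second condition says that leaves are adjacent to vertices of degree 3 only, and that
  vertices of degree 3 are not adjacent.\<close>

definition good_tree :: "('v \<Rightarrow> 'v option) \<Rightarrow> 'v set \<Rightarrow> bool" where
  "good_tree par V \<longleftrightarrow> V \<noteq> {} \<and> (\<forall>w\<in>verts V. deg par V w \<le> 3) \<and> (\<forall>e\<in>V. edge_excess par V e = 0)"

lemma sum_edge_excess:
  assumes "rtree par V"
  shows "(\<Sum>e\<in>V. edge_excess par V e) = edge_dm par V + int (card {w\<in>verts V. deg par V w = 1})"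
proof -
  have fin: "finite (verts V)" using rtree_finite[OF assms] by simp
  have "(\<Sum>e\<in>V. of_bool (deg par V (Some e) = 1) + of_bool (deg par V (par e) = 1)) =
      (\<Sum>w\<in>verts V. int (deg par V w) * of_bool (deg par V w = 1))"
    using handshake[OF assms, of "\<lambda>w. of_bool (deg par V w = 1)"] by simp
  also have "\<dots> = (\<Sum>w\<in>verts V. if deg par V w = 1 then 1 else 0)"
    by (rule sum.cong) auto
  also have "\<dots> = (\<Sum>w\<in>{w\<in>verts V. deg par V w = 1}. 1)"
    by (rule sum.inter_filter[OF fin, symmetric])
  also have "\<dots> = int (card {w\<in>verts V. deg par V w = 1})" by simp
  finally show ?thesis
    unfolding edge_excess_def edge_dm_def sum.distrib[symmetric] by (simp add: sum.distrib add.assoc)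
qed

text \<open>k^3 - k is a product of three consecutive integers. It converts a statement about power
  sums into the bound 3 for all degrees.\<close>

lemma dm_cube:
  fixes k :: int
  assumes "-1 \<le> k"
  shows "0 \<le> k ^ 3 - k" "k ^ 3 - k = 0 \<longleftrightarrow> k \<le> 1"
proof -
  have f: "k ^ 3 - k = (k + 1) * k * (k - 1)" by (simp add: algebra_simps eval_nat_numeral)
  consider "k = -1" | "k = 0" | "k = 1" | "k \<ge> 2" using assms by linarith
  then have "0 \<le> k ^ 3 - k \<and> (k ^ 3 - k = 0 \<longleftrightarrow> k \<le> 1)" unfolding f by cases auto
  then show "0 \<le> k ^ 3 - k" "k ^ 3 - k = 0 \<longleftrightarrow> k \<le> 1" by blast+
qed

lemma dm_cases:
  assumes "rtree par V" "V \<noteq> {}" "deg par V w \<le> 3" "w \<in> verts V"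
  shows "dm par V w = -1 \<and> deg par V w = 1 \<or> dm par V w = 0 \<and> deg par V w = 2 \<or> dm par V w = 1 \<and> deg par V w = 3"
  using deg_pos[OF assms(1,2,4)] assms(3) by (auto simp: dm_def)

lemma degree_counts:
  assumes T: "rtree par V" "V \<noteq> {}" and d: "\<forall>w\<in>verts V. deg par V w \<le> 3"
  shows "2 * int (card {w\<in>verts V. deg par V w = 1}) = power_sum_dm par V 2 + 2"
    and "2 * int (card {w\<in>verts V. deg par V w = 3}) = power_sum_dm par V 2 - 2"
proof -
  have fin: "finite (verts V)" using rtree_finite[OF T(1)] by simp
  have c: "int (card {w\<in>verts V. P w}) = (\<Sum>w\<in>verts V. of_bool (P w))" for P
    using sum.inter_filter[OF fin, of "\<lambda>_. 1::int" P] by (simp add: of_bool_def)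
  have "2 * int (card {w\<in>verts V. deg par V w = 1}) = (\<Sum>w\<in>verts V. (dm par V w)\<^sup>2 - dm par V w)"
    unfolding c sum_distrib_left
  proof (rule sum.cong[OF refl])
    fix w assume "w \<in> verts V"
    from dm_cases[OF T bspec[OF d this] this] show "2 * of_bool (deg par V w = 1) = (dm par V w)\<^sup>2 - dm par V w"
      by (elim disjE conjE) simp_all
  qed
  then show "2 * int (card {w\<in>verts V. deg par V w = 1}) = power_sum_dm par V 2 + 2"
    unfolding sum_subtractf sum_dm[OF T(1)] by (simp add: power_sum_dm_def)
  have "2 * int (card {w\<in>verts V. deg par V w = 3}) = (\<Sum>w\<in>verts V. (dm par V w)\<^sup>2 + dm par V w)"
    unfolding c sum_distrib_left
  proof (rule sum.cong[OF refl])
    fix w assume "w \<in> verts V"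
    from dm_cases[OF T bspec[OF d this] this] show "2 * of_bool (deg par V w = 3) = (dm par V w)\<^sup>2 + dm par V w"
      by (elim disjE conjE) simp_all
  qed
  then show "2 * int (card {w\<in>verts V. deg par V w = 3}) = power_sum_dm par V 2 - 2"
    unfolding sum.distrib sum_dm[OF T(1)] by (simp add: power_sum_dm_def)
qed

lemma prod_degrees:
  fixes x :: "'a::comm_ring_1"
  assumes T: "rtree par V" "V \<noteq> {}" and d: "\<forall>w\<in>verts V. deg par V w \<le> 3"
  shows "(\<Prod>w\<in>verts V. 1 + x * of_int (dm par V w)) =
    (1 - x) ^ card {w\<in>verts V. deg par V w = 1} * (1 + x) ^ card {w\<in>verts V. deg par V w = 3}"
proof -
  have fin: "finite (verts V)" using rtree_finite[OF T(1)] by simp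
  have c: "(\<Prod>w\<in>verts V. if P w then y else 1) = y ^ card {w\<in>verts V. P w}" for P and y :: 'a
    using prod.inter_filter[OF fin, of "\<lambda>_. y" P] by simp
  have "1 + x * of_int (dm par V w) = (if deg par V w = 1 then 1 - x else 1) * (if deg par V w = 3 then 1 + x else 1)"
    if "w \<in> verts V" for w
    using dm_cases[OF T bspec[OF d that] that] by (elim disjE conjE) simp_all
  then have "(\<Prod>w\<in>verts V. 1 + x * of_int (dm par V w)) =
      (\<Prod>w\<in>verts V. (if deg par V w = 1 then 1 - x else 1) * (if deg par V w = 3 then 1 + x else 1))"
    by (rule prod.cong[OF refl])
  then show ?thesis unfolding prod.distrib c .
qed

lemma edge_excess_nonneg:
  assumes T: "rtree par V" and d: "\<forall>w\<in>verts V. deg par V w \<le> 3" and e: "e \<in> V"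
  shows "0 \<le> edge_excess par V e"
proof -
  have ne: "V \<noteq> {}" and e1: "Some e \<in> verts V" using e by auto
  note e2 = rtree_par_in[OF T e]
  from dm_cases[OF T ne bspec[OF d e1] e1] dm_cases[OF T ne bspec[OF d e2] e2] show ?thesis
    unfolding edge_excess_def by (elim disjE conjE) simp_all
qed

text \<open>The third power sum bounds the degrees by 3, and the second one then counts them, so the
  factors that depend on degrees agree and cancel. The coefficient of X^4 now compares
  \<open>edge_dm\<close>, and a vanishing sum of nonnegative excesses vanishes termwise.\<close>

lemma good_tree_transfer:
  fixes b :: "'v option \<Rightarrow> real fps" and b' :: "'w option \<Rightarrow> real fps"
  assumes T: "rtree par V" "tree_pivots par V b" and T': "rtree par' V'" "tree_pivots par' V' b'" "V' \<noteq> {}"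
    and eq: "(\<Prod>w\<in>verts V. b w) = (\<Prod>w\<in>verts V'. b' w)" and good: "good_tree par V"
  shows "good_tree par' V'"
    and "card {w\<in>verts V'. deg par' V' w = 3} = card {w\<in>verts V. deg par V w = 3}"
proof -
  have fin: "finite (verts V)" "finite (verts V')" "finite V'"
    using rtree_finite[OF T(1)] rtree_finite[OF T'(1)] by auto
  have ne: "V \<noteq> {}" and d: "\<forall>w\<in>verts V. deg par V w \<le> 3" and ex: "\<forall>e\<in>V. edge_excess par V e = 0"
    using good by (auto simp: good_tree_def)
  note ps = pivots_power_sums[OF T T'(1,2) eq]
  have "(\<Sum>w\<in>verts V'. dm par' V' w ^ 3 - dm par' V' w) = (\<Sum>w\<in>verts V. dm par V w ^ 3 - dm par V w)"
    unfolding sum_subtractf sum_dm[OF T(1)] sum_dm[OF T'(1)] using ps(2) by (simp add: power_sum_dm_def)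
  also have "\<dots> = (\<Sum>w\<in>verts V. 0)"
  proof (rule sum.cong[OF refl])
    fix w assume w: "w \<in> verts V"
    from dm_cases[OF T(1) ne bspec[OF d w] w] show "dm par V w ^ 3 - dm par V w = 0" by (elim disjE conjE) simp_all
  qed
  finally have z: "(\<Sum>w\<in>verts V'. dm par' V' w ^ 3 - dm par' V' w) = 0" by simp
  have ge: "-1 \<le> dm par' V' w" if "w \<in> verts V'" for w
    using deg_pos[OF T'(1,3) that] by (simp add: dm_def)
  have "\<forall>w\<in>verts V'. dm par' V' w ^ 3 - dm par' V' w = 0"
    using z sum_nonneg_eq_0_iff[OF fin(2), of "\<lambda>w. dm par' V' w ^ 3 - dm par' V' w"] dm_cube(1)[OF ge] by simp
  then have d': "\<forall>w\<in>verts V'. deg par' V' w \<le> 3" 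
  proof (intro ballI)
    fix w assume w: "w \<in> verts V'"
    then have "dm par' V' w \<le> 1" using dm_cube(2)[OF ge[OF w]] \<open>\<forall>w\<in>verts V'. dm par' V' w ^ 3 - dm par' V' w = 0\<close> by metis
    then show "deg par' V' w \<le> 3" by (simp add: dm_def)
  qed
  note cnt = degree_counts[OF T(1) ne d] degree_counts[OF T'(1,3) d']
  have n: "card {w\<in>verts V'. deg par' V' w = 1} = card {w\<in>verts V. deg par V w = 1}"
    "card {w\<in>verts V'. deg par' V' w = 3} = card {w\<in>verts V. deg par V w = 3}"
    using cnt ps(1) by linarith+
  then show "card {w\<in>verts V'. deg par' V' w = 3} = card {w\<in>verts V. deg par V w = 3}" by simp
  let ?x = "fps_X - fps_X\<^sup>2 :: real fps"
  let ?h = "1 - fps_X\<^sup>2 - 2 * fps_X ^ 3 :: real fps"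
  let ?k = "power_sum_dm par V 2"
  define E where "E = (1 - ?x) ^ card {w\<in>verts V. deg par V w = 1} * (1 + ?x) ^ card {w\<in>verts V. deg par V w = 3}"
  have "fcong 5 (\<Prod>w\<in>verts V. b w) (E * (?h - fps_X ^ 4 * of_int (-2 + ?k + edge_dm par V)))"
    using tree_order_4[OF T] unfolding prod_degrees[OF T(1) ne d] E_def power_sum_dm_def .
  moreover have "fcong 5 (\<Prod>w\<in>verts V'. b' w) (E * (?h - fps_X ^ 4 * of_int (-2 + ?k + edge_dm par' V')))"
    using tree_order_4[OF T'(1,2)] unfolding prod_degrees[OF T'(1,3) d'] E_def n ps(1) unfolding power_sum_dm_def .
  ultimately have "fcong 5 ((?h - fps_X ^ 4 * of_int (-2 + ?k + edge_dm par V)) * E)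
      ((?h - fps_X ^ 4 * of_int (-2 + ?k + edge_dm par' V')) * E)"
    unfolding eq mult.commute[of E] by (rule fcong_trans[OF fcong_sym])
  then have "fcong 5 (?h - fps_X ^ 4 * of_int (-2 + ?k + edge_dm par V)) (?h - fps_X ^ 4 * of_int (-2 + ?k + edge_dm par' V'))"
    by (rule fcong_cancel_unit) (simp add: E_def fps_power_zeroth)
  then have h4: "(?h - fps_X ^ 4 * of_int (-2 + ?k + edge_dm par V)) $ 4 = (?h - fps_X ^ 4 * of_int (-2 + ?k + edge_dm par' V')) $ 4"
    by (simp add: fcong_def)
  have n4: "(fps_X ^ 4 * of_int j :: real fps) $ 4 = of_int j" for j
    by (simp add: fps_X_power_mult_nth flip: fps_of_int)
  have "edge_dm par V = edge_dm par' V'" using h4 unfolding fps_sub_nth n4 by simp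
  then have "(\<Sum>e\<in>V'. edge_excess par' V' e) = (\<Sum>e\<in>V. edge_excess par V e)"
    unfolding sum_edge_excess[OF T(1)] sum_edge_excess[OF T'(1)] n by simp
  also have "\<dots> = 0" using ex by simp
  finally have "\<forall>e\<in>V'. edge_excess par' V' e = 0"
    using sum_nonneg_eq_0_iff[OF fin(3), of "edge_excess par' V'"] edge_excess_nonneg[OF T'(1) d'] by simp
  then show "good_tree par' V'" using T'(3) d' by (simp add: good_tree_def)
qed

section \<open>The polynomial of a line graph\<close>

definition qX :: "real poly" where "qX = [:0, 1:]"

text \<open>With A the adjacency matrix of the line graph this is det ((1 + q^2) I + q A). It is
  kept as a polynomial, since degrees and values at roots of unity will be taken.\<close>

definition line_poly :: "('v \<Rightarrow> 'v option) \<Rightarrow> 'v set \<Rightarrow> real poly" where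
  "line_poly par V = sdet V (shifted (\<lambda>e f. qX * gram (ladj par) e f) ((1 - qX)\<^sup>2))"

lemma line_poly_iso:
  assumes "finite V" and b: "bij_betw \<psi> V V'"
    and l: "\<And>e f. e \<in> V \<Longrightarrow> f \<in> V \<Longrightarrow> ladj par' (\<psi> e) (\<psi> f) = ladj par e f"
  shows "line_poly par' V' = line_poly par V"
  unfolding line_poly_def sdet_reindex[OF assms(1) b]
proof (rule sdet_cong[OF refl])
  fix x y assume xy: "x \<in> V" "y \<in> V"
  have "\<psi> x = \<psi> y \<longleftrightarrow> x = y" using b xy by (auto simp: bij_betw_def dest: inj_onD)
  then show "(if \<psi> x = \<psi> y then (1 - qX)\<^sup>2 else 0) + qX * gram (ladj par') (\<psi> x) (\<psi> y) =
      (if x = y then (1 - qX)\<^sup>2 else 0) + qX * gram (ladj par) x y"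
    using l[OF xy] by (simp add: gram_def)
qed

lemma one_minus_X [simp]: "1 - qX \<noteq> 0"
  by (simp add: qX_def one_pCons)

lemma line_poly_tmat:
  assumes "rtree par V"
  shows "(1 - qX)\<^sup>2 * line_poly par V =
    sdet (verts V) (tmat par V (\<lambda>w. (1 - qX)\<^sup>2 + qX * of_nat (deg par V w)) qX)"
proof -
  have "(1 - qX)\<^sup>2 \<noteq> 0" by (intro power_not_zero one_minus_X)
  from sdet_line_graph[OF assms this, of qX] show ?thesis unfolding line_poly_def .
qed

lemma fps_of_poly_qX: "fps_of_poly qX = fps_X"
  unfolding qX_def by (rule fps_of_poly_fps_X)

lemma line_poly_pivots:
  fixes b :: "'v option \<Rightarrow> real fps"
  assumes T: "rtree par V" and b: "tree_pivots par V b"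
  shows "fps_of_poly ((1 - qX)\<^sup>2 * line_poly par V) = (\<Prod>w\<in>verts V. b w)"
proof -
  interpret h: comm_ring_hom "fps_of_poly :: real poly \<Rightarrow> real fps" by (rule fps_of_poly_hom)
  have g: "fps_of_poly (gram R x y) = gram R x y" for R :: "'v \<Rightarrow> 'v \<Rightarrow> bool" and x y
    by (simp add: gram_def hom_distribs)
  have q: "fps_of_poly ((1 - qX)\<^sup>2) = (1 - fps_X)\<^sup>2" by (simp only: hom_distribs h.hom_one fps_of_poly_qX)
  have "fps_of_poly (line_poly par V) = sdet V (shifted (\<lambda>e f. fps_X * gram (ladj par) e f) ((1 - fps_X)\<^sup>2))"
    unfolding line_poly_def sdet_hom[OF fps_of_poly_hom rtree_finite[OF T]]
    by (rule sdet_cong[OF refl]) (simp only: h.hom_add h.hom_mult g fps_of_poly_qX q h.hom_zero if_distrib[of fps_of_poly])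
  then show ?thesis using line_graph_pivots[OF T b] by (simp only: h.hom_mult q)
qed

lemma good_tree_line_poly:
  assumes T: "rtree par V" and T': "rtree par' V'" "V' \<noteq> {}"
    and eq: "line_poly par V = line_poly par' V'" and good: "good_tree par V"
  shows "good_tree par' V'"
    and "card {w\<in>verts V'. deg par' V' w = 3} = card {w\<in>verts V. deg par V w = 3}"
proof -
  obtain b :: "'a option \<Rightarrow> real fps" where b: "tree_pivots par V b" using tree_pivots_exist[OF T] by blast
  obtain b' :: "'b option \<Rightarrow> real fps" where b': "tree_pivots par' V' b'" using tree_pivots_exist[OF T'(1)] by blast
  have "(\<Prod>w\<in>verts V. b w) = (\<Prod>w\<in>verts V'. b' w)"
    using line_poly_pivots[OF T b] line_poly_pivots[OF T'(1) b'] eq by simp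
  from good_tree_transfer[OF T b T'(1) b' T'(2) this good]
  show "good_tree par' V'"
    and "card {w\<in>verts V'. deg par' V' w = 3} = card {w\<in>verts V. deg par V w = 3}" by blast+
qed

lemma cat_line_poly:
  assumes gs: "gs \<noteq> []" "\<forall>g\<in>set gs. 1 \<le> g"
  shows "(1 + qX) ^ (length gs + 2) * ((1 - qX)\<^sup>2 * line_poly cat_par (cat_edges (cat_bits gs))) =
    (1 - qX) * cJ qX (ca qX) (cb qX) gs"
proof -
  interpret h: comm_ring_hom "fps_of_poly :: real poly \<Rightarrow> real fps" by (rule fps_of_poly_hom)
  obtain b :: "(nat \<times> bool) option \<Rightarrow> real fps" where b: "tree_pivots cat_par (cat_edges (cat_bits gs)) b"
    using tree_pivots_exist[OF rtree_cat] by blast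
  have "fps_of_poly ((1 + qX) ^ (length gs + 2) * ((1 - qX)\<^sup>2 * line_poly cat_par (cat_edges (cat_bits gs)))) =
      (1 + fps_X) ^ (length gs + 2) * (\<Prod>w\<in>verts (cat_edges (cat_bits gs)). b w)"
    unfolding h.hom_mult[of "(1 + qX) ^ (length gs + 2)"] line_poly_pivots[OF rtree_cat b]
    by (simp only: hom_distribs h.hom_one fps_of_poly_qX)
  also have "\<dots> = (1 - fps_X) * cJ fps_X (ca fps_X) (cb fps_X) gs" by (rule cat_pivots_cJ[OF gs b])
  also have "\<dots> = fps_of_poly ((1 - qX) * cJ qX (ca qX) (cb qX) gs)"
    by (simp only: h.hom_mult h.hom_minus h.hom_one cJ_hom[OF fps_of_poly_hom] ca_hom[OF fps_of_poly_hom] fps_of_poly_qX)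
  finally show ?thesis by (simp only: fps_of_poly_eq_iff)
qed

lemma cat_line_poly_cJ:
  assumes gs: "gs \<noteq> []" "\<forall>g\<in>set gs. 1 \<le> g" and gs': "gs' \<noteq> []" "\<forall>g\<in>set gs'. 1 \<le> g"
    and len: "length gs = length gs'"
    and eq: "line_poly cat_par (cat_edges (cat_bits gs)) = line_poly cat_par (cat_edges (cat_bits gs'))"
  shows "cJ qX (ca qX) (cb qX) gs = cJ qX (ca qX) (cb qX) gs'" and "XJ gs = XJ gs'"
proof -
  have "(1 - qX) * cJ qX (ca qX) (cb qX) gs = (1 - qX) * cJ qX (ca qX) (cb qX) gs'"
    unfolding cat_line_poly[OF gs, symmetric] cat_line_poly[OF gs', symmetric] len eq ..
  then show J: "cJ qX (ca qX) (cb qX) gs = cJ qX (ca qX) (cb qX) gs'"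
    using one_minus_X by (simp only: mult_cancel_left) blast
  have "XJ hs = fps_of_poly (cJ qX (ca qX) (cb qX) hs)" for hs
    by (simp only: cJ_hom[OF fps_of_poly_hom] ca_hom[OF fps_of_poly_hom] fps_of_poly_qX)
  then show "XJ gs = XJ gs'" using J by simp
qed

section \<open>Pairs of leaves with a common neighbour\<close>

text \<open>Replacing row \<open>a v\<close> leaves the rows of all other pairs untouched, so the
  factors can be extracted one after the other.\<close>

lemma row_pairs_dvd:
  fixes f :: "'v \<Rightarrow> 'v \<Rightarrow> 'a::idom"
  assumes "finite C" and A: "finite A" and ab: "a ` C \<subseteq> A" "b ` C \<subseteq> A" "inj_on a C" "a ` C \<inter> b ` C = {}"
    and row: "\<And>v y. v \<in> C \<Longrightarrow> y \<in> A \<Longrightarrow> f (a v) y = f (b v) y + c * g v y"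
  shows "c ^ card C dvd sdet A f"
  using assms(1) ab row
proof (induction C arbitrary: f rule: finite_induct)
  case (insert v C)
  have ne: "a u \<noteq> a v" "b u \<noteq> a v" if "u \<in> C" for u
  proof -
    show "a u \<noteq> a v" using insert.prems(3) insert.hyps(2) that by (auto simp: inj_on_def)
    have "b u \<in> b ` insert v C" "a v \<in> a ` insert v C" using that by simp_all
    then show "b u \<noteq> a v" using insert.prems(4) by (metis IntI empty_iff)
  qed
  have "a v \<noteq> b v" using insert.prems by auto
  then have 1: "sdet A f = c * sdet A (f(a v := g v))"
    using insert.prems by (intro sdet_row_factor[OF A]) auto
  have "c ^ card C dvd sdet A (f(a v := g v))"
  proof (rule insert.IH)
    show "a ` C \<subseteq> A" "b ` C \<subseteq> A" "inj_on a C" "a ` C \<inter> b ` C = {}" using insert.prems by auto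
    show "(f(a v := g v)) (a u) y = (f(a v := g v)) (b u) y + c * g u y" if "u \<in> C" "y \<in> A" for u y
      using ne[OF that(1)] insert.prems(5)[of u y] that by simp
  qed
  then show ?case using 1 insert.hyps by simp
qed simp

lemma tadj_sym: "tadj par V x y = tadj par V y x"
  by (auto simp: tadj_def)

lemma tadj_in:
  assumes "rtree par V" "tadj par V x y"
  shows "x \<in> verts V \<and> y \<in> verts V \<and> x \<noteq> y"
proof -
  obtain e where e: "e \<in> V" "x = Some e \<and> y = par e \<or> y = Some e \<and> x = par e"
    using assms(2) by (auto simp: tadj_def)
  then show ?thesis using rtree_par_in[OF assms(1) e(1)] par_neq[OF assms(1) e(1)] by auto
qed

definition nbrs :: "('v \<Rightarrow> 'v option) \<Rightarrow> 'v set \<Rightarrow> 'v option \<Rightarrow> 'v option set" where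
  "nbrs par V w = {x. tadj par V w x}"

lemma nbrs_subset: "rtree par V \<Longrightarrow> nbrs par V w \<subseteq> verts V"
  unfolding nbrs_def using tadj_in by blast

lemma card_nbrs:
  assumes T: "rtree par V"
  shows "card (nbrs par V w) = deg par V w"
proof -
  define other where "other e = (if w = Some e then par e else Some e)" for e
  let ?E = "{e\<in>V. w = Some e \<or> w = par e}"
  have inj: "inj_on other ?E"
  proof (rule inj_onI)
    fix e f assume ef: "e \<in> ?E" "f \<in> ?E" "other e = other f"
    show "e = f"
    proof (rule ccontr)
      assume ne: "e \<noteq> f"
      have V: "e \<in> V" "f \<in> V" using ef by simp_all
      consider "w = Some e" "w = par f" | "w = Some f" "w = par e" | "w \<noteq> Some e" "w \<noteq> Some f"
        using ef(1,2) ne by (cases "w = Some e"; cases "w = Some f") auto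
      then show False
      proof cases
        case 1
        then have "par e = Some f" "par f = Some e" using ef(3) ne by (simp_all add: other_def)
        then show False using par_antisym[OF T V] by simp
      next
        case 2
        then have "par f = Some e" "par e = Some f" using ef(3) ne by (simp_all add: other_def)
        then show False using par_antisym[OF T V] by simp
      next
        case 3
        then show False using ef(3) ne by (simp add: other_def)
      qed
    qed
  qed
  have img: "other ` ?E = nbrs par V w"
  proof (rule Set.set_eqI)
    fix x
    show "x \<in> other ` ?E \<longleftrightarrow> x \<in> nbrs par V w"
    proof
      assume "x \<in> other ` ?E"
      then obtain e where "e \<in> ?E" "x = other e" by blast
      then show "x \<in> nbrs par V w" by (auto simp: other_def nbrs_def tadj_def split: if_splits)
    next
      assume "x \<in> nbrs par V w"
      then obtain e where e: "e \<in> V" "w = Some e \<and> x = par e \<or> x = Some e \<and> w = par e"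
        by (auto simp: nbrs_def tadj_def)
      then have "x = other e" using par_neq[OF T e(1)] by (auto simp: other_def)
      then show "x \<in> other ` ?E" using e by blast
    qed
  qed
  have "card (nbrs par V w) = card ?E" unfolding img[symmetric] by (rule card_image[OF inj])
  then show ?thesis by (simp add: deg_def)
qed

lemma leaf_nbrs:
  assumes "rtree par V" "deg par V w = 1" "tadj par V w x"
  shows "nbrs par V w = {x}"
proof -
  have "card (nbrs par V w) = 1" using card_nbrs[OF assms(1)] assms(2) by simp
  then obtain z where "nbrs par V w = {z}" by (rule card_1_singletonE)
  moreover have "x \<in> nbrs par V w" using assms(3) by (simp add: nbrs_def)
  ultimately show ?thesis by auto
qed

text \<open>This is connectedness: both ends of an edge lie in \<open>S\<close> or neither does, so
  every vertex agrees with the root.\<close>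

lemma tree_closed_set:
  assumes T: "rtree par V" and S: "s \<in> S" "s \<in> verts V" and cl: "\<And>x y. x \<in> S \<Longrightarrow> tadj par V x y \<Longrightarrow> y \<in> S"
  shows "verts V \<subseteq> S"
proof -
  obtain r :: "'a option \<Rightarrow> nat" where r: "\<forall>e\<in>V. r (par e) < r (Some e)" using rtree_rank[OF T] by blast
  have iff: "Some e \<in> S \<longleftrightarrow> par e \<in> S" if "e \<in> V" for e
  proof -
    have "tadj par V (Some e) (par e)" "tadj par V (par e) (Some e)" using that by (auto simp: tadj_def)
    then show ?thesis using cl by blast
  qed
  have root: "x \<in> S \<longleftrightarrow> None \<in> S" if "x \<in> verts V" for x
    using that
  proof (induction "r x" arbitrary: x rule: less_induct)
    case less
    show ?case
    proof (cases x)
      case (Some e)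
      then have e: "e \<in> V" using less.prems by auto
      then have "par e \<in> S \<longleftrightarrow> None \<in> S" using r rtree_par_in[OF T e] Some by (intro less.hyps) auto
      then show ?thesis using iff[OF e] Some by simp
    qed simp
  qed
  then show ?thesis using S by blast
qed

text \<open>Two leaves at one vertex have the same row outside their own columns, where the leaf's
  diagonal entry 1 - q + q^2 stands; the rows differ by a multiple of this entry.\<close>

lemma cherries_dvd:
  assumes T: "rtree par V" and C: "finite C"
    and ab: "\<And>v. v \<in> C \<Longrightarrow> a v \<noteq> b v \<and> deg par V (a v) = 1 \<and> deg par V (b v) = 1 \<and> tadj par V v (a v) \<and> tadj par V v (b v)"
  shows "(1 - qX + qX\<^sup>2) ^ card C dvd (1 - qX)\<^sup>2 * line_poly par V"
proof -
  define f where "f = tmat par V (\<lambda>w. (1 - qX)\<^sup>2 + qX * of_nat (deg par V w)) qX"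
  have na: "nbrs par V (a v) = {v}" "nbrs par V (b v) = {v}" if "v \<in> C" for v
    using leaf_nbrs[OF T, of "a v" v] leaf_nbrs[OF T, of "b v" v] ab[OF that] tadj_sym[of par V] by auto
  have ta: "tadj par V (a v) y \<longleftrightarrow> y = v" "tadj par V (b v) y \<longleftrightarrow> y = v" if "v \<in> C" for v y
    using na[OF that] by (auto simp: nbrs_def)
  have vn: "v \<noteq> a v" "v \<noteq> b v" if "v \<in> C" for v using ab[OF that] tadj_in[OF T] by blast+
  have c: "(1 - qX)\<^sup>2 + qX * of_nat 1 = 1 - qX + qX\<^sup>2"
    by (simp add: power2_eq_square algebra_simps)
  have row: "f (a v) y = f (b v) y + (1 - qX + qX\<^sup>2) * (of_bool (y = a v) - of_bool (y = b v))"
    if "v \<in> C" for v y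
  proof -
    have d: "deg par V (a v) = 1" "deg par V (b v) = 1" "a v \<noteq> b v" using ab[OF that] by auto
    show ?thesis
      unfolding f_def tmat_def ta[OF that] d c using vn[OF that] d(3)
      by (cases "y = a v"; cases "y = b v"; cases "y = v") auto
  qed
  have disj: "a u \<noteq> b v" if "u \<in> C" "v \<in> C" for u v
  proof
    assume e: "a u = b v"
    then have "u = v" using na[OF that(1)] na[OF that(2)] by auto
    then show False using ab[OF that(1)] e by simp
  qed
  have "(1 - qX + qX\<^sup>2) ^ card C dvd sdet (verts V) f"
  proof (rule row_pairs_dvd[OF C, where a = a and b = b and g = "\<lambda>v y. of_bool (y = a v) - of_bool (y = b v)"])
    show "finite (verts V)" using rtree_finite[OF T] by simp
    have abV: "a v \<in> verts V \<and> b v \<in> verts V" if "v \<in> C" for v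
      using tadj_in[OF T, of v "a v"] tadj_in[OF T, of v "b v"] ab[OF that] by simp
    show "a ` C \<subseteq> verts V" by (rule image_subsetI) (rule conjunct1[OF abV])
    show "b ` C \<subseteq> verts V" by (rule image_subsetI) (rule conjunct2[OF abV])
    show "inj_on a C" using na by (metis inj_onI singleton_inject)
    show "a ` C \<inter> b ` C = {}" using disj by blast
  qed (rule row)
  then show ?thesis using line_poly_tmat[OF T] unfolding f_def by simp
qed

text \<open>\<open>w\<close> has order 6, so its square has order 3.\<close>

lemma root_of_unity_power:
  fixes w :: complex
  assumes w: "w\<^sup>2 = w - 1" and g: "g mod 3 \<noteq> 0"
  shows "w ^ (2 * g) \<noteq> 1"
proof
  assume a: "w ^ (2 * g) = 1"
  have w3: "w ^ 3 = -1"
  proof -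
    have "w ^ 3 = w * w\<^sup>2" by (simp add: eval_nat_numeral)
    also have "\<dots> = w * (w - 1)" unfolding w ..
    also have "\<dots> = w\<^sup>2 - w" by (simp add: algebra_simps power2_eq_square)
    also have "\<dots> = -1" unfolding w by simp
    finally show ?thesis .
  qed
  have w6: "w ^ 6 = 1" using power_mult[of w 3 2] w3 by simp
  define k where "k = g div 3"
  have "g mod 3 = 1 \<or> g mod 3 = 2" using g by linarith
  then have "g = 3 * k + 1 \<or> g = 3 * k + 2" unfolding k_def using div_mult_mod_eq[of g 3] by linarith
  then consider "2 * g = 6 * k + 2" | "2 * g = 6 * k + 4" by linarith
  then show False
  proof cases
    case 1
    have "w ^ (2 * g) = (w ^ 6) ^ k * w\<^sup>2" unfolding 1 by (simp only: power_add power_mult)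
    then have "w\<^sup>2 = 1" unfolding a w6 by simp
    then have "w = 2" unfolding w by (simp add: algebra_simps)
    then show False using w by simp
  next
    case 2
    have "w ^ 4 = w ^ 3 * w" by (simp add: eval_nat_numeral mult_ac)
    then have "w ^ (2 * g) = (w ^ 6) ^ k * (w ^ 3 * w)" unfolding 2 by (simp only: power_add power_mult)
    then have "1 = - w" unfolding a w6 w3 by simp
    then have "w = -1" by (metis minus_minus)
    then show False using w by simp
  qed
qed

lemma eval_of_real_hom: "comm_ring_hom (\<lambda>p. poly (map_poly complex_of_real p) w)"
proof -
  interpret r: comm_ring_hom complex_of_real by unfold_locales simp_all
  interpret m: map_poly_comm_ring_hom complex_of_real ..
  show ?thesis by unfold_locales (simp_all add: m.hom_mult m.hom_add)
qed

text \<open>The two ends contribute the square of 1 - q + q^2 to \<open>cJ\<close>. Once it is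
  cancelled, a third factor would make the rest vanish at a primitive sixth root of unity, which
  \<open>cJ_nonzero\<close> forbids for gaps not divisible by 3.\<close>

lemma cat_few_cherries:
  assumes gs: "gs \<noteq> []" "\<forall>g\<in>set gs. g mod 3 \<noteq> 0" and k: "3 \<le> k"
  shows "\<not> (1 - qX + qX\<^sup>2) ^ k dvd (1 - qX)\<^sup>2 * line_poly cat_par (cat_edges (cat_bits gs))"
proof
  let ?c = "1 - qX + qX\<^sup>2 :: real poly"
  let ?s = "1 + 2 * qX - qX ^ 3" and ?t = "qX - 2 * qX ^ 3 - qX ^ 4"
  assume "?c ^ k dvd (1 - qX)\<^sup>2 * line_poly cat_par (cat_edges (cat_bits gs))"
  then have "?c ^ 3 dvd (1 - qX)\<^sup>2 * line_poly cat_par (cat_edges (cat_bits gs))"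
    using k by (meson dvd_trans le_imp_power_dvd)
  then obtain R where R: "(1 - qX)\<^sup>2 * line_poly cat_par (cat_edges (cat_bits gs)) = ?c ^ 3 * R" by (rule dvdE)
  have pos: "\<forall>g\<in>set gs. 1 \<le> g" 
  proof
    fix g assume "g \<in> set gs"
    then have "g mod 3 \<noteq> 0" using gs(2) by blast
    then show "1 \<le> g" by (cases g) auto
  qed
  have "(1 + qX) ^ (length gs + 2) * (?c ^ 3 * R) = (1 - qX) * cJ qX (ca qX) (cb qX) gs"
    using cat_line_poly[OF gs(1) pos] unfolding R .
  also have "cJ qX (ca qX) (cb qX) gs = ?c\<^sup>2 * cJ qX ?s ?t gs"
    unfolding ca_factor by (rule cJ_scale)
  finally have "?c\<^sup>2 * ((1 + qX) ^ (length gs + 2) * (?c * R)) = ?c\<^sup>2 * ((1 - qX) * cJ qX ?s ?t gs)"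
    by (simp add: power2_eq_square power3_eq_cube mult_ac)
  moreover have "?c\<^sup>2 \<noteq> 0" by (intro power_not_zero) (simp add: qX_def one_pCons power2_eq_square)
  ultimately have eq: "(1 + qX) ^ (length gs + 2) * (?c * R) = (1 - qX) * cJ qX ?s ?t gs"
    by (simp only: mult_cancel_left) blast
  \<comment> \<open>This is exp (i pi / 3), a root of 1 - q + q^2.\<close>
  define w where "w = Complex (1/2) (sqrt 3 / 2)"
  have w: "w\<^sup>2 = w - 1"
    by (simp add: w_def power2_eq_square complex_eq_iff)
  define h where "h p = poly (map_poly complex_of_real p) w" for p
  have hh: "comm_ring_hom h" unfolding h_def by (rule eval_of_real_hom)
  interpret h: comm_ring_hom h by (rule hh)
  have hX: "h qX = w" by (simp add: h_def qX_def map_poly_pCons)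
  have hc: "h ?c = 0" using w by (simp add: hom_distribs hX)
  have hst: "h ?s = 1 + 2 * w - w ^ 3" "h ?t = w - 2 * w ^ 3 - w ^ 4" by (simp_all add: hom_distribs hX)
  have h0: "h ((1 + qX) ^ (length gs + 2) * (?c * R)) = 0" unfolding h.hom_mult hc by simp
  have "(1 - w) * cJ w (1 + 2 * w - w ^ 3) (w - 2 * w ^ 3 - w ^ 4) gs = h ((1 - qX) * cJ qX ?s ?t gs)"
  proof -
    have "h (1 - qX) = 1 - w" by (simp only: h.hom_minus h.hom_one hX)
    moreover have "h (cJ qX ?s ?t gs) = cJ w (1 + 2 * w - w ^ 3) (w - 2 * w ^ 3 - w ^ 4) gs"
      using cJ_hom[OF hh, of qX ?s ?t gs] unfolding hX hst .
    ultimately show ?thesis by (simp only: h.hom_mult)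
  qed
  also have "\<dots> = 0" unfolding eq[symmetric] h0 ..
  finally have "(1 - w) * cJ w (1 + 2 * w - w ^ 3) (w - 2 * w ^ 3 - w ^ 4) gs = 0" .
  moreover have "1 - w \<noteq> 0" "2 + 2 * w \<noteq> 0" by (simp_all add: w_def complex_eq_iff)
  moreover have "\<forall>g\<in>set gs. w ^ (2 * g) \<noteq> 1" using root_of_unity_power[OF w] gs(2) by blast
  ultimately show False using cJ_nonzero[OF w _ gs(1)] by (metis mult_eq_0_iff)
qed

section \<open>Recognizing caterpillars\<close>

text \<open>An unrooted model of the caterpillar. In contrast to \<open>cat_edges\<close> neither
  end is distinguished, so that reversing the bits is a symmetry.\<close>

definition cat_verts :: "bool list \<Rightarrow> (nat \<times> bool) set" where
  "cat_verts bs = {(i, b). i < length bs \<and> (b \<longrightarrow> bs ! i)}"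

definition cat_adj :: "nat \<times> bool \<Rightarrow> nat \<times> bool \<Rightarrow> bool" where
  "cat_adj s t \<longleftrightarrow> \<not> snd s \<and> \<not> snd t \<and> (fst t = Suc (fst s) \<or> fst s = Suc (fst t)) \<or>
    snd s \<noteq> snd t \<and> fst s = fst t"

definition caterpillar :: "('v \<Rightarrow> 'v option) \<Rightarrow> 'v set \<Rightarrow> bool list \<Rightarrow> bool" where
  "caterpillar par V bs \<longleftrightarrow> (\<exists>\<nu>. bij_betw \<nu> (cat_verts bs) (verts V) \<and>
    (\<forall>s\<in>cat_verts bs. \<forall>t\<in>cat_verts bs. tadj par V (\<nu> s) (\<nu> t) \<longleftrightarrow> cat_adj s t))"

lemma caterpillar_cat:
  assumes "length bs \<ge> 2" "\<not> bs ! 0"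
  shows "caterpillar cat_par (cat_edges bs) bs"
proof -
  define \<nu> where "\<nu> s = (if s = (0, False) then None else Some s)" for s :: "nat \<times> bool"
  have nz: "0 < i" if "bs ! i" for i using that assms(2) by (cases i) auto
  have "bij_betw \<nu> (cat_verts bs) (verts (cat_edges bs))"
  proof (rule bij_betwI')
    fix s t show "\<nu> s = \<nu> t \<longleftrightarrow> s = t" by (auto simp: \<nu>_def)
  next
    fix s assume s: "s \<in> cat_verts bs"
    obtain i b where e: "s = (i, b)" by (cases s)
    show "\<nu> s \<in> verts (cat_edges bs)"
      using s nz[of i] by (cases b) (auto simp: e \<nu>_def cat_verts_def cat_edges_def)
  next
    fix y assume "y \<in> verts (cat_edges bs)"
    then consider "y = None" | i b where "y = Some (i, b)" "(i, b) \<in> cat_edges bs" by auto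
    then show "\<exists>x\<in>cat_verts bs. y = \<nu> x"
    proof cases
      case 1
      then show ?thesis using assms by (intro bexI[of _ "(0, False)"]) (auto simp: \<nu>_def cat_verts_def)
    next
      case 2
      then show ?thesis
        by (intro bexI[of _ "(i, b)"]) (auto simp: \<nu>_def cat_verts_def cat_edges_def split: if_splits)
    qed
  qed
  moreover have "tadj cat_par (cat_edges bs) (\<nu> s) (\<nu> t) \<longleftrightarrow> cat_adj s t"
    if st: "s \<in> cat_verts bs" "t \<in> cat_verts bs" for s t
  proof -
    have e: "(s \<in> cat_edges bs \<and> \<nu> s = Some s \<and> \<nu> t = cat_par s) \<longleftrightarrow>
        s \<noteq> (0, False) \<and> (if snd s then t = (fst s, False) else t = (fst s - 1, False))"
      if st: "s \<in> cat_verts bs" "t \<in> cat_verts bs" for s t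
    proof -
      obtain i b where s: "s = (i, b)" by (cases s)
      obtain j c where t: "t = (j, c)" by (cases t)
      show ?thesis
        using st nz[of i] nz[of j] by (cases b; cases c) (auto simp: s t \<nu>_def cat_verts_def cat_edges_def)
    qed
    have "tadj cat_par (cat_edges bs) (\<nu> s) (\<nu> t) \<longleftrightarrow>
        (s \<in> cat_edges bs \<and> \<nu> s = Some s \<and> \<nu> t = cat_par s) \<or> (t \<in> cat_edges bs \<and> \<nu> t = Some t \<and> \<nu> s = cat_par t)"
      unfolding tadj_def \<nu>_def by auto
    also have "\<dots> \<longleftrightarrow> cat_adj s t"
      unfolding e[OF st] e[OF st(2,1)] using st nz[of "fst s"] nz[of "fst t"]
      by (cases s; cases t) (auto simp: cat_adj_def cat_verts_def)
    finally show ?thesis .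
  qed
  ultimately show ?thesis unfolding caterpillar_def by blast
qed

lemma caterpillar_rev:
  assumes "caterpillar par V bs"
  shows "caterpillar par V (rev bs)"
proof -
  let ?n = "length bs"
  define \<rho> where "\<rho> s = (?n - 1 - fst s, snd s)" for s :: "nat \<times> bool"
  obtain \<nu> where \<nu>: "bij_betw \<nu> (cat_verts bs) (verts V)"
    "\<And>s t. s \<in> cat_verts bs \<Longrightarrow> t \<in> cat_verts bs \<Longrightarrow> tadj par V (\<nu> s) (\<nu> t) \<longleftrightarrow> cat_adj s t"
    using assms unfolding caterpillar_def by blast
  have \<rho>1: "\<rho> s \<in> cat_verts bs" if "s \<in> cat_verts (rev bs)" for s
    using that by (cases s) (auto simp: \<rho>_def cat_verts_def rev_nth)
  have \<rho>2: "\<rho> s \<in> cat_verts (rev bs)" if "s \<in> cat_verts bs" for s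
    using that by (cases s) (auto simp: \<rho>_def cat_verts_def rev_nth)
  have \<rho>\<rho>: "\<rho> (\<rho> s) = s" if "fst s < ?n" for s
    using that by (cases s) (auto simp: \<rho>_def)
  have lt: "fst s < ?n" if "s \<in> cat_verts bs \<or> s \<in> cat_verts (rev bs)" for s
    using that by (auto simp: cat_verts_def)
  have "bij_betw \<rho> (cat_verts (rev bs)) (cat_verts bs)"
    by (rule bij_betw_byWitness[of _ \<rho>]) (use \<rho>1 \<rho>2 \<rho>\<rho> lt in auto)
  then have "bij_betw (\<nu> \<circ> \<rho>) (cat_verts (rev bs)) (verts V)" using \<nu>(1) by (rule bij_betw_trans)
  moreover have "cat_adj (\<rho> s) (\<rho> t) \<longleftrightarrow> cat_adj s t"
    if "s \<in> cat_verts (rev bs)" "t \<in> cat_verts (rev bs)" for s t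
    using lt[of s] lt[of t] that by (auto simp: cat_adj_def \<rho>_def)
  ultimately show ?thesis unfolding caterpillar_def using \<nu>(2) \<rho>1 by (intro exI[of _ "\<nu> \<circ> \<rho>"]) auto
qed

text \<open>An edge is determined by its set of ends, and edges are adjacent in the line graph when
  these sets meet. Mapping end sets by \<open>\<phi>\<close> is therefore compatible with any choice
  of roots.\<close>

lemma tree_line_iso:
  assumes T: "rtree par V" and T': "rtree par' V'" and \<phi>: "bij_betw \<phi> (verts V) (verts V')"
    and adj: "\<And>x y. x \<in> verts V \<Longrightarrow> y \<in> verts V \<Longrightarrow> tadj par' V' (\<phi> x) (\<phi> y) \<longleftrightarrow> tadj par V x y"
  shows "\<exists>\<psi>. bij_betw \<psi> V V' \<and> (\<forall>e\<in>V. \<forall>f\<in>V. ladj par' (\<psi> e) (\<psi> f) = ladj par e f)"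
proof -
  define en where "en e = {Some e, par e}" for e
  define en' where "en' e = {Some e, par' e}" for e
  have inj: "inj_on en V"
  proof (rule inj_onI)
    fix e f assume "e \<in> V" "f \<in> V" "en e = en f"
    then show "e = f" using par_antisym[OF T, of e f] by (auto simp: en_def doubleton_eq_iff)
  qed
  have inj': "inj_on en' V'"
  proof (rule inj_onI)
    fix e f assume "e \<in> V'" "f \<in> V'" "en' e = en' f"
    then show "e = f" using par_antisym[OF T', of e f] by (auto simp: en'_def doubleton_eq_iff)
  qed
  have ta: "tadj par V x y \<longleftrightarrow> {x, y} \<in> en ` V" for x y
    by (auto simp: tadj_def en_def image_iff doubleton_eq_iff)
  have ta': "tadj par' V' x y \<longleftrightarrow> {x, y} \<in> en' ` V'" for x y
    by (auto simp: tadj_def en'_def image_iff doubleton_eq_iff)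
  have sub: "en e \<subseteq> verts V" if "e \<in> V" for e using rtree_par_in[OF T that] that by (auto simp: en_def)
  have sub': "en' e \<subseteq> verts V'" if "e \<in> V'" for e using rtree_par_in[OF T' that] that by (auto simp: en'_def)
  have \<phi>inj: "inj_on \<phi> (verts V)" using \<phi> by (rule bij_betw_imp_inj_on)
  have img: "(\<lambda>S. \<phi> ` S) ` (en ` V) = en' ` V'"
  proof (rule Set.set_eqI)
    fix S
    show "S \<in> (\<lambda>S. \<phi> ` S) ` (en ` V) \<longleftrightarrow> S \<in> en' ` V'"
    proof
      assume "S \<in> (\<lambda>S. \<phi> ` S) ` (en ` V)"
      then obtain e where e: "e \<in> V" "S = {\<phi> (Some e), \<phi> (par e)}" by (auto simp: en_def)
      have "tadj par V (Some e) (par e)" using e(1) by (auto simp: tadj_def)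
      then have "tadj par' V' (\<phi> (Some e)) (\<phi> (par e))" using adj e(1) rtree_par_in[OF T e(1)] by auto
      then show "S \<in> en' ` V'" unfolding ta' e(2) .
    next
      assume "S \<in> en' ` V'"
      then obtain e where e: "e \<in> V'" "S = {Some e, par' e}" by (auto simp: en'_def)
      have "Some e \<in> \<phi> ` verts V" "par' e \<in> \<phi> ` verts V"
        using \<phi> e(1) rtree_par_in[OF T' e(1)] by (auto simp: bij_betw_def)
      then obtain x y where xy: "x \<in> verts V" "y \<in> verts V" "Some e = \<phi> x" "par' e = \<phi> y" by blast
      have "tadj par' V' (Some e) (par' e)" using e(1) by (auto simp: tadj_def)
      then have "tadj par V x y" using adj[OF xy(1,2)] xy(3,4) by simp
      then have "{x, y} \<in> en ` V" unfolding ta .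
      moreover have "S = \<phi> ` {x, y}" using e(2) xy by simp
      ultimately show "S \<in> (\<lambda>S. \<phi> ` S) ` (en ` V)" by blast
    qed
  qed
  have "inj_on (\<lambda>S. \<phi> ` S) (en ` V)"
    by (rule inj_on_image) (rule inj_on_subset[OF \<phi>inj], use sub in blast)
  then have b2: "bij_betw (\<lambda>S. \<phi> ` S) (en ` V) (en' ` V')" using img by (simp add: bij_betw_def)
  have b1: "bij_betw en V (en ` V)" using inj by (simp add: bij_betw_def)
  have b3: "bij_betw en' V' (en' ` V')" using inj' by (simp add: bij_betw_def)
  define \<psi> where "\<psi> = inv_into V' en' \<circ> ((\<lambda>S. \<phi> ` S) \<circ> en)"
  have \<psi>: "bij_betw \<psi> V V'"
    unfolding \<psi>_def by (rule bij_betw_trans[OF bij_betw_trans[OF b1 b2] bij_betw_inv_into[OF b3]])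
  have en\<psi>: "en' (\<psi> e) = \<phi> ` en e" if "e \<in> V" for e
  proof -
    have "\<phi> ` en e \<in> en' ` V'" using img that by blast
    then show ?thesis by (simp add: \<psi>_def f_inv_into_f)
  qed
  have l: "ladj par e f \<longleftrightarrow> e \<noteq> f \<and> en e \<inter> en f \<noteq> {}" for e f
    by (auto simp: ladj_def en_def)
  have l': "ladj par' e f \<longleftrightarrow> e \<noteq> f \<and> en' e \<inter> en' f \<noteq> {}" for e f
    by (auto simp: ladj_def en'_def)
  have "ladj par' (\<psi> e) (\<psi> f) = ladj par e f" if ef: "e \<in> V" "f \<in> V" for e f
  proof -
    have "\<psi> e = \<psi> f \<longleftrightarrow> e = f" using \<psi> ef by (auto simp: bij_betw_def dest: inj_onD)
    moreover have "en' (\<psi> e) \<inter> en' (\<psi> f) = \<phi> ` (en e \<inter> en f)"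
      unfolding en\<psi>[OF ef(1)] en\<psi>[OF ef(2)]
      by (rule inj_on_image_Int[OF \<phi>inj sub[OF ef(1)] sub[OF ef(2)], symmetric])
    ultimately show ?thesis unfolding l l' by simp
  qed
  then show ?thesis using \<psi> by blast
qed

lemma caterpillar_iso:
  assumes T: "rtree par V" "caterpillar par V bs" and T': "rtree par' V'" "caterpillar par' V' bs"
  shows "\<exists>\<psi>. bij_betw \<psi> V V' \<and> (\<forall>e\<in>V. \<forall>f\<in>V. ladj par' (\<psi> e) (\<psi> f) = ladj par e f)"
proof -
  obtain \<nu> where \<nu>: "bij_betw \<nu> (cat_verts bs) (verts V)"
    "\<And>s t. s \<in> cat_verts bs \<Longrightarrow> t \<in> cat_verts bs \<Longrightarrow> tadj par V (\<nu> s) (\<nu> t) \<longleftrightarrow> cat_adj s t"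
    using T(2) unfolding caterpillar_def by blast
  obtain \<mu> where \<mu>: "bij_betw \<mu> (cat_verts bs) (verts V')"
    "\<And>s t. s \<in> cat_verts bs \<Longrightarrow> t \<in> cat_verts bs \<Longrightarrow> tadj par' V' (\<mu> s) (\<mu> t) \<longleftrightarrow> cat_adj s t"
    using T'(2) unfolding caterpillar_def by blast
  let ?i = "inv_into (cat_verts bs) \<nu>"
  have i: "bij_betw ?i (verts V) (cat_verts bs)" by (rule bij_betw_inv_into[OF \<nu>(1)])
  show ?thesis
  proof (rule tree_line_iso[OF T(1) T'(1)])
    show "bij_betw (\<mu> \<circ> ?i) (verts V) (verts V')" by (rule bij_betw_trans[OF i \<mu>(1)])
    show "tadj par' V' ((\<mu> \<circ> ?i) x) ((\<mu> \<circ> ?i) y) \<longleftrightarrow> tadj par V x y" if xy: "x \<in> verts V" "y \<in> verts V" for x y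
    proof -
      have a: "?i x \<in> cat_verts bs" "?i y \<in> cat_verts bs" using bij_betwE[OF i] xy by blast+
      have b: "\<nu> (?i x) = x" "\<nu> (?i y) = y"
        by (rule bij_betw_inv_into_right[OF \<nu>(1) xy(1)], rule bij_betw_inv_into_right[OF \<nu>(1) xy(2)])
      show ?thesis using \<mu>(2)[OF a] \<nu>(2)[OF a] b by simp
    qed
  qed
qed

lemma good_adj:
  assumes T: "rtree par V" and good: "good_tree par V" and xy: "tadj par V x y"
  shows "deg par V x = 1 \<Longrightarrow> deg par V y = 3" and "deg par V x = 3 \<Longrightarrow> deg par V y \<noteq> 3"
proof -
  have ne: "V \<noteq> {}" and d: "\<forall>w\<in>verts V. deg par V w \<le> 3" and ex: "\<forall>e\<in>V. edge_excess par V e = 0"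
    using good by (auto simp: good_tree_def)
  obtain e where e: "e \<in> V" "x = Some e \<and> y = par e \<or> y = Some e \<and> x = par e"
    using xy by (auto simp: tadj_def)
  have v: "Some e \<in> verts V" "par e \<in> verts V" using e(1) rtree_par_in[OF T e(1)] by auto
  have "edge_excess par V e = 0" using ex e(1) by blast
  then have "(deg par V (Some e) = 1 \<longrightarrow> deg par V (par e) = 3) \<and> (deg par V (par e) = 1 \<longrightarrow> deg par V (Some e) = 3) \<and>
      \<not> (deg par V (Some e) = 3 \<and> deg par V (par e) = 3)"
    using dm_cases[OF T ne bspec[OF d v(1)] v(1)] dm_cases[OF T ne bspec[OF d v(2)] v(2)]
    unfolding edge_excess_def by (elim disjE conjE) simp_all
  then show "deg par V x = 1 \<Longrightarrow> deg par V y = 3" and "deg par V x = 3 \<Longrightarrow> deg par V y \<noteq> 3"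
    using e(2) by auto
qed

abbreviation leaves_at :: "('v \<Rightarrow> 'v option) \<Rightarrow> 'v set \<Rightarrow> 'v option \<Rightarrow> 'v option set" where
  "leaves_at par V v \<equiv> {x\<in>nbrs par V v. deg par V x = 1}"

text \<open>There are two more leaves than vertices of degree 3, so that two vertices with two leaves
  each leave exactly one leaf for every other vertex of degree 3.\<close>

lemma leaf_everywhere:
  assumes T: "rtree par V" and good: "good_tree par V" and c3: "card V \<noteq> 3"
    and few: "card {v\<in>verts V. deg par V v = 3 \<and> 2 \<le> card (leaves_at par V v)} \<le> 2"
  shows "\<forall>v\<in>verts V. deg par V v = 3 \<longrightarrow> leaves_at par V v \<noteq> {}"
    and "\<exists>v\<in>verts V. deg par V v = 3 \<and> 2 \<le> card (leaves_at par V v)"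
proof -
  have ne: "V \<noteq> {}" and d: "\<forall>w\<in>verts V. deg par V w \<le> 3" using good by (auto simp: good_tree_def)
  have fin: "finite (verts V)" using rtree_finite[OF T] by simp
  let ?L = "{w\<in>verts V. deg par V w = 1}" and ?D = "{w\<in>verts V. deg par V w = 3}"
  let ?C = "{v\<in>verts V. deg par V v = 3 \<and> 2 \<le> card (leaves_at par V v)}"
  have finn: "finite (nbrs par V v)" for v using nbrs_subset[OF T] fin by (rule finite_subset)
  have L: "?L = (\<Union>v\<in>?D. leaves_at par V v)"
  proof
    show "?L \<subseteq> (\<Union>v\<in>?D. leaves_at par V v)"
    proof
      fix x assume x: "x \<in> ?L"
      then have "card (nbrs par V x) = 1" using card_nbrs[OF T, of x] by simp
      then obtain v where "nbrs par V x = {v}" by (rule card_1_singletonE)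
      then have xv: "tadj par V x v" by (auto simp: nbrs_def)
      then have "deg par V v = 3" using good_adj(1)[OF T good xv] x by simp
      then show "x \<in> (\<Union>v\<in>?D. leaves_at par V v)"
        using xv x tadj_in[OF T xv] tadj_sym[of par V x v] by (intro UN_I[of v]) (auto simp: nbrs_def)
    qed
    show "(\<Union>v\<in>?D. leaves_at par V v) \<subseteq> ?L" using nbrs_subset[OF T] by auto
  qed
  have "card ?L = (\<Sum>v\<in>?D. card (leaves_at par V v))"
    unfolding L
  proof (rule card_UN_disjoint)
    show "\<forall>u\<in>?D. \<forall>v\<in>?D. u \<noteq> v \<longrightarrow> leaves_at par V u \<inter> leaves_at par V v = {}"
    proof (intro ballI impI)
      fix u v :: "'a option" assume uv: "u \<noteq> v"
      have "False" if "x \<in> leaves_at par V u \<inter> leaves_at par V v" for x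
        using leaf_nbrs[OF T, of x u] leaf_nbrs[OF T, of x v] that tadj_sym[of par V] uv by (auto simp: nbrs_def)
      then show "leaves_at par V u \<inter> leaves_at par V v = {}" by blast
    qed
  qed (use fin finn in auto)
  moreover have "card ?L = card ?D + 2" using degree_counts[OF T ne d] by linarith
  ultimately have sum: "(\<Sum>v\<in>?D. card (leaves_at par V v)) = card ?D + 2" by simp
  \<comment> \<open>Three leaves at one vertex would make the tree a star with three edges, contrary
    to \<open>c3\<close>.\<close>
  have le2: "card (leaves_at par V v) \<le> 2" if v: "v \<in> ?D" for v
  proof (rule ccontr)
    assume "\<not> card (leaves_at par V v) \<le> 2"
    then have "card (nbrs par V v) \<le> card (leaves_at par V v)" using card_nbrs[OF T, of v] v by simp
    then have all: "leaves_at par V v = nbrs par V v" using finn[of v] by (intro card_seteq) auto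
    have "verts V \<subseteq> insert v (nbrs par V v)"
    proof (rule tree_closed_set[OF T, of v])
      fix x y assume x: "x \<in> insert v (nbrs par V v)" and xy: "tadj par V x y"
      show "y \<in> insert v (nbrs par V v)"
      proof (cases "x = v")
        case True
        then show ?thesis using xy by (simp add: nbrs_def)
      next
        case False
        then have "x \<in> leaves_at par V v" using x all by auto
        then have "nbrs par V x = {v}" using leaf_nbrs[OF T, of x v] tadj_sym[of par V] by (auto simp: nbrs_def)
        then show ?thesis using xy by (auto simp: nbrs_def)
      qed
    qed (use v in auto)
    then have "verts V = insert v (nbrs par V v)" using nbrs_subset[OF T, of v] v by auto
    moreover have "v \<notin> nbrs par V v" using tadj_in[OF T, of v v] by (auto simp: nbrs_def)
    ultimately have "card (verts V) = 4" using card_nbrs[OF T, of v] v finn[of v] by simp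
    moreover have "card (verts V) = Suc (card V)" using rtree_finite[OF T] by (simp add: card_image)
    ultimately show False using c3 by simp
  qed
  let ?N = "{v\<in>?D. leaves_at par V v \<noteq> {}}"
  \<comment> \<open>With at most two leaves per vertex, the leaves are counted by the vertices
    having one plus the vertices having two. The latter are at most two, so the total
    \<open>card ?D + 2\<close> leaves no vertex of degree 3 without a leaf.\<close>
  have "card (leaves_at par V v) \<le> of_bool (2 \<le> card (leaves_at par V v)) + of_bool (leaves_at par V v \<noteq> {})"
    if "v \<in> ?D" for v
  proof (cases "leaves_at par V v = {}")
    case True
    then show ?thesis unfolding True by simp
  next
    case False
    then show ?thesis using le2[OF that] by simp
  qed
  then have "(\<Sum>v\<in>?D. card (leaves_at par V v)) \<le>
      (\<Sum>v\<in>?D. of_bool (2 \<le> card (leaves_at par V v)) + of_bool (leaves_at par V v \<noteq> {}))"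
    by (rule sum_mono)
  also have "\<dots> = card {v\<in>?D. 2 \<le> card (leaves_at par V v)} + card ?N"
  proof -
    have fD: "finite ?D" using fin by simp
    have "(\<Sum>v\<in>?D. of_bool (P v)) = card {v\<in>?D. P v}" for P
      using sum.inter_filter[OF fD, of "\<lambda>_. 1::nat" P] by (simp add: of_bool_def)
    then show ?thesis unfolding sum.distrib by simp
  qed
  also have "{v\<in>?D. 2 \<le> card (leaves_at par V v)} = ?C" by auto
  finally have le: "card ?D + 2 \<le> card ?C + card ?N" using sum by simp
  have "?N \<subseteq> ?D" "finite ?D" using fin by auto
  then have N: "card ?N \<le> card ?D" by (rule card_mono[rotated])
  have "card ?D \<le> card ?N" using le few by linarith
  then have "?N = ?D" using fin by (intro card_seteq) auto
  then show "\<forall>v\<in>verts V. deg par V v = 3 \<longrightarrow> leaves_at par V v \<noteq> {}" by blast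
  have "card ?C \<noteq> 0" using le N by linarith
  then have "?C \<noteq> {}" by (metis card.empty)
  then show "\<exists>v\<in>verts V. deg par V v = 3 \<and> 2 \<le> card (leaves_at par V v)" by blast
qed

text \<open>An initial piece of the spine, starting at a leaf of a vertex \<open>p 1\<close> with
  two leaves. Each inner vertex is recorded with its complete neighbourhood, which prevents a
  return; \<open>l i\<close> has a meaning only where \<open>p i\<close> has degree 3. For k > 1 the
  degree of \<open>p k\<close> is left open.\<close>

definition walk :: "('v \<Rightarrow> 'v option) \<Rightarrow> 'v set \<Rightarrow> nat \<Rightarrow> (nat \<Rightarrow> 'v option) \<Rightarrow> (nat \<Rightarrow> 'v option) \<Rightarrow> bool" where
  "walk par V k p l \<longleftrightarrow> 1 \<le> k \<and> inj_on p {..k} \<and> deg par V (p 0) = 1 \<and> deg par V (p 1) = 3 \<and>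
    2 \<le> card (leaves_at par V (p 1)) \<and> nbrs par V (p 0) = {p 1} \<and>
    (\<forall>i. 1 \<le> i \<longrightarrow> i < k \<longrightarrow>
      deg par V (p i) = 3 \<and> deg par V (l i) = 1 \<and> nbrs par V (p i) = {p (i - 1), p (Suc i), l i} \<and> l i \<noteq> p (i - 1) \<and> l i \<noteq> p (Suc i) \<or>
      deg par V (p i) = 2 \<and> nbrs par V (p i) = {p (i - 1), p (Suc i)})"

lemma walkD:
  assumes "walk par V k p l"
  shows "1 \<le> k" "inj_on p {..k}" "deg par V (p 0) = 1" "deg par V (p 1) = 3" "2 \<le> card (leaves_at par V (p 1))"
    "nbrs par V (p 0) = {p 1}"
    "\<And>i. 1 \<le> i \<Longrightarrow> i < k \<Longrightarrow>
      deg par V (p i) = 3 \<and> deg par V (l i) = 1 \<and> nbrs par V (p i) = {p (i - 1), p (Suc i), l i} \<and> l i \<noteq> p (i - 1) \<and> l i \<noteq> p (Suc i) \<or>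
      deg par V (p i) = 2 \<and> nbrs par V (p i) = {p (i - 1), p (Suc i)}"
  using assms unfolding walk_def by blast+

lemma walk_last:
  assumes "walk par V k p l"
  shows "p (k - 1) \<in> nbrs par V (p k)"
proof -
  have "p k \<in> nbrs par V (p (k - 1))"
  proof (cases "k = 1")
    case True
    then show ?thesis using walkD(6)[OF assms] by simp
  next
    case False
    then have "1 \<le> k - 1" "k - 1 < k" "Suc (k - 1) = k" using walkD(1)[OF assms] by auto
    then show ?thesis using walkD(7)[OF assms, of "k - 1"] by auto
  qed
  then show ?thesis using tadj_sym[of par V] by (auto simp: nbrs_def)
qed

text \<open>All neighbours of an earlier vertex \<open>p i\<close> are on record, so a return to it
  would make \<open>p k\<close> the leaf \<open>l i\<close>, contrary to its degree.\<close>

lemma walk_fresh: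
  assumes T: "rtree par V" and w: "walk par V k p l" and d: "deg par V (p k) \<noteq> 1"
    and y: "y \<in> nbrs par V (p k)" "y \<noteq> p (k - 1)"
  shows "y \<notin> p ` {..k}"
proof
  assume "y \<in> p ` {..k}"
  then obtain i where i: "i \<le> k" "y = p i" by auto
  have eq: "p a = p b \<longleftrightarrow> a = b" if "a \<le> k" "b \<le> k" for a b
    using walkD(2)[OF w] that by (auto simp: inj_on_def)
  have "i \<noteq> k" using tadj_in[OF T, of "p k" "p k"] y(1) i by (auto simp: nbrs_def)
  moreover have "i \<noteq> k - 1" using y(2) i by auto
  ultimately have ik: "Suc i < k" using i(1) by linarith
  have pk: "p k \<in> nbrs par V (p i)" using y(1) i(2) tadj_sym[of par V] by (auto simp: nbrs_def)
  show False
  proof (cases "i = 0")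
    case True
    then show ?thesis using pk walkD(6)[OF w] eq[of k 1] ik by auto
  next
    case False
    have "p k \<noteq> p (i - 1)" "p k \<noteq> p (Suc i)" using eq[of k "i - 1"] eq[of k "Suc i"] ik by auto
    then have "p k = l i \<and> deg par V (l i) = 1" using walkD(7)[OF w, of i] False ik pk by auto
    then show ?thesis using d by simp
  qed
qed

text \<open>At degree 3 a leaf other than the predecessor is set aside as \<open>l k\<close>, and
  the third neighbour continues the walk. Such a leaf exists at \<open>p 1\<close> because there are
  two, and later on because the predecessor is not a leaf.\<close>

lemma walk_extend:
  assumes T: "rtree par V" and good: "good_tree par V"
    and leaf: "\<forall>v\<in>verts V. deg par V v = 3 \<longrightarrow> leaves_at par V v \<noteq> {}"
    and w: "walk par V k p l" and d: "deg par V (p k) \<noteq> 1"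
  shows "\<exists>p l. walk par V (Suc k) p l"
proof -
  have V: "p k \<in> verts V" "p (k - 1) \<in> nbrs par V (p k)"
    using walk_last[OF w] tadj_in[OF T, of "p k" "p (k - 1)"] by (auto simp: nbrs_def)
  have finn: "finite (nbrs par V v)" for v
    using nbrs_subset[OF T] rtree_finite[OF T] by (meson finite_imageI finite_insert finite_subset)
  have k: "1 \<le> k" by (rule walkD(1)[OF w])
  have dd: "deg par V (p k) = 2 \<or> deg par V (p k) = 3"
    using good d deg_pos[OF T _ V(1)] V(1) unfolding good_tree_def by force
  define step where "step y c = walk par V (Suc k) (p(Suc k := y)) (l(k := c))" for y c
  have step: "step y c" if y: "y \<in> nbrs par V (p k)" "y \<noteq> p (k - 1)"
    and n: "deg par V (p k) = 3 \<and> deg par V c = 1 \<and> nbrs par V (p k) = {p (k - 1), y, c} \<and> c \<noteq> p (k - 1) \<and> c \<noteq> y \<or>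
      deg par V (p k) = 2 \<and> nbrs par V (p k) = {p (k - 1), y}" for y c
  proof -
    let ?p = "p(Suc k := y)" and ?l = "l(k := c)"
    have "y \<notin> p ` {..k}" by (rule walk_fresh[OF T w d y])
    then have "inj_on ?p {..Suc k}"
      using walkD(2)[OF w] by (auto simp: atMost_Suc inj_on_def)
    moreover have "deg par V (?p i) = 3 \<and> deg par V (?l i) = 1 \<and> nbrs par V (?p i) = {?p (i - 1), ?p (Suc i), ?l i} \<and>
        ?l i \<noteq> ?p (i - 1) \<and> ?l i \<noteq> ?p (Suc i) \<or> deg par V (?p i) = 2 \<and> nbrs par V (?p i) = {?p (i - 1), ?p (Suc i)}"
      if i: "1 \<le> i" "i < Suc k" for i
    proof (cases "i = k")
      case True
      have "k - Suc 0 \<noteq> Suc k" by arith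
      then show ?thesis using n k True by simp
    next
      case False
      then have "i < k" using i by simp
      moreover have "i - Suc 0 \<noteq> Suc k" using i(2) by arith
      ultimately show ?thesis using walkD(7)[OF w i(1)] by simp
    qed
    moreover have "?p 0 = p 0" "?p 1 = p 1" using k by auto
    ultimately show ?thesis unfolding step_def walk_def using walkD(3-6)[OF w] by simp
  qed
  have "\<exists>y c. step y c"
    using dd
  proof
    assume d2: "deg par V (p k) = 2"
    then have "card (nbrs par V (p k) - {p (k - 1)}) = 1" using V(2) card_nbrs[OF T, of "p k"] finn[of "p k"] by simp
    then obtain y where "nbrs par V (p k) - {p (k - 1)} = {y}" by (rule card_1_singletonE)
    then have "nbrs par V (p k) = {p (k - 1), y}" "y \<noteq> p (k - 1)" using V(2) by auto
    then show ?thesis using step[of y y] d2 by auto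
  next
    assume d3: "deg par V (p k) = 3"
    have "\<exists>c\<in>leaves_at par V (p k). c \<noteq> p (k - 1)"
    proof (cases "k = 1")
      case True
      show ?thesis
      proof (rule ccontr)
        assume "\<not> ?thesis"
        then have "leaves_at par V (p 1) \<subseteq> {p 0}" using True by auto
        then have "card (leaves_at par V (p 1)) \<le> card {p 0}" by (intro card_mono) auto
        then show False using walkD(5)[OF w] by simp
      qed
    next
      case False
      then have "1 \<le> k - 1" "k - 1 < k" using k by auto
      then have "deg par V (p (k - 1)) \<noteq> 1" using walkD(7)[OF w, of "k - 1"] by auto
      moreover obtain c where c: "c \<in> leaves_at par V (p k)" using bspec[OF leaf V(1)] d3 by blast
      ultimately have "c \<noteq> p (k - 1)" by auto
      then show ?thesis using c by blast
    qed
    then obtain c where c: "c \<in> nbrs par V (p k)" "deg par V c = 1" "c \<noteq> p (k - 1)" by blast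
    have "card (nbrs par V (p k) - {p (k - 1)} - {c}) = 1"
      using V(2) c card_nbrs[OF T, of "p k"] finn[of "p k"] d3 by simp
    then obtain y where "nbrs par V (p k) - {p (k - 1)} - {c} = {y}" by (rule card_1_singletonE)
    then have "nbrs par V (p k) = {p (k - 1), y, c}" "y \<noteq> p (k - 1)" "y \<noteq> c" using V(2) c by auto
    then show ?thesis using step[of y c] d3 c by auto
  qed
  then show ?thesis unfolding step_def by blast
qed

text \<open>If no walk ended in a leaf, walks could be extended forever; an injective walk cannot
  have more vertices than the tree.\<close>

lemma walk_complete:
  assumes T: "rtree par V" and good: "good_tree par V"
    and leaf: "\<forall>v\<in>verts V. deg par V v = 3 \<longrightarrow> leaves_at par V v \<noteq> {}"
    and v: "deg par V v = 3" "2 \<le> card (leaves_at par V v)"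
  shows "\<exists>k p l. walk par V k p l \<and> deg par V (p k) = 1"
proof (rule ccontr)
  assume no: "\<not> ?thesis"
  have "leaves_at par V v \<noteq> {}" using v(2) by (metis card.empty not_numeral_le_zero)
  then obtain a where a: "a \<in> nbrs par V v" "deg par V a = 1" by blast
  then have na: "nbrs par V a = {v}" using leaf_nbrs[OF T, of a v] tadj_sym[of par V] by (auto simp: nbrs_def)
  have av: "a \<noteq> v" using a v by auto
  have "walk par V 1 (\<lambda>i. if i = 0 then a else v) (\<lambda>_. a)"
    unfolding walk_def using a na v av by (auto simp: inj_on_def)
  then have ex: "\<exists>p l. walk par V (Suc k) p l" for k
  proof (induction k)
    case (Suc k)
    then obtain p l where w: "walk par V (Suc k) p l" by blast
    then have "deg par V (p (Suc k)) \<noteq> 1" using no by blast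
    then show ?case by (rule walk_extend[OF T good leaf w])
  qed auto
  obtain p l where w: "walk par V (Suc (card (verts V))) p l" using ex by blast
  have "p i \<in> verts V" if "i \<le> Suc (card (verts V))" for i
  proof (cases "i = 0")
    case True
    then show ?thesis using walkD(6)[OF w] tadj_in[OF T, of "p 0" "p 1"] by (auto simp: nbrs_def)
  next
    case False
    have "p i \<in> nbrs par V (p (i - 1))"
    proof (cases "i = 1")
      case True
      then show ?thesis using walkD(6)[OF w] by simp
    next
      case False
      then have "1 \<le> i - 1" "i - 1 < Suc (card (verts V))" "Suc (i - 1) = i" using \<open>i \<noteq> 0\<close> that by auto
      then show ?thesis using walkD(7)[OF w, of "i - 1"] by auto
    qed
    then show ?thesis using nbrs_subset[OF T] by blast
  qed
  then have "p ` {..Suc (card (verts V))} \<subseteq> verts V" by auto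
  then have "card (p ` {..Suc (card (verts V))}) \<le> card (verts V)"
    using rtree_finite[OF T] by (intro card_mono) auto
  then show False using card_image[OF walkD(2)[OF w]] by simp
qed

text \<open>The walk and its leaves form a set closed under adjacency, hence by connectedness the
  whole tree.\<close>

lemma walk_caterpillar:
  assumes T: "rtree par V" and good: "good_tree par V" and w: "walk par V k p l" and d: "deg par V (p k) = 1"
  defines "bs \<equiv> map (\<lambda>i. deg par V (p i) = 3) [0..<Suc k]"
  shows "caterpillar par V bs" and "2 \<le> k" and "\<not> bs ! 0" "bs ! 1" "\<not> bs ! k" "bs ! (k - 1)" "length bs = Suc k"
    and "\<And>i. Suc i < length bs \<Longrightarrow> \<not> (bs ! i \<and> bs ! Suc i)"
proof -
  note W = walkD[OF w]
  have k1: "k \<noteq> 1" using d W(4) by auto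
  then show k2: "2 \<le> k" using W(1) by simp
  have len: "length bs = Suc k" by (simp add: bs_def)
  then show "length bs = Suc k" .
  have bs: "bs ! i \<longleftrightarrow> deg par V (p i) = 3" if "i \<le> k" for i
    using that unfolding bs_def by (simp del: upt_Suc)
  show "\<not> bs ! 0" "bs ! 1" "\<not> bs ! k" using bs[of 0] bs[of 1] bs[of k] W(1,3,4) d by auto
  have adj: "tadj par V (p i) (p (Suc i))" if "i < k" for i
  proof (cases "i = 0")
    case True
    then show ?thesis using W(6) by (auto simp: nbrs_def)
  next
    case False
    then show ?thesis using W(7)[of i] that by (auto simp: nbrs_def)
  qed
  have nk: "nbrs par V (p k) = {p (k - 1)}"
    using walk_last[OF w] by (intro leaf_nbrs[OF T d]) (simp add: nbrs_def)
  have "deg par V (p (k - 1)) = 3"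
    using walk_last[OF w] by (intro good_adj(1)[OF T good _ d]) (simp add: nbrs_def)
  then show "bs ! (k - 1)" using bs[of "k - 1"] by simp
  show "\<not> (bs ! i \<and> bs ! Suc i)" if "Suc i < length bs" for i
    using bs[of i] bs[of "Suc i"] that good_adj(2)[OF T good adj[of i]] unfolding len by auto
  have inner: "0 < i \<and> i < k" if "i \<le> k" "bs ! i" for i
    using that bs[of i] W(3) d by (cases "i = 0"; cases "i = k") auto
  have in3: "deg par V (p i) = 3" "deg par V (l i) = 1" "nbrs par V (p i) = {p (i - 1), p (Suc i), l i}"
    "l i \<noteq> p (i - 1)" "l i \<noteq> p (Suc i)" if "i \<le> k" "bs ! i" for i
    using W(7)[of i] inner[OF that] bs[OF that(1)] that(2) by auto
  have in2: "nbrs par V (p i) = {p (i - 1), p (Suc i)}" if "0 < i" "i < k" "\<not> bs ! i" for i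
    using W(7)[of i] bs[of i] that by auto
  have nl: "nbrs par V (l i) = {p i}" if "i \<le> k" "bs ! i" for i
  proof (rule leaf_nbrs[OF T in3(2)[OF that]])
    show "tadj par V (l i) (p i)" using in3(3)[OF that] tadj_sym[of par V] by (auto simp: nbrs_def)
  qed
  have peq: "p a = p b \<longleftrightarrow> a = b" if "a \<le> k" "b \<le> k" for a b
    using W(2) that by (auto simp: inj_on_def)
  have leq: "l a = l b \<longleftrightarrow> a = b" if "a \<le> k" "b \<le> k" "bs ! a" "bs ! b" for a b
    using nl[of a] nl[of b] peq[of a b] that by auto
  have lp: "l a \<noteq> p b" if a: "a \<le> k" "bs ! a" and b: "b \<le> k" for a b
  proof
    assume e: "l a = p b"
    have "deg par V (p b) = 1" using in3(2)[OF a] e by simp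
    then have "b = 0 \<or> b = k" using W(7)[of b] b by (cases "b = 0"; cases "b = k") auto
    then show False
    proof
      assume "b = 0"
      then have "p a = p 1" using nl[OF a] e W(6) by auto
      then have "a = 1" using peq[of a 1] a W(1) by simp
      then show False using in3(4)[OF a] e \<open>b = 0\<close> by simp
    next
      assume "b = k"
      then have "p a = p (k - 1)" using nl[OF a] e nk by auto
      then have "a = k - 1" using peq[of a "k - 1"] a by simp
      then show False using in3(5)[OF a] e \<open>b = k\<close> k2 by simp
    qed
  qed
  define \<nu> where "\<nu> s = (if snd s then l (fst s) else p (fst s))" for s
  let ?I = "cat_verts bs"
  have I: "(i, b) \<in> ?I \<longleftrightarrow> i \<le> k \<and> (b \<longrightarrow> bs ! i)" for i b by (auto simp: cat_verts_def len)
  have inj: "\<nu> s = \<nu> t \<longleftrightarrow> s = t" if "s \<in> ?I" "t \<in> ?I" for s t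
  proof -
    obtain i b where s: "s = (i, b)" by (cases s)
    obtain j c where t: "t = (j, c)" by (cases t)
    show ?thesis
      using that peq[of i j] leq[of i j] lp[of i j] lp[of j i] unfolding s t I \<nu>_def by (cases b; cases c) auto
  qed
  have nb: "nbrs par V (\<nu> s) = \<nu> ` {t\<in>?I. cat_adj s t}" if s: "s \<in> ?I" for s
  proof -
    obtain i b where sib: "s = (i, b)" by (cases s)
    have ib: "i \<le> k" "b \<Longrightarrow> bs ! i" using s unfolding sib I by auto
    show ?thesis
    proof (cases b)
      case True
      have "{t\<in>?I. cat_adj s t} = {(i, False)}"
        using ib True by (auto simp: sib cat_adj_def I)
      then show ?thesis using nl[OF ib(1) ib(2)[OF True]] True by (simp add: sib \<nu>_def)
    next
      case False
      consider "i = 0" | "i = k" | "0 < i" "i < k" "bs ! i" | "0 < i" "i < k" "\<not> bs ! i"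
        using ib(1) by linarith
      then show ?thesis
      proof cases
        case 1
        have "{t\<in>?I. cat_adj s t} = {(1, False)}"
          using 1 False \<open>\<not> bs ! 0\<close> W(1) by (auto simp: sib cat_adj_def I)
        then show ?thesis using W(6) 1 False by (simp add: sib \<nu>_def)
      next
        case 2
        have "{t\<in>?I. cat_adj s t} = {(k - 1, False)}"
          using 2 False \<open>\<not> bs ! k\<close> W(1) by (auto simp: sib cat_adj_def I)
        then show ?thesis using nk 2 False by (simp add: sib \<nu>_def)
      next
        case 3
        have "{t\<in>?I. cat_adj s t} = {(i - 1, False), (Suc i, False), (i, True)}"
          using 3 False by (auto simp: sib cat_adj_def I)
        then show ?thesis using in3(3)[OF ib(1) 3(3)] False by (simp add: sib \<nu>_def)
      next
        case 4
        have "{t\<in>?I. cat_adj s t} = {(i - 1, False), (Suc i, False)}"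
          using 4 False by (auto simp: sib cat_adj_def I)
        then show ?thesis using in2[OF 4] False by (simp add: sib \<nu>_def)
      qed
    qed
  qed
  have nbt: "tadj par V (\<nu> s) y \<longleftrightarrow> y \<in> \<nu> ` {t\<in>?I. cat_adj s t}" if "s \<in> ?I" for s y
    using nb[OF that] by (auto simp: nbrs_def)
  have tad: "tadj par V (\<nu> s) (\<nu> t) \<longleftrightarrow> cat_adj s t" if st: "s \<in> ?I" "t \<in> ?I" for s t
  proof
    assume "tadj par V (\<nu> s) (\<nu> t)"
    then obtain t' where t': "t' \<in> ?I" "cat_adj s t'" "\<nu> t = \<nu> t'" unfolding nbt[OF st(1)] by blast
    then have "t = t'" using inj[OF st(2) t'(1)] by simp
    then show "cat_adj s t" using t'(2) by simp
  next
    assume "cat_adj s t"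
    then show "tadj par V (\<nu> s) (\<nu> t)" unfolding nbt[OF st(1)] using st(2) by blast
  qed
  have "p 0 \<in> verts V" using tadj_in[OF T adj[of 0]] W(1) by auto
  moreover have "p 0 = \<nu> (0, False)" "(0, False) \<in> ?I" by (auto simp: \<nu>_def I)
  ultimately have "verts V \<subseteq> \<nu> ` ?I"
    by (intro tree_closed_set[OF T, of "p 0"]) (use nbt in auto)
  moreover have "\<nu> s \<in> verts V" if s: "s \<in> ?I" for s
  proof -
    have "{t\<in>?I. cat_adj s t} \<noteq> {}"
    proof -
      obtain i b where sib: "s = (i, b)" by (cases s)
      have "(if b then (i, False) else if i = 0 then (1, False) else (i - 1, False)) \<in> {t\<in>?I. cat_adj s t}"
        using s W(1) by (auto simp: sib cat_adj_def I)
      then show ?thesis by blast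
    qed
    then obtain t where "t \<in> ?I" "cat_adj s t" by blast
    then have "tadj par V (\<nu> s) (\<nu> t)" using tad s by blast
    then show ?thesis using tadj_in[OF T] by blast
  qed
  ultimately have "bij_betw \<nu> ?I (verts V)" using inj by (auto simp: bij_betw_def inj_on_def)
  then show "caterpillar par V bs" unfolding caterpillar_def using tad by blast
qed

section \<open>Bit lists and gap sequences\<close>

lemma gap_bits_append: "gap_bits (xs @ ys) = gap_bits xs @ gap_bits ys"
  by (simp add: gap_bits_def)

lemma cat_bits_rev: "cat_bits (rev gs) = rev (cat_bits gs)"
proof -
  have "True # gap_bits (rev gs) = rev (gap_bits gs) @ [True]"
  proof (induction gs)
    case (Cons g gs)
    have "True # gap_bits (rev (g # gs)) = (True # gap_bits (rev gs)) @ replicate (g - 1) False @ [True]"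
      by (simp add: gap_bits_append) (simp add: gap_bits_def)
    also have "\<dots> = rev (gap_bits (g # gs)) @ [True]" unfolding Cons by (simp add: gap_bits_def)
    finally show ?case .
  qed (simp add: gap_bits_def)
  then show ?thesis by (simp add: cat_bits_def)
qed

text \<open>Every run up to the next \<open>True\<close> is a gap. As the preceding bit is
  \<open>True\<close>, the run contains a \<open>False\<close>, which makes the gap at least
  2.\<close>

lemma gap_bits_parse:
  assumes "last (True # xs)" "successively (\<lambda>a b. \<not> (a \<and> b)) (True # xs)"
  shows "\<exists>gs. xs = gap_bits gs \<and> (\<forall>g\<in>set gs. 2 \<le> g)"
  using assms
proof (induction "length xs" arbitrary: xs rule: less_induct)
  case less
  show ?case
  proof (cases "xs = []")
    case True
    then show ?thesis by (intro exI[of _ "[]"]) (simp add: gap_bits_def)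
  next
    case False
    then have "last xs" using less.prems(1) by simp
    then have "True \<in> set xs" using False last_in_set[of xs] by simp
    then obtain ys zs where xs: "xs = ys @ True # zs" "True \<notin> set ys" using split_list_first[of True xs] by blast
    have "\<forall>y\<in>set ys. y = False" using xs(2) by (metis (full_types))
    then have ys: "ys = replicate (length ys) False" by (simp add: replicate_length_same)
    have "ys \<noteq> []" using less.prems(2) xs(1) by auto
    have "successively (\<lambda>a b. \<not> (a \<and> b)) ((True # ys) @ (True # zs))" using less.prems(2) xs(1) by simp
    then have "successively (\<lambda>a b. \<not> (a \<and> b)) (True # zs)" unfolding successively_append_iff by blast
    moreover have "last (True # zs)" using less.prems(1) xs(1) by simp
    ultimately obtain gs where gs: "zs = gap_bits gs" "\<forall>g\<in>set gs. 2 \<le> g"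
      using less.hyps[of zs] xs(1) by auto
    have "gap_bits (Suc (length ys) # gs) = replicate (length ys) False @ True # gap_bits gs"
      by (simp add: gap_bits_def)
    then have "xs = gap_bits (Suc (length ys) # gs)" using xs(1) ys gs(1) by simp
    moreover have "2 \<le> Suc (length ys)" using \<open>ys \<noteq> []\<close> by (cases ys) auto
    ultimately show ?thesis using gs(2) by (intro exI[of _ "Suc (length ys) # gs"]) auto
  qed
qed

lemma cat_bits_parse:
  assumes "length bs \<ge> 3" "\<not> bs ! 0" "bs ! 1" "\<not> bs ! (length bs - 1)" "bs ! (length bs - 2)"
    and no: "\<And>i. Suc i < length bs \<Longrightarrow> \<not> (bs ! i \<and> bs ! Suc i)"
  shows "\<exists>gs. bs = cat_bits gs \<and> (\<forall>g\<in>set gs. 2 \<le> g)"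
proof -
  obtain b0 b1 cs where 1: "bs = b0 # b1 # cs" "cs \<noteq> []"
    using assms(1) by (cases bs; cases "tl bs"; cases "tl (tl bs)") auto
  obtain xs b where 2: "cs = xs @ [b]" using 1(2) by (cases cs rule: rev_cases) auto
  have bs: "bs = False # True # xs @ [False]"
    using assms(2,3,4) unfolding 1(1) 2 by (simp add: nth_append)
  have "last (True # xs)"
  proof (cases "xs = []")
    case False
    then show ?thesis using assms(5) unfolding bs by (simp add: nth_append last_conv_nth nth_Cons' split: if_splits)
  qed simp
  moreover have "successively (\<lambda>a b. \<not> (a \<and> b)) bs"
    unfolding successively_conv_nth using no by blast
  then have "successively (\<lambda>a b. \<not> (a \<and> b)) ([False] @ (True # xs) @ [False])" unfolding bs by simp
  then have "successively (\<lambda>a b. \<not> (a \<and> b)) (True # xs)" unfolding successively_append_iff by blast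
  ultimately obtain gs where "xs = gap_bits gs" "\<forall>g\<in>set gs. 2 \<le> g" using gap_bits_parse by blast
  then show ?thesis unfolding bs cat_bits_def by blast
qed

lemma cat_bits_props:
  assumes "\<forall>g\<in>set gs. 2 \<le> g"
  shows "length (cat_bits gs) \<ge> 3" "\<not> cat_bits gs ! 0" "cat_bits gs ! 1"
    "\<not> cat_bits gs ! (length (cat_bits gs) - 1)" "cat_bits gs ! (length (cat_bits gs) - 2)"
    and "Suc i < length (cat_bits gs) \<Longrightarrow> \<not> (cat_bits gs ! i \<and> cat_bits gs ! Suc i)"
    and "length (filter id (cat_bits gs)) = length gs + 1"
proof -
  show "length (cat_bits gs) \<ge> 3" "\<not> cat_bits gs ! 0" "cat_bits gs ! 1"
    "\<not> cat_bits gs ! (length (cat_bits gs) - 1)" by (simp_all add: cat_bits_def nth_append)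
  have last: "last (True # gap_bits gs)" by (induction gs) (auto simp: gap_bits_def split: if_splits)
  have e: "cat_bits gs = (False # (True # gap_bits gs)) @ [False]" by (simp add: cat_bits_def)
  have "cat_bits gs ! (length (cat_bits gs) - 2) = last (True # gap_bits gs)"
    by (cases "gap_bits gs = []") (simp_all add: cat_bits_def nth_append last_conv_nth nth_Cons')
  then show "cat_bits gs ! (length (cat_bits gs) - 2)" using last by simp
  have succ: "successively (\<lambda>a b. \<not> (a \<and> b)) (True # gap_bits gs)"
    using assms
  proof (induction gs)
    case (Cons g gs)
    obtain m where m: "g - 1 = Suc m" using Cons.prems by (cases "g - 1") auto
    have r: "successively (\<lambda>a b. \<not> (a \<and> b)) (replicate n False)" for n
      unfolding successively_conv_nth by simp
    have "True # gap_bits (g # gs) = [True] @ replicate (Suc m) False @ (True # gap_bits gs)"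
      using m by (simp add: gap_bits_def)
    then show ?case using Cons r[of "Suc m"] by (simp only: successively_append_iff) auto
  qed (simp add: gap_bits_def)
  have "successively (\<lambda>a b. \<not> (a \<and> b)) ([False] @ (True # gap_bits gs) @ [False])"
    using succ by (simp only: successively_append_iff) auto
  then have "successively (\<lambda>a b. \<not> (a \<and> b)) (cat_bits gs)" by (simp add: cat_bits_def)
  then show "Suc i < length (cat_bits gs) \<Longrightarrow> \<not> (cat_bits gs ! i \<and> cat_bits gs ! Suc i)"
    unfolding successively_conv_nth by blast
  have "length (filter id (gap_bits gs)) = length gs" by (induction gs) (auto simp: gap_bits_def)
  then show "length (filter id (cat_bits gs)) = length gs + 1" by (simp add: cat_bits_def)
qed

lemma cat_degrees:
  assumes g2: "\<forall>g\<in>set gs. 2 \<le> g"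
  defines "bs \<equiv> cat_bits gs"
  defines "D \<equiv> deg cat_par (cat_edges bs)"
  shows "D None = 1" and "i < length bs \<Longrightarrow> bs ! i \<Longrightarrow> D (Some (i, True)) = 1"
    and "1 \<le> i \<Longrightarrow> i < length bs \<Longrightarrow> D (Some (i, False)) = (if bs ! i then 3 else if Suc i < length bs then 2 else 1)"
proof -
  note P = cat_bits_props[OF g2, folded bs_def]
  have ch: "length bs \<ge> 2" "\<not> bs ! 0" using P(1,2) by auto
  note C = cat_children[OF ch] and DC = deg_children[OF rtree_cat[of bs]]
  show "D None = 1" unfolding D_def DC(1) C(1) by simp
  show "D (Some (i, True)) = 1" if i: "i < length bs" "bs ! i"
  proof -
    have "(i, True) \<in> cat_edges bs" using i by (simp add: cat_edges_def)
    from DC(2)[OF this] show ?thesis unfolding D_def C(3) by simp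
  qed
  show "D (Some (i, False)) = (if bs ! i then 3 else if Suc i < length bs then 2 else 1)" if i: "1 \<le> i" "i < length bs"
  proof -
    have "(i, False) \<in> cat_edges bs" using i by (simp add: cat_edges_def)
    from DC(2)[OF this] have "D (Some (i, False)) = Suc (card ((if Suc i < length bs then {(Suc i, False)} else {}) \<union> (if bs ! i then {(i, True)} else {})))"
      unfolding D_def C(2)[OF i] .
    moreover have "Suc i < length bs" if "bs ! i"
    proof (rule ccontr)
      assume "\<not> Suc i < length bs"
      then have "i = length bs - 1" using i by simp
      then show False using P(4) that by simp
    qed
    ultimately show ?thesis by auto
  qed
qed

text \<open>Gaps of at least 2 keep vertices of degree 3 apart, and the end points of the spine are
  leaves next to vertices of degree 3.\<close>

lemma good_tree_cat:
  assumes g2: "\<forall>g\<in>set gs. 2 \<le> g"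
  shows "good_tree cat_par (cat_edges (cat_bits gs))"
    and "card {w\<in>verts (cat_edges (cat_bits gs)). deg cat_par (cat_edges (cat_bits gs)) w = 3} = length gs + 1"
proof -
  define bs where "bs = cat_bits gs"
  let ?V = "cat_edges bs"
  note P = cat_bits_props[OF g2, folded bs_def] and D = cat_degrees[OF g2, folded bs_def]
  have nz: "1 \<le> i" if "bs ! i" for i using that P(2) by (cases i) auto
  have lt: "Suc i < length bs" if "bs ! i" "i < length bs" for i
  proof (rule ccontr)
    assume "\<not> Suc i < length bs"
    then have "i = length bs - 1" using that by simp
    then show False using P(4) that by simp
  qed
  have le3: "deg cat_par ?V w \<le> 3" if "w \<in> verts ?V" for w
  proof (cases w)
    case (Some e)
    obtain i b where e: "e = (i, b)" by (cases e)
    have "(i, b) \<in> ?V" using that Some e by auto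
    then show ?thesis using D(2,3)[of i] Some e by (cases b) (auto simp: cat_edges_def)
  qed (simp add: D(1))
  have ex0: "edge_excess cat_par ?V e = 0" if e: "e \<in> ?V" for e
  proof -
    obtain i b where ib: "e = (i, b)" by (cases e)
    show ?thesis
    proof (cases b)
      case True
      then have i: "i < length bs" "bs ! i" using e ib by (auto simp: cat_edges_def)
      have "cat_par e = Some (i, False)" using nz[OF i(2)] ib True by simp
      then show ?thesis using D(2)[OF i] D(3)[OF nz[OF i(2)] i(1)] i ib True by (simp add: edge_excess_def dm_def)
    next
      case False
      then have i: "1 \<le> i" "i < length bs" using e ib by (auto simp: cat_edges_def)
      show ?thesis
      proof (cases "i = 1")
        case True
        then show ?thesis using D(1) D(3)[OF i] P(3) ib False by (simp add: edge_excess_def dm_def)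
      next
        case i1: False
        have p: "cat_par e = Some (i - 1, False)" using ib False i i1 by simp
        have j: "1 \<le> i - 1" "i - 1 < length bs" "Suc (i - 1) = i" using i i1 by auto
        have no: "\<not> (bs ! (i - 1) \<and> bs ! i)" using P(6)[of "i - 1"] j i by simp
        show ?thesis
        proof (cases "Suc i < length bs")
          case True
          then show ?thesis using D(3)[OF i] D(3)[OF j(1,2)] j i no p ib False by (auto simp: edge_excess_def dm_def)
        next
          case last: False
          then have "length bs - 1 = i" "length bs - 2 = i - 1" using i by auto
          then have "\<not> bs ! i" "bs ! (i - 1)" using P(4,5) by simp_all
          then show ?thesis using D(3)[OF i] D(3)[OF j(1,2)] last p ib False by (simp add: edge_excess_def dm_def)
        qed
      qed
    qed
  qed
  have "(1, False) \<in> ?V" using P(1) by (simp add: cat_edges_def)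
  then show "good_tree cat_par (cat_edges (cat_bits gs))"
    unfolding good_tree_def bs_def[symmetric] using le3 ex0 by blast
  have "{w\<in>verts ?V. deg cat_par ?V w = 3} = (\<lambda>i. Some (i, False)) ` {i. i < length bs \<and> bs ! i}"
  proof (rule Set.set_eqI)
    fix w
    have mem: "(i, b) \<in> ?V \<longleftrightarrow> i < length bs \<and> (if b then bs ! i else 0 < i)" for i b by (simp add: cat_edges_def)
    show "w \<in> {w\<in>verts ?V. deg cat_par ?V w = 3} \<longleftrightarrow> w \<in> (\<lambda>i. Some (i, False)) ` {i. i < length bs \<and> bs ! i}"
    proof (cases w)
      case (Some e)
      obtain i b where e: "e = (i, b)" by (cases e)
      show ?thesis
        using D(2,3)[of i] nz[of i] Some e by (cases b) (auto simp: mem split: if_splits)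
    qed (auto simp: D(1))
  qed
  then have "card {w\<in>verts ?V. deg cat_par ?V w = 3} = card {i. i < length bs \<and> bs ! i}"
    by (simp add: card_image inj_on_def)
  then show "card {w\<in>verts (cat_edges (cat_bits gs)). deg cat_par (cat_edges (cat_bits gs)) w = 3} = length gs + 1"
    using P(7) unfolding bs_def[symmetric] by (simp add: length_filter_conv_card)
qed

text \<open>A caterpillar can be read from either end, so the gaps are recovered up to reversal. By
  \<open>huge_gap_at_end\<close> the huge gap is first or last, and reversal reduces the second case
  to the first, where \<open>decode_gaps\<close> applies.\<close>

lemma caterpillar_determined:
  assumes w: "w \<noteq> []" "set w \<subseteq> {4, 5}" "last w = 5" and N: "N > 6" "N mod 3 \<noteq> 0" "2 * N > 11 + 2 * sum_list w + 3 * length w"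
    and T: "rtree par V" and card: "card V = card (cat_edges (cat_bits (N # w)))"
    and eq: "line_poly par V = line_poly cat_par (cat_edges (cat_bits (N # w)))"
  shows "\<exists>\<psi>. bij_betw \<psi> V (cat_edges (cat_bits (N # w))) \<and> (\<forall>e\<in>V. \<forall>f\<in>V. ladj cat_par (\<psi> e) (\<psi> f) = ladj par e f)"
proof -
  let ?gs = "N # w"
  have g2: "\<forall>g\<in>set ?gs. 2 \<le> g" and m3: "\<forall>g\<in>set ?gs. g mod 3 \<noteq> 0" using w N by auto
  have pos: "\<forall>g\<in>set gs. 1 \<le> g" if "\<forall>g\<in>set gs. 2 \<le> g" for gs :: "nat list" using that by force
  have cardc: "card (cat_edges (cat_bits gs)) = sum_list gs + length gs + 3" if "\<forall>g\<in>set gs. 2 \<le> g" for gs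
    by (rule card_cat_edges[OF pos[OF that]])
  have c3: "3 < card V" unfolding card cardc[OF g2] by simp
  then have ne: "V \<noteq> {}" by auto
  note good_t = good_tree_line_poly[OF rtree_cat T ne eq[symmetric] good_tree_cat(1)[OF g2]]
  define C where "C = {v\<in>verts V. deg par V v = 3 \<and> 2 \<le> card (leaves_at par V v)}"
  have finV: "finite (verts V)" using rtree_finite[OF T] by simp
  then have finC: "finite C" by (simp add: C_def)
  have "\<exists>ab. fst ab \<noteq> snd ab \<and> deg par V (fst ab) = 1 \<and> deg par V (snd ab) = 1 \<and> tadj par V v (fst ab) \<and> tadj par V v (snd ab)"
    if "v \<in> C" for v
  proof -
    have "2 \<le> card (leaves_at par V v)" using that by (simp add: C_def)
    then obtain S where "S \<subseteq> leaves_at par V v" "card S = 2" by (rule obtain_subset_with_card_n)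
    then obtain a b where "a \<in> leaves_at par V v" "b \<in> leaves_at par V v" "a \<noteq> b" by (auto simp: card_2_iff)
    then show ?thesis by (intro exI[of _ "(a, b)"]) (auto simp: nbrs_def)
  qed
  then obtain ab where ab: "\<And>v. v \<in> C \<Longrightarrow> fst (ab v) \<noteq> snd (ab v) \<and> deg par V (fst (ab v)) = 1 \<and>
      deg par V (snd (ab v)) = 1 \<and> tadj par V v (fst (ab v)) \<and> tadj par V v (snd (ab v))"
    by metis
  have "(1 - qX + qX\<^sup>2) ^ card C dvd (1 - qX)\<^sup>2 * line_poly par V"
    by (rule cherries_dvd[OF T finC, where a = "\<lambda>v. fst (ab v)" and b = "\<lambda>v. snd (ab v)"]) (rule ab)
  then have "card C \<le> 2"
    using cat_few_cherries[of ?gs "card C"] m3 unfolding eq by fastforce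
  then have few: "card {v\<in>verts V. deg par V v = 3 \<and> 2 \<le> card (leaves_at par V v)} \<le> 2" by (simp add: C_def)
  have c3': "card V \<noteq> 3" using c3 by simp
  note lf = leaf_everywhere[OF T good_t(1) c3' few]
  obtain v where v: "deg par V v = 3" "2 \<le> card (leaves_at par V v)" using lf(2) by blast
  obtain k p l where wk: "walk par V k p l" "deg par V (p k) = 1"
    using walk_complete[OF T good_t(1) lf(1) v] by blast
  define bs where "bs = map (\<lambda>i. deg par V (p i) = 3) [0..<Suc k]"
  note B = walk_caterpillar[OF T good_t(1) wk, folded bs_def]
  have kk: "length bs - 1 = k" "length bs - 2 = k - 1" "length bs \<ge> 3" using B(2,7) by auto
  have "\<exists>gs. bs = cat_bits gs \<and> (\<forall>g\<in>set gs. 2 \<le> g)"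
    by (rule cat_bits_parse) (use B kk in auto)
  then obtain gs where gs: "bs = cat_bits gs" "\<forall>g\<in>set gs. 2 \<le> g" by blast
  have key: "\<exists>\<psi>. bij_betw \<psi> V (cat_edges (cat_bits hs)) \<and> (\<forall>e\<in>V. \<forall>f\<in>V. ladj cat_par (\<psi> e) (\<psi> f) = ladj par e f)"
    and lp: "line_poly cat_par (cat_edges (cat_bits hs)) = line_poly cat_par (cat_edges (cat_bits ?gs))"
    and len: "length hs = length ?gs" and sum: "sum_list hs = sum_list ?gs"
    if cp: "caterpillar par V (cat_bits hs)" and h2: "\<forall>g\<in>set hs. 2 \<le> g" for hs
  proof -
    note Q = cat_bits_props[OF h2]
    have "caterpillar cat_par (cat_edges (cat_bits hs)) (cat_bits hs)"
      using Q(1,2) by (intro caterpillar_cat) auto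
    from caterpillar_iso[OF T cp rtree_cat this]
    show key: "\<exists>\<psi>. bij_betw \<psi> V (cat_edges (cat_bits hs)) \<and> (\<forall>e\<in>V. \<forall>f\<in>V. ladj cat_par (\<psi> e) (\<psi> f) = ladj par e f)" .
    then obtain \<psi> where \<psi>: "bij_betw \<psi> V (cat_edges (cat_bits hs))"
      "\<And>e f. e \<in> V \<Longrightarrow> f \<in> V \<Longrightarrow> ladj cat_par (\<psi> e) (\<psi> f) = ladj par e f" by blast
    show lp: "line_poly cat_par (cat_edges (cat_bits hs)) = line_poly cat_par (cat_edges (cat_bits ?gs))"
      using line_poly_iso[OF rtree_finite[OF T] \<psi>] eq by simp
    have "cat_edges (cat_bits hs) \<noteq> {}" using good_tree_cat(1)[OF h2] by (simp add: good_tree_def)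
    from good_tree_line_poly(2)[OF rtree_cat rtree_cat this lp[symmetric] good_tree_cat(1)[OF g2]]
    show len: "length hs = length ?gs" unfolding good_tree_cat(2)[OF g2] good_tree_cat(2)[OF h2] by simp
    have "card V = card (cat_edges (cat_bits hs))" using \<psi>(1) by (rule bij_betw_same_card)
    then show "sum_list hs = sum_list ?gs" using len unfolding card cardc[OF g2] cardc[OF h2] by simp
  qed
  have fin: "?thesis" if cp: "caterpillar par V (cat_bits hs)" and h2: "\<forall>g\<in>set hs. 2 \<le> g" and hd: "hd hs = N" for hs
  proof -
    have "hs \<noteq> []" using len[OF cp h2] by auto
    then obtain w' where hs: "hs = N # w'" using hd by (cases hs) auto
    have "cJ qX (ca qX) (cb qX) (N # w) = cJ qX (ca qX) (cb qX) (N # w')"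
      using cat_line_poly_cJ(1)[OF _ pos[OF h2] _ pos[OF g2] len[OF cp h2] lp[OF cp h2]] unfolding hs by simp
    from decode_gaps[folded qX_def, OF this] have "w = w'"
      using len[OF cp h2] sum[OF cp h2] pos[OF g2] pos[OF h2] N(3) unfolding hs by auto
    then show ?thesis using key[OF cp h2] unfolding hs by simp
  qed
  have cp: "caterpillar par V (cat_bits gs)" using B(1) unfolding gs(1) .
  have "gs \<noteq> []" using len[OF cp gs(2)] by auto
  have "XJ ?gs = XJ gs"
    using cat_line_poly_cJ(2)[OF \<open>gs \<noteq> []\<close> pos[OF gs(2)] _ pos[OF g2] len[OF cp gs(2)] lp[OF cp gs(2)]] by simp
  then have "hd gs = N \<or> last gs = N"
    by (intro huge_gap_at_end[OF w N(1) len[OF cp gs(2)] sum[OF cp gs(2)] gs(2)])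
  then show ?thesis
  proof
    assume "hd gs = N"
    then show ?thesis by (rule fin[OF cp gs(2)])
  next
    assume l: "last gs = N"
    show ?thesis
    proof (rule fin)
      show "caterpillar par V (cat_bits (rev gs))" unfolding cat_bits_rev by (rule caterpillar_rev[OF cp])
    qed (use gs(2) l \<open>gs \<noteq> []\<close> in \<open>auto simp: hd_rev\<close>)
  qed
qed

section \<open>Graphs with smallest eigenvalue greater than -2\<close>

text \<open>Extending a Gram representation by one vertex: the projection of the new vector to the span of
  the old ones has norm less than 2.\<close>

lemma gram_extension:
  fixes U :: "'v \<Rightarrow> 'd \<Rightarrow> real"
  assumes V: "finite V" "x \<notin> V" and D: "finite D"
    and gram: "\<And>e f. e \<in> V \<Longrightarrow> f \<in> V \<Longrightarrow> (\<Sum>d\<in>D. U e d * U f d) = gram R e f"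
    and sym: "\<And>e. e \<in> V \<Longrightarrow> R x e = R e x"
    and pd: "posdef (insert x V) (gram R)"
  obtains c h where "\<And>d. h d = (\<Sum>f\<in>V. c f * U f d)"
    "\<And>e. e \<in> V \<Longrightarrow> (\<Sum>d\<in>D. h d * U e d) = of_bool (R x e)"
    "(\<Sum>d\<in>D. (h d)\<^sup>2) < 2"
proof -
  have "posdef V (gram R)" using V by (intro posdef_subset[OF _ _ pd]) auto
  then have "sdet V (gram R) \<noteq> (0::real)" by (rule posdef_sdet_nonzero[OF V(1)])
  then obtain c where c: "\<And>e. e \<in> V \<Longrightarrow> (\<Sum>f\<in>V. gram R e f * c f) = (of_bool (R x e) :: real)"
    using sdet_solve[OF V(1), of "gram R" "\<lambda>e. of_bool (R x e)"] by blast
  define h where "h d = (\<Sum>f\<in>V. c f * U f d)" for d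
  have hU: "(\<Sum>d\<in>D. h d * U e d) = of_bool (R x e)" if "e \<in> V" for e
  proof -
    have "(\<Sum>d\<in>D. h d * U e d) = (\<Sum>d\<in>D. \<Sum>f\<in>V. c f * (U e d * U f d))"
      unfolding h_def sum_distrib_right by (intro sum.cong refl) (simp only: mult_ac)
    also have "\<dots> = (\<Sum>f\<in>V. c f * (\<Sum>d\<in>D. U e d * U f d))"
      unfolding sum_distrib_left by (rule sum.swap)
    also have "\<dots> = (\<Sum>f\<in>V. gram R e f * c f)"
      by (rule sum.cong[OF refl]) (subst gram[OF that], assumption, rule mult.commute)
    finally show ?thesis using c[OF that] by simp
  qed
  define s where "s = (\<Sum>f\<in>V. c f * of_bool (R x f))"
  have norm: "(\<Sum>d\<in>D. (h d)\<^sup>2) = s"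
  proof -
    have "(\<Sum>d\<in>D. (h d)\<^sup>2) = (\<Sum>d\<in>D. \<Sum>f\<in>V. c f * (h d * U f d))"
      unfolding power2_eq_square
      by (rule sum.cong[OF refl], subst (2) h_def) (simp add: sum_distrib_left mult_ac)
    also have "\<dots> = (\<Sum>f\<in>V. c f * (\<Sum>d\<in>D. h d * U f d))"
      unfolding sum_distrib_left by (rule sum.swap)
    also have "\<dots> = s" unfolding s_def by (rule sum.cong[OF refl]) (simp only: hU)
    finally show ?thesis .
  qed
  \<comment> \<open>The form is tested at the difference of the projection and the new vector; its
    value is 2 - s.\<close>
  define c' where "c' = c(x := -1)"
  have c': "c' e = c e" if "e \<in> V" for e using that V(2) by (auto simp: c'_def)
  have gx: "gram R x e = of_bool (R x e)" "gram R e x = of_bool (R x e)" if "e \<in> V" for e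
    using that V(2) sym[OF that] by (auto simp: gram_def)
  have "0 < qform (insert x V) (gram R) c'"
    using pd unfolding posdef_def by (auto simp: c'_def)
  also have "qform (insert x V) (gram R) c' =
      (\<Sum>y\<in>insert x V. c' x * gram R x y * c' y) + (\<Sum>e\<in>V. \<Sum>y\<in>insert x V. c' e * gram R e y * c' y)"
    unfolding qform_def using V by simp
  also have "(\<Sum>y\<in>insert x V. c' x * gram R x y * c' y) = 2 - s"
  proof -
    have "(\<Sum>y\<in>V. c' x * gram R x y * c' y) = (\<Sum>y\<in>V. - (c y * of_bool (R x y)))"
      by (rule sum.cong[OF refl]) (simp add: c' gx, simp add: c'_def)
    then show ?thesis using V by (simp add: s_def sum_negf) (simp add: c'_def gram_def)
  qed
  also have "(\<Sum>e\<in>V. \<Sum>y\<in>insert x V. c' e * gram R e y * c' y) = (\<Sum>e\<in>V. 0)"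
  proof (rule sum.cong[OF refl])
    fix e assume e: "e \<in> V"
    have "(\<Sum>y\<in>V. c' e * gram R e y * c' y) = c e * (\<Sum>y\<in>V. gram R e y * c y)"
      unfolding sum_distrib_left by (rule sum.cong[OF refl]) (simp add: c' e mult.assoc)
    also have "\<dots> = c e * of_bool (R x e)" by (simp only: c[OF e])
    finally show "(\<Sum>y\<in>insert x V. c' e * gram R e y * c' y) = 0"
      using V e by (simp add: gx c') (simp add: c'_def)
  qed
  finally have "s < 2" by simp
  with norm have "(\<Sum>d\<in>D. (h d)\<^sup>2) < 2" by simp
  with hU show ?thesis by (intro that[of h c]) (auto simp: h_def)
qed

text \<open>These are the vectors of squared length below 2 in the dual of a root lattice of type A.
  If k0 coordinates are m and k1 are m + 1, the squared length is k0 k1 / (k0 + k1). With eight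
  coordinates k1 = 3 would still fit, as in the lattice E_8; nine rule this out.\<close>

lemma short_vector_shape:
  fixes z :: "'d \<Rightarrow> real"
  assumes D: "finite D" "card D \<ge> 9"
    and int: "\<And>a b. a \<in> D \<Longrightarrow> b \<in> D \<Longrightarrow> z a - z b \<in> \<int>"
    and sum0: "(\<Sum>a\<in>D. z a) = 0" and norm: "(\<Sum>a\<in>D. (z a)\<^sup>2) < 2"
  obtains \<alpha> \<epsilon> K where "\<epsilon> \<in> {1, -1}" "K \<subseteq> D" "card K \<le> 2"
    "\<And>a. a \<in> D \<Longrightarrow> z a = \<alpha> + \<epsilon> * of_bool (a \<in> K)"
proof -
  have ne: "D \<noteq> {}" using D by auto
  have "Min (z ` D) \<in> z ` D" using D ne by (intro Min_in) auto
  then obtain a0 where a0: "a0 \<in> D" "z a0 = Min (z ` D)" by auto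
  define m where "m = z a0"
  have ge: "z a \<ge> m" if "a \<in> D" for a using that D a0 by (simp add: m_def)
  have le: "z a = m \<or> z a = m + 1" if a: "a \<in> D" for a
  proof -
    obtain k :: int where k: "z a - m = of_int k"
      using int[OF a a0(1)] by (auto simp: m_def elim: Ints_cases)
    \<comment> \<open>Two coordinates that differ by 2 or more have squares with sum at least
      2.\<close>
    have "k < 2"
    proof (rule ccontr)
      assume "\<not> k < 2"
      then have "2 \<le> (of_int k :: real)" by simp
      then have d: "2 \<le> z a - m" using k by simp
      then have "a \<noteq> a0" by (auto simp: m_def)
      then have "(z a)\<^sup>2 + m\<^sup>2 = (\<Sum>b\<in>{a, a0}. (z b)\<^sup>2)" by (simp add: m_def)
      also have "\<dots> \<le> (\<Sum>a\<in>D. (z a)\<^sup>2)" using D a a0 by (intro sum_mono2) auto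
      finally have "2 * ((z a)\<^sup>2 + m\<^sup>2) < 4" using norm by simp
      moreover have "4 \<le> (z a - m)\<^sup>2" using power_mono[OF d, of 2] by simp
      then have "4 \<le> 2 * ((z a)\<^sup>2 + m\<^sup>2)"
      proof (rule order_trans)
        show "(z a - m)\<^sup>2 \<le> 2 * ((z a)\<^sup>2 + m\<^sup>2)"
          using zero_le_power2[of "z a + m"] by (simp add: power2_diff power2_sum)
      qed
      ultimately show False by simp
    qed
    moreover have "k \<ge> 0" using ge[OF a] k by (metis diff_ge_0_iff_ge of_int_0_le_iff)
    ultimately have "k = 0 \<or> k = 1" by linarith
    then show ?thesis using k by auto
  qed
  define K1 where "K1 = {a\<in>D. z a = m + 1}"
  define K0 where "K0 = {a\<in>D. z a = m}"
  have K: "D = K0 \<union> K1" "K0 \<inter> K1 = {}" "finite K0" "finite K1"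
    using le D by (auto simp: K0_def K1_def)
  define k0 k1 where "k0 = real (card K0)" and "k1 = real (card K1)"
  have M: "k0 + k1 \<ge> 9"
  proof -
    have "card D = card K0 + card K1" using K by (simp add: card_Un_disjoint)
    then have "real (card D) = k0 + k1" by (simp add: k0_def k1_def)
    moreover have "real (card D) \<ge> 9" using D by simp
    ultimately show ?thesis by simp
  qed
  have split: "(\<Sum>a\<in>D. f (z a)) = k0 * f m + k1 * f (m + 1)" for f :: "real \<Rightarrow> real"
  proof -
    have "(\<Sum>a\<in>D. f (z a)) = (\<Sum>a\<in>K0. f (z a)) + (\<Sum>a\<in>K1. f (z a))"
      using K by (simp add: sum.union_disjoint)
    also have "(\<Sum>a\<in>K0. f (z a)) = (\<Sum>a\<in>K0. f m)" by (rule sum.cong) (auto simp: K0_def)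
    also have "(\<Sum>a\<in>K1. f (z a)) = (\<Sum>a\<in>K1. f (m + 1))" by (rule sum.cong) (auto simp: K1_def)
    finally show ?thesis by (simp add: k0_def k1_def)
  qed
  have e1: "k0 * m + k1 * (m + 1) = 0" using split[of "\<lambda>t. t"] sum0 by simp
  have e2: "k0 * m\<^sup>2 + k1 * (m + 1)\<^sup>2 < 2" using split[of "\<lambda>t. t\<^sup>2"] norm by simp
  have "k0 * k1 < 2 * (k0 + k1)"
  proof -
    have "(k0 + k1) * (k0 * m\<^sup>2 + k1 * (m + 1)\<^sup>2) = (k0 * m + k1 * (m + 1))\<^sup>2 + k0 * k1"
      by (simp add: power2_eq_square algebra_simps)
    also have "\<dots> = k0 * k1" by (simp add: e1)
    finally have "k0 * k1 = (k0 + k1) * (k0 * m\<^sup>2 + k1 * (m + 1)\<^sup>2)" by simp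
    also have "\<dots> < (k0 + k1) * 2" using M by (intro mult_strict_left_mono e2) simp
    finally show ?thesis by simp
  qed
  have "k0 \<le> 2 \<or> k1 \<le> 2"
  proof (rule ccontr)
    assume "\<not> (k0 \<le> 2 \<or> k1 \<le> 2)"
    then have "3 \<le> k0" "3 \<le> k1" unfolding k0_def k1_def by auto
    \<comment> \<open>Expanded, k0 k1 \<ge> 3 (k0 + k1) - 9, which is at least 2 (k0 + k1) when
      there are nine coordinates or more.\<close>
    then have "0 \<le> (k0 - 3) * (k1 - 3)" by simp
    then show False using \<open>k0 * k1 < 2 * (k0 + k1)\<close> M by (simp add: algebra_simps)
  qed
  then show ?thesis
  proof
    assume "k1 \<le> 2"
    then show ?thesis
      using le by (intro that[of 1 K1 m]) (auto simp: K1_def k1_def)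
  next
    assume "k0 \<le> 2"
    then show ?thesis
      using le by (intro that[of "-1" K0 "m + 1"]) (auto simp: K0_def k0_def)
  qed
qed

definition tree_rep :: "('v \<Rightarrow> 'v \<Rightarrow> bool) \<Rightarrow> ('v \<Rightarrow> 'v option) \<Rightarrow> 'v set \<Rightarrow> bool" where
  "tree_rep R par V \<longleftrightarrow> rtree par V \<and> (\<forall>e\<in>V. \<forall>f\<in>V. e \<noteq> f \<longrightarrow> R e f = ladj par e f)"

text \<open>The second alternative of the classification: integral coordinates generating a lattice of
  type \<open>D\<^sub>n\<close>, whose dual consists of vectors with all coordinates in \<open>\<int>\<close> or all in \<open>\<int> + 1/2\<close>.\<close>

definition D_rep :: "('v \<Rightarrow> 'v \<Rightarrow> bool) \<Rightarrow> ('v \<Rightarrow> 'v \<Rightarrow> int) \<Rightarrow> 'v set \<Rightarrow> bool" where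
  "D_rep R U V \<longleftrightarrow> (\<forall>e\<in>V. \<forall>f\<in>V. (\<Sum>d\<in>V. U e d * U f d) = gram R e f) \<and>
    (\<forall>y::'v \<Rightarrow> real. (\<forall>e\<in>V. (\<Sum>d\<in>V. y d * of_int (U e d)) \<in> \<int>) \<longrightarrow>
      (\<forall>d\<in>V. y d \<in> \<int>) \<or> (\<forall>d\<in>V. y d - 1/2 \<in> \<int>))"

text \<open>A tree is bipartite. Changing signs on one side turns the vectors e_a + e_b of the edges
  into differences, which are roots of type A.\<close>

lemma tree_sign:
  assumes "rtree par V"
  shows "\<exists>s::'v option \<Rightarrow> real. (\<forall>a. s a = 1 \<or> s a = -1) \<and> (\<forall>e\<in>V. s (par e) = - s (Some e))"
  using assms
proof (induction rule: rtree.induct)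
  case rtree_empty
  show ?case by (intro exI[of _ "\<lambda>_. 1"]) auto
next
  case (rtree_insert V v)
  then obtain s :: "'v option \<Rightarrow> real"
    where s: "\<forall>a. s a = 1 \<or> s a = -1" "\<forall>e\<in>V. s (par e) = - s (Some e)" by blast
  have pv: "par e \<noteq> Some v" if "e \<in> insert v V" for e
    using that rtree_par_in[OF rtree_insert(1)] rtree_insert(2,3) by fastforce
  define s' where "s' = s(Some v := - s (par v))"
  have "s' a = 1 \<or> s' a = -1" for a
    using spec[OF s(1), of a] spec[OF s(1), of "par v"] by (auto simp: s'_def)
  moreover have "s' (par e) = - s' (Some e)" if e: "e \<in> insert v V" for e
    using pv[OF e] s(2) e rtree_insert(2) by (auto simp: s'_def)
  ultimately show ?case by blast
qed

lemma tree_differences: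
  assumes "rtree par V" "\<And>e. e \<in> V \<Longrightarrow> z (Some e) - z (par e) \<in> \<int>" "a \<in> verts V" "b \<in> verts V"
  shows "z a - z b \<in> (\<int> :: real set)"
proof -
  have "\<forall>a\<in>verts V. z a - z None \<in> \<int>"
    using assms(1,2)
  proof (induction rule: rtree.induct)
    case (rtree_insert V v)
    then have "z (par v) - z None \<in> \<int>" "z (Some v) - z (par v) \<in> \<int>" by auto
    then have "z (Some v) - z None \<in> \<int>" using Ints_add by fastforce
    then show ?case using rtree_insert by auto
  qed simp
  then have "z a - z None \<in> \<int>" "z b - z None \<in> \<int>" using assms(3,4) by blast+
  then have "(z a - z None) - (z b - z None) \<in> \<int>" by (rule Ints_diff)
  then show ?thesis by simp
qed

lemma half_integer_of_double: "2 * t \<in> \<int> \<Longrightarrow> t \<in> \<int> \<or> t - 1/2 \<in> (\<int> :: real set)"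
proof -
  assume "2 * t \<in> \<int>"
  then obtain k :: int where k: "2 * t = of_int k" by (auto elim: Ints_cases)
  obtain l where "k = 2 * l \<or> k = 2 * l + 1" by (metis oddE evenE)
  then have "t = of_int l \<or> t - 1/2 = of_int l" using k by auto
  then show ?thesis using Ints_of_int by metis
qed

text \<open>In signed coordinates the projection of the new vector is \<alpha> + \<epsilon> times
  the indicator of \<open>K\<close>, and \<open>x\<close> is adjacent to the edges with exactly one
  end in \<open>K\<close>. If \<open>K\<close> is one vertex, \<open>x\<close> becomes an edge
  attached there; if \<open>K\<close> has two, \<open>x\<close> is represented by a vector with
  entries \<plusminus>1 at both, and the lattice becomes one of type D. The 8 edges provide the 9
  coordinates for \<open>short_vector_shape\<close>.\<close>

lemma tree_rep_extend:
  fixes R :: "'v \<Rightarrow> 'v \<Rightarrow> bool"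
  assumes rep: "tree_rep R par V" and card: "card V \<ge> 8" and x: "x \<notin> V"
    and sym: "\<And>e. e \<in> V \<Longrightarrow> R x e = R e x" and pd: "posdef (insert x V) (gram R)"
    and adj: "\<exists>e\<in>V. R x e"
  shows "(\<exists>par'. tree_rep R par' (insert x V)) \<or> (\<exists>U. D_rep R U (insert x V))"
proof -
  have T: "rtree par V" and lad: "\<And>e f. e \<in> V \<Longrightarrow> f \<in> V \<Longrightarrow> e \<noteq> f \<Longrightarrow> R e f = ladj par e f"
    using rep by (auto simp: tree_rep_def)
  note fin = rtree_finite[OF T]
  have g1: "(\<Sum>a\<in>verts V. inc par a e * inc par a f) = (gram R e f :: 'b::comm_ring_1)" if "e \<in> V" "f \<in> V" for e f
    unfolding gram_ladj[OF T that] using lad[OF that] by (auto simp: gram_def)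
  have finV: "finite (verts V)" using fin by simp
  obtain c h where h: "\<And>a. h a = (\<Sum>f\<in>V. c f * inc par a f)"
    "\<And>e. e \<in> V \<Longrightarrow> (\<Sum>a\<in>verts V. h a * inc par a e) = (of_bool (R x e) :: real)"
    "(\<Sum>a\<in>verts V. (h a)\<^sup>2) < 2"
  proof (rule gram_extension[where U = "\<lambda>e a. inc par a e" and D = "verts V", OF fin x finV g1 sym pd])
    fix c h assume "\<And>a. h a = (\<Sum>f\<in>V. c f * inc par a f)"
      "\<And>e. e \<in> V \<Longrightarrow> (\<Sum>a\<in>verts V. h a * inc par a e) = (of_bool (R x e) :: real)"
      "(\<Sum>a\<in>verts V. (h a)\<^sup>2) < 2"
    then show thesis by (rule that)
  qed assumption+
  obtain s :: "'v option \<Rightarrow> real" where s: "\<And>a. s a = 1 \<or> s a = -1" "\<And>e. e \<in> V \<Longrightarrow> s (par e) = - s (Some e)"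
    using tree_sign[OF T] by blast
  have ss: "s a * s a = 1" "(s a)\<^sup>2 = 1" for a using s(1)[of a] by auto
  have sI: "s a \<in> \<int>" for a using s(1)[of a] by auto
  define z where "z a = s a * h a" for a
  have hsum: "h (Some e) + h (par e) = of_bool (R x e)" if "e \<in> V" for e
    using h(2)[OF that] sum_inc[OF T that, of h] by (simp add: mult.commute)
  have zdiff: "z (Some e) - z (par e) = s (Some e) * of_bool (R x e)" if "e \<in> V" for e
    unfolding hsum[OF that, symmetric] z_def s(2)[OF that] by (simp add: algebra_simps)
  have zint: "z a - z b \<in> \<int>" if "a \<in> verts V" "b \<in> verts V" for a b
    by (rule tree_differences[OF T _ that]) (simp add: zdiff sI)
  have zsum: "(\<Sum>a\<in>verts V. z a) = 0"
  proof -
    have "(\<Sum>a\<in>verts V. z a) = (\<Sum>a\<in>verts V. \<Sum>f\<in>V. c f * (inc par a f * s a))"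
      unfolding z_def h(1) sum_distrib_left by (intro sum.cong refl) (simp only: mult_ac)
    also have "\<dots> = (\<Sum>f\<in>V. c f * (\<Sum>a\<in>verts V. inc par a f * s a))"
      unfolding sum_distrib_left by (rule sum.swap)
    also have "\<dots> = (\<Sum>f\<in>V. 0)"
      by (rule sum.cong[OF refl]) (simp only: sum_inc[OF T] s(2), simp)
    finally show ?thesis by simp
  qed
  have znorm: "(\<Sum>a\<in>verts V. (z a)\<^sup>2) < 2"
    using h(3) by (simp only: z_def power_mult_distrib ss(2) mult_1)
  have cardD: "card (verts V) \<ge> 9" using fin card by (simp add: card_image)
  obtain \<alpha> \<epsilon> K where K: "\<epsilon> \<in> {1, -1::real}" "K \<subseteq> verts V" "card K \<le> 2"
    "\<And>a. a \<in> verts V \<Longrightarrow> z a = \<alpha> + \<epsilon> * of_bool (a \<in> K)"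
  proof (rule short_vector_shape[OF finV cardD zint zsum znorm])
    fix \<alpha> \<epsilon> K assume "\<epsilon> \<in> {1, -1::real}" "K \<subseteq> verts V" "card K \<le> 2"
      "\<And>a. a \<in> verts V \<Longrightarrow> z a = \<alpha> + \<epsilon> * of_bool (a \<in> K)"
    then show thesis by (rule that)
  qed assumption+
  have finK: "finite K" using K(2) fin by (auto intro: finite_subset)
  have RK: "of_bool (R x e) = s (Some e) * \<epsilon> * (of_bool (Some e \<in> K) - of_bool (par e \<in> K))" if "e \<in> V" for e
  proof -
    have "of_bool (R x e) = (s (Some e) * s (Some e)) * of_bool (R x e)" unfolding ss(1) by simp
    also have "\<dots> = s (Some e) * (z (Some e) - z (par e))" unfolding zdiff[OF that] by (rule mult.assoc)
    also have "z (Some e) - z (par e) = \<epsilon> * (of_bool (Some e \<in> K) - of_bool (par e \<in> K))"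
    proof -
      have "Some e \<in> verts V" using that by simp
      then show ?thesis unfolding K(4)[OF \<open>Some e \<in> verts V\<close>] K(4)[OF rtree_par_in[OF T that]]
        by (simp only: right_diff_distrib add_diff_cancel_left)
    qed
    finally show ?thesis by (simp only: mult.assoc)
  qed
  have Riff: "R x e \<longleftrightarrow> (Some e \<in> K) \<noteq> (par e \<in> K)" if "e \<in> V" for e
  proof -
    have "s (Some e) * \<epsilon> \<noteq> 0" using K(1) s(1)[of "Some e"] by auto
    then show ?thesis
      by (cases "R x e"; cases "Some e \<in> K"; cases "par e \<in> K") (use RK[OF that] in simp_all)
  qed
  have "card K \<noteq> 0" using adj Riff finK by auto
  then consider "card K = 1" | "card K = 2" using K(3) by linarith
  then show ?thesis
  proof cases
    case 1
    then obtain v0 where v0: "K = {v0}" by (rule card_1_singletonE)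
    define par' where "par' = par(x := v0)"
    have v0V: "v0 \<in> verts V" using K(2) v0 by auto
    have par': "par' e = par e" if "e \<in> V" for e using that x by (auto simp: par'_def)
    have px: "par' x = v0" by (simp add: par'_def)
    have T': "rtree par' (insert x V)"
      by (rule rtree_insert[OF rtree_cong[OF T par'] x]) (use px v0V in auto)
    have nx: "par e \<noteq> Some x" if "e \<in> V" for e using rtree_par_in[OF T that] x by auto
    have lx: "R x e = ladj par' x e" "ladj par' x e = ladj par' e x" if e: "e \<in> V" for e
      using Riff[OF e] par_neq[OF T e] nx[OF e] e x
      unfolding ladj_def px par'[OF e] v0 by auto
    have "R e f = ladj par' e f" if ef: "e \<in> insert x V" "f \<in> insert x V" "e \<noteq> f" for e f
    proof (cases "e = x \<or> f = x")
      case True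
      then show ?thesis using ef lx sym by auto
    next
      case False
      then have "e \<in> V" "f \<in> V" using ef by auto
      then show ?thesis using lad ef(3) by (simp add: ladj_def par')
    qed
    then have "tree_rep R par' (insert x V)" using T' by (auto simp: tree_rep_def)
    then show ?thesis by blast
  next
    case 2
    \<comment> \<open>\<open>x\<close> serves as the name of the root's coordinate, so that
      coordinates are indexed by \<open>insert x V\<close> and \<open>U\<close> is square.\<close>
    define \<phi> where "\<phi> d = (if d = x then None else Some d)" for d
    have bij: "bij_betw \<phi> (insert x V) (verts V)"
      by (rule bij_betw_byWitness[of _ "\<lambda>a. case a of None \<Rightarrow> x | Some d \<Rightarrow> d"])
         (use x in \<open>auto simp: \<phi>_def split: option.splits\<close>)
    define y :: "'v option \<Rightarrow> int" where "y a = (if a \<in> K then (if s a * \<epsilon> = 1 then 1 else -1) else 0)" for a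
    have yr: "of_int (y a) = s a * \<epsilon> * of_bool (a \<in> K)" for a
      using s(1)[of a] K(1) by (auto simp: y_def)
    define U where "U e d = (if e = x then y (\<phi> d) else inc par (\<phi> d) e)" for e d
    have re: "(\<Sum>d\<in>insert x V. g (\<phi> d)) = (\<Sum>a\<in>verts V. g a)" for g :: "'v option \<Rightarrow> 'c::comm_monoid_add"
      by (rule sum.reindex_bij_betw[OF bij])
    have yy: "(\<Sum>a\<in>verts V. y a * y a) = 2"
    proof -
      have "(\<Sum>a\<in>verts V. y a * y a) = (\<Sum>a\<in>verts V. of_bool (a \<in> K))"
        by (rule sum.cong) (auto simp: y_def)
      also have "\<dots> = (\<Sum>a\<in>K. 1)" using fin K(2)
        by (intro sum.mono_neutral_cong_right) auto
      finally show ?thesis using 2 by simp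
    qed
    have ye: "(\<Sum>a\<in>verts V. inc par a e * y a) = of_bool (R x e)" if e: "e \<in> V" for e
    proof -
      have "(\<Sum>a\<in>verts V. inc par a e * y a) = y (Some e) + y (par e)" by (rule sum_inc[OF T e])
      moreover have "real_of_int (y (Some e) + y (par e)) = real_of_int (of_bool (R x e))"
        using RK[OF e] by (simp add: yr s(2)[OF e] algebra_simps)
      ultimately show ?thesis by (simp only: of_int_eq_iff)
    qed
    have "(\<Sum>d\<in>insert x V. U e d * U f d) = gram R e f" if ef: "e \<in> insert x V" "f \<in> insert x V" for e f
    proof -
      consider "e = x" "f = x" | "e = x" "f \<in> V" | "e \<in> V" "f = x" | "e \<in> V" "f \<in> V" using ef by blast
      then show ?thesis
      proof cases
        case 1
        then show ?thesis using re[of "\<lambda>a. y a * y a"] yy by (simp add: U_def gram_def del: sum.insert)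
      next
        case 2
        then have "f \<noteq> x" using x by auto
        then show ?thesis using re[of "\<lambda>a. inc par a f * y a"] ye[OF 2(2)] 2
          by (simp add: U_def gram_def mult.commute of_bool_def del: sum.insert)
      next
        case 3
        then have "e \<noteq> x" using x by auto
        then show ?thesis using re[of "\<lambda>a. inc par a e * y a"] ye[OF 3(1)] 3 sym[OF 3(1)]
          by (simp add: U_def gram_def of_bool_def del: sum.insert)
      next
        case 4
        then have "e \<noteq> x" "f \<noteq> x" using x by auto
        then have "(\<Sum>d\<in>insert x V. U e d * U f d) = (\<Sum>d\<in>insert x V. (\<lambda>a. inc par a e * inc par a f) (\<phi> d))"
          by (simp add: U_def del: sum.insert)
        also have "\<dots> = (\<Sum>a\<in>verts V. inc par a e * inc par a f)" by (rule re)
        also have "\<dots> = gram R e f" by (rule g1[OF 4])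
        finally show ?thesis .
      qed
    qed
    moreover have "(\<forall>d\<in>insert x V. w d \<in> \<int>) \<or> (\<forall>d\<in>insert x V. w d - 1/2 \<in> \<int>)"
      if w: "\<forall>e\<in>insert x V. (\<Sum>d\<in>insert x V. w d * of_int (U e d)) \<in> \<int>" for w :: "'v \<Rightarrow> real"
    proof -
      define w' where "w' a = (case a of None \<Rightarrow> w x | Some d \<Rightarrow> w d)" for a
      have ww: "w d = w' (\<phi> d)" if "d \<in> insert x V" for d by (simp add: w'_def \<phi>_def)
      define u where "u a = s a * w' a" for a
      have "w' (Some e) + w' (par e) \<in> \<int>" if e: "e \<in> V" for e
      proof -
        have "e \<noteq> x" using e x by auto
        then have "(\<Sum>d\<in>insert x V. w d * of_int (U e d)) = (\<Sum>d\<in>insert x V. inc par (\<phi> d) e * w' (\<phi> d))"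
          by (intro sum.cong refl) (simp add: ww U_def inc_def)
        also have "\<dots> = w' (Some e) + w' (par e)"
          using re[of "\<lambda>a. inc par a e * w' a"] sum_inc[OF T e, of w'] by simp
        finally show ?thesis using w e by auto
      qed
      then have "u (Some e) - u (par e) \<in> \<int>" if "e \<in> V" for e
      proof -
        have "u (Some e) - u (par e) = s (Some e) * (w' (Some e) + w' (par e))"
          by (simp add: u_def s(2)[OF that] algebra_simps)
        then show ?thesis
          using sI \<open>\<And>e. e \<in> V \<Longrightarrow> w' (Some e) + w' (par e) \<in> \<int>\<close>[OF that] by (simp add: Ints_mult)
      qed
      then have ud: "u a - u b \<in> \<int>" if "a \<in> verts V" "b \<in> verts V" for a b
        using tree_differences[OF T _ that] by blast
      \<comment> \<open>Pairing with the edges makes all coordinates of \<open>u\<close> congruent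
        modulo 1; pairing with the new vector makes twice such a coordinate integral.\<close>
      obtain k1 k2 where k: "K = {k1, k2}" "k1 \<noteq> k2" using 2 by (auto simp: card_2_iff)
      have "(\<Sum>a\<in>verts V. w' a * of_int (y a)) = (\<Sum>a\<in>K. \<epsilon> * u a)"
        using fin K(2) by (intro sum.mono_neutral_cong_right) (auto simp: yr u_def)
      also have "\<dots> = \<epsilon> * (u k1 + u k2)" using k by (simp add: algebra_simps)
      finally have eq: "(\<Sum>a\<in>verts V. w' a * of_int (y a)) = \<epsilon> * (u k1 + u k2)" .
      have "(\<Sum>d\<in>insert x V. w d * of_int (U x d)) = (\<Sum>d\<in>insert x V. w' (\<phi> d) * of_int (y (\<phi> d)))"
        by (intro sum.cong refl) (simp add: ww U_def)
      also have "\<dots> = \<epsilon> * (u k1 + u k2)" using re[of "\<lambda>a. w' a * of_int (y a)"] eq by simp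
      finally have "\<epsilon> * (u k1 + u k2) \<in> \<int>" using w by force
      moreover have "\<epsilon> \<in> \<int>" using K(1) by auto
      ultimately have "\<epsilon> * (\<epsilon> * (u k1 + u k2)) \<in> \<int>" by (rule Ints_mult[rotated])
      moreover have "\<epsilon> * (\<epsilon> * c) = c" for c using K(1) by auto
      ultimately have "u k1 + u k2 \<in> \<int>" by (simp only:)
      moreover have "u k1 - u k2 \<in> \<int>" using ud k K(2) by auto
      ultimately have "(u k1 + u k2) + (u k1 - u k2) \<in> \<int>" by (rule Ints_add)
      then have "2 * u k1 \<in> \<int>" by simp
      then have half: "u k1 \<in> \<int> \<or> u k1 - 1/2 \<in> \<int>" by (rule half_integer_of_double)
      have k1V: "k1 \<in> verts V" using k K(2) by auto
      show ?thesis
        using half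
      proof
        assume a: "u k1 \<in> \<int>"
        have "w' a \<in> \<int>" if "a \<in> verts V" for a
        proof -
          have "u a \<in> \<int>" using Ints_add[OF ud[OF that k1V] a] by simp
          then have "s a * u a \<in> \<int>" by (intro Ints_mult sI)
          then show ?thesis using ss(1)[of a] by (simp add: u_def mult.assoc[symmetric])
        qed
        then have "\<forall>d\<in>insert x V. w d \<in> \<int>" using ww bij_betwE[OF bij] by metis
        then show ?thesis by (rule disjI1)
      next
        assume a: "u k1 - 1/2 \<in> \<int>"
        have "w' a - 1/2 \<in> \<int>" if "a \<in> verts V" for a
        proof -
          have ua: "u a - 1/2 \<in> \<int>" using Ints_add[OF ud[OF that k1V] a] by simp
          have "w' a = s a * u a" using ss(1)[of a] by (simp add: u_def mult.assoc[symmetric])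
          then have "w' a = u a \<or> w' a = - u a" using s(1)[of a] by auto
          moreover have "- (u a - 1/2) - 1 = - u a - 1/2" by simp
          then have "- u a - 1/2 \<in> \<int>" using Ints_diff[OF Ints_minus[OF ua] Ints_1] by (simp only:)
          ultimately show ?thesis using ua by auto
        qed
        then have "\<forall>d\<in>insert x V. w d - 1/2 \<in> \<int>" using ww bij_betwE[OF bij] by metis
        then show ?thesis by (rule disjI2)
      qed
    qed
    ultimately have "D_rep R U (insert x V)" by (auto simp: D_rep_def simp del: sum.insert)
    then show ?thesis by blast
  qed
qed

text \<open>The projection \<open>h\<close> pairs integrally with the lattice. Half-integral
  coordinates would give squared length at least 9/4, so \<open>h\<close> is integral, nonzero and
  of squared length below 2, hence a unit vector up to sign. The new vector is \<open>h\<close> plus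
  a unit vector in a new coordinate.\<close>

lemma D_rep_extend:
  fixes R :: "'v \<Rightarrow> 'v \<Rightarrow> bool"
  assumes rep: "D_rep R U V" and card: "card V \<ge> 9" and x: "x \<notin> V"
    and sym: "\<And>e. e \<in> V \<Longrightarrow> R x e = R e x" and pd: "posdef (insert x V) (gram R)"
    and adj: "\<exists>e\<in>V. R x e"
  shows "\<exists>U. D_rep R U (insert x V)"
proof -
  have fin: "finite V" using card by (auto intro: card_ge_0_finite)
  have gram: "(\<Sum>d\<in>V. U e d * U f d) = gram R e f" if "e \<in> V" "f \<in> V" for e f
    using rep that by (auto simp: D_rep_def)
  have dual: "(\<forall>d\<in>V. y d \<in> \<int>) \<or> (\<forall>d\<in>V. y d - 1/2 \<in> \<int>)"
    if "\<forall>e\<in>V. (\<Sum>d\<in>V. y d * of_int (U e d)) \<in> \<int>" for y :: "'v \<Rightarrow> real"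
    using rep that unfolding D_rep_def by blast
  have gramr: "(\<Sum>d\<in>V. real_of_int (U e d) * real_of_int (U f d)) = gram R e f" if "e \<in> V" "f \<in> V" for e f
  proof -
    have "(\<Sum>d\<in>V. real_of_int (U e d) * real_of_int (U f d)) = real_of_int (\<Sum>d\<in>V. U e d * U f d)"
      by simp
    also have "\<dots> = gram R e f" unfolding gram[OF that] by (simp add: gram_def)
    finally show ?thesis .
  qed
  obtain c h where h: "\<And>d. h d = (\<Sum>f\<in>V. c f * real_of_int (U f d))"
    "\<And>e. e \<in> V \<Longrightarrow> (\<Sum>d\<in>V. h d * real_of_int (U e d)) = of_bool (R x e)"
    "(\<Sum>d\<in>V. (h d)\<^sup>2) < 2"
  proof (rule gram_extension[where U = "\<lambda>e d. real_of_int (U e d)" and D = V, OF fin x fin gramr sym pd])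
    fix c h assume "\<And>d. h d = (\<Sum>f\<in>V. c f * real_of_int (U f d))"
      "\<And>e. e \<in> V \<Longrightarrow> (\<Sum>d\<in>V. h d * real_of_int (U e d)) = of_bool (R x e)"
      "(\<Sum>d\<in>V. (h d)\<^sup>2) < 2"
    then show thesis by (rule that)
  qed assumption+
  have "(\<forall>d\<in>V. h d \<in> \<int>) \<or> (\<forall>d\<in>V. h d - 1/2 \<in> \<int>)"
    by (rule dual) (simp add: h(2))
  then have hint: "\<forall>d\<in>V. h d \<in> \<int>"
  proof
    assume a: "\<forall>d\<in>V. h d - 1/2 \<in> \<int>"
    have "1/4 \<le> (h d)\<^sup>2" if d: "d \<in> V" for d
    proof -
      obtain k :: int where k: "h d - 1/2 = of_int k" using a d by (auto elim: Ints_cases)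
      have "0 \<le> k * (k + 1)" by (cases "k \<ge> 0") (auto simp: mult_nonneg_nonneg mult_nonpos_nonpos)
      then have "0 \<le> real_of_int (k * (k + 1))" by (simp only: of_int_0_le_iff)
      moreover have "(h d)\<^sup>2 = real_of_int (k * (k + 1)) + 1/4"
      proof -
        have "h d = of_int k + 1/2" using k by simp
        then show ?thesis by (simp add: power2_eq_square algebra_simps)
      qed
      ultimately show ?thesis by simp
    qed
    then have "(\<Sum>d\<in>V. 1/4) \<le> (\<Sum>d\<in>V. (h d)\<^sup>2)" by (rule sum_mono)
    then have "real (card V) / 4 < 2" using h(3) by simp
    then show ?thesis using card by simp
  qed simp
  define k where "k d = \<lfloor>h d\<rfloor>" for d
  have hk: "h d = of_int (k d)" if "d \<in> V" for d using hint that by (auto simp: k_def elim: Ints_cases)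
  have "real_of_int (\<Sum>d\<in>V. (k d)\<^sup>2) = (\<Sum>d\<in>V. (h d)\<^sup>2)"
    unfolding of_int_sum by (rule sum.cong[OF refl]) (simp add: hk)
  then have "real_of_int (\<Sum>d\<in>V. (k d)\<^sup>2) < real_of_int 2" using h(3) by simp
  then have norm: "(\<Sum>d\<in>V. (k d)\<^sup>2) < 2" by (simp only: of_int_less_iff)
  obtain e0 where e0: "e0 \<in> V" "R x e0" using adj by blast
  have kU: "(\<Sum>d\<in>V. k d * U e d) = of_bool (R x e)" if e: "e \<in> V" for e
  proof -
    have "real_of_int (\<Sum>d\<in>V. k d * U e d) = (\<Sum>d\<in>V. h d * real_of_int (U e d))"
      unfolding of_int_sum by (rule sum.cong[OF refl]) (simp add: hk)
    also have "\<dots> = real_of_int (of_bool (R x e))" using h(2)[OF e] by simp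
    finally show ?thesis by (simp only: of_int_eq_iff)
  qed
  obtain d0 where d0: "d0 \<in> V" "k d0 \<noteq> 0"
  proof -
    have "\<exists>d\<in>V. k d \<noteq> 0"
    proof (rule ccontr)
      assume "\<not> (\<exists>d\<in>V. k d \<noteq> 0)"
      then have "(\<Sum>d\<in>V. k d * U e0 d) = 0" by (intro sum.neutral) auto
      then show False using kU[OF e0(1)] e0(2) by simp
    qed
    then show ?thesis using that by blast
  qed
  have sq: "1 \<le> (i::int)\<^sup>2" if "i \<noteq> 0" for i
    using that by (simp add: int_one_le_iff_zero_less)
  have other: "k d = 0" if d: "d \<in> V" "d \<noteq> d0" for d
  proof (rule ccontr)
    assume "k d \<noteq> 0"
    have "2 \<le> (k d)\<^sup>2 + (k d0)\<^sup>2" using sq[OF \<open>k d \<noteq> 0\<close>] sq[OF d0(2)] by linarith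
    also have "\<dots> = (\<Sum>d\<in>{d, d0}. (k d)\<^sup>2)" using d(2) by simp
    also have "\<dots> \<le> (\<Sum>d\<in>V. (k d)\<^sup>2)" using fin d d0 by (intro sum_mono2) auto
    finally show False using norm by simp
  qed
  have single: "(\<Sum>d\<in>V. g d * k d) = g d0 * k d0" for g :: "'v \<Rightarrow> int"
  proof -
    have "(\<Sum>d\<in>V. g d * k d) = (\<Sum>d\<in>{d0}. g d * k d)"
      using fin d0 other by (intro sum.mono_neutral_right) auto
    then show ?thesis by simp
  qed
  have kd0: "k d0 * k d0 = 1"
  proof -
    have "(\<Sum>d\<in>V. (k d)\<^sup>2) = k d0 * k d0" using single[of k] by (simp add: power2_eq_square)
    then show ?thesis using norm sq[OF d0(2)] by (simp add: power2_eq_square)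
  qed
  define W where "W e d = (if e = x then (if d = x then 1 else k d) else if d = x then 0 else U e d)" for e d
  have W0: "W x x = 1" "e \<in> V \<Longrightarrow> W e x = 0" for e using x by (auto simp: W_def)
  have gxx: "(\<Sum>d\<in>insert x V. W x d * W x d) = 2"
  proof -
    have "(\<Sum>d\<in>insert x V. W x d * W x d) = W x x * W x x + (\<Sum>d\<in>V. W x d * W x d)"
      by (rule sum.insert[OF fin x])
    also have "(\<Sum>d\<in>V. W x d * W x d) = (\<Sum>d\<in>V. k d * k d)"
      by (rule sum.cong[OF refl]) (use x in \<open>auto simp: W_def\<close>)
    finally show ?thesis unfolding single kd0 W0(1) by simp
  qed
  have gxe: "(\<Sum>d\<in>insert x V. W x d * W e d) = of_bool (R x e)" if e: "e \<in> V" for e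
  proof -
    have "(\<Sum>d\<in>insert x V. W x d * W e d) = (\<Sum>d\<in>V. W x d * W e d)"
      using fin x W0(2)[OF e] by simp
    also have "\<dots> = (\<Sum>d\<in>V. k d * U e d)"
      by (rule sum.cong[OF refl]) (use x e in \<open>auto simp: W_def\<close>)
    finally show ?thesis using kU[OF e] by simp
  qed
  have gef: "(\<Sum>d\<in>insert x V. W e d * W f d) = gram R e f" if ef: "e \<in> V" "f \<in> V" for e f
  proof -
    have "(\<Sum>d\<in>insert x V. W e d * W f d) = (\<Sum>d\<in>V. W e d * W f d)"
      using fin x W0(2)[OF ef(1)] by simp
    also have "\<dots> = (\<Sum>d\<in>V. U e d * U f d)"
      by (rule sum.cong[OF refl]) (use x ef in \<open>auto simp: W_def\<close>)
    finally show ?thesis using gram[OF ef] by simp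
  qed
  have "(\<Sum>d\<in>insert x V. W e d * W f d) = gram R e f" if ef: "e \<in> insert x V" "f \<in> insert x V" for e f
  proof -
    consider "e = x" "f = x" | "e = x" "f \<in> V" | "e \<in> V" "f = x" | "e \<in> V" "f \<in> V" using ef by blast
    then show ?thesis
    proof cases
      case 1
      then show ?thesis using gxx by (simp add: gram_def)
    next
      case 2
      have "f \<noteq> x" using 2 x by auto
      then show ?thesis unfolding 2(1) gxe[OF 2(2)] by (simp add: gram_def)
    next
      case 3
      have "e \<noteq> x" using 3 x by auto
      have "(\<Sum>d\<in>insert x V. W e d * W f d) = (\<Sum>d\<in>insert x V. W x d * W e d)"
        unfolding 3(2) by (rule sum.cong[OF refl]) (rule mult.commute)
      then show ?thesis unfolding gxe[OF 3(1)] using sym[OF 3(1)] \<open>e \<noteq> x\<close> 3(2) by (simp add: gram_def)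
    next
      case 4
      then show ?thesis by (rule gef)
    qed
  qed
  moreover have "(\<forall>d\<in>insert x V. w d \<in> \<int>) \<or> (\<forall>d\<in>insert x V. w d - 1/2 \<in> \<int>)"
    if w: "\<forall>e\<in>insert x V. (\<Sum>d\<in>insert x V. w d * of_int (W e d)) \<in> \<int>" for w :: "'v \<Rightarrow> real"
  proof -
    have "(\<Sum>d\<in>V. w d * of_int (U e d)) \<in> \<int>" if e: "e \<in> V" for e
    proof -
      have "(\<Sum>d\<in>insert x V. w d * of_int (W e d)) = (\<Sum>d\<in>V. w d * of_int (W e d))"
        using fin x W0(2)[OF e] by simp
      also have "\<dots> = (\<Sum>d\<in>V. w d * of_int (U e d))"
        by (rule sum.cong[OF refl]) (use x e in \<open>auto simp: W_def\<close>)
      finally have eq: "(\<Sum>d\<in>insert x V. w d * of_int (W e d)) = (\<Sum>d\<in>V. w d * of_int (U e d))" .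
      have "(\<Sum>d\<in>insert x V. w d * of_int (W e d)) \<in> \<int>" using w e by blast
      then show ?thesis unfolding eq .
    qed
    then have cls: "(\<forall>d\<in>V. w d \<in> \<int>) \<or> (\<forall>d\<in>V. w d - 1/2 \<in> \<int>)" by (intro dual) blast
    have "(\<Sum>d\<in>insert x V. w d * of_int (W x d)) = w x + (\<Sum>d\<in>V. w d * of_int (W x d))"
      using fin x W0(1) by simp
    also have "(\<Sum>d\<in>V. w d * of_int (W x d)) = (\<Sum>d\<in>{d0}. w d * of_int (k d))"
      using fin d0 other x by (intro sum.mono_neutral_cong_right) (auto simp: W_def)
    finally have eq: "(\<Sum>d\<in>insert x V. w d * of_int (W x d)) = w x + w d0 * of_int (k d0)" by simp
    have "(\<Sum>d\<in>insert x V. w d * of_int (W x d)) \<in> \<int>" using w by blast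
    then have wx: "w x + w d0 * of_int (k d0) \<in> \<int>" unfolding eq .
    have k1: "k d0 = 1 \<or> k d0 = -1" using kd0 by (simp add: zmult_eq_1_iff)
    show ?thesis
      using cls
    proof
      assume a: "\<forall>d\<in>V. w d \<in> \<int>"
      then have "w d0 * of_int (k d0) \<in> \<int>" using d0 by (intro Ints_mult) auto
      from Ints_diff[OF wx this] have "w x \<in> \<int>" by simp
      then show ?thesis using a by auto
    next
      assume a: "\<forall>d\<in>V. w d - 1/2 \<in> \<int>"
      then have wd: "w d0 - 1/2 \<in> \<int>" using d0 by auto
      have "w x - 1/2 \<in> \<int>"
        using k1
      proof
        assume "k d0 = 1"
        then have "w x - 1/2 = (w x + w d0 * of_int (k d0)) - (w d0 - 1/2) - 1" by simp
        then show ?thesis using Ints_diff[OF Ints_diff[OF wx wd] Ints_1] by (simp only:)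
      next
        assume "k d0 = -1"
        then have "w x - 1/2 = (w x + w d0 * of_int (k d0)) + (w d0 - 1/2)" by simp
        then show ?thesis using Ints_add[OF wx wd] by (simp only:)
      qed
      then show ?thesis using a by auto
    qed
  qed
  ultimately have "D_rep R W (insert x V)" unfolding D_rep_def by blast
  then show ?thesis by blast
qed

definition connected_in :: "('v \<Rightarrow> 'v \<Rightarrow> bool) \<Rightarrow> 'v set \<Rightarrow> bool" where
  "connected_in R C \<longleftrightarrow> (\<forall>S. S \<noteq> {} \<longrightarrow> S \<subset> C \<longrightarrow> (\<exists>x\<in>C - S. \<exists>e\<in>S. R x e))"

text \<open>Growth by a neighbouring vertex may turn the line graph of a tree into type D, but not
  conversely. The bound 9 for type D holds because the transition itself adds a vertex to at least
  8.\<close>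

lemma tree_or_D_rep:
  fixes R :: "'v \<Rightarrow> 'v \<Rightarrow> bool"
  assumes C: "finite C" "connected_in R C" and sym: "\<And>x y. R x y = R y x"
    and pd: "posdef C (gram R)"
    and V: "V \<subseteq> C" "card V \<ge> 8" "tree_rep R par V"
  shows "(\<exists>par. tree_rep R par C) \<or> (\<exists>U. D_rep R U C)"
proof -
  have "(\<exists>par. tree_rep R par C) \<or> (\<exists>U. D_rep R U C)"
    if "V \<subseteq> C" "(card V \<ge> 8 \<and> (\<exists>par. tree_rep R par V)) \<or> (card V \<ge> 9 \<and> (\<exists>U. D_rep R U V))" for V
    using that
  proof (induction "card (C - V)" arbitrary: V rule: less_induct)
    case less
    show ?case
    proof (cases "V = C")
      case True
      then show ?thesis using less.prems by auto
    next
      case False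
      then have "V \<subset> C" using less.prems by auto
      moreover have "V \<noteq> {}" using less.prems(2) by auto
      ultimately obtain x e where xe: "x \<in> C" "x \<notin> V" "e \<in> V" "R x e"
        using C(2) unfolding connected_in_def by blast
      have finV: "finite V" using less.prems(1) C(1) by (rule finite_subset)
      have pd': "posdef (insert x V) (gram R)"
        using less.prems(1) xe(1) by (intro posdef_subset[OF C(1) _ pd]) auto
      have "(\<exists>par. tree_rep R par (insert x V)) \<or> (\<exists>U. D_rep R U (insert x V))"
        using less.prems(2)
      proof
        assume "card V \<ge> 8 \<and> (\<exists>par. tree_rep R par V)"
        then obtain par where "card V \<ge> 8" "tree_rep R par V" by blast
        then show ?thesis using tree_rep_extend[of R par V x] xe sym pd' by blast
      next
        assume "card V \<ge> 9 \<and> (\<exists>U. D_rep R U V)"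
        then obtain U where "card V \<ge> 9" "D_rep R U V" by blast
        then show ?thesis using D_rep_extend[of R U V x] xe sym pd' by blast
      qed
      moreover have "card (insert x V) = Suc (card V)" using finV xe(2) by simp
      moreover have "card V \<ge> 8" using less.prems(2) by auto
      moreover have "card (C - insert x V) < card (C - V)"
        using C(1) xe by (intro psubset_card_mono) auto
      moreover have "insert x V \<subseteq> C" using less.prems(1) xe(1) by auto
      ultimately show ?thesis
        by (intro less.hyps[of "insert x V"]) auto
    qed
  qed
  from this[OF V(1)] V show ?thesis by blast
qed

text \<open>Coordinates are indexed by \<open>V\<close> itself, so the Gram matrix is U U^T with a
  square matrix \<open>U\<close>.\<close>

lemma sdet_D_rep_square:
  assumes "finite V" "D_rep R U V"
  shows "\<exists>k::int. sdet V (gram R) = k\<^sup>2"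
proof -
  have "sdet V (gram R) = sdet V (\<lambda>e f. \<Sum>d\<in>V. U e d * U f d)"
    using assms(2) by (intro sdet_cong) (auto simp: D_rep_def)
  also have "\<dots> = sdet V U * sdet V (\<lambda>d f. U f d)"
    using sdet_mult[OF assms(1), of U "\<lambda>d f. U f d"] by simp
  also have "sdet V (\<lambda>d f. U f d) = sdet V U" by (rule sdet_transpose[OF assms(1)])
  finally show ?thesis by (auto simp: power2_eq_square)
qed

section \<open>Large connected graphs contain a large tree line graph\<close>

lemma tree_rep_clique:
  assumes "finite V" "\<And>e f. e \<in> V \<Longrightarrow> f \<in> V \<Longrightarrow> e \<noteq> f \<Longrightarrow> R e f"
  shows "tree_rep R (\<lambda>_. None) V"
proof -
  have "rtree (\<lambda>_. None) V" using assms(1) by (induction V) (auto intro: rtree.intros)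
  then show ?thesis using assms(2) by (auto simp: tree_rep_def ladj_def)
qed

lemma tree_rep_path:
  fixes u :: "nat \<Rightarrow> 'v"
  assumes inj: "inj_on u {..<n}"
    and path: "\<And>i j. i < n \<Longrightarrow> j < n \<Longrightarrow> i \<noteq> j \<Longrightarrow> R (u i) (u j) \<longleftrightarrow> j = Suc i \<or> i = Suc j"
  shows "\<exists>par. tree_rep R par (u ` {..<n})"
proof -
  define ix where "ix = inv_into {..<n} u"
  have ix: "ix (u i) = i" if "i < n" for i using inj that by (simp add: ix_def)
  define par where "par v = (if ix v = 0 then None else Some (u (ix v - 1)))" for v
  have "rtree par (u ` {..<m})" if "m \<le> n" for m
    using that
  proof (induction m)
    case (Suc m)
    have "u m \<notin> u ` {..<m}"
    proof
      assume "u m \<in> u ` {..<m}"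
      then obtain i where "i < m" "u m = u i" by auto
      then show False using inj_onD[OF inj, of m i] Suc.prems by auto
    qed
    moreover have "par (u m) \<in> insert None (Some ` u ` {..<m})"
      using Suc.prems ix[of m] by (auto simp: par_def)
    ultimately have "rtree par (insert (u m) (u ` {..<m}))"
      using Suc by (intro rtree_insert) auto
    then show ?case by (simp add: lessThan_Suc)
  qed (simp add: rtree_empty)
  moreover have "R e f = ladj par e f" if ef: "e \<in> u ` {..<n}" "f \<in> u ` {..<n}" "e \<noteq> f" for e f
  proof -
    obtain i j where ij: "e = u i" "f = u j" "i < n" "j < n" using ef by auto
    have eq: "u a = u b \<longleftrightarrow> a = b" if "a < n" "b < n" for a b
      using inj_onD[OF inj, of a b] that by auto
    have pu: "par (u a) = (if a = 0 then None else Some (u (a - 1)))" if "a < n" for a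
      using that by (simp add: par_def ix)
    have "i \<noteq> j" using ef(3) ij by auto
    then show ?thesis
      unfolding ij(1,2) path[OF ij(3,4) \<open>i \<noteq> j\<close>] ladj_def pu[OF ij(3)] pu[OF ij(4)] eq[OF ij(3,4)]
      using ij(3,4) eq[of "i - 1" "j - 1"] eq[of "i - 1" j] eq[of "j - 1" i] by (cases i; cases j) auto
  qed
  ultimately show ?thesis by (auto simp: tree_rep_def)
qed

text \<open>With -2 at the centre and 1 at the four leaves the form takes the value 8 - 16 + 8 =
  0.\<close>

lemma posdef_no_claw:
  assumes "v \<notin> I" "card I = 4" "\<And>i. i \<in> I \<Longrightarrow> R v i \<and> R i v" "\<And>i j. i \<in> I \<Longrightarrow> j \<in> I \<Longrightarrow> i \<noteq> j \<Longrightarrow> \<not> R i j"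
  shows "\<not> posdef (insert v I) (gram R)"
proof
  assume pd: "posdef (insert v I) (gram R)"
  have fin: "finite I" using assms(2) by (auto intro: card_ge_0_finite)
  define c :: "'a \<Rightarrow> real" where "c x = (if x = v then -2 else 1)" for x
  have ci: "c i = 1" if "i \<in> I" for i using that assms(1) by (auto simp: c_def)
  have cv: "c v = -2" by (simp add: c_def)
  have gv: "gram R v i = (1::real)" "gram R i v = (1::real)" if "i \<in> I" for i
    using assms(1,3) that by (auto simp: gram_def)
  have g2: "gram R x x = (2::real)" for x by (simp add: gram_def)
  have "0 < qform (insert v I) (gram R) c" using pd by (auto simp: posdef_def c_def)
  also have "qform (insert v I) (gram R) c =
      (\<Sum>y\<in>insert v I. c v * gram R v y * c y) + (\<Sum>i\<in>I. \<Sum>y\<in>insert v I. c i * gram R i y * c y)"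
    unfolding qform_def by (rule sum.insert[OF fin assms(1)])
  also have "(\<Sum>y\<in>insert v I. c v * gram R v y * c y) = 0"
  proof -
    have "(\<Sum>y\<in>I. c v * gram R v y * c y) = (\<Sum>y\<in>I. -2)" by (rule sum.cong[OF refl]) (simp add: gv ci cv)
    then show ?thesis using fin assms(1,2) by (simp add: g2 cv)
  qed
  also have "(\<Sum>i\<in>I. \<Sum>y\<in>insert v I. c i * gram R i y * c y) = (\<Sum>i\<in>I. 0)"
  proof (rule sum.cong[OF refl])
    fix i assume i: "i \<in> I"
    have "(\<Sum>y\<in>I. c i * gram R i y * c y) = (\<Sum>y\<in>I. if y = i then 2 else 0)"
      by (rule sum.cong[OF refl]) (use i assms(4) in \<open>auto simp: ci gram_def\<close>)
    then show "(\<Sum>y\<in>insert v I. c i * gram R i y * c y) = 0"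
      using fin assms(1) i by (simp add: gv ci cv)
  qed
  finally show False by simp
qed

text \<open>Ramsey's theorem is applied to the neighbourhood of \<open>v\<close>; four independent
  neighbours are excluded by \<open>posdef_no_claw\<close>. The bound is uniform in the
  graph.\<close>

lemma large_degree_clique:
  "\<exists>\<Delta>. \<forall>R C v. finite (C :: 'v set) \<longrightarrow> v \<in> C \<longrightarrow> posdef C (gram R) \<longrightarrow> (\<forall>x y. R x y = R y x) \<longrightarrow>
    (\<forall>x. \<not> R x x) \<longrightarrow> card {x\<in>C. R v x} \<ge> \<Delta> \<longrightarrow> (\<exists>V\<subseteq>C. card V = 8 \<and> (\<forall>e\<in>V. \<forall>f\<in>V. e \<noteq> f \<longrightarrow> R e f))"
proof -
  obtain r where r0: "\<forall>(V::'v set) E. finite V \<and> r \<le> card V \<longrightarrow>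
      (\<exists>S \<subseteq> V. card S = 8 \<and> clique S E \<or> card S = 4 \<and> indep S E)"
    using ramsey2[where m = 8 and n = 4 and 'a = 'v] by (elim exE conjE) (rule that)
  have r: "\<exists>S \<subseteq> V. card S = 8 \<and> clique S E \<or> card S = 4 \<and> indep S E" if "finite V" "r \<le> card V" for V :: "'v set" and E
    using spec[OF spec[OF r0, of V], of E] that by simp
  have "\<exists>V\<subseteq>C. card V = 8 \<and> (\<forall>e\<in>V. \<forall>f\<in>V. e \<noteq> f \<longrightarrow> R e f)"
    if C: "finite C" "v \<in> C" "posdef C (gram R)" "\<forall>x y. R x y = R y x" "\<forall>x. \<not> R x x"
      and d: "card {x\<in>C. R v x} \<ge> r" for R and C :: "'v set" and v
  proof -
    define E where "E = {e. \<exists>x y. e = {x, y} \<and> R x y}"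
    have E: "{x, y} \<in> E \<longleftrightarrow> R x y" for x y
    proof
      assume "{x, y} \<in> E"
      then obtain a b where "{x, y} = {a, b}" "R a b" by (auto simp: E_def)
      then show "R x y" using C(4) by (auto simp: doubleton_eq_iff)
    qed (auto simp: E_def)
    obtain S where S: "S \<subseteq> {x\<in>C. R v x}" "card S = 8 \<and> clique S E \<or> card S = 4 \<and> indep S E"
      using r[OF _ d, of E] C(1) by auto
    have "\<not> (card S = 4 \<and> indep S E)"
    proof
      assume a: "card S = 4 \<and> indep S E"
      have "\<not> posdef (insert v S) (gram R)"
        using a S(1) C(4,5) E by (intro posdef_no_claw) (auto simp: indep_def)
      moreover have "posdef (insert v S) (gram R)"
        using S(1) C by (intro posdef_subset[OF C(1) _ C(3)]) auto
      ultimately show False by simp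
    qed
    then have "card S = 8" "clique S E" using S(2) by auto
    then show ?thesis using S(1) E by (intro exI[of _ S]) (auto simp: clique_def)
  qed
  then show ?thesis by blast
qed

text \<open>The ball of radius k around \<open>v\<close>, not the sphere.\<close>

primrec level :: "('v \<Rightarrow> 'v \<Rightarrow> bool) \<Rightarrow> 'v set \<Rightarrow> 'v \<Rightarrow> nat \<Rightarrow> 'v set" where
  "level R C v 0 = {v}"
| "level R C v (Suc k) = level R C v k \<union> {x\<in>C. \<exists>y\<in>level R C v k. R y x}"

lemma level_mono: "i \<le> j \<Longrightarrow> level R C v i \<subseteq> level R C v j"
  by (induction j) (auto simp: le_Suc_eq)

lemma level_subset: "v \<in> C \<Longrightarrow> level R C v k \<subseteq> C"
  by (induction k) auto

lemma level_card:
  assumes "finite C" "v \<in> C" "\<And>y. y \<in> C \<Longrightarrow> card {x\<in>C. R y x} \<le> \<Delta>"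
  shows "card (level R C v k) \<le> (1 + \<Delta>) ^ k"
proof (induction k)
  case (Suc k)
  have fin: "finite (level R C v k)" using level_subset[OF assms(2)] assms(1) by (rule finite_subset)
  have "{x\<in>C. \<exists>y\<in>level R C v k. R y x} = (\<Union>y\<in>level R C v k. {x\<in>C. R y x})" by auto
  then have "card (level R C v (Suc k)) \<le> card (level R C v k) + card (\<Union>y\<in>level R C v k. {x\<in>C. R y x})"
    by (simp add: card_Un_le)
  also have "card (\<Union>y\<in>level R C v k. {x\<in>C. R y x}) \<le> (\<Sum>y\<in>level R C v k. card {x\<in>C. R y x})"
    by (rule card_UN_le[OF fin])
  also have "\<dots> \<le> (\<Sum>y\<in>level R C v k. \<Delta>)"
    using level_subset[OF assms(2), of R k] by (intro sum_mono assms(3)) auto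
  also have "\<dots> = card (level R C v k) * \<Delta>" by simp
  finally have "card (level R C v (Suc k)) \<le> card (level R C v k) * (1 + \<Delta>)" by (simp add: algebra_simps)
  also have "\<dots> \<le> (1 + \<Delta>) ^ k * (1 + \<Delta>)" using Suc by (rule mult_le_mono1)
  finally show ?case by (simp add: mult.commute)
qed simp

lemma geodesic:
  assumes "x \<in> level R C v k" "k > 0 \<Longrightarrow> x \<notin> level R C v (k - 1)"
  shows "\<exists>u. u k = x \<and> (\<forall>i\<le>k. u i \<in> level R C v i \<and> (i > 0 \<longrightarrow> u i \<notin> level R C v (i - 1))) \<and>
    (\<forall>i<k. R (u i) (u (Suc i)))"
  using assms
proof (induction k arbitrary: x)
  case 0
  then show ?case by (intro exI[of _ "\<lambda>_. x"]) auto
next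
  case (Suc k)
  then obtain y where y: "y \<in> level R C v k" "R y x" "x \<in> C" by auto
  have "y \<notin> level R C v (k - 1)" if "k > 0"
  proof
    assume "y \<in> level R C v (k - 1)"
    then have "x \<in> level R C v (Suc (k - 1))" using y by auto
    then show False using Suc.prems that by simp
  qed
  then obtain u where u: "u k = y" "\<forall>i\<le>k. u i \<in> level R C v i \<and> (i > 0 \<longrightarrow> u i \<notin> level R C v (i - 1))"
    "\<forall>i<k. R (u i) (u (Suc i))" using Suc.IH[of y] y by blast
  show ?case
    using u y Suc.prems by (intro exI[of _ "u(Suc k := x)"]) (auto simp: le_Suc_eq less_Suc_eq)
qed

text \<open>A shortest path is induced. Some vertex has distance exactly 7 from \<open>v\<close>,
  and a geodesic to it has 8 vertices.\<close>

lemma long_induced_path: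
  assumes C: "finite C" "connected_in R C" "v \<in> C" and sym: "\<And>x y. R x y = R y x"
    and big: "card (level R C v 7) < card C"
  shows "\<exists>u. inj_on u {..<8} \<and> u ` {..<8} \<subseteq> C \<and>
    (\<forall>i j. i < 8 \<longrightarrow> j < 8 \<longrightarrow> i \<noteq> j \<longrightarrow> (R (u i) (u j) \<longleftrightarrow> j = Suc i \<or> i = Suc j))"
proof -
  have "level R C v 6 \<noteq> C"
  proof
    assume "level R C v 6 = C"
    moreover have "level R C v 6 \<subseteq> level R C v 7" by (rule level_mono) simp
    ultimately have "level R C v 7 = C" using level_subset[OF C(3), of R 7] by auto
    then show False using big by simp
  qed
  then have "level R C v 6 \<subset> C" using level_subset[OF C(3), of R 6] by auto
  moreover have "level R C v 6 \<noteq> {}" using level_mono[of 0 6 R C v] by auto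
  ultimately obtain x y where xy: "x \<in> C" "x \<notin> level R C v 6" "y \<in> level R C v 6" "R x y"
    using C(2) unfolding connected_in_def by blast
  have "R y x" using xy(4) sym[of x y] by simp
  then have x: "x \<in> level R C v (Suc 6)" "x \<notin> level R C v 6"
    unfolding level.simps using xy by blast+
  have s67: "Suc 6 = (7::nat)" by simp
  have x7: "x \<in> level R C v 7" using x(1) unfolding s67 .
  have x6: "x \<notin> level R C v (7 - 1)" using x(2) by simp
  obtain u where u0: "\<forall>i\<le>7. u i \<in> level R C v i \<and> (i > 0 \<longrightarrow> u i \<notin> level R C v (i - 1))"
    "\<forall>i<7. R (u i) (u (Suc i))"
    using geodesic[OF x7 x6] by blast
  have u: "\<And>i. i \<le> 7 \<Longrightarrow> u i \<in> level R C v i"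
    "\<And>i. i \<le> 7 \<Longrightarrow> i > 0 \<Longrightarrow> u i \<notin> level R C v (i - 1)" "\<And>i. i < 7 \<Longrightarrow> R (u i) (u (Suc i))"
    using u0 by blast+
  have far: "u i \<noteq> u j \<and> (R (u i) (u j) \<longrightarrow> j = Suc i)" if ij: "i < j" "j \<le> 7" for i j
  proof -
    have nj: "u j \<notin> level R C v (j - 1)" using u(2)[of j] ij by simp
    have "u i \<in> level R C v (j - 1)" 
    proof (rule subsetD[OF level_mono])
      show "i \<le> j - 1" using ij by arith
      show "u i \<in> level R C v i" using u(1)[of i] ij by simp
    qed
    then have "u i \<noteq> u j" using nj by auto
    moreover have "j = Suc i" if "R (u i) (u j)"
    proof (rule ccontr)
      assume "j \<noteq> Suc i"
      have "u j \<in> C" using u(1)[of j] level_subset[OF C(3)] ij by blast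
      then have "u j \<in> level R C v (Suc i)" using that u(1)[of i] ij by auto
      then have "u j \<in> level R C v (j - 1)" 
      proof (rule subsetD[OF level_mono, rotated])
        show "Suc i \<le> j - 1" using ij \<open>j \<noteq> Suc i\<close> by arith
      qed
      then show False using nj by simp
    qed
    ultimately show ?thesis by blast
  qed
  have "inj_on u {..<8}"
  proof (rule inj_onI)
    fix i j assume "i \<in> {..<8::nat}" "j \<in> {..<8}" "u i = u j"
    then show "i = j" using far[of i j] far[of j i] by (cases i j rule: linorder_cases) auto
  qed
  moreover have "u ` {..<8} \<subseteq> C"
  proof (rule image_subsetI)
    fix i assume "i \<in> {..<8::nat}"
    then have "u i \<in> level R C v i" by (intro u(1)) simp
    then show "u i \<in> C" by (rule subsetD[OF level_subset[OF C(3)]])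
  qed
  moreover have "R (u i) (u j) \<longleftrightarrow> j = Suc i \<or> i = Suc j" if "i < 8" "j < 8" "i \<noteq> j" for i j
  proof (cases i j rule: linorder_cases)
    case less
    then show ?thesis using far[of i j] u(3)[of i] that by auto
  next
    case greater
    then show ?thesis using far[of j i] u(3)[of j] that sym[of "u i" "u j"] by auto
  qed (use that in auto)
  ultimately show ?thesis by blast
qed

text \<open>Either some degree is large enough for a clique of 8 vertices, the line graph of a star,
  or the degrees are below \<Delta> and a ball of radius 7 has at most (1 + \<Delta>)^7 vertices, so
  that an induced path of 8 vertices exists.\<close>

lemma tree_rep_start:
  "\<exists>B. \<forall>R C. finite (C :: 'v set) \<longrightarrow> (\<forall>x y. R x y = R y x) \<longrightarrow> (\<forall>x. \<not> R x x) \<longrightarrow> connected_in R C \<longrightarrow>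
    posdef C (gram R) \<longrightarrow> card C > B \<longrightarrow> (\<exists>V par. V \<subseteq> C \<and> card V = 8 \<and> tree_rep R par V)"
proof -
  obtain \<Delta> where \<Delta>0: "\<forall>R C v. finite (C :: 'v set) \<longrightarrow> v \<in> C \<longrightarrow> posdef C (gram R) \<longrightarrow> (\<forall>x y. R x y = R y x) \<longrightarrow>
      (\<forall>x. \<not> R x x) \<longrightarrow> card {x\<in>C. R v x} \<ge> \<Delta> \<longrightarrow> (\<exists>V\<subseteq>C. card V = 8 \<and> (\<forall>e\<in>V. \<forall>f\<in>V. e \<noteq> f \<longrightarrow> R e f))"
    by (rule exE[OF large_degree_clique]) (rule that)
  have \<Delta>: "\<exists>V\<subseteq>C. card V = 8 \<and> (\<forall>e\<in>V. \<forall>f\<in>V. e \<noteq> f \<longrightarrow> R e f)"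
    if "finite C" "v \<in> C" "posdef C (gram R)" "\<forall>x y. R x y = R y x" "\<forall>x. \<not> R x x" "card {x\<in>C. R v x} \<ge> \<Delta>"
    for R and C :: "'v set" and v
    using spec[OF spec[OF spec[OF \<Delta>0, of R], of C], of v] that by (elim impE) auto
  have main: "\<exists>V par. V \<subseteq> C \<and> card V = 8 \<and> tree_rep R par V"
    if C: "finite C" "connected_in R C" "posdef C (gram R)" "card C > (1 + \<Delta>) ^ 7"
      and sym: "\<forall>x y. R x y = R y x" and irr: "\<forall>x. \<not> R x x" for R and C :: "'v set"
  proof (cases "\<exists>v\<in>C. card {x\<in>C. R v x} \<ge> \<Delta>")
    case True
    then obtain V where V: "V \<subseteq> C" "card V = 8" "\<forall>e\<in>V. \<forall>f\<in>V. e \<noteq> f \<longrightarrow> R e f"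
      using \<Delta>[OF C(1) _ C(3) sym irr] by blast
    then have "tree_rep R (\<lambda>_. None) V"
      using C(1) by (intro tree_rep_clique) (auto intro: finite_subset)
    then show ?thesis using V by blast
  next
    case False
    have "C \<noteq> {}" using C(4) by auto
    then obtain v where v: "v \<in> C" by auto
    have "card (level R C v 7) \<le> (1 + \<Delta>) ^ 7"
      using False by (intro level_card[OF C(1) v]) (auto simp: not_le less_imp_le)
    then have "card (level R C v 7) < card C" using C(4) by simp
    then obtain u where u: "inj_on u {..<8::nat}" "u ` {..<8} \<subseteq> C"
      "\<And>i j. i < 8 \<Longrightarrow> j < 8 \<Longrightarrow> i \<noteq> j \<Longrightarrow> R (u i) (u j) \<longleftrightarrow> j = Suc i \<or> i = Suc j"
      using long_induced_path[OF C(1,2) v] sym by blast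
    obtain par where "tree_rep R par (u ` {..<8})" using tree_rep_path[of u 8 R] u(1,3) by blast
    moreover have "card (u ` {..<8}) = 8" using card_image[OF u(1)] by simp
    ultimately show ?thesis using u(2) by blast
  qed
  show ?thesis by (intro exI[of _ "(1 + \<Delta>) ^ 7"] allI impI) (rule main)
qed

section \<open>Graphs cospectral with a caterpillar graph\<close>

definition gdet :: "'v set \<Rightarrow> ('v \<Rightarrow> 'v \<Rightarrow> bool) \<Rightarrow> 'a \<Rightarrow> 'a \<Rightarrow> 'a::idom" where
  "gdet A R u q = sdet A (shifted (\<lambda>x y. q * gram R x y) u)"

lemma gdet_cong:
  assumes "\<And>x y. x \<in> A \<Longrightarrow> y \<in> A \<Longrightarrow> x \<noteq> y \<Longrightarrow> R x y = S x y"
  shows "gdet A R u q = gdet A S u q"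
  unfolding gdet_def by (rule sdet_cong[OF refl]) (use assms in \<open>auto simp: gram_def\<close>)

lemma gdet_reindex:
  assumes "finite A" and g: "bij_betw g A B"
    and R: "\<And>x y. x \<in> A \<Longrightarrow> y \<in> A \<Longrightarrow> x \<noteq> y \<Longrightarrow> R' (g x) (g y) = R x y"
  shows "gdet B R' u q = gdet A R u q"
  unfolding gdet_def sdet_reindex[OF assms(1) g]
proof (rule sdet_cong[OF refl])
  fix x y assume xy: "x \<in> A" "y \<in> A"
  have "g x = g y \<longleftrightarrow> x = y" using g xy by (auto simp: bij_betw_def dest: inj_onD)
  then show "(if g x = g y then u else 0) + q * gram R' (g x) (g y) = (if x = y then u else 0) + q * gram R x y"
    using R[OF xy] by (simp add: gram_def)
qed

lemma gdet_split:
  assumes "finite A" "finite B" "A \<inter> B = {}" and no: "\<And>x y. x \<in> A \<Longrightarrow> y \<in> B \<Longrightarrow> \<not> R x y"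
  shows "gdet (A \<union> B) R u q = gdet A R u q * gdet B R u q"
  unfolding gdet_def
proof (rule sdet_block[OF assms(1-3)])
  fix x y assume xy: "x \<in> A" "y \<in> B"
  then have "x \<noteq> y" using assms(3) by auto
  then show "(if x = y then u else 0) + q * gram R x y = 0" using no[OF xy] by (simp add: gram_def)
qed

lemma gdet_0_1: "gdet A R 0 1 = sdet A (gram R)"
  unfolding gdet_def by (rule sdet_cong[OF refl]) simp

text \<open>N^T N is a sum of squares, and its determinant is not zero by
  \<open>sdet_gram_tree\<close>.\<close>

lemma posdef_tree:
  assumes T: "rtree par V"
  shows "posdef V (gram (ladj par))"
proof -
  note fin = rtree_finite[OF T]
  have q: "qform V (gram (ladj par)) c = (\<Sum>a\<in>verts V. (\<Sum>e\<in>V. c e * inc par a e)\<^sup>2)" for c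
  proof -
    have "qform V (gram (ladj par)) c = (\<Sum>e\<in>V. \<Sum>f\<in>V. \<Sum>a\<in>verts V. (c e * inc par a e) * (c f * inc par a f))"
      unfolding qform_def
    proof (intro sum.cong refl)
      fix e f assume ef: "e \<in> V" "f \<in> V"
      show "c e * gram (ladj par) e f * c f = (\<Sum>a\<in>verts V. (c e * inc par a e) * (c f * inc par a f))"
        unfolding gram_ladj[OF T ef, symmetric] sum_distrib_left sum_distrib_right
        by (intro sum.cong refl) (simp only: mult_ac)
    qed
    also have "\<dots> = (\<Sum>e\<in>V. \<Sum>a\<in>verts V. \<Sum>f\<in>V. (c e * inc par a e) * (c f * inc par a f))"
      by (rule sum.cong[OF refl]) (rule sum.swap)
    also have "\<dots> = (\<Sum>a\<in>verts V. \<Sum>e\<in>V. \<Sum>f\<in>V. (c e * inc par a e) * (c f * inc par a f))"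
      by (rule sum.swap)
    finally show ?thesis unfolding power2_eq_square sum_product .
  qed
  have psd: "qform V (gram (ladj par)) c \<ge> 0" for c unfolding q by (intro sum_nonneg) simp
  have sym: "gram (ladj par) x y = (gram (ladj par) y x :: real)" for x y by (auto simp: gram_def ladj_def)
  have "real (card V + 1) \<noteq> 0" by simp
  then have ns: "sdet V (gram (ladj par)) \<noteq> (0::real)" unfolding sdet_gram_tree[OF T] .
  obtain \<epsilon> where \<epsilon>: "\<epsilon> > 0" "\<And>c. qform V (gram (ladj par)) c \<ge> \<epsilon> * (\<Sum>x\<in>V. (c x)\<^sup>2)"
    using semidef_nonsingular_bound[OF fin sym psd ns] by blast
  show ?thesis
    unfolding posdef_def
  proof (intro allI impI)
    fix c :: "'a \<Rightarrow> real" assume "\<exists>x\<in>V. c x \<noteq> 0"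
    then obtain x where x: "x \<in> V" "c x \<noteq> 0" by blast
    have "0 < (\<Sum>x\<in>V. (c x)\<^sup>2)" using x fin by (intro sum_pos2[of V x]) auto
    then show "qform V (gram (ladj par)) c > 0" using \<epsilon> by (meson less_le_trans mult_pos_pos)
  qed
qed

lemma gdet_posdef_nonzero:
  assumes A: "finite A" and pd: "posdef A (gram R)" and uq: "u \<ge> 0" "q > (0::real)"
  shows "gdet A R u q \<noteq> 0"
  unfolding gdet_def
proof (rule posdef_sdet_nonzero[OF A])
  show "posdef A (shifted (\<lambda>x y. q * gram R x y) u)"
    unfolding posdef_def
  proof (intro allI impI)
    fix c :: "'a \<Rightarrow> real" assume c: "\<exists>x\<in>A. c x \<noteq> 0"
    have "qform A (\<lambda>x y. q * gram R x y) c = q * qform A (gram R) c"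
      unfolding qform_def sum_distrib_left by (intro sum.cong refl) (simp only: mult_ac)
    moreover have "0 < qform A (gram R) c" using pd c by (simp add: posdef_def)
    ultimately have "0 < qform A (\<lambda>x y. q * gram R x y) c" using uq(2) by simp
    moreover have "0 \<le> u * (\<Sum>x\<in>A. (c x)\<^sup>2)" using uq(1) by (intro mult_nonneg_nonneg sum_nonneg) auto
    ultimately show "0 < qform A (shifted (\<lambda>x y. q * gram R x y) u) c" unfolding qform_shifted[OF A] by simp
  qed
qed

section \<open>Complete graphs as line graphs of stars\<close>

abbreviation complete_rel :: "'v \<Rightarrow> 'v \<Rightarrow> bool" where "complete_rel \<equiv> \<lambda>_ _. True"

lemma rtree_star: "finite V \<Longrightarrow> rtree (\<lambda>_. None) V"
  by (induction V rule: finite_induct) (auto intro: rtree.intros)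

lemma gram_complete: "gram complete_rel = gram (ladj (\<lambda>_. None))"
  by (intro ext) (auto simp: gram_def ladj_def)

lemma gdet_complete_nonzero: "finite Y \<Longrightarrow> u \<ge> 0 \<Longrightarrow> q > (0::real) \<Longrightarrow> gdet Y complete_rel u q \<noteq> 0"
  using gdet_posdef_nonzero[of Y complete_rel] posdef_tree[OF rtree_star, of Y] unfolding gram_complete by blast

lemma gdet_complete_card:
  assumes "finite Y" "finite Z" "card Y = card Z"
  shows "gdet Y complete_rel u q = gdet Z complete_rel u q"
proof -
  obtain g where "bij_betw g Y Z" using finite_same_card_bij[OF assms] by blast
  then show ?thesis by (rule gdet_reindex[OF assms(1), symmetric]) simp
qed

lemma sdet_complete: "finite Y \<Longrightarrow> sdet Y (gram complete_rel) = (of_nat (card Y + 1) :: real)"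
  unfolding gram_complete by (rule sdet_gram_tree[OF rtree_star])

lemma sdet_gram_of_int:
  assumes "finite A"
  shows "real_of_int (sdet A (gram R)) = sdet A (gram R)"
proof -
  have h: "comm_ring_hom real_of_int" by unfold_locales simp_all
  have "real_of_int (sdet A (gram R)) = sdet A (\<lambda>x y. real_of_int (gram R x y))" by (rule sdet_hom[OF h assms])
  also have "\<dots> = sdet A (gram R)" by (rule sdet_cong[OF refl]) (simp add: gram_def)
  finally show ?thesis .
qed

lemma poly_line_poly:
  assumes "finite V"
  shows "poly (line_poly par V) q = gdet V (ladj par) ((1 - q)\<^sup>2) q"
proof -
  have h: "comm_ring_hom (\<lambda>p. poly p q)" by unfold_locales simp_all
  have g: "poly (gram R x y) q = gram R x y" for R :: "'a \<Rightarrow> 'a \<Rightarrow> bool" and x y by (simp add: gram_def)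
  have X: "poly qX q = q" by (simp add: qX_def)
  have "poly (line_poly par V) q = sdet V (\<lambda>x y. poly ((if x = y then (1 - qX)\<^sup>2 else 0) + qX * gram (ladj par) x y) q)"
    unfolding line_poly_def by (rule sdet_hom[OF h assms])
  also have "\<dots> = gdet V (ladj par) ((1 - q)\<^sup>2) q"
    unfolding gdet_def
  proof (rule sdet_cong[OF refl])
    fix x y
    show "poly ((if x = y then (1 - qX)\<^sup>2 else 0) + qX * gram (ladj par) x y) q =
        (if x = y then (1 - q)\<^sup>2 else 0) + q * gram (ladj par) x y"
      by (cases "x = y") (simp_all only: if_True if_False refl poly_add poly_mult poly_power poly_diff poly_1 poly_0 g X)
  qed
  finally show ?thesis .
qed

text \<open>Infinitely many points determine a polynomial. The interval 0 < q < 1 is chosen because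
  positive definite factors are nonzero there and can be cancelled.\<close>

lemma line_poly_eqI:
  assumes fin: "finite V" "finite V'"
    and eq: "\<And>q. 0 < q \<Longrightarrow> q < 1 \<Longrightarrow> gdet V (ladj par) ((1 - q)\<^sup>2) q = gdet V' (ladj par') ((1 - q)\<^sup>2) (q::real)"
  shows "line_poly par V = line_poly par' V'"
proof (rule ccontr)
  assume "line_poly par V \<noteq> line_poly par' V'"
  then have "finite {q. poly (line_poly par V - line_poly par' V') q = 0}" by (intro poly_roots_finite) simp
  moreover have "{0<..<1::real} \<subseteq> {q. poly (line_poly par V - line_poly par' V') q = 0}"
    using eq by (auto simp: poly_line_poly fin)
  ultimately have "finite {0<..<1::real}" by (rule finite_subset[rotated])
  then show False by (simp add: infinite_Ioo)
qed

text \<open>The Leibniz expansion. It bounds the determinant of a small component, so that a large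
  prime factor forces a large component.\<close>

lemma sdet_int_bound:
  fixes f :: "'v \<Rightarrow> 'v \<Rightarrow> int"
  assumes A: "finite A" and f: "\<And>x y. \<bar>f x y\<bar> \<le> 2"
  shows "\<bar>sdet A f\<bar> \<le> fact (card A) * 2 ^ card A"
proof -
  let ?n = "card A"
  let ?M = "mat ?n ?n (\<lambda>(i, j). f (enum_set A i) (enum_set A j))"
  let ?P = "{p. p permutes {0..<?n}}"
  have "sdet A f = (\<Sum>p\<in>?P. signof p * (\<Prod>i = 0..<?n. ?M $$ (i, p i)))"
    unfolding sdet_def by (rule det_def') simp
  then have "\<bar>sdet A f\<bar> \<le> (\<Sum>p\<in>?P. \<bar>signof p * (\<Prod>i = 0..<?n. ?M $$ (i, p i))\<bar>)" by (simp only: sum_abs)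
  also have "\<dots> \<le> (\<Sum>p\<in>?P. 2 ^ ?n)"
  proof (rule sum_mono)
    fix p assume p: "p \<in> ?P"
    have pi: "p i < ?n" if "i < ?n" for i using p that permutes_in_image[of p "{0..<?n}" i] by auto
    have "(\<Prod>i = 0..<?n. \<bar>?M $$ (i, p i)\<bar>) \<le> (\<Prod>i = 0..<?n. 2)"
      by (rule prod_mono) (use f pi in auto)
    moreover have "\<bar>signof p :: int\<bar> = 1" by (simp add: sign_def)
    ultimately show "\<bar>signof p * (\<Prod>i = 0..<?n. ?M $$ (i, p i))\<bar> \<le> 2 ^ ?n" by (simp add: abs_mult abs_prod)
  qed
  also have "\<dots> = fact ?n * 2 ^ ?n" using card_permutations[of "{0..<?n}" ?n] by simp
  finally show ?thesis .
qed

text \<open>Along a disconnection the determinant is a product, and the prime divides one of the two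
  factors; the induction continues on that side.\<close>

lemma prime_component:
  fixes R :: "'v \<Rightarrow> 'v \<Rightarrow> bool" and p :: int
  assumes p: "prime p" and "finite A" and sym: "\<And>x y. R x y = R y x" and "p dvd sdet A (gram R)"
  shows "\<exists>C\<subseteq>A. connected_in R C \<and> (\<forall>x\<in>C. \<forall>y\<in>A - C. \<not> R x y) \<and> p dvd sdet C (gram R)"
  using assms(2,4)
proof (induction "card A" arbitrary: A rule: less_induct)
  case less
  show ?case
  proof (cases "connected_in R A")
    case True
    then show ?thesis using less.prems by (intro exI[of _ A]) auto
  next
    case False
    then obtain S where S0: "S \<noteq> {}" "S \<subset> A" "\<not> (\<exists>x\<in>A - S. \<exists>e\<in>S. R x e)"
      unfolding connected_in_def not_all not_imp by (elim exE conjE) (rule that)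
    have S: "S \<noteq> {}" "S \<subset> A" "\<And>x e. x \<in> A - S \<Longrightarrow> e \<in> S \<Longrightarrow> \<not> R x e" using S0 by blast+
    have fin: "finite S" "finite (A - S)" using S(2) less.prems(1) by (auto intro: finite_subset)
    have A: "A = S \<union> (A - S)" using S(2) by auto
    have "gdet (S \<union> (A - S)) R 0 (1::int) = gdet S R 0 1 * gdet (A - S) R 0 1"
      using S(3) sym by (intro gdet_split fin) auto
    then have "sdet A (gram R) = sdet S (gram R) * (sdet (A - S) (gram R) :: int)"
      unfolding gdet_0_1 A[symmetric] .
    then consider "p dvd sdet S (gram R)" | "p dvd sdet (A - S) (gram R)"
      using less.prems(2) p by (auto simp: prime_dvd_mult_iff)
    then show ?thesis
    proof cases
      case 1
      have "card S < card A" using S(2) less.prems(1) by (rule psubset_card_mono[rotated])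
      from less.hyps[OF this fin(1) 1] obtain C where C: "C \<subseteq> S" "connected_in R C" "\<forall>x\<in>C. \<forall>y\<in>S - C. \<not> R x y" "p dvd sdet C (gram R)"
        by blast
      have "\<forall>x\<in>C. \<forall>y\<in>A - C. \<not> R x y"
      proof (intro ballI)
        fix x y assume xy: "x \<in> C" "y \<in> A - C"
        show "\<not> R x y"
        proof (cases "y \<in> S")
          case True
          then show ?thesis using C(3) xy by blast
        next
          case False
          then have "\<not> R y x" using S(3)[of y x] xy C(1) by blast
          then show ?thesis using sym[of x y] by simp
        qed
      qed
      moreover have "C \<subseteq> A" using C(1) S(2) by auto
      ultimately show ?thesis using C(2,4) by (intro exI[of _ C] conjI)
    next
      case 2
      have "card (A - S) < card A" using S(1,2) less.prems(1) by (intro psubset_card_mono) auto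
      from less.hyps[OF this fin(2) 2] obtain C where C: "C \<subseteq> A - S" "connected_in R C" "\<forall>x\<in>C. \<forall>y\<in>(A - S) - C. \<not> R x y" "p dvd sdet C (gram R)"
        by blast
      have "\<forall>x\<in>C. \<forall>y\<in>A - C. \<not> R x y"
      proof (intro ballI)
        fix x y assume xy: "x \<in> C" "y \<in> A - C"
        show "\<not> R x y"
        proof (cases "y \<in> S")
          case True
          then show ?thesis using S(3)[of x y] xy C(1) by blast
        next
          case False
          then show ?thesis using C(3) xy by blast
        qed
      qed
      moreover have "C \<subseteq> A" using C(1) by auto
      ultimately show ?thesis using C(2,4) by (intro exI[of _ C] conjI)
    qed
  qed
qed

text \<open>An integral root of a polynomial with integral coefficients divides the constant
  term.\<close>

lemma eigenvalue_dvd_det: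
  fixes k :: int
  assumes A: "finite A" and z: "gdet A R (- k) 1 = 0"
  shows "k dvd sdet A (gram R)"
proof -
  define P where "P = gdet A R ([:0, 1:] :: int poly) 1"
  have ev: "poly P c = gdet A R c 1" for c
  proof -
    have h: "comm_ring_hom (\<lambda>p. poly p c)" by unfold_locales simp_all
    show ?thesis unfolding P_def gdet_def sdet_hom[OF h A] by (rule sdet_cong[OF refl]) (simp add: gram_def)
  qed
  obtain a Q where P: "P = pCons a Q" by (cases P) auto
  have "sdet A (gram R) = a" using ev[of 0] unfolding gdet_0_1 P by simp
  moreover have "a + (- k) * poly Q (- k) = 0" using ev[of "- k"] z unfolding P by simp
  ultimately have "sdet A (gram R) = k * poly Q (- k)" by simp
  then show ?thesis by simp
qed

text \<open>At a vertex where an eigenvector is largest, all other vertices must be neighbours.\<close>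

lemma complete_of_eigenvalue:
  fixes R :: "'v \<Rightarrow> 'v \<Rightarrow> bool"
  assumes Y: "finite Y" "Y \<noteq> {}" and z: "gdet Y R (- real (card Y + 1)) 1 = 0"
  shows "\<forall>x\<in>Y. \<forall>y\<in>Y. x \<noteq> y \<longrightarrow> R x y"
proof -
  obtain c0 where c0: "\<exists>x\<in>Y. c0 x \<noteq> 0"
    "\<forall>x\<in>Y. (\<Sum>y\<in>Y. ((if x = y then - real (card Y + 1) else 0) + 1 * gram R x y) * c0 y) = 0"
    using sdet_kernel[OF Y(1) z[unfolded gdet_def]] by blast
  have key: "\<forall>x\<in>Y. \<forall>y\<in>Y. x \<noteq> y \<longrightarrow> R x y"
    if c: "\<exists>x\<in>Y. c x > 0" "\<forall>x\<in>Y. (\<Sum>y\<in>Y. ((if x = y then - real (card Y + 1) else 0) + 1 * gram R x y) * c y) = 0"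
    for c
  proof -
    define m where "m = Max (c ` Y)"
    have "m \<in> c ` Y" unfolding m_def using Y by (intro Max_in) auto
    then obtain x0 where x0: "x0 \<in> Y" "c x0 = m" by auto
    have le: "c y \<le> m" if "y \<in> Y" for y using that Y by (simp add: m_def)
    have m0: "m > 0" using c(1) le by force
    \<comment> \<open>The eigenvalue equation in row \<open>x\<close> asks for a total of (card Y -
      1) m from the card Y - 1 other vertices, each contributing at most m. So each is a neighbour
      and attains the maximum.\<close>
    have max: "c y = m \<and> R x y" if x: "x \<in> Y" "c x = m" and y: "y \<in> Y" "y \<noteq> x" for x y
    proof (rule ccontr)
      assume a: "\<not> (c y = m \<and> R x y)"
      let ?g = "\<lambda>y. of_bool (R x y) * c y"
      have fin: "finite (Y - {x})" using Y by simp
      have "(\<Sum>y\<in>Y. ((if x = y then - real (card Y + 1) else 0) + 1 * gram R x y) * c y) =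
          (2 - real (card Y + 1)) * m + (\<Sum>y\<in>Y - {x}. ((if x = y then - real (card Y + 1) else 0) + 1 * gram R x y) * c y)"
        using x by (subst sum.remove[OF Y(1) x(1)]) (simp add: gram_def)
      also have "(\<Sum>y\<in>Y - {x}. ((if x = y then - real (card Y + 1) else 0) + 1 * gram R x y) * c y) = (\<Sum>y\<in>Y - {x}. ?g y)"
        by (intro sum.cong refl) (auto simp: gram_def)
      finally have sp: "(\<Sum>y\<in>Y. ((if x = y then - real (card Y + 1) else 0) + 1 * gram R x y) * c y) =
          (2 - real (card Y + 1)) * m + (\<Sum>y\<in>Y - {x}. ?g y)" .
      have "(2 - real (card Y + 1)) * m + (\<Sum>y\<in>Y - {x}. ?g y) = 0"
        unfolding sp[symmetric] by (rule bspec[OF c(2) x(1)])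
      then have "(\<Sum>y\<in>Y - {x}. ?g y) = - ((2 - real (card Y + 1)) * m)" by (rule eq_neg_iff_add_eq_0[THEN iffD2, OF trans[OF add.commute]])
      also have "\<dots> = (real (card Y + 1) - 2) * m" by (simp only: minus_mult_left minus_diff_eq)
      finally have "(\<Sum>y\<in>Y - {x}. ?g y) = (real (card Y + 1) - 2) * m" .
      moreover have "real (card (Y - {x})) = real (card Y + 1) - 2"
      proof -
        have "Suc (card (Y - {x})) = card Y" by (rule card_Suc_Diff1[OF Y(1) x(1)])
        then show ?thesis by linarith
      qed
      ultimately have s: "(\<Sum>y\<in>Y - {x}. ?g y) = (\<Sum>y\<in>Y - {x}. m)" by simp
      have gle: "?g z \<le> m" if "z \<in> Y - {x}" for z using le[of z] that m0 by auto
      have gm: "?g y < m" using a le[of y] y m0 by (cases "R x y") auto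
      have "(\<Sum>y\<in>Y - {x}. ?g y) < (\<Sum>y\<in>Y - {x}. m)"
      proof (rule sum_strict_mono_ex1[OF fin])
        show "\<forall>z\<in>Y - {x}. ?g z \<le> m" using gle by blast
        show "\<exists>z\<in>Y - {x}. ?g z < m" using gm y by (intro bexI[of _ y]) simp_all
      qed
      then show False using s by simp
    qed
    have all: "c x = m" if "x \<in> Y" for x using max[OF x0 that] x0 by (cases "x = x0") auto
    show ?thesis using max all by blast
  qed
  obtain x where x: "x \<in> Y" "c0 x \<noteq> 0" using c0(1) by blast
  show ?thesis
  proof (cases "c0 x > 0")
    case True
    then show ?thesis using key[of c0] c0(2) x by blast
  next
    case False
    have "(\<Sum>y\<in>Y. ((if x = y then - real (card Y + 1) else 0) + 1 * gram R x y) * - c0 y) = 0" if "x \<in> Y" for x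
      using c0(2) that by (simp add: sum_negf)
    then show ?thesis using key[of "\<lambda>x. - c0 x"] x False by force
  qed
qed

section \<open>The family of graphs and their determination by the spectrum\<close>

definition rel_graph :: "nat \<Rightarrow> (nat \<Rightarrow> nat \<Rightarrow> bool) \<Rightarrow> nat set set" where
  "rel_graph n R = {{i, j} | i j. i < n \<and> j < n \<and> i \<noteq> j \<and> R i j}"

lemma rel_graph_simple: "rel_graph n R \<in> simple_graphs n"
  by (auto simp: rel_graph_def simple_graphs_def)

lemma adj_rel_graph:
  assumes "\<And>x y. R x y = R y x" "i < n" "j < n"
  shows "adj (rel_graph n R) i j \<longleftrightarrow> i \<noteq> j \<and> R i j"
  using assms by (auto simp: rel_graph_def doubleton_eq_iff)

text \<open>The line graph of a caterpillar, on the vertices below \<open>M\<close>, together with a complete graph.\<close>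

definition cat_rel :: "nat list \<Rightarrow> nat \<Rightarrow> nat \<Rightarrow> bool" where
  "cat_rel gs i j \<longleftrightarrow> (let V = cat_edges (cat_bits gs); M = card V in
    i < M \<and> j < M \<and> ladj cat_par (enum_set V i) (enum_set V j) \<or> M \<le> i \<and> M \<le> j)"

abbreviation cat_graph :: "nat \<Rightarrow> nat list \<Rightarrow> nat set set" where
  "cat_graph n gs \<equiv> rel_graph n (cat_rel gs)"

lemma cat_rel_sym: "cat_rel gs x y = cat_rel gs y x"
  unfolding cat_rel_def Let_def ladj_def by auto

lemma adj_cat_graph:
  "i < n \<Longrightarrow> j < n \<Longrightarrow> adj (cat_graph n gs) i j \<longleftrightarrow> i \<noteq> j \<and> cat_rel gs i j"
  by (rule adj_rel_graph[OF cat_rel_sym])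

lemma gdet_cat_graph:
  fixes gs :: "nat list"
  defines "V \<equiv> cat_edges (cat_bits gs)"
  assumes M: "card V \<le> n"
  shows "gdet {..<n} (adj (cat_graph n gs)) u q = gdet V (ladj cat_par) u q * gdet {..<n - card V} complete_rel u q"
proof -
  let ?M = "card V"
  have finV: "finite V" by (simp add: V_def)
  have b: "bij_betw (enum_set V) {..<?M} V" using enum_set[OF finV] by (simp add: lessThan_atLeast0)
  have "gdet {..<n} (adj (cat_graph n gs)) u q = gdet {..<n} (cat_rel gs) u q"
    by (rule gdet_cong) (auto simp: adj_cat_graph)
  also have "\<dots> = gdet {..<?M} (cat_rel gs) u q * gdet {?M..<n} (cat_rel gs) u q"
  proof -
    have un: "{..<n} = {..<?M} \<union> {?M..<n}" using M by auto
    show ?thesis unfolding un by (rule gdet_split) (auto simp: cat_rel_def Let_def V_def)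
  qed
  also have "gdet {..<?M} (cat_rel gs) u q = gdet V (ladj cat_par) u q"
    by (rule gdet_reindex[OF _ b, symmetric]) (auto simp: cat_rel_def Let_def V_def)
  also have "gdet {?M..<n} (cat_rel gs) u q = gdet {?M..<n} complete_rel u q"
    by (rule gdet_cong) (auto simp: cat_rel_def Let_def V_def)
  also have "\<dots> = gdet {..<n - ?M} complete_rel u q" by (rule gdet_complete_card) auto
  finally show ?thesis .
qed

text \<open>P < p makes the component with determinant divisible by \<open>p\<close> large enough to
  be classified. The bound n + 2 < 2 p ensures that this determinant is \<open>p\<close> itself and
  that the rest has determinant below \<open>p\<close>.\<close>

theorem cat_graph_determined:
  obtains P :: nat where "\<And>p n N w. prime p \<Longrightarrow> P < p \<Longrightarrow> p \<le> n + 1 \<Longrightarrow> n + 2 < 2 * p \<Longrightarrow>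
    w \<noteq> [] \<Longrightarrow> set w \<subseteq> {4, 5} \<Longrightarrow> last w = 5 \<Longrightarrow> N > 6 \<Longrightarrow> N mod 3 \<noteq> 0 \<Longrightarrow> 2 * N > 11 + 2 * sum_list w + 3 * length w \<Longrightarrow>
    card (cat_edges (cat_bits (N # w))) + 1 = p \<Longrightarrow> determined_by_spectrum n (cat_graph n (N # w))"
proof -
  obtain B where B: "\<forall>R C. finite (C :: nat set) \<longrightarrow> (\<forall>x y. R x y = R y x) \<longrightarrow> (\<forall>x. \<not> R x x) \<longrightarrow> connected_in R C \<longrightarrow>
    posdef C (gram R) \<longrightarrow> card C > B \<longrightarrow> (\<exists>V par. V \<subseteq> C \<and> card V = 8 \<and> tree_rep R par V)"
    by (rule exE[OF tree_rep_start]) (rule that)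
  \<comment> \<open>\<open>fact B * 2 ^ B\<close> exceeds or equals the determinant of every
    component with at most \<open>B\<close> vertices, so \<open>p\<close> divides none of them
    unless it is zero.\<close>
  have "determined_by_spectrum n (cat_graph n (N # w))"
    if p: "prime p" "fact B * 2 ^ B < p" "p \<le> n + 1" "n + 2 < 2 * p"
      and w: "w \<noteq> []" "set w \<subseteq> {4, 5}" "last w = 5" and N: "N > 6" "N mod 3 \<noteq> 0" "2 * N > 11 + 2 * sum_list w + 3 * length w"
      and card: "card (cat_edges (cat_bits (N # w))) + 1 = p"
    for p n N w
    unfolding determined_by_spectrum_def
  proof (intro allI ballI impI)
    fix m F assume F: "F \<in> simple_graphs m" and sp: "graph_spectrum m F = graph_spectrum n (cat_graph n (N # w))"
    have mn: "m = n" using arg_cong[OF sp, of size] unfolding size_graph_spectrum .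
    note F = F[unfolded mn] and sp = sp[unfolded mn]
    define V where "V = cat_edges (cat_bits (N # w))"
    define r where "r = n - card V"
    have finV: "finite V" by (simp add: V_def)
    have M: "card V \<le> n" "card V + 1 = p" using card p(3) by (simp_all add: V_def)
    have r1: "r + 1 < p" using M p(4) by (simp add: r_def)
    let ?A = "{..<n}" and ?R = "adj F"
    have sym: "?R x y = ?R y x" for x y by (simp add: insert_commute)
    have irr: "\<not> ?R x x" for x using F by (auto simp: simple_graphs_def)
    have T: "rtree cat_par V" unfolding V_def by (rule rtree_cat)
    have gd: "gdet ?A ?R u q = gdet V (ladj cat_par) u q * gdet {..<r} complete_rel u q" for u q :: real
      using cospectral_gram_sdet[OF rel_graph_simple F sp, where u = u and q = q] gdet_cat_graph[of "N # w" n u q] M(1)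
      unfolding gdet_def V_def r_def by simp
    \<comment> \<open>The determinants of all shifts agree with those of the given graph, which is
      positive definite as a union of line graphs of trees.\<close>
    have pd: "posdef ?A (gram ?R)"
    proof (rule posdef_of_nonsingular_shifts)
      show "gram ?R x y = (gram ?R y x :: real)" for x y using sym[of x y] by (auto simp: gram_def)
      fix t :: real assume t: "t \<ge> 0"
      have "gdet ?A ?R t 1 \<noteq> 0"
        unfolding gd using gdet_posdef_nonzero[OF finV posdef_tree[OF T] t] gdet_complete_nonzero[of "{..<r}" t 1] t by simp
      then show "sdet ?A (shifted (gram ?R) t) \<noteq> 0" by (simp add: gdet_def)
    qed simp
    have detA: "sdet ?A (gram ?R) = int (p * (r + 1))"
    proof -
      have "real_of_int (sdet ?A (gram ?R)) = gdet ?A ?R 0 1" unfolding sdet_gram_of_int[OF finite_lessThan] gdet_0_1 ..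
      also have "\<dots> = real (card V + 1) * real (r + 1)"
        unfolding gd unfolding gdet_0_1 sdet_gram_tree[OF T] sdet_complete[OF finite_lessThan] by simp
      also have "\<dots> = real_of_int (int (p * (r + 1)))" unfolding M(2) by (simp only: of_nat_mult of_int_mult of_int_of_nat_eq)
      finally show ?thesis by (simp only: of_int_eq_iff)
    qed
    have pi: "prime (int p)" using p(1) by simp
    have pdvd: "int p dvd sdet ?A (gram ?R)" unfolding detA by simp
    obtain C where C: "C \<subseteq> ?A" "connected_in ?R C" "\<forall>x\<in>C. \<forall>y\<in>?A - C. \<not> ?R x y" "int p dvd sdet C (gram ?R)"
      using prime_component[OF pi finite_lessThan sym pdvd] by (elim exE conjE) (rule that)
    define Y where "Y = ?A - C"
    have fin: "finite C" "finite Y" using C(1) by (auto simp: Y_def intro: finite_subset)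
    have disj: "C \<inter> Y = {}" "C \<union> Y = ?A" using C(1) by (auto simp: Y_def)
    have split: "gdet ?A ?R u q = gdet C ?R u q * gdet Y ?R u q" for u q :: "'t::idom"
      unfolding disj(2)[symmetric] by (rule gdet_split[OF fin disj(1)]) (use C(3) in \<open>auto simp: Y_def\<close>)
    have pdC: "posdef C (gram ?R)" by (rule posdef_subset[OF finite_lessThan C(1) pd])
    have detC0: "sdet C (gram ?R) \<noteq> (0::int)"
    proof
      assume "sdet C (gram ?R) = (0::int)"
      then have "sdet C (gram ?R) = (0::real)" unfolding sdet_gram_of_int[OF fin(1), symmetric] by simp
      then show False using posdef_sdet_nonzero[OF fin(1) pdC] by simp
    qed
    have big: "card C > B"
    proof (rule ccontr)
      assume "\<not> card C > B"
      then have cB: "card C \<le> B" by simp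
      have "int p \<le> \<bar>sdet C (gram ?R)\<bar>" using dvd_imp_le_int[OF detC0 C(4)] by simp
      also have "\<dots> \<le> fact (card C) * 2 ^ card C" by (rule sdet_int_bound[OF fin(1)]) (simp add: gram_def)
      also have "\<dots> \<le> fact B * 2 ^ B" using cB by (intro mult_mono fact_mono power_increasing) auto
      also have "\<dots> = int (fact B * 2 ^ B)" by simp
      finally show False using p(2) by linarith
    qed
    have symA: "\<forall>x y. ?R x y = ?R y x" by (intro allI) (rule sym)
    have irrA: "\<forall>x. \<not> ?R x x" by (intro allI) (rule irr)
    obtain V0 par0 where V0: "V0 \<subseteq> C" "card V0 = 8" "tree_rep ?R par0 V0"
      using mp[OF mp[OF mp[OF mp[OF mp[OF mp[OF spec[OF spec[OF B, of ?R], of C] fin(1)] symA] irrA] C(2)] pdC] big]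
      by (elim exE conjE) (rule that)
    have "(\<exists>par. tree_rep ?R par C) \<or> (\<exists>U. D_rep ?R U C)"
      by (rule tree_or_D_rep[OF fin(1) C(2) sym pdC V0(1) _ V0(3)]) (simp add: V0(2))
    \<comment> \<open>A square divisible by \<open>p\<close> is divisible by p^2, whereas the
      determinant of the whole graph is p (r + 1) with 0 < r + 1 < p.\<close>
    moreover have "\<not> (\<exists>U. D_rep ?R U C)"
    proof
      assume "\<exists>U. D_rep ?R U C"
      then obtain k :: int where k: "sdet C (gram ?R) = k\<^sup>2" using sdet_D_rep_square[OF fin(1)] by blast
      then have "int p dvd k" using C(4) pi by (simp add: prime_dvd_power_iff)
      then have "(int p)\<^sup>2 dvd sdet C (gram ?R)" unfolding k by (rule dvd_power_same)
      moreover have "(sdet C (gram ?R) :: int) dvd sdet ?A (gram ?R)"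
        using split[of 0 "1::int"] unfolding gdet_0_1 by simp
      ultimately have "(int p)\<^sup>2 dvd int (p * (r + 1))" unfolding detA by (rule dvd_trans)
      then have "int p * int p dvd int p * int (r + 1)" by (simp only: power2_eq_square of_nat_mult)
      then have "int p = 0 \<or> int p dvd int (r + 1)" by (simp only: dvd_mult_cancel_left)
      moreover have "int p \<noteq> 0" using prime_gt_0_nat[OF p(1)] by simp
      ultimately have "int p dvd int (r + 1)" by blast
      then have "p dvd r + 1" by (simp only: int_dvd_int_iff)
      then show False using r1 by (auto dest: dvd_imp_le)
    qed
    ultimately obtain par where rep: "tree_rep ?R par C" by blast
    have TC: "rtree par C" and lad: "\<And>x y. x \<in> C \<Longrightarrow> y \<in> C \<Longrightarrow> x \<noteq> y \<Longrightarrow> ?R x y = ladj par x y"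
      using rep by (auto simp: tree_rep_def)
    have gC: "gdet C ?R u q = gdet C (ladj par) u q" for u q :: "'t::idom" by (rule gdet_cong) (rule lad)
    have detC: "sdet C (gram ?R) = int (card C + 1)"
    proof -
      have "real_of_int (sdet C (gram ?R)) = gdet C (ladj par) 0 1"
        unfolding gC[symmetric] unfolding gdet_0_1 by (rule sdet_gram_of_int[OF fin(1)])
      also have "\<dots> = real_of_int (int (card C + 1))" unfolding gdet_0_1 sdet_gram_tree[OF TC] by simp
      finally show ?thesis by (simp only: of_int_eq_iff)
    qed
    have "p dvd card C + 1" using C(4) unfolding detC by (simp only: int_dvd_int_iff)
    moreover have "card C \<le> n" using card_mono[OF finite_lessThan C(1)] by simp
    \<comment> \<open>card C + 1 is a positive multiple of \<open>p\<close> and at most n + 1 < 2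
      p.\<close>
    ultimately have cC: "card C + 1 = p"
    proof -
      obtain k where k: "card C + 1 = p * k" using \<open>p dvd card C + 1\<close> by (rule dvdE)
      have "k \<noteq> 0"
      proof
        assume "k = 0"
        then show False using k by simp
      qed
      moreover have "k < 2"
      proof (rule ccontr)
        assume "\<not> k < 2"
        then have "p * 2 \<le> p * k" by simp
        then show False using k \<open>card C \<le> n\<close> p(4) by linarith
      qed
      ultimately have "k = 1" by simp
      then show ?thesis using k by simp
    qed
    have cY: "card Y = r"
    proof -
      have "card Y = n - card C" unfolding Y_def using C(1) fin(1) by (simp add: card_Diff_subset)
      then show ?thesis using cC M(2) by (simp add: r_def)
    qed
    have Ycomp: "\<forall>x\<in>Y. \<forall>y\<in>Y. x \<noteq> y \<longrightarrow> ?R x y"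
    proof (cases "Y = {}")
      case False
      then have r0: "r \<noteq> 0" using cY fin(2) by auto
      \<comment> \<open>r + 1 is the eigenvalue of A + 2I for the constant vector: all column sums
        of the shifted matrix vanish, so the system with right hand side 1 is unsolvable.\<close>
      have z0: "gdet {..<r} complete_rel (- real (r + 1)) 1 = 0"
      proof -
        have "\<not> gdet {..<r} complete_rel (- real (r + 1)) 1 \<noteq> 0"
        proof
          assume "gdet {..<r} complete_rel (- real (r + 1)) 1 \<noteq> 0"
          from sdet_solve[OF finite_lessThan this[unfolded gdet_def], of "\<lambda>_. 1"]
          obtain c where c: "\<forall>x<r. (\<Sum>y<r. ((if x = y then - real (r + 1) else 0) + 1 * gram complete_rel x y) * c y) = 1"
            by auto
          have "(\<Sum>x<r. \<Sum>y<r. ((if x = y then - real (r + 1) else 0) + 1 * gram complete_rel x y) * c y) = (\<Sum>x<r. 1)"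
            using c by (intro sum.cong) auto
          moreover have "(\<Sum>x<r. \<Sum>y<r. ((if x = y then - real (r + 1) else 0) + 1 * gram complete_rel x y) * c y) = (\<Sum>y<r. 0)"
          proof (subst sum.swap, rule sum.cong[OF refl])
            fix y assume y: "y \<in> {..<r}"
            have "(\<Sum>x<r. ((if x = y then - real (r + 1) else 0) + 1 * gram complete_rel x y) * c y) =
                (\<Sum>x<r. (if x = y then - real r * c y else 0) + c y)"
              by (intro sum.cong refl) (auto simp: gram_def algebra_simps)
            also have "\<dots> = 0" using y by (simp add: sum.distrib)
            finally show "(\<Sum>x<r. ((if x = y then - real (r + 1) else 0) + 1 * gram complete_rel x y) * c y) = 0" .
          qed
          ultimately show False using r0 by simp
        qed
        then show ?thesis by blast
      qed
      have "gdet C ?R (- real (r + 1)) 1 * gdet Y ?R (- real (r + 1)) 1 = 0"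
        unfolding split[symmetric] gd z0 by (rule mult_zero_right)
      \<comment> \<open>Otherwise r + 1 divides the determinant \<open>p\<close> of
        \<open>C\<close>, although 1 < r + 1 < p.\<close>
      moreover have "gdet C ?R (- real (r + 1)) 1 \<noteq> 0"
      proof
        assume z: "gdet C ?R (- real (r + 1)) 1 = 0"
        have h: "comm_ring_hom real_of_int" by unfold_locales simp_all
        have "real_of_int (gdet C ?R (- int (r + 1)) 1) = gdet C ?R (- real (r + 1)) 1"
          unfolding gdet_def sdet_hom[OF h fin(1)] by (rule sdet_cong[OF refl]) (auto simp: gram_def)
        then have "gdet C ?R (- int (r + 1)) 1 = 0" using z by simp
        then have "int (r + 1) dvd sdet C (gram ?R)" by (rule eigenvalue_dvd_det[OF fin(1)])
        then have "r + 1 dvd p" unfolding detC cC by (simp only: int_dvd_int_iff)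
        then have "r + 1 = 1 \<or> r + 1 = p" using p(1) unfolding prime_nat_iff by blast
        then show False using r1 r0 by simp
      qed
      ultimately have "gdet Y ?R (- real (card Y + 1)) 1 = 0" unfolding cY by simp
      then show ?thesis by (rule complete_of_eigenvalue[OF fin(2) False])
    qed auto
    have gY: "gdet Y ?R u q = gdet {..<r} complete_rel u q" for u q :: real
    proof -
      have "gdet Y ?R u q = gdet Y complete_rel u q" by (rule gdet_cong) (use Ycomp in auto)
      then show ?thesis using gdet_complete_card[OF fin(2), of "{..<r}"] cY by simp
    qed
    have lp: "line_poly par C = line_poly cat_par V"
    proof (rule line_poly_eqI[OF fin(1) finV])
      fix q :: real assume q: "0 < q" "q < 1"
      have "gdet C (ladj par) ((1 - q)\<^sup>2) q * gdet {..<r} complete_rel ((1 - q)\<^sup>2) q =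
          gdet C ?R ((1 - q)\<^sup>2) q * gdet Y ?R ((1 - q)\<^sup>2) q"
        by (simp only: gC gY)
      also have "\<dots> = gdet ?A ?R ((1 - q)\<^sup>2) q" by (rule split[symmetric])
      also have "\<dots> = gdet V (ladj cat_par) ((1 - q)\<^sup>2) q * gdet {..<r} complete_rel ((1 - q)\<^sup>2) q" by (rule gd)
      finally have "gdet C (ladj par) ((1 - q)\<^sup>2) q * gdet {..<r} complete_rel ((1 - q)\<^sup>2) q =
          gdet V (ladj cat_par) ((1 - q)\<^sup>2) q * gdet {..<r} complete_rel ((1 - q)\<^sup>2) q" .
      then show "gdet C (ladj par) ((1 - q)\<^sup>2) q = gdet V (ladj cat_par) ((1 - q)\<^sup>2) q"
        using gdet_complete_nonzero[of "{..<r}" "(1 - q)\<^sup>2" q] q by simp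
    qed
    have cc: "card C = card (cat_edges (cat_bits (N # w)))" using cC card by simp
    obtain \<psi> where \<psi>: "bij_betw \<psi> C V" "\<And>e f. e \<in> C \<Longrightarrow> f \<in> C \<Longrightarrow> ladj cat_par (\<psi> e) (\<psi> f) = ladj par e f"
      using caterpillar_determined[OF w N TC cc lp[unfolded V_def], folded V_def] by blast
    let ?M = "card V"
    have b: "bij_betw (enum_set V) {..<?M} V" using enum_set[OF finV] by (simp add: lessThan_atLeast0)
    define g1 where "g1 = inv_into {..<?M} (enum_set V) \<circ> \<psi>"
    have g1: "bij_betw g1 C {..<?M}" unfolding g1_def by (rule bij_betw_trans[OF \<psi>(1) bij_betw_inv_into[OF b]])
    have eg1: "enum_set V (g1 x) = \<psi> x" if "x \<in> C" for x
      unfolding g1_def using bij_betw_inv_into_right[OF b bij_betwE[OF \<psi>(1), rule_format, OF that]] by simp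
    have "card Y = card {?M..<n}" using cY by (simp add: r_def)
    then obtain g2 where g2: "bij_betw g2 Y {?M..<n}" using finite_same_card_bij[OF fin(2)] by blast
    define g where "g x = (if x \<in> C then g1 x else g2 x)" for x
    have gC1: "g x = g1 x" if "x \<in> C" for x using that by (simp add: g_def)
    have gY1: "g x = g2 x" if "x \<in> Y" for x using that disj(1) by (auto simp: g_def)
    have bC: "bij_betw g C {..<?M}" using g1 gC1 by (subst bij_betw_cong[of C g g1]) auto
    have bY: "bij_betw g Y {?M..<n}" using g2 gY1 by (subst bij_betw_cong[of Y g g2]) auto
    have "bij_betw g (C \<union> Y) ({..<?M} \<union> {?M..<n})" by (rule bij_betw_combine[OF bC bY]) auto
    moreover have "{..<?M} \<union> {?M..<n} = ?A" using M(1) by auto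
    ultimately have bg: "bij_betw g ?A ?A" using disj(2) by simp
    have adjs: "{u, v} \<in> F \<longleftrightarrow> {g u, g v} \<in> cat_graph n (N # w)" if uv: "u < n" "v < n" for u v
    proof (cases "u = v")
      case True
      then show ?thesis using irr[of u] by (auto simp: rel_graph_def doubleton_eq_iff)
    next
      case False
      have gn: "g u < n" "g v < n" "g u \<noteq> g v"
        using bij_betwE[OF bg] uv inj_onD[OF bij_betw_imp_inj_on[OF bg], of u v] False by auto
      have R: "{g u, g v} \<in> cat_graph n (N # w) \<longleftrightarrow> cat_rel (N # w) (g u) (g v)"
        using adj_cat_graph[OF gn(1,2), of "N # w"] gn(3) by simp
      have cr: "cat_rel (N # w) i j \<longleftrightarrow> i < ?M \<and> j < ?M \<and> ladj cat_par (enum_set V i) (enum_set V j) \<or> ?M \<le> i \<and> ?M \<le> j" for i j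
        unfolding cat_rel_def Let_def V_def ..
      have lC: "g x < ?M" if "x \<in> C" for x using bij_betwE[OF bC] that by auto
      have lY: "?M \<le> g x" if "x \<in> Y" for x using bij_betwE[OF bY] that by auto
      consider "u \<in> C" "v \<in> C" | "u \<in> C" "v \<in> Y" | "u \<in> Y" "v \<in> C" | "u \<in> Y" "v \<in> Y"
        using uv disj(2) by blast
      then show ?thesis
      proof cases
        case 1
        have "cat_rel (N # w) (g u) (g v) \<longleftrightarrow> ladj cat_par (\<psi> u) (\<psi> v)"
          unfolding cr using lC 1 eg1 gC1 by (simp add: not_le[symmetric])
        then show ?thesis using R lad[OF 1 False] \<psi>(2)[OF 1] by simp
      next
        case 2
        then have "\<not> {u, v} \<in> F" using C(3) by (auto simp: Y_def)
        moreover have "\<not> cat_rel (N # w) (g u) (g v)" unfolding cr using lC[OF 2(1)] lY[OF 2(2)] by simp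
        ultimately show ?thesis using R by simp
      next
        case 3
        then have "\<not> {v, u} \<in> F" using C(3) by (auto simp: Y_def)
        moreover have "\<not> cat_rel (N # w) (g u) (g v)" unfolding cr using lC[OF 3(2)] lY[OF 3(1)] by simp
        ultimately show ?thesis using R sym[of u v] by simp
      next
        case 4
        have "cat_rel (N # w) (g u) (g v)" unfolding cr using lY 4 by simp
        then show ?thesis using R Ycomp 4 False by simp
      qed
    qed
    show "graph_isomorphic m F n (cat_graph n (N # w))"
      unfolding mn graph_isomorphic_def using bg adjs by blast
  qed
  then show ?thesis by (rule that)
qed

text \<open>Isomorphic graphs have equal determinants, and the complete parts have the same size and
  cancel. The remaining polynomial decodes to the gaps.\<close>

lemma cat_graph_inj:
  assumes iso: "graph_isomorphic n (cat_graph n (N # w)) n (cat_graph n (N # w'))"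
    and M: "card (cat_edges (cat_bits (N # w))) \<le> n"
    and len: "length w = length w'" "sum_list w = sum_list w'"
    and N: "2 * N > 11 + 2 * sum_list w + 3 * length w" "1 \<le> N" and pos: "\<forall>g\<in>set w. 1 \<le> g" "\<forall>g\<in>set w'. 1 \<le> g"
  shows "w = w'"
proof -
  have pos': "\<forall>g\<in>set (N # w). 1 \<le> g" "\<forall>g\<in>set (N # w'). 1 \<le> g" using pos N(2) by auto
  have M': "card (cat_edges (cat_bits (N # w'))) = card (cat_edges (cat_bits (N # w)))"
    unfolding card_cat_edges[OF pos'(1)] card_cat_edges[OF pos'(2)] using len by simp
  define r where "r = n - card (cat_edges (cat_bits (N # w)))"
  obtain f where f: "bij_betw f {..<n} {..<n}"
    "\<forall>u\<in>{..<n}. \<forall>v\<in>{..<n}. {u, v} \<in> cat_graph n (N # w) \<longleftrightarrow> {f u, f v} \<in> cat_graph n (N # w')"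
    using iso unfolding graph_isomorphic_def by blast
  have "gdet {..<n} (adj (cat_graph n (N # w'))) u q = gdet {..<n} (adj (cat_graph n (N # w))) u q" for u q :: real
    by (rule gdet_reindex[OF finite_lessThan f(1)]) (use f(2) in blast)
  then have h: "gdet {..<n} (adj (cat_graph n (N # w'))) u q = gdet {..<n} (adj (cat_graph n (N # w))) u q" for u q :: real .
  have 1: "gdet {..<n} (adj (cat_graph n (N # w))) u q =
      gdet (cat_edges (cat_bits (N # w))) (ladj cat_par) u q * gdet {..<r} complete_rel u q" for u q :: real
    unfolding r_def by (rule gdet_cat_graph[OF M])
  have 2: "gdet {..<n} (adj (cat_graph n (N # w'))) u q =
      gdet (cat_edges (cat_bits (N # w'))) (ladj cat_par) u q * gdet {..<r} complete_rel u q" for u q :: real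
    unfolding r_def M'[symmetric] by (rule gdet_cat_graph) (simp only: M' M)
  have eq: "gdet (cat_edges (cat_bits (N # w'))) (ladj cat_par) u q * gdet {..<r} complete_rel u q =
      gdet (cat_edges (cat_bits (N # w))) (ladj cat_par) u q * gdet {..<r} complete_rel u q" for u q :: real
    by (simp only: 1[symmetric] 2[symmetric] h)
  have "line_poly cat_par (cat_edges (cat_bits (N # w))) = line_poly cat_par (cat_edges (cat_bits (N # w')))"
  proof (rule line_poly_eqI)
    fix q :: real assume "0 < q" "q < 1"
    then show "gdet (cat_edges (cat_bits (N # w))) (ladj cat_par) ((1 - q)\<^sup>2) q =
        gdet (cat_edges (cat_bits (N # w'))) (ladj cat_par) ((1 - q)\<^sup>2) q"
      using eq[of "(1 - q)\<^sup>2" q] gdet_complete_nonzero[of "{..<r}" "(1 - q)\<^sup>2" q] by simp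
  qed simp_all
  then have "cJ qX (ca qX) (cb qX) (N # w) = cJ qX (ca qX) (cb qX) (N # w')"
    using len by (intro cat_line_poly_cJ(1) pos') auto
  from decode_gaps[folded qX_def, OF this len N(1) pos] show ?thesis .
qed

section \<open>Primes between $n$ and $2n$\<close>

text \<open>The recursion of Leibniz' harmonic triangle.\<close>

lemma harmonic_triangle_dvd:
  assumes "\<And>i. 1 \<le> i \<Longrightarrow> i \<le> n \<Longrightarrow> i dvd L" "1 \<le> m" "m \<le> n"
  shows "m * (n choose m) dvd (L::nat)"
  using assms(2,1,3)
proof (induction m arbitrary: n rule: dec_induct)
  case base
  then show ?case by auto
next
  case (step m)
  obtain k where n: "n = Suc k" and mk: "m \<le> k" using step.prems(2) by (cases n) auto
  have "m * (n choose m) dvd L" "m * (k choose m) dvd L"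
    using step.prems mk by (auto intro!: step.IH simp: n)
  \<comment> \<open>After multiplication by \<open>L\<close> the recursion 1 / ((m + 1) C(n, m + 1))
    = 1 / (m C(n - 1, m)) - 1 / (m C(n, m)) has the terms b - a, b and a, so b - a is the new
    quotient.\<close>
  then obtain a b where a: "L = m * (n choose m) * a" and b: "L = m * (k choose m) * b"
    unfolding dvd_def by blast
  have pos: "(n choose m) > 0" "(k choose m) > 0" "m > 0" using mk n step.hyps by auto
  have absorb: "(n - m) * (n choose m) = n * (k choose m)"
    using binomial_absorb_comp[of n m] by (simp add: n)
  have absorb': "Suc m * (n choose Suc m) = n * (k choose m)"
    using Suc_times_binomial_eq[of k m] by (simp add: n mult.commute)
  have kb: "n * b = (n - m) * b + m * b" using mk n by (simp flip: add_mult_distrib)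
  have "(n - m) * (n choose m) * b * m = n * (m * (k choose m) * b)"
    unfolding absorb by (simp only: mult_ac)
  also have "\<dots> = n * (m * (n choose m) * a)" by (simp only: a[symmetric] b[symmetric])
  finally have "(n - m) * (n choose m) * b * m = n * (n choose m) * a * m" by (simp only: mult_ac)
  then have nb: "(n - m) * b = n * a" using pos by (simp add: mult_ac)
  have ba: "a \<le> b"
  proof (rule ccontr)
    assume "\<not> a \<le> b"
    then have "(n - m) * b < n * a" using n mk by (intro mult_le_less_imp_less) auto
    then show False using nb by simp
  qed
  have mb: "m * b = n * (b - a)" using nb kb ba by (simp add: diff_mult_distrib2)
  have "L = Suc m * (n choose Suc m) * (b - a)"
    unfolding absorb' using b mb by (simp add: mult_ac)
  then show ?case by simp
qed

text \<open>By \<open>harmonic_triangle_dvd\<close> the binomial divides lcm (1, ..., n), and a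
  prime power dividing an lcm divides one of the numbers.\<close>

lemma prime_power_dvd_binomial_le:
  assumes p: "prime p" and d: "p ^ e dvd (n choose m)" and m: "1 \<le> m" "m \<le> n"
  shows "p ^ e \<le> n"
proof -
  have "p ^ e dvd Lcm A \<Longrightarrow> finite A \<Longrightarrow> 0 \<notin> A \<Longrightarrow> e > 0 \<Longrightarrow> \<exists>i\<in>A. p ^ e dvd i" for A :: "nat set"
  proof (induction A rule: infinite_finite_induct)
    case empty
    then show ?case using p by (auto simp: prime_nat_iff)
  next
    case (insert x A)
    have "Lcm A \<noteq> 0" using insert by (auto simp: Lcm_0_iff)
    moreover have "x \<noteq> 0" using insert by auto
    ultimately have "multiplicity p (lcm x (Lcm A)) = max (multiplicity p x) (multiplicity p (Lcm A))"
      by (rule multiplicity_lcm[OF _ _ p, rotated])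
    moreover have "e \<le> multiplicity p (lcm x (Lcm A))"
      using insert.prems(1) \<open>Lcm A \<noteq> 0\<close> \<open>x \<noteq> 0\<close> p
      by (subst (asm) power_dvd_iff_le_multiplicity) auto
    ultimately have "e \<le> multiplicity p x \<or> e \<le> multiplicity p (Lcm A)" by auto
    then have "p ^ e dvd x \<or> p ^ e dvd Lcm A" by (auto intro: multiplicity_dvd')
    then show ?case using insert by auto
  qed simp
  moreover have "p ^ e dvd Lcm {1..n}"
  proof -
    have "m * (n choose m) dvd Lcm {1..n}" by (rule harmonic_triangle_dvd) (use m in auto)
    then show ?thesis using d by (metis dvd_mult dvd_trans)
  qed
  ultimately have "e > 0 \<Longrightarrow> \<exists>i\<in>{1..n}. p ^ e dvd i" by auto
  then show ?thesis using m by (cases "e = 0") (auto dest: dvd_imp_le)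
qed

lemma prod_primes_dvd:
  assumes "finite A" "\<And>p. p \<in> A \<Longrightarrow> prime p" "\<And>p. p \<in> A \<Longrightarrow> p dvd x"
  shows "\<Prod>A dvd (x::nat)"
  using assms
proof (induction A)
  case (insert p A)
  have "coprime p (\<Prod>A)"
    using insert by (intro prod_coprime_right) (auto intro!: primes_coprime)
  then show ?case using insert by (auto intro!: divides_mult)
qed simp

text \<open>Erdos' induction: an even n > 2 is not prime, and for n = 2 m + 1 the primes above m + 1
  divide C(n, m), which is one of two equal entries of a row with sum 2 * 4^m.\<close>

lemma primorial_le: "\<Prod>{p. prime p \<and> p \<le> n} \<le> 4 ^ n"
proof (induction n rule: less_induct)
  case (less n)
  show ?case
  proof (cases "n \<le> 2")
    case True
    show ?thesis
    proof (cases "n = 2")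
      case True
      have "{p. prime p \<and> p \<le> n} = {2}"
        by (auto simp: True dest: prime_ge_2_nat)
      then show ?thesis by (simp add: True)
    next
      case False
      then have none: "{p. prime p \<and> p \<le> n} = {}"
        using \<open>n \<le> 2\<close> by (auto dest: prime_ge_2_nat)
      show ?thesis unfolding none by simp
    qed
  next
    case n: False
    show ?thesis
    proof (cases "even n")
      case True
      have "\<not> prime n" using True n by (metis prime_odd_nat not_le)
      then have "{p. prime p \<and> p \<le> n} = {p. prime p \<and> p \<le> n - 1}"
        using n by (auto simp: le_eq_less_or_eq)
      then have "\<Prod>{p. prime p \<and> p \<le> n} \<le> 4 ^ (n - 1)" using less.IH[of "n - 1"] n by simp
      also have "\<dots> \<le> 4 ^ n" by (intro power_increasing) auto
      finally show ?thesis .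
    next
      case False
      then obtain m where m: "n = 2 * m + 1" by (elim oddE)
      have m1: "m \<ge> 1" using n m by simp
      let ?A = "{p. prime p \<and> p \<le> m + 1}" and ?B = "{p. prime p \<and> m + 1 < p \<and> p \<le> n}"
      have finB: "finite ?B" by (rule finite_subset[of _ "{..n}"]) auto
      have AB: "{p. prime p \<and> p \<le> n} = ?A \<union> ?B" using m by auto
      have "\<Prod>?B dvd (n choose m)"
      proof (rule prod_primes_dvd[OF finB])
        fix p assume p: "p \<in> ?B"
        then have pr: "prime p" by simp
        have "p dvd fact n" using p by (simp add: prime_dvd_fact_iff)
        moreover have "fact n = fact m * fact (n - m) * (n choose m)"
          using binomial_fact_lemma[of m n] m by simp
        moreover have "\<not> p dvd fact m" using p pr by (simp add: prime_dvd_fact_iff)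
        moreover have "\<not> p dvd fact (n - m)" unfolding prime_dvd_fact_iff[OF pr] using p m by simp
        ultimately show "p dvd (n choose m)" using pr by (auto simp: prime_dvd_mult_iff)
      qed simp
      then have "\<Prod>?B \<le> (n choose m)" by (rule dvd_imp_le) (simp add: m)
      also have "\<dots> \<le> 4 ^ m"
      proof -
        have "(n choose m) + (n choose Suc m) \<le> (\<Sum>k\<le>n. n choose k)"
        proof -
          have "(\<Sum>k\<in>{m, Suc m}. n choose k) \<le> (\<Sum>k\<le>n. n choose k)"
            using m by (intro sum_mono2) auto
          then show ?thesis by simp
        qed
        moreover have "(n choose Suc m) = (n choose m)"
          using binomial_symmetric[of m n] m by simp
        moreover have "(\<Sum>k\<le>n. n choose k) = 2 * 4 ^ m"
          using choose_row_sum[of n] by (simp add: m power_mult)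
        ultimately show ?thesis by simp
      qed
      finally have B: "\<Prod>?B \<le> 4 ^ m" .
      have A: "\<Prod>?A \<le> 4 ^ (m + 1)" using less.IH[of "m + 1"] m m1 by simp
      have "\<Prod>{p. prime p \<and> p \<le> n} = \<Prod>?A * \<Prod>?B"
        unfolding AB by (rule prod.union_disjoint) (use finB in auto)
      also have "\<dots> \<le> 4 ^ (m + 1) * 4 ^ m" by (rule mult_le_mono[OF A B])
      also have "\<dots> = 4 ^ n" by (simp add: m power_add mult_2)
      finally show ?thesis .
    qed
  qed
qed

text \<open>Only 2 p is a multiple of \<open>p\<close> among n + 1, ..., 2 n. Their product is n!
  C(2n, n), and \<open>p\<close> divides n!, so a further factor \<open>p\<close> in the binomial is
  impossible.\<close>

lemma prime_not_dvd_central_binomial: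
  assumes p: "prime p" and "2 * n < 3 * p" "p \<le> n" "n \<ge> 3"
  shows "\<not> p dvd (2 * n choose n)"
proof
  assume d: "p dvd (2 * n choose n)"
  have p3: "p \<ge> 3" using assms by linarith
  have "fact (2 * n) = fact n * (\<Prod>i\<in>{n<..2 * n}. i)"
  proof -
    have "{1..2 * n} = {1..n} \<union> {n<..2 * n}" by auto
    then have "(fact (2 * n) :: nat) = \<Prod>({1..n} \<union> {n<..2 * n})"
      unfolding fact_prod by simp
    also have "\<dots> = \<Prod>{1..n} * \<Prod>{n<..2 * n}" by (rule prod.union_disjoint) auto
    finally show ?thesis by (simp add: fact_prod)
  qed
  moreover have "(fact (2 * n) :: nat) = fact n * fact n * (2 * n choose n)"
    using binomial_fact_lemma[of n "2 * n"] by simp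
  ultimately have eq: "fact n * (2 * n choose n) = \<Prod>{n<..2 * n}"
    by simp
  have "p dvd fact n" using assms by (simp add: prime_dvd_fact_iff)
  then have pp: "p * p dvd \<Prod>{n<..2 * n}" unfolding eq[symmetric] using d by (rule mult_dvd_mono)
  have "2 * p \<in> {n<..2 * n}" using assms by auto
  then have "\<Prod>{n<..2 * n} = 2 * p * \<Prod>({n<..2 * n} - {2 * p})" by (intro prod.remove) auto
  then have "p * p dvd p * (2 * \<Prod>({n<..2 * n} - {2 * p}))" using pp by (simp add: mult_ac)
  then have "p dvd 2 * \<Prod>({n<..2 * n} - {2 * p})" using p by (simp add: prime_gt_0_nat)
  then have "p dvd 2 \<or> (\<exists>i\<in>{n<..2 * n} - {2 * p}. p dvd i)"
    using p by (simp add: prime_dvd_mult_iff prime_dvd_prod_iff)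
  then show False
  proof
    assume "p dvd 2" then show False using p3 by (auto dest: dvd_imp_le)
  next
    assume "\<exists>i\<in>{n<..2 * n} - {2 * p}. p dvd i"
    then obtain i where i: "i \<in> {n<..2 * n} - {2 * p}" "p dvd i" by blast
    then obtain k where k: "n < p * k" "p * k \<le> 2 * n" "p * k \<noteq> 2 * p" by (auto elim: dvdE)
    have "k < 3"
    proof (rule ccontr)
      assume "\<not> k < 3"
      then have "p * 3 \<le> p * k" by (intro mult_le_mono2) simp
      then show False using k(2) assms(2) by linarith
    qed
    moreover have "k > 1"
    proof (rule ccontr)
      assume "\<not> k > 1"
      then have "p * k \<le> p * 1" by (intro mult_le_mono2) simp
      then show False using k(1) assms(3) by linarith
    qed
    ultimately have "k = 2" by simp
    then show False using k(3) by simp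
  qed
qed

text \<open>Primes up to sqrt (2n) contribute at most 2n each. Larger ones occur to the first power
  and are at most 2n/3, so \<open>primorial_le\<close> bounds their product.\<close>

lemma central_binomial_upper:
  assumes n: "n \<ge> 3" and none: "\<And>p. prime p \<Longrightarrow> n < p \<Longrightarrow> \<not> p \<le> 2 * n"
  shows "real (2 * n choose n) \<le> (2 * real n) powr sqrt (2 * real n) * 4 powr (2 * real n / 3)"
proof -
  define C where "C = (2 * n choose n)"
  define P where "P = prime_factors C"
  define s where "s = nat \<lfloor>sqrt (2 * real n)\<rfloor>"
  define P1 where "P1 = {p\<in>P. p \<le> s}"
  define P2 where "P2 = {p\<in>P. s < p}"
  have C0: "C > 0" by (simp add: C_def)
  have fin: "finite P" by (simp add: P_def)
  have Pp: "prime p" "p dvd C" if "p \<in> P" for p using that by (auto simp: P_def)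
  have le: "p ^ multiplicity p C \<le> 2 * n" if "p \<in> P" for p
    using prime_power_dvd_binomial_le[OF Pp(1)[OF that], of "multiplicity p C" "2 * n" n] n
    by (auto simp: C_def multiplicity_dvd)
  have "C = (\<Prod>p\<in>P. p ^ multiplicity p C)" unfolding P_def by (rule prime_factorization_nat[OF C0])
  also have "P = P1 \<union> P2" by (auto simp: P1_def P2_def)
  also have "(\<Prod>p\<in>P1 \<union> P2. p ^ multiplicity p C) = (\<Prod>p\<in>P1. p ^ multiplicity p C) * (\<Prod>p\<in>P2. p ^ multiplicity p C)"
    using fin by (intro prod.union_disjoint) (auto simp: P1_def P2_def)
  finally have C: "C = (\<Prod>p\<in>P1. p ^ multiplicity p C) * (\<Prod>p\<in>P2. p ^ multiplicity p C)" .
  have "(\<Prod>p\<in>P1. p ^ multiplicity p C) \<le> (\<Prod>p\<in>P1. 2 * n)"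
    by (intro prod_mono) (auto simp: P1_def le)
  also have "\<dots> = (2 * n) ^ card P1" by simp
  also have "\<dots> \<le> (2 * n) ^ s"
  proof (rule power_increasing)
    have "P1 \<subseteq> {1..s}"
    proof
      fix p assume p: "p \<in> P1"
      then show "p \<in> {1..s}" using prime_ge_1_nat[OF Pp(1), of p] by (auto simp: P1_def)
    qed
    then show "card P1 \<le> s" using card_mono[of "{1..s}" P1] by simp
  qed (use n in auto)
  finally have 1: "(\<Prod>p\<in>P1. p ^ multiplicity p C) \<le> (2 * n) ^ s" .
  have "(\<Prod>p\<in>P2. p ^ multiplicity p C) \<le> (\<Prod>p\<in>P2. p)"
  proof (intro prod_mono conjI)
    fix p assume p: "p \<in> P2"
    have "sqrt (2 * real n) < real p" using p by (auto simp: P2_def s_def) linarith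
    then have "(sqrt (2 * real n))\<^sup>2 < (real p)\<^sup>2" by (intro power_strict_mono) auto
    then have "real (2 * n) < real (p\<^sup>2)" by simp
    then have "2 * n < p ^ 2" by (simp only: of_nat_less_iff)
    have "multiplicity p C < 2"
    proof (rule ccontr)
      assume "\<not> multiplicity p C < 2"
      then have "p ^ 2 \<le> p ^ multiplicity p C"
        using p Pp(1) by (intro power_increasing) (auto simp: P2_def dest!: prime_gt_0_nat)
      then show False using le[of p] p \<open>2 * n < p ^ 2\<close> by (auto simp: P2_def)
    qed
    moreover have "p > 0" using p Pp(1) by (auto simp: P2_def dest!: prime_gt_0_nat)
    ultimately show "p ^ multiplicity p C \<le> p"
      using power_increasing[of "multiplicity p C" 1 p] by simp
  qed simp
  also have "\<dots> \<le> \<Prod>{p. prime p \<and> p \<le> 2 * n div 3}"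
  proof (rule dvd_imp_le[OF prod_dvd_prod_subset])
    show fin: "finite {p. prime p \<and> p \<le> 2 * n div 3}" by (rule finite_subset[of _ "{..2 * n div 3}"]) auto
    show "P2 \<subseteq> {p. prime p \<and> p \<le> 2 * n div 3}"
    proof
      fix p assume "p \<in> P2"
      then have p: "prime p" "p dvd C" using Pp by (auto simp: P2_def)
      have "p ^ 1 \<le> 2 * n"
        using prime_power_dvd_binomial_le[OF p(1), of 1 "2 * n" n] p(2) n by (simp add: C_def)
      then have "p \<le> n" using none[OF p(1)] by (cases "n < p") auto
      then have "\<not> 2 * n < 3 * p"
        using prime_not_dvd_central_binomial[OF p(1), of n] p(2) n by (auto simp: C_def)
      then show "p \<in> {p. prime p \<and> p \<le> 2 * n div 3}" using p(1) by auto
    qed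
    show "0 < \<Prod>{p. prime p \<and> p \<le> 2 * n div 3}" using fin by (intro prod_pos) (auto dest: prime_gt_0_nat)
  qed
  also have "\<dots> \<le> 4 ^ (2 * n div 3)" by (rule primorial_le)
  finally have 2: "(\<Prod>p\<in>P2. p ^ multiplicity p C) \<le> 4 ^ (2 * n div 3)" .
  have "C \<le> (2 * n) ^ s * 4 ^ (2 * n div 3)" using C mult_le_mono[OF 1 2] by simp
  then have "real C \<le> real ((2 * n) ^ s * 4 ^ (2 * n div 3))" by (simp only: of_nat_le_iff)
  also have "\<dots> = (2 * real n) powr real s * 4 powr real (2 * n div 3)"
    using n by (simp add: powr_realpow)
  also have "\<dots> \<le> (2 * real n) powr sqrt (2 * real n) * 4 powr (2 * real n / 3)"
  proof (intro mult_mono powr_mono)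
    show "real s \<le> sqrt (2 * real n)" by (simp add: s_def)
    have "3 * (2 * n div 3) \<le> 2 * n" by simp
    then have "real (3 * (2 * n div 3)) \<le> real (2 * n)" by (simp only: of_nat_le_iff)
    then show "real (2 * n div 3) \<le> 2 * real n / 3" by simp
  qed (use n in auto)
  finally show ?thesis by (simp add: C_def)
qed

text \<open>Bertrand's postulate for large n: the lower bound 4^n / (2n) for C(2n, n) outgrows the
  bound that holds without such a prime.\<close>

theorem eventually_prime_between: "\<exists>N. \<forall>n\<ge>N. \<exists>p::nat. prime p \<and> n < p \<and> p \<le> 2 * n"
proof -
  have "eventually (\<lambda>n::nat. (2 * real n) powr sqrt (2 * real n) * 4 powr (2 * real n / 3) <
      4 powr real n / (2 * real n)) at_top"
    by real_asymp
  then obtain N where N: "\<And>n. n \<ge> N \<Longrightarrow> (2 * real n) powr sqrt (2 * real n) * 4 powr (2 * real n / 3) <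
      4 powr real n / (2 * real n)"
    by (auto simp: eventually_at_top_linorder)
  have "\<exists>p::nat. prime p \<and> n < p \<and> p \<le> 2 * n" if n: "n \<ge> max N 3" for n
  proof (rule ccontr)
    assume "\<nexists>p. prime p \<and> n < p \<and> p \<le> 2 * n"
    then have "real (2 * n choose n) \<le> (2 * real n) powr sqrt (2 * real n) * 4 powr (2 * real n / 3)"
      using n by (intro central_binomial_upper) auto
    also have "\<dots> < 4 powr real n / (2 * real n)" using N n by simp
    also have "\<dots> = 4 ^ n / (2 * real n)" by (simp add: powr_realpow)
    also have "\<dots> \<le> real (2 * n choose n)" using central_binomial_lower_bound[of n] n by simp
    finally show False by simp
  qed
  then show ?thesis by blast
qed

section \<open>Counting\<close>

text \<open>A bit chooses the order of a pair 4, 5, so length and sum do not depend on the bits. The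
  last 5 is what \<open>huge_gap_at_end\<close> asks for, and the leading fours adjust the residue
  of the huge gap modulo 3.\<close>

definition code_gaps :: "nat \<Rightarrow> bool list \<Rightarrow> nat list" where
  "code_gaps e bl = replicate e 4 @ concat (map (\<lambda>b. if b then [4, 5] else [5, 4]) bl) @ [5]"

lemma code_gaps_props:
  "code_gaps e bl \<noteq> []" "set (code_gaps e bl) \<subseteq> {4, 5}" "last (code_gaps e bl) = 5"
  "length (code_gaps e bl) = e + 2 * length bl + 1" "sum_list (code_gaps e bl) = 4 * e + 9 * length bl + 5"
proof -
  have "length (concat (map (\<lambda>b. if b then [4, 5] else [5, 4::nat]) bl)) = 2 * length bl"
    "sum_list (concat (map (\<lambda>b. if b then [4, 5] else [5, 4::nat]) bl)) = 9 * length bl"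
    by (induction bl) auto
  then show "length (code_gaps e bl) = e + 2 * length bl + 1" "sum_list (code_gaps e bl) = 4 * e + 9 * length bl + 5"
    by (simp_all add: code_gaps_def sum_list_replicate)
qed (auto simp: code_gaps_def split: if_splits)

lemma code_gaps_inj:
  assumes "code_gaps e bl = code_gaps e bl'" "length bl = length bl'"
  shows "bl = bl'"
proof -
  have "concat (map (\<lambda>b. if b then [4, 5] else [5, 4::nat]) bl) = concat (map (\<lambda>b. if b then [4, 5] else [5, 4]) bl')"
    using assms(1) by (simp add: code_gaps_def)
  with assms(2) show ?thesis
    by (induction bl bl' rule: list_induct2) (auto split: if_splits)
qed

lemma exp_half_le: "exp (real k / 2) \<le> 2 ^ k"
proof -
  have "(exp (1 / 2 :: real))\<^sup>2 = exp 1" by (simp add: power2_eq_square flip: exp_add)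
  also have "\<dots> \<le> 2\<^sup>2" using exp_le by simp
  finally have "exp (1 / 2 :: real) \<le> 2" by (rule power2_le_imp_le) simp
  then have "exp (1 / 2 :: real) ^ k \<le> 2 ^ k" by (intro power_mono) auto
  then show ?thesis using exp_of_nat_mult[of k "1 / 2 :: real"] by simp
qed

text \<open>The left hand side of the equation is the number of vertices of the tree with gaps
  \<open>N # code_gaps e bl\<close> for \<open>K\<close> bits. Passing from e = 0 to e = 1 lowers
  \<open>N\<close> by 5 and so changes its residue modulo 3.\<close>

lemma gap_length_exists:
  fixes p K :: nat
  assumes "100 * K \<le> p" "500 < p"
  obtains e N where "N + 11 * K + 5 * e + 11 = p" "e \<le> 1" "N mod 3 \<noteq> 0" "N > 6"
proof -
  have le: "11 * K + 11 \<le> p" using assms by linarith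
  define N0 where "N0 = p - (11 * K + 11)"
  have N0: "N0 + 11 * K + 11 = p" using le by (simp add: N0_def)
  then have big: "N0 > 100" using assms by linarith
  show ?thesis
  proof (cases "N0 mod 3 = 0")
    case True
    then have "(N0 - 5) mod 3 \<noteq> 0" using big by presburger
    then show ?thesis using that[of "N0 - 5" 1] N0 big by simp
  next
    case False
    then show ?thesis using that[of N0 0] N0 big by simp
  qed
qed

theorem theorem1p4:
  shows "\<exists>c::real. c > 0 \<and> (\<exists>N::nat. \<forall>n\<ge>N. real (num_DS_graphs n) \<ge> exp (c * real n))"
proof -
  obtain P :: nat where P: "\<And>p n N w. prime p \<Longrightarrow> P < p \<Longrightarrow> p \<le> n + 1 \<Longrightarrow> n + 2 < 2 * p \<Longrightarrow>
    w \<noteq> [] \<Longrightarrow> set w \<subseteq> {4, 5} \<Longrightarrow> last w = 5 \<Longrightarrow> N > 6 \<Longrightarrow> N mod 3 \<noteq> 0 \<Longrightarrow> 2 * N > 11 + 2 * sum_list w + 3 * length w \<Longrightarrow>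
    card (cat_edges (cat_bits (N # w))) + 1 = p \<Longrightarrow> determined_by_spectrum n (cat_graph n (N # w))"
    by (rule cat_graph_determined) (rule that)
  obtain N0 :: nat where N0: "\<forall>n\<ge>N0. \<exists>p::nat. prime p \<and> n < p \<and> p \<le> 2 * n"
    using eventually_prime_between by blast
  have "exp (1 / 1000 * real n) \<le> real (num_DS_graphs n)" if n: "n \<ge> 2 * N0 + 2 * P + 1000" for n
  proof -
    \<comment> \<open>The interval for this argument ends at n + 1 or n + 2, whichever is even; an
      even end is not a prime, so p \<le> n + 1.\<close>
    have "n div 2 + 1 \<ge> N0" using n by linarith
    then obtain p where p: "prime p" "n div 2 + 1 < p" "p \<le> 2 * (n div 2 + 1)" using N0 by blast
    have pn: "n + 2 < 2 * p" "500 < p" "P < p" using p(2) n by linarith+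
    have "p \<le> n + 1"
    proof (rule ccontr)
      assume "\<not> p \<le> n + 1"
      then have "p = 2 * (n div 2 + 1)" using p(3) by presburger
      then have "even p" by simp
      then show False using p(1) pn(2) prime_odd_nat[of p] by simp
    qed
    \<comment> \<open>The share 1/100 keeps the small gaps short against \<open>N\<close>: what is
      needed below is 2 p > 46 K + 21 e + 46.\<close>
    define K where "K = p div 100"
    have K: "100 * K \<le> p" "p < 100 * K + 100" unfolding K_def by linarith+
    obtain e N where eN: "N + 11 * K + 5 * e + 11 = p" "e \<le> 1" "N mod 3 \<noteq> 0" "N > 6"
      using gap_length_exists[OF K(1) pn(2)] by blast
    define E where "E bl = cat_graph n (N # code_gaps e bl)" for bl
    have cp: "card (cat_edges (cat_bits (N # code_gaps e bl))) + 1 = p"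
      and big: "2 * N > 11 + 2 * sum_list (code_gaps e bl) + 3 * length (code_gaps e bl)"
      and pos: "\<forall>g\<in>set (code_gaps e bl). 1 \<le> g"
      if "length bl = K" for bl
    proof -
      show pos: "\<forall>g\<in>set (code_gaps e bl). 1 \<le> g" using code_gaps_props(2)[of e bl] by auto
      then have "\<forall>g\<in>set (N # code_gaps e bl). 1 \<le> g" using eN(4) by auto
      from card_cat_edges[OF this] show "card (cat_edges (cat_bits (N # code_gaps e bl))) + 1 = p"
        using code_gaps_props(4,5)[of e bl] that eN(1) by simp
      show "2 * N > 11 + 2 * sum_list (code_gaps e bl) + 3 * length (code_gaps e bl)"
      proof -
        have "2 * p > 46 * K + 21 * e + 46" using eN(2) K(1) pn(2) by linarith
        then show ?thesis unfolding code_gaps_props(4,5) that using eN(1) by presburger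
      qed
    qed
    have DS: "E bl \<in> DS_graphs n" if "length bl = K" for bl
      unfolding DS_graphs_def E_def
      using P[OF p(1) pn(3) \<open>p \<le> n + 1\<close> pn(1) code_gaps_props(1-3) eN(4,3) big[OF that] cp[OF that]] rel_graph_simple
      by blast
    let ?L = "{bl :: bool list. length bl = K}"
    define h where "h bl = graph_iso_rel n `` {E bl}" for bl
    have "inj_on h ?L"
    proof (rule inj_onI)
      fix bl bl' assume bl: "bl \<in> ?L" "bl' \<in> ?L" and eq: "h bl = h bl'"
      have "E bl' \<in> graph_iso_rel n `` {E bl'}"
        by (rule equiv_class_self[OF equiv_graph_iso_rel]) (simp add: E_def rel_graph_simple)
      then have "E bl' \<in> h bl" unfolding eq unfolding h_def .
      then have "(E bl, E bl') \<in> graph_iso_rel n" by (simp only: h_def Image_singleton_iff)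
      then have iso: "graph_isomorphic n (cat_graph n (N # code_gaps e bl)) n (cat_graph n (N # code_gaps e bl'))"
        by (simp add: graph_iso_rel_def E_def)
      have L: "length bl = K" "length bl' = K" using bl by simp_all
      have "code_gaps e bl = code_gaps e bl'"
      proof (rule cat_graph_inj[OF iso])
        show "card (cat_edges (cat_bits (N # code_gaps e bl))) \<le> n" using cp[OF L(1)] \<open>p \<le> n + 1\<close> by linarith
        show "length (code_gaps e bl) = length (code_gaps e bl')" "sum_list (code_gaps e bl) = sum_list (code_gaps e bl')"
          unfolding code_gaps_props L by simp_all
        show "1 \<le> N" using eN(4) by simp
      qed (use big[OF L(1)] pos[OF L(1)] pos[OF L(2)] in blast)+
      then show "bl = bl'" by (rule code_gaps_inj) (simp add: L)
    qed
    moreover have "h ` ?L \<subseteq> DS_graphs n // graph_iso_rel n"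
      using DS by (auto simp: h_def intro!: quotientI)
    moreover have "finite (DS_graphs n // graph_iso_rel n)"
    proof -
      have "finite (DS_graphs n)" using finite_simple_graphs by (simp add: DS_graphs_def)
      then show ?thesis by (simp add: quotient_def)
    qed
    ultimately have "card ?L \<le> num_DS_graphs n" unfolding num_DS_graphs_def by (rule card_inj_on_le)
    moreover have "card ?L = 2 ^ K"
      using card_lists_length_eq[of "UNIV :: bool set" K] by (simp add: card_UNIV_bool)
    ultimately have "2 ^ K \<le> num_DS_graphs n" by simp
    then have "(2::real) ^ K \<le> real (num_DS_graphs n)" by (metis of_nat_le_iff of_nat_numeral of_nat_power)
    moreover have "exp (real K / 2) \<le> 2 ^ K" by (rule exp_half_le)
    \<comment> \<open>n + 2 < 2 p and p < 100 K + 100 give K / 2 > n / 400 - 1/2, which is at least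
      n / 1000 for n \<ge> 1000.\<close>
    moreover have "1 / 1000 * real n \<le> real K / 2"
    proof -
      have "n + 2 < 200 * K + 200" using pn(1) K(2) by linarith
      then have "real n < 200 * real K + 198" by linarith
      then show ?thesis using n by linarith
    qed
    then have "exp (1 / 1000 * real n) \<le> exp (real K / 2)" by simp
    ultimately show ?thesis by linarith
  qed
  then show ?thesis by (intro exI[of _ "1 / 1000"]) auto
qed

end
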